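(* There is a polynomial transformation (polynomial-time many-one reduction) from $\mathrm{MRF\text{-}R}^{\star}$ to $\mathrm{MRF}^{\star}$ that maps instances with interdiction budget $k$ to instances with the same interdiction budget $k$. The same transformation is also a polynomial transformation from Integral $\mathrm{MRF\text{-}R}^{\star}$ to Integral $\mathrm{MRF}^{\star}$. The capacities in the resulting $\mathrm{MRF}^{\star}$ instance are polynomial in the size of the network.
   Context: For a digraph $D=(V,A)$ with $s,t\in V$ and capacities $u\in\mathbb{Q}_+^A$, let $\mathcal{P}$ be the set of $s$-$t$-paths (each identified with its arc set), $X:=\{x\in\mathbb{Q}_+^{\mathcal{P}}:\sum_{P\ni a}x_P\le u_a\ \forall a\in A\}$, and for $S\subseteq A$ let $\lambda(x,S):=\sum_{P\in\mathcal{P}:P\cap S\ne\emptyset}x_P$. $\mathrm{MRF}^{\star}$: given $D,s,t,u$, an interdiction budget $k\in\mathbb{N}$ and $L\in\mathbb{Q}_+$, decide whether $\max_{x\in X}\min_{S\subseteq A,|S|=k}\sum_{P:P\cap S=\emptyset}x_P\ge L$. Integral $\mathrm{MRF}^{\star}$: the same but the maximum is over integral $x\in X\cap\mathbb{Z}^{\mathcal{P}}$. $\mathrm{MRF\text{-}R}^{\star}$: given a directed acyclic graph $D=(V,A)$ with $s,t\in V$ and unit capacities $u\equiv 1$, an interdiction budget $k\in\mathbb{N}$, a compatibility graph $H=(A,E_H)$ (an undirected graph on the arc set of $D$) and a demand $\theta\in\mathbb{Q}_+$, decide whether there exists $x\in X$ with $\sum_{P\in\mathcal{P}}x_P=\theta$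 and $\max_{S\in\mathcal{S}_{H,k}}\lambda(x,S)\le k-1$, where $\mathcal{S}_{H,k}:=\{S\subseteq A: |S|\le k,\ S\text{ is a clique in }H\}$. Integral $\mathrm{MRF\text{-}R}^{\star}$: the same but $x$ is required to be integral.
   Formalization: The budget k is encoded in unary (same as binary when k ≤ |A|), since an MRF* instance with budget k needs at least k arcs and no budget-preserving polynomial reduction exists for huge binary k; MRF* instances are taken with k ≤ |A|, and s ≠ t is assumed so that the maximum exists. *)

theory Defs
  imports
    "Graph_Theory.Arc_Walk"
    "HOL-Computational_Algebra.Polynomial"
begin

section \<open>Polynomial-time computability\<close>

text \<open>
  The machine model is the WHILE language of N. D. Jones (\<^emph>\<open>Computability and Complexity\<close>): a
  structured imperative language over binary trees, with input and output in variable 0.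
  An assignment is charged the size of the tree it stores. With unit cost, sharing
  (\<open>X := Node X X\<close>) could build a tree of exponential size in linear time; with the cost below all
  stored trees have size at most input size plus running time, so that polynomial time
  coincides with polynomial time on Turing machines, for functions as well as for decision problems.
\<close>

datatype btree = Leaf | Node btree btree

datatype exp = Var nat | Const btree | Pair exp exp | Fst exp | Snd exp

datatype com =
    Skip
  | Assign nat exp
  | Seq com com
  | If exp com com
  | While exp com

type_synonym store = "nat \<Rightarrow> btree"

fun left :: "btree \<Rightarrow> btree" where
  "left Leaf = Leaf"
| "left (Node l r) = l"

fun right :: "btree \<Rightarrow> btree" where
  "right Leaf = Leaf"
| "right (Node l r) = r"

fun eval_exp :: "exp \<Rightarrow> store \<Rightarrow> btree" where
  "eval_exp (Var v) \<sigma> = \<sigma> v"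
| "eval_exp (Const d) \<sigma> = d"
| "eval_exp (Pair e1 e2) \<sigma> = Node (eval_exp e1 \<sigma>) (eval_exp e2 \<sigma>)"
| "eval_exp (Fst e) \<sigma> = left (eval_exp e \<sigma>)"
| "eval_exp (Snd e) \<sigma> = right (eval_exp e \<sigma>)"

text \<open>
  \<open>exec c \<sigma> n \<tau>\<close>: started in \<open>\<sigma>\<close>, the program \<open>c\<close> halts in \<open>\<tau>\<close> after time \<open>n\<close>.
  \<open>Leaf\<close> is false, every other tree is true. The generated function \<open>size\<close> on \<open>btree\<close> is the
  number of inner nodes.
\<close>

inductive exec :: "com \<Rightarrow> store \<Rightarrow> nat \<Rightarrow> store \<Rightarrow> bool" where
  Skip: "exec Skip \<sigma> 1 \<sigma>"
| Assign: "exec (Assign v e) \<sigma> (1 + size (eval_exp e \<sigma>)) (\<sigma>(v := eval_exp e \<sigma>))"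
| Seq: "exec c1 \<sigma> m \<rho> \<Longrightarrow> exec c2 \<rho> n \<tau> \<Longrightarrow> exec (Seq c1 c2) \<sigma> (m + n) \<tau>"
| IfTrue: "eval_exp b \<sigma> \<noteq> Leaf \<Longrightarrow> exec c1 \<sigma> n \<tau> \<Longrightarrow> exec (If b c1 c2) \<sigma> (1 + n) \<tau>"
| IfFalse: "eval_exp b \<sigma> = Leaf \<Longrightarrow> exec c2 \<sigma> n \<tau> \<Longrightarrow> exec (If b c1 c2) \<sigma> (1 + n) \<tau>"
| WhileFalse: "eval_exp b \<sigma> = Leaf \<Longrightarrow> exec (While b c) \<sigma> 1 \<sigma>"
| WhileTrue: "eval_exp b \<sigma> \<noteq> Leaf \<Longrightarrow> exec c \<sigma> m \<rho> \<Longrightarrow> exec (While b c) \<rho> n \<tau>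
    \<Longrightarrow> exec (While b c) \<sigma> (1 + m + n) \<tau>"

definition computes_within :: "com \<Rightarrow> btree \<Rightarrow> nat \<Rightarrow> btree \<Rightarrow> bool" where
  "computes_within c d N d' \<longleftrightarrow>
     (\<exists>n \<tau>. exec c ((\<lambda>_. Leaf)(0 := d)) n \<tau> \<and> n \<le> N \<and> \<tau> 0 = d')"

record 'i decision_problem =
  instances :: "'i set"
  yes_instance :: "'i \<Rightarrow> bool"
  encoding :: "'i \<Rightarrow> btree"

definition poly_time_computable ::
  "'i set \<Rightarrow> ('i \<Rightarrow> btree) \<Rightarrow> ('j \<Rightarrow> btree) \<Rightarrow> ('i \<Rightarrow> 'j) \<Rightarrow> bool" where
  "poly_time_computable D enc enc' f \<longleftrightarrow>
     (\<exists>c (p :: nat poly). \<forall>I\<in>D. computes_within c (enc I) (poly p (size (enc I))) (enc' (f I)))"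

definition polynomial_transformation ::
  "'i decision_problem \<Rightarrow> 'j decision_problem \<Rightarrow> ('i \<Rightarrow> 'j) \<Rightarrow> bool" where
  "polynomial_transformation A B f \<longleftrightarrow>
     (\<forall>I\<in>instances A. f I \<in> instances B \<and> (yes_instance A I \<longleftrightarrow> yes_instance B (f I))) \<and>
     poly_time_computable (instances A) (encoding A) (encoding B) f"


section \<open>Encodings\<close>

fun enc_unary :: "nat \<Rightarrow> btree" where
  "enc_unary 0 = Leaf"
| "enc_unary (Suc n) = Node Leaf (enc_unary n)"

fun enc_list :: "('a \<Rightarrow> btree) \<Rightarrow> 'a list \<Rightarrow> btree" where
  "enc_list f [] = Leaf"
| "enc_list f (x # xs) = Node (f x) (enc_list f xs)"

fun enc_prod :: "('a \<Rightarrow> btree) \<Rightarrow> ('b \<Rightarrow> btree) \<Rightarrow> 'a \<times> 'b \<Rightarrow> btree" where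
  "enc_prod f g (x, y) = Node (f x) (g y)"

text \<open>Binary representation, least significant bit first.\<close>

fun enc_binary :: "nat \<Rightarrow> btree" where
  "enc_binary n =
     (if n = 0 then Leaf
      else Node (if odd n then Node Leaf Leaf else Leaf) (enc_binary (n div 2)))"

declare enc_binary.simps [simp del]

text \<open>Only used for non-negative rationals, as numerator and denominator in lowest terms.\<close>

definition enc_rat :: "rat \<Rightarrow> btree" where
  "enc_rat q = enc_prod (enc_binary \<circ> nat) (enc_binary \<circ> nat) (quotient_of q)"


section \<open>Networks and path flows\<close>

text \<open>
  Vertices are \<open>{..<num_verts N}\<close> and arcs are the positions in the list of (tail, head) pairs,
  so that parallel arcs are allowed.
\<close>

record network =
  num_verts :: nat
  arc_list :: "(nat \<times> nat) list"
  source :: nat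
  sink :: nat

definition digraph_of :: "network \<Rightarrow> (nat, nat) pre_digraph" where
  "digraph_of N =
     \<lparr> verts = {..<num_verts N}, arcs = {..<length (arc_list N)},
       tail = (\<lambda>a. fst (arc_list N ! a)), head = (\<lambda>a. snd (arc_list N ! a)) \<rparr>"

definition is_network :: "network \<Rightarrow> bool" where
  "is_network N \<longleftrightarrow>
     wf_digraph (digraph_of N) \<and>
     source N \<in> verts (digraph_of N) \<and> sink N \<in> verts (digraph_of N) \<and> source N \<noteq> sink N"

definition network_size :: "network \<Rightarrow> nat" where
  "network_size N = card (verts (digraph_of N)) + card (arcs (digraph_of N))"

definition enc_network :: "network \<Rightarrow> btree" where
  "enc_network N =
     Node (enc_unary (num_verts N))
       (Node (enc_list (enc_prod enc_unary enc_unary) (arc_list N))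
         (Node (enc_unary (source N)) (enc_unary (sink N))))"

definition st_paths :: "network \<Rightarrow> nat set set" where
  "st_paths N = {set p | p. pre_digraph.apath (digraph_of N) (source N) p (sink N)}"

type_synonym path_flow = "nat set \<Rightarrow> rat"

text \<open>Values of a path flow outside \<open>st_paths N\<close> are never used.\<close>

definition path_flows :: "network \<Rightarrow> (nat \<Rightarrow> rat) \<Rightarrow> path_flow set" where
  "path_flows N u =
     {x. (\<forall>P\<in>st_paths N. 0 \<le> x P) \<and>
         (\<forall>a\<in>arcs (digraph_of N). (\<Sum>P | P \<in> st_paths N \<and> a \<in> P. x P) \<le> u a)}"

definition integral_flow :: "network \<Rightarrow> path_flow \<Rightarrow> bool" where
  "integral_flow N x \<longleftrightarrow> (\<forall>P\<in>st_paths N. x P \<in> \<int>)"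

definition flow_value :: "network \<Rightarrow> path_flow \<Rightarrow> rat" where
  "flow_value N x = (\<Sum>P\<in>st_paths N. x P)"

definition interdicted_flow :: "network \<Rightarrow> path_flow \<Rightarrow> nat set \<Rightarrow> rat" where
  "interdicted_flow N x S = (\<Sum>P | P \<in> st_paths N \<and> P \<inter> S \<noteq> {}. x P)"

definition surviving_flow :: "network \<Rightarrow> path_flow \<Rightarrow> nat set \<Rightarrow> rat" where
  "surviving_flow N x S = (\<Sum>P | P \<in> st_paths N \<and> P \<inter> S = {}. x P)"


section \<open>Maximum robust flow\<close>

text \<open>\<open>mrf_caps I ! a\<close> is the capacity of arc \<open>a\<close>.\<close>

record mrf =
  mrf_net :: network
  mrf_caps :: "rat list"
  mrf_budget :: nat
  mrf_threshold :: rat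

text \<open>
  The bound on the budget says that sets \<open>S\<close> of \<open>k\<close> arcs exist, so that the minimum over them
  is well defined.
\<close>

definition mrf_instances :: "mrf set" where
  "mrf_instances =
     {I. is_network (mrf_net I) \<and>
         length (mrf_caps I) = length (arc_list (mrf_net I)) \<and>
         (\<forall>c\<in>set (mrf_caps I). 0 \<le> c) \<and>
         mrf_budget I \<le> card (arcs (digraph_of (mrf_net I))) \<and>
         0 \<le> mrf_threshold I}"

definition robust_value :: "mrf \<Rightarrow> path_flow \<Rightarrow> rat" where
  "robust_value I x =
     Min (surviving_flow (mrf_net I) x `
       {S. S \<subseteq> arcs (digraph_of (mrf_net I)) \<and> card S = mrf_budget I})"

definition mrf_flows :: "mrf \<Rightarrow> path_flow set" where
  "mrf_flows I = path_flows (mrf_net I) (\<lambda>a. mrf_caps I ! a)"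

definition mrf_yes :: "mrf \<Rightarrow> bool" where
  "mrf_yes I \<longleftrightarrow>
     (\<exists>x. is_arg_max (robust_value I) (\<lambda>x. x \<in> mrf_flows I) x \<and>
          robust_value I x \<ge> mrf_threshold I)"

definition integral_mrf_yes :: "mrf \<Rightarrow> bool" where
  "integral_mrf_yes I \<longleftrightarrow>
     (\<exists>x. is_arg_max (robust_value I)
            (\<lambda>x. x \<in> mrf_flows I \<and> integral_flow (mrf_net I) x) x \<and>
          robust_value I x \<ge> mrf_threshold I)"

text \<open>
  Budgets are written in unary. For budgets not exceeding the number of arcs, hence for all
  instances of MRF, this is polynomially equivalent to binary notation.
\<close>

definition enc_mrf :: "mrf \<Rightarrow> btree" where
  "enc_mrf I =
     Node (enc_network (mrf_net I))
       (Node (enc_list enc_rat (mrf_caps I))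
         (Node (enc_unary (mrf_budget I)) (enc_rat (mrf_threshold I))))"

definition MRF :: "mrf decision_problem" where
  "MRF = \<lparr> instances = mrf_instances, yes_instance = mrf_yes, encoding = enc_mrf \<rparr>"

definition Integral_MRF :: "mrf decision_problem" where
  "Integral_MRF =
     \<lparr> instances = mrf_instances, yes_instance = integral_mrf_yes, encoding = enc_mrf \<rparr>"


section \<open>Robust flow with a compatibility graph\<close>

record mrfr =
  mrfr_net :: network
  mrfr_compat :: "(nat \<times> nat) list"
  mrfr_budget :: nat
  mrfr_demand :: rat

definition compat_edges :: "mrfr \<Rightarrow> nat set set" where
  "compat_edges I = {{a, b} | a b. (a, b) \<in> set (mrfr_compat I)}"

definition mrfr_instances :: "mrfr set" where
  "mrfr_instances =
     {I. is_network (mrfr_net I) \<and>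
         acyclic (arcs_ends (digraph_of (mrfr_net I))) \<and>
         (\<forall>(a, b)\<in>set (mrfr_compat I).
            a \<in> arcs (digraph_of (mrfr_net I)) \<and> b \<in> arcs (digraph_of (mrfr_net I)) \<and> a \<noteq> b) \<and>
         0 \<le> mrfr_demand I}"

definition interdictable_cliques :: "mrfr \<Rightarrow> nat set set" where
  "interdictable_cliques I =
     {S. S \<subseteq> arcs (digraph_of (mrfr_net I)) \<and> card S \<le> mrfr_budget I \<and>
         (\<forall>a\<in>S. \<forall>b\<in>S. a \<noteq> b \<longrightarrow> {a, b} \<in> compat_edges I)}"

definition mrfr_feasible :: "mrfr \<Rightarrow> path_flow \<Rightarrow> bool" where
  "mrfr_feasible I x \<longleftrightarrow>
     x \<in> path_flows (mrfr_net I) (\<lambda>_. 1) \<and>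
     flow_value (mrfr_net I) x = mrfr_demand I \<and>
     Max (interdicted_flow (mrfr_net I) x ` interdictable_cliques I) \<le> of_nat (mrfr_budget I) - 1"

definition mrfr_yes :: "mrfr \<Rightarrow> bool" where
  "mrfr_yes I \<longleftrightarrow> (\<exists>x. mrfr_feasible I x)"

definition integral_mrfr_yes :: "mrfr \<Rightarrow> bool" where
  "integral_mrfr_yes I \<longleftrightarrow> (\<exists>x. mrfr_feasible I x \<and> integral_flow (mrfr_net I) x)"

definition enc_mrfr :: "mrfr \<Rightarrow> btree" where
  "enc_mrfr I =
     Node (enc_network (mrfr_net I))
       (Node (enc_list (enc_prod enc_unary enc_unary) (mrfr_compat I))
         (Node (enc_unary (mrfr_budget I)) (enc_rat (mrfr_demand I))))"

definition MRF_R :: "mrfr decision_problem" where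
  "MRF_R = \<lparr> instances = mrfr_instances, yes_instance = mrfr_yes, encoding = enc_mrfr \<rparr>"

definition Integral_MRF_R :: "mrfr decision_problem" where
  "Integral_MRF_R =
     \<lparr> instances = mrfr_instances, yes_instance = integral_mrfr_yes, encoding = enc_mrfr \<rparr>"

end

theory Submission
  imports Defs "HOL-Library.Multiset"
begin

text \<open>
  Write \<open>n\<close> for the number of arcs of the given acyclic network and order them by a potential \<open>pos\<close>
  that increases along paths. Each arc \<open>a\<close> becomes an arc \<open>Mid a\<close> that carries the given flow,
  filler flow, and flow in the colours \<open>0..n\<close>, which enters through the exits of a chain
  \<open>F 0, ..., F n\<close> and leaves through guarded arcs \<open>Te\<close>. The threshold \<open>L\<close> is the capacity of all
  starting arcs other than \<open>F 0\<close>, \<open>P2\<close> and the dummy arcs \<open>Di\<close>, so these \<open>k\<close> arcs show that no flow can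
  exceed \<open>L\<close>, and a flow reaching \<open>L\<close> saturates all the other starting arcs. Incompatible arcs \<open>a\<close>, \<open>b\<close>
  are joined by a link that a coloured path uses to traverse both, so that failing them together is not
  worthwhile.

  A flow of the given problem is completed to a flow of value \<open>L\<close> by explicit paths. Conversely, in a
  flow of value \<open>L\<close>, the interdiction sets \<open>{F r, Te h a} \<union> Di\<close> force each colour \<open>i < n\<close> to send exactly
  one unit to each guard. Balancing \<open>pos\<close> then shows that these colours saturate all links and avoid the
  arcs of the given network, hence each of their paths hits at most one arc of a clique. Interdicting a
  clique therefore bounds the remaining flow through it. That remaining flow consists of pieces of walks
  in the given network; gluing them at the arcs where filler flow starts and ends yields the desired flow.
\<close>

section \<open>Polynomial time for typed functions\<close>

text \<open>The capacities are tuned so that the adversary's best choices all cost the same. In the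
  completed flow an arc \<open>Mid a\<close> carries at most \<open>M\<close>: filler
  \<open>U + n - deg a\<close>, coloured flow \<open>2 (n + 1) + deg a\<close>, and at most one unit
  of the given flow. Each colour \<open>i < n\<close> sends \<open>2 n\<close> units, but
  \<open>En i\<close> brings only \<open>2 n - 1\<close>, so the load of \<open>F r\<close> falls by
  one with each \<open>r\<close>, while the part of \<open>Te h a\<close> that avoids
  \<open>F r\<close> grows by one. Hence all sets made of \<open>F r\<close>, \<open>Te h a\<close>
  and dummy arcs are tight at once, and these equalities leave a robust flow no freedom in its
  colours below \<open>n\<close>. Interdicting a clique of \<open>k\<close> arcs
  \<open>Mid a\<close> destroys \<open>k (M - 1)\<close> plus the given flow through it; the bound
  \<open>k M - 1\<close> is thus the clique condition. The amount \<open>U = 2 n^2\<close> is what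
  \<open>n\<close> colours of \<open>2 n\<close> units put on the chain, so it lifts the other loads
  to the level of the chain. Cutting the budget off at \<open>\<kappa> = min k (n + 1)\<close> keeps
  the capacities polynomial in the given network: the remaining budget goes to dummy arcs of the
  largest load \<open>Q\<close>.\<close>

lemma poly_nat_mono: "x \<le> y \<Longrightarrow> poly (p :: nat poly) x \<le> poly p y"
  by (induction p) (auto intro!: add_mono mult_mono)

text \<open>The initial store is arbitrary apart from variable 0, and variables above
  \<open>m\<close> survive: this lets a program run inside another one that keeps its own data above
  \<open>m\<close>. The size bound on the output is part of the notion because it is the input size
  of whatever runs next.\<close>

definition pt :: "('a \<Rightarrow> btree) \<Rightarrow> ('b \<Rightarrow> btree) \<Rightarrow> ('a \<Rightarrow> 'b) \<Rightarrow> bool" where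
  "pt A B f \<longleftrightarrow>
     (\<exists>c m (p :: nat poly). \<forall>x.
        size (B (f x)) \<le> poly p (size (A x)) \<and>
        (\<forall>\<sigma>. \<sigma> 0 = A x \<longrightarrow>
           (\<exists>n \<tau>. exec c \<sigma> n \<tau> \<and> n \<le> poly p (size (A x)) \<and> \<tau> 0 = B (f x) \<and> (\<forall>v>m. \<tau> v = \<sigma> v))))"

lemma ptE:
  assumes "pt A B f"
  obtains p c m where
    "\<And>x. size (B (f x)) \<le> poly p (size (A x))"
    "\<And>x \<sigma>. \<sigma> 0 = A x \<Longrightarrow>
       \<exists>n \<tau>. exec c \<sigma> n \<tau> \<and> n \<le> poly p (size (A x)) \<and> \<tau> 0 = B (f x) \<and> (\<forall>v>m. \<tau> v = \<sigma> v)"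
  using assms unfolding pt_def by blast

lemma ptI:
  assumes "\<And>x. size (B (f x)) \<le> poly p (size (A x))"
    "\<And>x \<sigma>. \<sigma> 0 = A x \<Longrightarrow>
       \<exists>n \<tau>. exec c \<sigma> n \<tau> \<and> n \<le> poly p (size (A x)) \<and> \<tau> 0 = B (f x) \<and> (\<forall>v>m. \<tau> v = \<sigma> v)"
  shows "pt A B f"
  using assms unfolding pt_def by blast

lemma pt_size: "pt A B f \<Longrightarrow> \<exists>p. \<forall>x. size (B (f x)) \<le> poly p (size (A x))"
  unfolding pt_def by blast

lemma pt_id: "pt A A (\<lambda>x. x)"
proof (rule ptI[where c = Skip and p = "[:1, 1:]" and m = 0])
  fix x and \<sigma> :: store
  assume "\<sigma> 0 = A x"
  then show "\<exists>n \<tau>. exec Skip \<sigma> n \<tau> \<and> n \<le> poly [:1, 1:] (size (A x)) \<and> \<tau> 0 = A x \<and> (\<forall>v>0. \<tau> v = \<sigma> v)"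
    by (intro exI[of _ 1] exI[of _ \<sigma>] conjI exec.Skip) simp_all
qed simp

lemma pt_const: "pt A B (\<lambda>x. b)"
proof (rule ptI[where c = "Assign 0 (Const (B b))" and p = "[:1 + size (B b):]" and m = 0])
  fix x and \<sigma> :: store
  show "\<exists>n \<tau>. exec (Assign 0 (Const (B b))) \<sigma> n \<tau> \<and> n \<le> poly [:1 + size (B b):] (size (A x)) \<and>
    \<tau> 0 = B b \<and> (\<forall>v>0. \<tau> v = \<sigma> v)"
    using exec.Assign[of 0 "Const (B b)" \<sigma>]
    by (intro exI[of _ "1 + size (B b)"] exI[of _ "\<sigma>(0 := B b)"] conjI) simp_all
qed simp

text \<open>Only the stored tree matters, so a value may change its type or its encoding without any
  computation.\<close>

lemma pt_cast:
  assumes "pt E B f" "\<And>x. B (f x) = B' (f' x)"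
  shows "pt E B' f'"
  using assms unfolding pt_def by simp

lemma pt_comp:
  assumes "pt B C g" "pt A B f"
  shows "pt A C (\<lambda>x. g (f x))"
proof -
  obtain c1 m1 p1 where 1: "\<And>x. size (B (f x)) \<le> poly p1 (size (A x))"
    "\<And>x \<sigma>. \<sigma> 0 = A x \<Longrightarrow>
       \<exists>n \<tau>. exec c1 \<sigma> n \<tau> \<and> n \<le> poly p1 (size (A x)) \<and> \<tau> 0 = B (f x) \<and> (\<forall>v>m1. \<tau> v = \<sigma> v)"
    by (rule ptE[OF assms(2)]) (rule that)
  obtain c2 m2 p2 where 2: "\<And>x. size (C (g x)) \<le> poly p2 (size (B x))"
    "\<And>x \<sigma>. \<sigma> 0 = B x \<Longrightarrow>
       \<exists>n \<tau>. exec c2 \<sigma> n \<tau> \<and> n \<le> poly p2 (size (B x)) \<and> \<tau> 0 = C (g x) \<and> (\<forall>v>m2. \<tau> v = \<sigma> v)"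
    by (rule ptE[OF assms(1)]) (rule that)
  have le: "poly p2 (size (B (f x))) \<le> poly (pcompose p2 p1) (size (A x))" for x
    using 1(1) by (simp add: poly_pcompose poly_nat_mono)
  show ?thesis
  proof (rule ptI[where c = "Seq c1 c2" and p = "p1 + pcompose p2 p1" and m = "max m1 m2"])
    show "size (C (g (f x))) \<le> poly (p1 + pcompose p2 p1) (size (A x))" for x
      using 2(1)[of "f x"] le[of x] by simp
    fix x and \<sigma> :: store assume "\<sigma> 0 = A x"
    from 1(2)[of "\<sigma>" x, OF this] obtain n \<tau> where t: "exec c1 \<sigma> n \<tau>" "n \<le> poly p1 (size (A x))"
      "\<tau> 0 = B (f x)" "\<forall>v>m1. \<tau> v = \<sigma> v" by blast
    from 2(2)[of \<tau> "f x", OF t(3)] obtain n' \<tau>' where t': "exec c2 \<tau> n' \<tau>'" "n' \<le> poly p2 (size (B (f x)))"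
      "\<tau>' 0 = C (g (f x))" "\<forall>v>m2. \<tau>' v = \<tau> v" by blast
    show "\<exists>n \<tau>. exec (Seq c1 c2) \<sigma> n \<tau> \<and> n \<le> poly (p1 + pcompose p2 p1) (size (A x)) \<and>
       \<tau> 0 = C (g (f x)) \<and> (\<forall>v>max m1 m2. \<tau> v = \<sigma> v)"
      using t t' le[of x] by (intro exI[of _ "n + n'"] exI[of _ \<tau>'] conjI exec.Seq) auto
  qed
qed

text \<open>Projections of pairs, tails of lists and unary predecessors are all subtrees of the
  encoding, so one shape of program serves them.\<close>

lemma pt_subtree:
  assumes "pt E B f" "\<And>x. t (B (f x)) = B' (f' x)" "t = left \<or> t = right"
  shows "pt E B' f'"
proof -
  obtain ex where ex: "\<And>v \<sigma>. eval_exp (ex v) \<sigma> = t (\<sigma> v)"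
  proof (cases "t = left")
    case True
    then show ?thesis by (intro that[of "\<lambda>v. Fst (Var v)"]) simp
  next
    case False
    then show ?thesis using assms(3) by (intro that[of "\<lambda>v. Snd (Var v)"]) simp
  qed
  obtain c m p where 1: "\<And>x. size (B (f x)) \<le> poly p (size (E x))"
    "\<And>x \<sigma>. \<sigma> 0 = E x \<Longrightarrow>
       \<exists>n \<tau>. exec c \<sigma> n \<tau> \<and> n \<le> poly p (size (E x)) \<and> \<tau> 0 = B (f x) \<and> (\<forall>v>m. \<tau> v = \<sigma> v)"
    by (rule ptE[OF assms(1)]) (rule that)
  have "size (t d) \<le> size d" for d using assms(3) by (elim disjE; cases d; simp)
  then have le: "size (B' (f' x)) \<le> poly p (size (E x))" for x
    using assms(2)[of x, symmetric] 1(1)[of x] by (metis order.trans)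
  show ?thesis
  proof (rule ptI[where c = "Seq c (Assign 0 (ex 0))" and p = "p + 1 + p" and m = m])
    show "size (B' (f' x)) \<le> poly (p + 1 + p) (size (E x))" for x
      using le[of x] by simp
    fix x and \<sigma> :: store assume "\<sigma> 0 = E x"
    from 1(2)[of "\<sigma>" x, OF this] obtain n \<tau> where t: "exec c \<sigma> n \<tau>" "n \<le> poly p (size (E x))"
      "\<tau> 0 = B (f x)" "\<forall>v>m. \<tau> v = \<sigma> v" by blast
    show "\<exists>n \<tau>. exec (Seq c (Assign 0 (ex 0))) \<sigma> n \<tau> \<and> n \<le> poly (p + 1 + p) (size (E x)) \<and>
       \<tau> 0 = B' (f' x) \<and> (\<forall>v>m. \<tau> v = \<sigma> v)"
      using t le[of x] exec.Seq[OF t(1) exec.Assign[of 0 "ex 0" \<tau>]]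
      by (intro exI[of _ "n + (1 + size (B' (f' x)))"] exI[of _ "\<tau>(0 := B' (f' x))"] conjI)
        (simp_all add: ex assms(2))
  qed
qed

lemmas pt_left = pt_subtree[where t = left, simplified]
  and pt_right = pt_subtree[where t = right, simplified]

lemma pt_fst: "pt E (enc_prod A B) f \<Longrightarrow> pt E A (\<lambda>x. fst (f x))"
  by (erule pt_left) (metis enc_prod.simps left.simps(2) prod.collapse)

lemma pt_snd: "pt E (enc_prod A B) f \<Longrightarrow> pt E B (\<lambda>x. snd (f x))"
  by (erule pt_right) (metis enc_prod.simps right.simps(2) prod.collapse)

lemma pt_pair:
  assumes "pt E A f" "pt E B g"
  shows "pt E (enc_prod A B) (\<lambda>x. (f x, g x))"
proof -
  obtain c1 m1 p1 where 1: "\<And>x. size (A (f x)) \<le> poly p1 (size (E x))"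
    "\<And>x \<sigma>. \<sigma> 0 = E x \<Longrightarrow>
       \<exists>n \<tau>. exec c1 \<sigma> n \<tau> \<and> n \<le> poly p1 (size (E x)) \<and> \<tau> 0 = A (f x) \<and> (\<forall>v>m1. \<tau> v = \<sigma> v)"
    by (rule ptE[OF assms(1)]) (rule that)
  obtain c2 m2 p2 where 2: "\<And>x. size (B (g x)) \<le> poly p2 (size (E x))"
    "\<And>x \<sigma>. \<sigma> 0 = E x \<Longrightarrow>
       \<exists>n \<tau>. exec c2 \<sigma> n \<tau> \<and> n \<le> poly p2 (size (E x)) \<and> \<tau> 0 = B (g x) \<and> (\<forall>v>m2. \<tau> v = \<sigma> v)"
    by (rule ptE[OF assms(2)]) (rule that)
  \<comment> \<open>Both programs overwrite variable 0. Variable \<open>M + 1\<close> therefore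
    keeps the shared argument and \<open>M + 2\<close> the first result; neither program touches
    them.\<close>
  define M where "M = max m1 m2"
  let ?c = "Seq (Assign (M+1) (Var 0)) (Seq c1 (Seq (Assign (M+2) (Var 0)) (Seq (Assign 0 (Var (M+1)))
     (Seq c2 (Assign 0 (Pair (Var (M+2)) (Var 0)))))))"
  let ?p = "[:5, 2:] + p1 + p1 + p1 + p2 + p2"
  show ?thesis
  proof (rule ptI[where c = ?c and p = ?p and m = "M + 2"])
    show "size (enc_prod A B (f x, g x)) \<le> poly ?p (size (E x))" for x
      using 1(1)[of x] 2(1)[of x] by simp
    fix x and \<sigma> :: store assume s: "\<sigma> 0 = E x"
    let ?\<sigma>1 = "\<sigma>(M+1 := E x)"
    have "?\<sigma>1 0 = E x" using s by simp
    from 1(2)[of "?\<sigma>1" x, OF this] obtain n \<tau> where t: "exec c1 ?\<sigma>1 n \<tau>" "n \<le> poly p1 (size (E x))"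
      "\<tau> 0 = A (f x)" "\<forall>v>m1. \<tau> v = ?\<sigma>1 v" by blast
    let ?\<sigma>2 = "\<tau>(M+2 := A (f x), 0 := E x)"
    have "?\<sigma>2 0 = E x" by simp
    from 2(2)[of "?\<sigma>2" x, OF this] obtain n' \<tau>' where t': "exec c2 ?\<sigma>2 n' \<tau>'" "n' \<le> poly p2 (size (E x))"
      "\<tau>' 0 = B (g x)" "\<forall>v>m2. \<tau>' v = ?\<sigma>2 v" by blast
    have M1: "\<tau> (M+1) = E x" and M2: "\<tau>' (M+2) = A (f x)" using t(4) t'(4) by (auto simp: M_def)
    have e1: "exec (Assign (M+1) (Var 0)) \<sigma> (1 + size (E x)) ?\<sigma>1"
      using exec.Assign[of "M+1" "Var 0" \<sigma>] s by simp
    have e2: "exec (Assign (M+2) (Var 0)) \<tau> (1 + size (A (f x))) (\<tau>(M+2 := A (f x)))"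
      using exec.Assign[of "M+2" "Var 0" \<tau>] t(3) by simp
    have e3: "exec (Assign 0 (Var (M+1))) (\<tau>(M+2 := A (f x))) (1 + size (E x)) ?\<sigma>2"
      using exec.Assign[of 0 "Var (M+1)" "\<tau>(M+2 := A (f x))"] M1 by simp
    have e4: "exec (Assign 0 (Pair (Var (M+2)) (Var 0))) \<tau>' (1 + (size (A (f x)) + size (B (g x)) + 1))
        (\<tau>'(0 := Node (A (f x)) (B (g x))))"
      using exec.Assign[of 0 "Pair (Var (M+2)) (Var 0)" \<tau>'] M2 t'(3) by simp
    show "\<exists>n \<tau>. exec ?c \<sigma> n \<tau> \<and> n \<le> poly ?p (size (E x)) \<and>
       \<tau> 0 = enc_prod A B (f x, g x) \<and> (\<forall>v>M+2. \<tau> v = \<sigma> v)"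
    proof (intro exI conjI)
      show "exec ?c \<sigma> (1 + size (E x) + (n + ((1 + size (A (f x))) + ((1 + size (E x)) + (n' +
          (1 + (size (A (f x)) + size (B (g x)) + 1)))))))
         (\<tau>'(0 := Node (A (f x)) (B (g x))))"
        by (intro exec.Seq[OF e1] exec.Seq[OF t(1)] exec.Seq[OF e2] exec.Seq[OF e3] exec.Seq[OF t'(1)] e4)
    next
      show "\<forall>v>M+2. (\<tau>'(0 := Node (A (f x)) (B (g x)))) v = \<sigma> v"
        using t(4) t'(4) by (auto simp: M_def)
    qed (use 1(1)[of x] 2(1)[of x] t t' in auto)
  qed
qed

definition enc_bool :: "bool \<Rightarrow> btree" where
  "enc_bool b = (if b then Node Leaf Leaf else Leaf)"

lemma pt_if:
  assumes "pt E enc_bool b" "pt E A f" "pt E A g"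
  shows "pt E A (\<lambda>x. if b x then f x else g x)"
proof -
  obtain c0 m0 p0 where "\<And>x. size (enc_bool (b x)) \<le> poly p0 (size (E x))" and 0:
    "\<And>x \<sigma>. \<sigma> 0 = E x \<Longrightarrow>
       \<exists>n \<tau>. exec c0 \<sigma> n \<tau> \<and> n \<le> poly p0 (size (E x)) \<and> \<tau> 0 = enc_bool (b x) \<and> (\<forall>v>m0. \<tau> v = \<sigma> v)"
    by (rule ptE[OF assms(1)]) (rule that)
  obtain c1 m1 p1 where 1: "\<And>x. size (A (f x)) \<le> poly p1 (size (E x))"
    "\<And>x \<sigma>. \<sigma> 0 = E x \<Longrightarrow>
       \<exists>n \<tau>. exec c1 \<sigma> n \<tau> \<and> n \<le> poly p1 (size (E x)) \<and> \<tau> 0 = A (f x) \<and> (\<forall>v>m1. \<tau> v = \<sigma> v)"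
    by (rule ptE[OF assms(2)]) (rule that)
  obtain c2 m2 p2 where 2: "\<And>x. size (A (g x)) \<le> poly p2 (size (E x))"
    "\<And>x \<sigma>. \<sigma> 0 = E x \<Longrightarrow>
       \<exists>n \<tau>. exec c2 \<sigma> n \<tau> \<and> n \<le> poly p2 (size (E x)) \<and> \<tau> 0 = A (g x) \<and> (\<forall>v>m2. \<tau> v = \<sigma> v)"
    by (rule ptE[OF assms(3)]) (rule that)
  define M where "M = m0 + m1 + m2"
  let ?c = "Seq (Assign (M+1) (Var 0)) (Seq c0 (Seq (Assign (M+2) (Var 0)) (Seq (Assign 0 (Var (M+1)))
     (If (Var (M+2)) c1 c2))))"
  let ?p = "[:5, 2:] + p0 + p1 + p2"
  show ?thesis
  proof (rule ptI[where c = ?c and p = ?p and m = "M + 2"])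
    show "size (A (if b x then f x else g x)) \<le> poly ?p (size (E x))" for x
      using 1(1)[of x] 2(1)[of x] by simp
    fix x and \<sigma> :: store assume s: "\<sigma> 0 = E x"
    let ?\<sigma>1 = "\<sigma>(M+1 := E x)"
    have "?\<sigma>1 0 = E x" using s by simp
    from 0[of "?\<sigma>1" x, OF this] obtain n \<tau> where t: "exec c0 ?\<sigma>1 n \<tau>" "n \<le> poly p0 (size (E x))"
      "\<tau> 0 = enc_bool (b x)" "\<forall>v>m0. \<tau> v = ?\<sigma>1 v" by blast
    let ?\<sigma>2 = "\<tau>(M+2 := enc_bool (b x), 0 := E x)"
    have s2: "?\<sigma>2 0 = E x" by simp
    have "\<exists>n' \<tau>'. exec (If (Var (M+2)) c1 c2) ?\<sigma>2 (1 + n') \<tau>' \<and> n' \<le> poly (p1 + p2) (size (E x)) \<and>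
      \<tau>' 0 = A (if b x then f x else g x) \<and> (\<forall>v>M. \<tau>' v = ?\<sigma>2 v)"
    proof (cases "b x")
      case True
      from 1(2)[of ?\<sigma>2 x, OF s2] obtain n' \<tau>' where t': "exec c1 ?\<sigma>2 n' \<tau>'" "n' \<le> poly p1 (size (E x))"
        "\<tau>' 0 = A (f x)" "\<forall>v>m1. \<tau>' v = ?\<sigma>2 v" by blast
      then show ?thesis using True
        by (intro exI[of _ n'] exI[of _ \<tau>'] conjI exec.IfTrue) (auto simp: enc_bool_def M_def)
    next
      case False
      from 2(2)[of ?\<sigma>2 x, OF s2] obtain n' \<tau>' where t': "exec c2 ?\<sigma>2 n' \<tau>'" "n' \<le> poly p2 (size (E x))"
        "\<tau>' 0 = A (g x)" "\<forall>v>m2. \<tau>' v = ?\<sigma>2 v" by blast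
      then show ?thesis using False
        by (intro exI[of _ n'] exI[of _ \<tau>'] conjI exec.IfFalse) (auto simp: enc_bool_def M_def)
    qed
    then obtain n' \<tau>' where t': "exec (If (Var (M+2)) c1 c2) ?\<sigma>2 (1 + n') \<tau>'"
      "n' \<le> poly (p1 + p2) (size (E x))"
      "\<tau>' 0 = A (if b x then f x else g x)" "\<forall>v>M. \<tau>' v = ?\<sigma>2 v" by blast
    have M1: "\<tau> (M+1) = E x" using t(4) by (auto simp: M_def)
    have e1: "exec (Assign (M+1) (Var 0)) \<sigma> (1 + size (E x)) ?\<sigma>1"
      using exec.Assign[of "M+1" "Var 0" \<sigma>] s by simp
    have e2: "exec (Assign (M+2) (Var 0)) \<tau> (1 + size (enc_bool (b x))) (\<tau>(M+2 := enc_bool (b x)))"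
      using exec.Assign[of "M+2" "Var 0" \<tau>] t(3) by simp
    have e3: "exec (Assign 0 (Var (M+1))) (\<tau>(M+2 := enc_bool (b x))) (1 + size (E x)) ?\<sigma>2"
      using exec.Assign[of 0 "Var (M+1)" "\<tau>(M+2 := enc_bool (b x))"] M1 by simp
    have "size (enc_bool (b x)) \<le> 1" by (auto simp: enc_bool_def)
    then show "\<exists>n \<tau>. exec ?c \<sigma> n \<tau> \<and> n \<le> poly ?p (size (E x)) \<and>
       \<tau> 0 = A (if b x then f x else g x) \<and> (\<forall>v>M+2. \<tau> v = \<sigma> v)"
      using t t'
      by (intro exI[of _ "1 + size (E x) + (n + ((1 + size (enc_bool (b x))) + ((1 + size (E x)) + (1 + n'))))"]
          exI[of _ \<tau>'] conjI exec.Seq[OF e1] exec.Seq[OF t(1)] exec.Seq[OF e2] exec.Seq[OF e3] t'(1))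
        (auto simp: M_def)
  qed
qed

text \<open>The language only tests for \<open>Leaf\<close>; this normalises the answer to the two
  trees of \<open>enc_bool\<close>.\<close>

lemma pt_test:
  assumes "pt E B f" "\<And>x. b x \<longleftrightarrow> B (f x) \<noteq> Leaf"
  shows "pt E enc_bool b"
proof -
  obtain c m p where 1: "\<And>x. size (B (f x)) \<le> poly p (size (E x))"
    "\<And>x \<sigma>. \<sigma> 0 = E x \<Longrightarrow>
       \<exists>n \<tau>. exec c \<sigma> n \<tau> \<and> n \<le> poly p (size (E x)) \<and> \<tau> 0 = B (f x) \<and> (\<forall>v>m. \<tau> v = \<sigma> v)"
    by (rule ptE[OF assms(1)]) (rule that)
  let ?c = "Seq c (If (Var 0) (Assign 0 (Const (Node Leaf Leaf))) (Assign 0 (Const Leaf)))"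
  show ?thesis
  proof (rule ptI[where c = ?c and p = "p + [:3:]" and m = m])
    show "size (enc_bool (b x)) \<le> poly (p + [:3:]) (size (E x))" for x
      by (auto simp: enc_bool_def)
    fix x and \<sigma> :: store assume "\<sigma> 0 = E x"
    from 1(2)[of "\<sigma>" x, OF this] obtain n \<tau> where t: "exec c \<sigma> n \<tau>" "n \<le> poly p (size (E x))"
      "\<tau> 0 = B (f x)" "\<forall>v>m. \<tau> v = \<sigma> v" by blast
    have "\<exists>n' \<tau>'. exec (If (Var 0) (Assign 0 (Const (Node Leaf Leaf))) (Assign 0 (Const Leaf))) \<tau> n' \<tau>' \<and>
      n' \<le> 3 \<and> \<tau>' = \<tau>(0 := enc_bool (b x))"
    proof (cases "b x")
      case True
      then have "eval_exp (Var 0) \<tau> \<noteq> Leaf" using assms(2) t(3) by simp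
      from exec.IfTrue[OF this exec.Assign[of 0 "Const (Node Leaf Leaf)" \<tau>]] show ?thesis
        using True by (intro exI[of _ "1 + (1 + size (Node Leaf Leaf))"] exI[of _ "\<tau>(0 := enc_bool (b x))"] conjI)
          (simp_all add: enc_bool_def)
    next
      case False
      then have "eval_exp (Var 0) \<tau> = Leaf" using assms(2) t(3) by simp
      from exec.IfFalse[OF this exec.Assign[of 0 "Const (Leaf)" \<tau>]] show ?thesis
        using False by (intro exI[of _ "1 + (1 + size (Leaf))"] exI[of _ "\<tau>(0 := enc_bool (b x))"] conjI)
          (simp_all add: enc_bool_def)
    qed
    then obtain n' where t': "exec (If (Var 0) (Assign 0 (Const (Node Leaf Leaf))) (Assign 0 (Const Leaf))) \<tau> n'
       (\<tau>(0 := enc_bool (b x)))" "n' \<le> 3" by blast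
    show "\<exists>n \<tau>. exec ?c \<sigma> n \<tau> \<and> n \<le> poly (p + [:3:]) (size (E x)) \<and>
       \<tau> 0 = enc_bool (b x) \<and> (\<forall>v>m. \<tau> v = \<sigma> v)"
      using t t' exec.Seq[OF t(1) t'(1)]
      by (intro exI[of _ "n + n'"] exI[of _ "\<tau>(0 := enc_bool (b x))"] conjI) simp_all
  qed
qed

lemma size_enc_list: "size (enc_list A xs) = (\<Sum>x\<leftarrow>xs. size (A x) + 1)"
  by (induction xs) auto

lemma length_le_size: "length xs \<le> size (enc_list A xs)"
  by (induction xs) auto

lemma elem_le_size: "x \<in> set xs \<Longrightarrow> size (A x) \<le> size (enc_list A xs)"
  by (induction xs) auto

text \<open>Variable \<open>M + 1\<close> holds the environment, \<open>M + 2\<close> the rest of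
  the list and \<open>M + 3\<close> the accumulator. The bound \<open>qb\<close> covers the
  accumulator after every prefix, so each round is charged the same amount.\<close>

lemma exec_fold:
  assumes step: "\<And>e x s \<sigma>. \<sigma> 0 = enc_prod E (enc_prod A S) (e, x, s) \<Longrightarrow>
       \<exists>n \<tau>. exec c \<sigma> n \<tau> \<and> n \<le> poly p (size (enc_prod E (enc_prod A S) (e, x, s))) \<and>
         \<tau> 0 = S (h e x s) \<and> (\<forall>v>m. \<tau> v = \<sigma> v)"
    and "m \<le> M"
  defines "prog \<equiv> While (Var (M+2)) (Seq (Assign 0 (Pair (Var (M+1)) (Pair (Fst (Var (M+2))) (Var (M+3)))))
     (Seq c (Seq (Assign (M+3) (Var 0)) (Assign (M+2) (Snd (Var (M+2)))))))"
  shows "\<sigma> (M+1) = E e \<Longrightarrow> \<sigma> (M+2) = enc_list A xs \<Longrightarrow> \<sigma> (M+3) = S s \<Longrightarrow>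
    (\<And>i. i \<le> length xs \<Longrightarrow> size (S (fold (h e) (take i xs) s)) \<le> qb) \<Longrightarrow> size (enc_list A xs) \<le> lb \<Longrightarrow>
    \<exists>n \<tau>. exec prog \<sigma> n \<tau> \<and>
      n \<le> length xs * (poly p (2 + size (E e) + lb + qb) + (6 + size (E e) + 2 * lb + 2 * qb)) + 1 \<and>
      \<tau> (M+3) = S (fold (h e) xs s) \<and> (\<forall>v>M+3. \<tau> v = \<sigma> v)"
proof (induction xs arbitrary: s \<sigma>)
  case Nil
  then have "exec prog \<sigma> 1 \<sigma>" unfolding prog_def by (intro exec.WhileFalse) simp
  then show ?case using Nil by (intro exI[of _ 1] exI[of _ \<sigma>]) auto
next
  case (Cons x xs)
  let ?i = "enc_prod E (enc_prod A S) (e, x, s)"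
  let ?W = "poly p (2 + size (E e) + lb + qb) + (6 + size (E e) + 2 * lb + 2 * qb)"
  have qs: "size (S s) \<le> qb" using Cons.prems(4)[of 0] by simp
  have qh: "size (S (h e x s)) \<le> qb" using Cons.prems(4)[of 1] by simp
  have lx: "size (A x) + size (enc_list A xs) + 1 \<le> lb" using Cons.prems(5) by simp
  have e1: "exec (Assign 0 (Pair (Var (M+1)) (Pair (Fst (Var (M+2))) (Var (M+3))))) \<sigma> (1 + size ?i)
     (\<sigma>(0 := ?i))"
    using exec.Assign[of 0 "Pair (Var (M+1)) (Pair (Fst (Var (M+2))) (Var (M+3)))" \<sigma>] Cons.prems by simp
  obtain n \<tau> where t: "exec c (\<sigma>(0 := ?i)) n \<tau>" "n \<le> poly p (size ?i)"
    "\<tau> 0 = S (h e x s)" "\<forall>v>m. \<tau> v = (\<sigma>(0 := ?i)) v"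
    using step[of "\<sigma>(0 := ?i)" e x s] by auto
  let ?\<tau>1 = "\<tau>(M+3 := S (h e x s))"
  let ?\<tau>2 = "?\<tau>1(M+2 := enc_list A xs)"
  have e2: "exec (Assign (M+3) (Var 0)) \<tau> (1 + size (S (h e x s))) ?\<tau>1"
    using exec.Assign[of "M+3" "Var 0" \<tau>] t(3) by simp
  have e3: "exec (Assign (M+2) (Snd (Var (M+2)))) ?\<tau>1 (1 + size (enc_list A xs)) ?\<tau>2"
    using exec.Assign[of "M+2" "Snd (Var (M+2))" ?\<tau>1] t(4) Cons.prems(2) \<open>m \<le> M\<close> by simp
  have "\<exists>n \<tau>. exec prog ?\<tau>2 n \<tau> \<and> n \<le> length xs * ?W + 1 \<and>
      \<tau> (M+3) = S (fold (h e) xs (h e x s)) \<and> (\<forall>v>M+3. \<tau> v = ?\<tau>2 v)"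
  proof (rule Cons.IH)
    show "?\<tau>2 (M + 1) = E e" using Cons.prems(1) t(4) \<open>m \<le> M\<close> by simp
    show "size (S (fold (h e) (take i xs) (h e x s))) \<le> qb" if "i \<le> length xs" for i
      using Cons.prems(4)[of "Suc i"] that by simp
  qed (use lx in auto)
  then obtain n' \<tau>' where t': "exec prog ?\<tau>2 n' \<tau>'" "n' \<le> length xs * ?W + 1"
      "\<tau>' (M+3) = S (fold (h e) xs (h e x s))" "\<forall>v>M+3. \<tau>' v = ?\<tau>2 v" by blast
  have E: "exec prog \<sigma> (1 + ((1 + size ?i) + (n + ((1 + size (S (h e x s))) + (1 + size (enc_list A xs))))) + n') \<tau>'"
    unfolding prog_def
    by (rule exec.WhileTrue[OF _ exec.Seq[OF e1 exec.Seq[OF t(1) exec.Seq[OF e2 e3]]] t'(1)[unfolded prog_def]])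
      (use Cons.prems(2) in simp)
  have "size ?i \<le> 2 + size (E e) + lb + qb" using qs lx by simp
  then have "n \<le> poly p (2 + size (E e) + lb + qb)" using t(2) poly_nat_mono order.trans by blast
  then have "1 + ((1 + size ?i) + (n + ((1 + size (S (h e x s))) + (1 + size (enc_list A xs))))) \<le> ?W"
    using qs qh lx by simp
  then have T: "1 + ((1 + size ?i) + (n + ((1 + size (S (h e x s))) + (1 + size (enc_list A xs))))) + n'
     \<le> length (x # xs) * ?W + 1" using t'(2) by simp
  have "\<forall>v>M+3. \<tau>' v = \<sigma> v" using t'(4) t(4) \<open>m \<le> M\<close> by simp
  then show ?case using t'(3) by (intro exI, intro conjI) (rule E, rule T, simp_all)
qed

text \<open>A step that runs in polynomial time can still square the size of the accumulator in each
  round. The bound on all intermediate accumulators excludes this and cannot be deduced from the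
  step alone.\<close>

lemma pt_fold:
  assumes "pt (enc_prod E (enc_prod A S)) S (\<lambda>z. h (fst z) (fst (snd z)) (snd (snd z)))"
    and "pt E (enc_list A) xs" "pt E S s"
    and bd: "\<And>e i. i \<le> length (xs e) \<Longrightarrow> size (S (fold (h e) (take i (xs e)) (s e))) \<le> poly q (size (E e))"
  shows "pt E S (\<lambda>e. fold (h e) (xs e) (s e))"
proof -
  obtain c0 m0 p0 where
    "\<And>z. size (S (h (fst z) (fst (snd z)) (snd (snd z)))) \<le> poly p0 (size (enc_prod E (enc_prod A S) z))" and 0:
    "\<And>z \<sigma>. \<sigma> 0 = enc_prod E (enc_prod A S) z \<Longrightarrow>
       \<exists>n \<tau>. exec c0 \<sigma> n \<tau> \<and> n \<le> poly p0 (size (enc_prod E (enc_prod A S) z)) \<and>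
         \<tau> 0 = S (h (fst z) (fst (snd z)) (snd (snd z))) \<and> (\<forall>v>m0. \<tau> v = \<sigma> v)"
    by (rule ptE[OF assms(1)]) (rule that)
  obtain c1 m1 p1 where 1: "\<And>x. size (enc_list A (xs x)) \<le> poly p1 (size (E x))"
    "\<And>x \<sigma>. \<sigma> 0 = E x \<Longrightarrow>
       \<exists>n \<tau>. exec c1 \<sigma> n \<tau> \<and> n \<le> poly p1 (size (E x)) \<and> \<tau> 0 = enc_list A (xs x) \<and> (\<forall>v>m1. \<tau> v = \<sigma> v)"
    by (rule ptE[OF assms(2)]) (rule that)
  obtain c2 m2 p2 where 2: "\<And>x. size (S (s x)) \<le> poly p2 (size (E x))"
    "\<And>x \<sigma>. \<sigma> 0 = E x \<Longrightarrow>
       \<exists>n \<tau>. exec c2 \<sigma> n \<tau> \<and> n \<le> poly p2 (size (E x)) \<and> \<tau> 0 = S (s x) \<and> (\<forall>v>m2. \<tau> v = \<sigma> v)"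
    by (rule ptE[OF assms(3)]) (rule that)
  define M where "M = m0 + m1 + m2"
  define loop where "loop = While (Var (M+2)) (Seq (Assign 0 (Pair (Var (M+1)) (Pair (Fst (Var (M+2))) (Var (M+3)))))
     (Seq c0 (Seq (Assign (M+3) (Var 0)) (Assign (M+2) (Snd (Var (M+2)))))))"
  let ?c = "Seq (Assign (M+1) (Var 0)) (Seq c1 (Seq (Assign (M+2) (Var 0)) (Seq (Assign 0 (Var (M+1)))
     (Seq c2 (Seq (Assign (M+3) (Var 0)) (Seq loop (Assign 0 (Var (M+3)))))))))"
  let ?r = "[:2, 1:] + p1 + q"
  \<comment> \<open>The product accounts for the loop: at most \<open>p1\<close> rounds, each of
    which runs \<open>c0\<close> on a tree of size at most \<open>?r\<close>.\<close>
  let ?p = "[:6, 2:] + p1 + p1 + p2 + p2 + q + (p1 * (pcompose p0 ?r + ([:6, 1:] + p1 + p1 + q + q)))"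
  show ?thesis
  proof (rule ptI[where c = ?c and p = ?p and m = "M + 3"])
    show "size (S (fold (h x) (xs x) (s x))) \<le> poly ?p (size (E x))" for x
      using bd[of "length (xs x)" x] by simp
    fix x and \<sigma> :: store assume s: "\<sigma> 0 = E x"
    let ?\<sigma>1 = "\<sigma>(M+1 := E x)"
    have "?\<sigma>1 0 = E x" using s by simp
    from 1(2)[of "?\<sigma>1" x, OF this] obtain n \<tau> where t: "exec c1 ?\<sigma>1 n \<tau>" "n \<le> poly p1 (size (E x))"
      "\<tau> 0 = enc_list A (xs x)" "\<forall>v>m1. \<tau> v = ?\<sigma>1 v" by blast
    let ?l = "enc_list A (xs x)"
    let ?\<sigma>2 = "\<tau>(M+2 := ?l, 0 := E x)"
    have "?\<sigma>2 0 = E x" by simp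
    from 2(2)[of "?\<sigma>2" x, OF this] obtain n' \<tau>' where t': "exec c2 ?\<sigma>2 n' \<tau>'" "n' \<le> poly p2 (size (E x))"
      "\<tau>' 0 = S (s x)" "\<forall>v>m2. \<tau>' v = ?\<sigma>2 v" by blast
    let ?\<sigma>3 = "\<tau>'(M+3 := S (s x))"
    have M1: "\<tau> (M+1) = E x" using t(4) by (auto simp: M_def)
    have "\<exists>n \<tau>. exec loop ?\<sigma>3 n \<tau> \<and>
      n \<le> length (xs x) * (poly p0 (2 + size (E x) + poly p1 (size (E x)) + poly q (size (E x))) +
         (6 + size (E x) + 2 * poly p1 (size (E x)) + 2 * poly q (size (E x)))) + 1 \<and>
      \<tau> (M+3) = S (fold (h x) (xs x) (s x)) \<and> (\<forall>v>M+3. \<tau> v = ?\<sigma>3 v)"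
      unfolding loop_def
    proof (rule exec_fold[where m = m0])
      show "\<exists>n \<tau>. exec c0 \<sigma> n \<tau> \<and> n \<le> poly p0 (size (enc_prod E (enc_prod A S) (e, x, s))) \<and>
         \<tau> 0 = S (h e x s) \<and> (\<forall>v>m0. \<tau> v = \<sigma> v)" if "\<sigma> 0 = enc_prod E (enc_prod A S) (e, x, s)"
        for e x s and \<sigma> :: store using 0[of \<sigma> "(e, x, s)", OF that] by simp
      show "?\<sigma>3 (M + 1) = E x" "?\<sigma>3 (M + 2) = ?l"
        using t'(4) M1 by (auto simp: M_def)
    qed (use bd 1(1) in \<open>auto simp: M_def\<close>)
    then obtain n3 \<tau>3 where t3: "exec loop ?\<sigma>3 n3 \<tau>3"
      "n3 \<le> length (xs x) * (poly p0 (2 + size (E x) + poly p1 (size (E x)) + poly q (size (E x))) +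
         (6 + size (E x) + 2 * poly p1 (size (E x)) + 2 * poly q (size (E x)))) + 1"
      "\<tau>3 (M+3) = S (fold (h x) (xs x) (s x))" "\<forall>v>M+3. \<tau>3 v = ?\<sigma>3 v" by blast
    have "length (xs x) \<le> poly p1 (size (E x))"
      using length_le_size[of "xs x" A] 1(1)[of x] by linarith
    then have n3: "n3 \<le> poly p1 (size (E x)) * (poly p0 (2 + size (E x) + poly p1 (size (E x)) + poly q (size (E x))) +
         (6 + size (E x) + 2 * poly p1 (size (E x)) + 2 * poly q (size (E x)))) + 1"
      using t3(2) by (meson add_le_mono1 mult_le_mono1 order.trans)
    let ?o = "S (fold (h x) (xs x) (s x))"
    have e1: "exec (Assign (M+1) (Var 0)) \<sigma> (1 + size (E x)) ?\<sigma>1"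
      using exec.Assign[of "M+1" "Var 0" \<sigma>] s by simp
    have e2: "exec (Assign (M+2) (Var 0)) \<tau> (1 + size ?l) (\<tau>(M+2 := ?l))"
      using exec.Assign[of "M+2" "Var 0" \<tau>] t(3) by simp
    have e3: "exec (Assign 0 (Var (M+1))) (\<tau>(M+2 := ?l)) (1 + size (E x)) ?\<sigma>2"
      using exec.Assign[of 0 "Var (M+1)" "\<tau>(M+2 := ?l)"] M1 by simp
    have e4: "exec (Assign (M+3) (Var 0)) \<tau>' (1 + size (S (s x))) ?\<sigma>3"
      using exec.Assign[of "M+3" "Var 0" \<tau>'] t'(3) by simp
    have e5: "exec (Assign 0 (Var (M+3))) \<tau>3 (1 + size ?o) (\<tau>3(0 := ?o))"
      using exec.Assign[of 0 "Var (M+3)" \<tau>3] t3(3) by simp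
    have bo: "size ?o \<le> poly q (size (E x))" using bd[of "length (xs x)" x] by simp
    show "\<exists>n \<tau>. exec ?c \<sigma> n \<tau> \<and> n \<le> poly ?p (size (E x)) \<and> \<tau> 0 = ?o \<and> (\<forall>v>M+3. \<tau> v = \<sigma> v)"
    proof (intro exI conjI)
      show "exec ?c \<sigma> (1 + size (E x) + (n + ((1 + size ?l) + ((1 + size (E x)) + (n' + ((1 + size (S (s x))) +
         (n3 + (1 + size ?o)))))))) (\<tau>3(0 := ?o))"
        by (intro exec.Seq[OF e1] exec.Seq[OF t(1)] exec.Seq[OF e2] exec.Seq[OF e3] exec.Seq[OF t'(1)]
            exec.Seq[OF e4] exec.Seq[OF t3(1)] e5)
      show "\<forall>v>M+3. (\<tau>3(0 := ?o)) v = \<sigma> v" using t(4) t'(4) t3(4) by (auto simp: M_def)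
      show "1 + size (E x) + (n + ((1 + size ?l) + ((1 + size (E x)) + (n' + ((1 + size (S (s x))) +
         (n3 + (1 + size ?o))))))) \<le> poly ?p (size (E x))"
        using n3 bo 1(1)[of x] 2(1)[of x] t(2) t'(2)
        by (simp add: poly_pcompose algebra_simps)
    qed simp
  qed
qed

text \<open>If each round adds only an amount bounded in terms of the environment, sizes grow
  linearly in the number of rounds. Most loops below satisfy this simpler criterion.\<close>

lemma pt_fold_add:
  assumes "pt (enc_prod E (enc_prod A S)) S (\<lambda>z. h (fst z) (fst (snd z)) (snd (snd z)))"
    and "pt E (enc_list A) xs" "pt E S s"
    and bd: "\<And>e x s. x \<in> set (xs e) \<Longrightarrow> size (S (h e x s)) \<le> size (S s) + poly q (size (E e))"
  shows "pt E S (\<lambda>e. fold (h e) (xs e) (s e))"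
proof -
  obtain p1 where p1: "\<And>x. size (enc_list A (xs x)) \<le> poly p1 (size (E x))"
    using pt_size[OF assms(2)] by blast
  obtain p2 where p2: "\<And>x. size (S (s x)) \<le> poly p2 (size (E x))"
    using pt_size[OF assms(3)] by blast
  have fb: "size (S (fold (h e) ys t)) \<le> size (S t) + length ys * poly q (size (E e))"
    if "set ys \<subseteq> set (xs e)" for e ys t
    using that
  proof (induction ys arbitrary: t)
    case (Cons y ys)
    have "size (S (fold (h e) ys (h e y t))) \<le> size (S (h e y t)) + length ys * poly q (size (E e))"
      using Cons by simp
    moreover have "size (S (h e y t)) \<le> size (S t) + poly q (size (E e))"
      using Cons.prems by (intro bd) simp
    ultimately show ?case by simp
  qed simp
  show ?thesis
  proof (rule pt_fold[OF assms(1-3), where q = "p2 + p1 * q"])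
    fix e i
    have "length (take i (xs e)) \<le> poly p1 (size (E e))"
      using length_le_size[of "xs e" A] p1[of e] by simp
    then have "length (take i (xs e)) * poly q (size (E e)) \<le> poly p1 (size (E e)) * poly q (size (E e))"
      by (rule mult_le_mono1)
    moreover have "size (S (fold (h e) (take i (xs e)) (s e))) \<le>
        size (S (s e)) + length (take i (xs e)) * poly q (size (E e))"
      by (rule fb) (rule set_take_subset)
    ultimately show "size (S (fold (h e) (take i (xs e)) (s e))) \<le> poly (p2 + p1 * q) (size (E e))"
      using p2[of e] unfolding poly_add poly_mult by linarith
  qed
qed

section \<open>Polynomial-time functions on numbers and lists\<close>

lemmas pt_first = pt_fst[OF pt_id] and pt_second = pt_snd[OF pt_id]

lemma pt_Cons: "pt E A f \<Longrightarrow> pt E (enc_list A) g \<Longrightarrow> pt E (enc_list A) (\<lambda>e. f e # g e)"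
  by (rule pt_cast[OF pt_pair[of E A f "enc_list A" g]]) auto

lemma pt_Suc: "pt E enc_unary f \<Longrightarrow> pt E enc_unary (\<lambda>e. Suc (f e))"
  by (rule pt_cast[OF pt_pair[of E "\<lambda>_. Leaf" "\<lambda>_. ()" enc_unary f]]) (auto intro: pt_const)

lemma pt_pred: "pt E enc_unary f \<Longrightarrow> pt E enc_unary (\<lambda>e. f e - 1)"
proof (erule pt_right)
  show "right (enc_unary (f x)) = enc_unary (f x - 1)" for x by (cases "f x") auto
qed

lemma pt_tl: "pt E (enc_list A) f \<Longrightarrow> pt E (enc_list A) (\<lambda>e. tl (f e))"
proof (erule pt_right)
  show "right (enc_list A (f x)) = enc_list A (tl (f x))" for x by (cases "f x") auto
qed

lemma pt_not: "pt E enc_bool b \<Longrightarrow> pt E enc_bool (\<lambda>e. \<not> b e)"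
  by (rule pt_cast[OF pt_if[of E b enc_bool "\<lambda>_. False" "\<lambda>_. True"]]) (auto simp: pt_const)

lemma pt_and: "pt E enc_bool b \<Longrightarrow> pt E enc_bool c \<Longrightarrow> pt E enc_bool (\<lambda>e. b e \<and> c e)"
  by (rule pt_cast[OF pt_if[of E b enc_bool c "\<lambda>_. False"]]) (auto simp: pt_const)

lemma pt_or: "pt E enc_bool b \<Longrightarrow> pt E enc_bool c \<Longrightarrow> pt E enc_bool (\<lambda>e. b e \<or> c e)"
  by (rule pt_cast[OF pt_if[of E b enc_bool "\<lambda>_. True" c]]) (auto simp: pt_const)

lemma pt_eq_bool: "pt E enc_bool b \<Longrightarrow> pt E enc_bool c \<Longrightarrow> pt E enc_bool (\<lambda>e. b e = c e)"
  by (rule pt_cast[OF pt_if[of E b enc_bool c "\<lambda>e. \<not> c e"]]) (auto simp: pt_not)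

lemma pt_Nil: "pt E (enc_list A) xs \<Longrightarrow> pt E enc_bool (\<lambda>e. xs e = [])"
proof -
  assume "pt E (enc_list A) xs"
  then have "pt E enc_bool (\<lambda>e. xs e \<noteq> [])"
  proof (rule pt_test)
    show "xs x \<noteq> [] \<longleftrightarrow> enc_list A (xs x) \<noteq> Leaf" for x by (cases "xs x") auto
  qed
  from pt_not[OF this] show ?thesis by simp
qed

lemma pt_is_0: "pt E enc_unary f \<Longrightarrow> pt E enc_bool (\<lambda>e. f e = 0)"
proof -
  assume "pt E enc_unary f"
  then have "pt E enc_bool (\<lambda>e. f e \<noteq> 0)"
  proof (rule pt_test)
    show "f x \<noteq> 0 \<longleftrightarrow> enc_unary (f x) \<noteq> Leaf" for x by (cases "f x") auto
  qed
  from pt_not[OF this] show ?thesis by simp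
qed

text \<open>A unary number and a list of units are the same tree, so loops over lists double as
  counted loops.\<close>

lemma pt_replicate: "pt E enc_unary n \<Longrightarrow> pt E A x \<Longrightarrow> pt E (enc_list (\<lambda>_ :: unit. Leaf)) (\<lambda>e. replicate (n e) ())"
proof (erule pt_cast)
  have "enc_unary m = enc_list (\<lambda>_ :: unit. Leaf) (replicate m ())" for m by (induction m) auto
  then show "enc_unary (n x) = enc_list (\<lambda>_ :: unit. Leaf) (replicate (n x) ())" for x .
qed

lemma fold_const_funpow: "fold (\<lambda>_. f) xs s = (f ^^ length xs) s"
  by (induction xs arbitrary: s) (auto simp: funpow_swap1)

lemma pt_funpow:
  assumes h: "pt (enc_prod E S) S (\<lambda>z. h (fst z) (snd z))" and n: "pt E enc_unary n" and s: "pt E S s"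
    and bd: "\<And>e i. i \<le> n e \<Longrightarrow> size (S ((h e ^^ i) (s e))) \<le> poly q (size (E e))"
  shows "pt E S (\<lambda>e. (h e ^^ n e) (s e))"
proof -
  let ?U = "\<lambda>_ :: unit. Leaf"
  have "pt E S (\<lambda>e. fold (\<lambda>_. h e) (replicate (n e) ()) (s e))"
  proof (rule pt_fold[where A = ?U])
    have "pt (enc_prod E (enc_prod ?U S)) (enc_prod E S) (\<lambda>z. (fst z, snd (snd z)))"
      by (rule pt_pair pt_fst pt_snd pt_id)+
    from pt_comp[OF h this]
    show "pt (enc_prod E (enc_prod ?U S)) S (\<lambda>z. h (fst z) (snd (snd z)))" by simp
    show "pt E (enc_list ?U) (\<lambda>e. replicate (n e) ())" using n by (rule pt_replicate[OF _ pt_id])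
    show "size (S (fold (\<lambda>_. h e) (take i (replicate (n e) ())) (s e))) \<le> poly q (size (E e))"
      if "i \<le> length (replicate (n e) ())" for e i
      using bd[of i e] that by (simp add: fold_const_funpow min_absorb1)
  qed (rule s)
  then show ?thesis by (simp add: fold_const_funpow)
qed

lemma size_enc_unary [simp]: "size (enc_unary n) = n"
  by (induction n) auto

lemma pt_unary_bound:
  assumes "pt E enc_unary f"
  obtains p where "\<And>e. f e \<le> poly p (size (E e))"
  using pt_size[OF assms] by auto

lemma pt_funpow_add:
  assumes h: "pt (enc_prod E S) S (\<lambda>z. h (fst z) (snd z))" and n: "pt E enc_unary n" and s: "pt E S s"
    and bd: "\<And>e t. size (S (h e t)) \<le> size (S t) + poly q (size (E e))"
  shows "pt E S (\<lambda>e. (h e ^^ n e) (s e))"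
proof -
  obtain pn where pn: "\<And>e. n e \<le> poly pn (size (E e))" by (rule pt_unary_bound[OF n]) (rule that)
  obtain ps where ps: "\<And>e. size (S (s e)) \<le> poly ps (size (E e))" using pt_size[OF s] by blast
  have it: "size (S ((h e ^^ i) t)) \<le> size (S t) + i * poly q (size (E e))" for e i t
  proof (induction i)
    case (Suc i)
    then show ?case using bd[of e "(h e ^^ i) t"] by simp
  qed simp
  show ?thesis
  proof (rule pt_funpow[OF h n s, where q = "ps + pn * q"])
    fix e i assume "i \<le> n e"
    then have "i * poly q (size (E e)) \<le> poly pn (size (E e)) * poly q (size (E e))"
      using pn[of e] by (intro mult_right_mono) auto
    then show "size (S ((h e ^^ i) (s e))) \<le> poly (ps + pn * q) (size (E e))"
      using it[where e = e and i = i and t = "s e"] ps[of e] unfolding poly_add poly_mult by linarith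
  qed
qed

lemma funpow_Suc: "(Suc ^^ m) n = m + n"
  by (induction m) auto

lemma pt_add:
  assumes "pt E enc_unary f" "pt E enc_unary g"
  shows "pt E enc_unary (\<lambda>e. f e + g e)"
proof -
  have "pt E enc_unary (\<lambda>e. (Suc ^^ f e) (g e))"
    by (rule pt_funpow_add[where h = "\<lambda>_. Suc" and q = "[:1:]"]) (auto intro: assms pt_Suc pt_second)
  then show ?thesis by (simp add: funpow_Suc)
qed

lemma pt_mult:
  assumes "pt E enc_unary f" "pt E enc_unary g"
  shows "pt E enc_unary (\<lambda>e. f e * g e)"
proof -
  obtain p where p: "\<And>e. g e \<le> poly p (size (E e))" by (rule pt_unary_bound[OF assms(2)]) (rule that)
  have "pt E enc_unary (\<lambda>e. ((\<lambda>s. g e + s) ^^ f e) 0)"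
    by (rule pt_funpow_add[where h = "\<lambda>e s. g e + s" and q = p])
      (auto intro!: assms(1) pt_const pt_add pt_comp[OF assms(2) pt_first] pt_second p)
  moreover have "((\<lambda>s. b + s) ^^ a) 0 = a * b" for a b :: nat by (induction a) auto
  ultimately show ?thesis by simp
qed

lemma pt_minus:
  assumes "pt E enc_unary f" "pt E enc_unary g"
  shows "pt E enc_unary (\<lambda>e. f e - g e)"
proof -
  have "pt E enc_unary (\<lambda>e. ((\<lambda>s. s - 1) ^^ g e) (f e))"
    by (rule pt_funpow_add[where h = "\<lambda>_ s. s - 1" and q = 0]) (auto intro: assms pt_pred[simplified] pt_second)
  moreover have "((\<lambda>s. s - 1) ^^ a) b = b - a" for a b :: nat by (induction a) auto
  ultimately show ?thesis by simp
qed

lemma pt_less: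
  assumes "pt E enc_unary f" "pt E enc_unary g"
  shows "pt E enc_bool (\<lambda>e. f e < g e)"
  using pt_not[OF pt_is_0[OF pt_minus[OF assms(2,1)]]] by (rule pt_cast) (simp add: not_le)

lemma pt_le:
  assumes "pt E enc_unary f" "pt E enc_unary g"
  shows "pt E enc_bool (\<lambda>e. f e \<le> g e)"
  using pt_is_0[OF pt_minus[OF assms]] by (rule pt_cast) auto

lemma pt_eq:
  assumes "pt E enc_unary f" "pt E enc_unary g"
  shows "pt E enc_bool (\<lambda>e. f e = g e)"
  using pt_and[OF pt_le[OF assms] pt_le[OF assms(2,1)]] by (rule pt_cast) (rule arg_cong[of _ _ enc_bool], auto)

lemma pt_rev:
  assumes "pt E (enc_list A) xs"
  shows "pt E (enc_list A) (\<lambda>e. rev (xs e))"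
proof -
  obtain p where p: "\<And>e. size (enc_list A (xs e)) \<le> poly p (size (E e))" using pt_size[OF assms] by blast
  have "pt E (enc_list A) (\<lambda>e. fold Cons (xs e) [])"
  proof (rule pt_fold_add[OF _ assms pt_const, where h = "\<lambda>_. Cons" and q = "p + 1"])
    show "size (enc_list A (x # s)) \<le> size (enc_list A s) + poly (p + 1) (size (E e))" if "x \<in> set (xs e)" for e x s
      using elem_le_size[OF that, of A] p[of e] by simp
  qed (rule pt_Cons pt_fst pt_snd pt_id)+
  then show ?thesis by (simp add: rev_conv_fold)
qed

lemma pt_append:
  assumes xs: "pt E (enc_list A) xs" and ys: "pt E (enc_list A) ys"
  shows "pt E (enc_list A) (\<lambda>e. xs e @ ys e)"
proof -
  obtain p where p: "\<And>e. size (enc_list A (xs e)) \<le> poly p (size (E e))" using pt_size[OF xs] by blast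
  have "pt E (enc_list A) (\<lambda>e. fold Cons (rev (xs e)) (ys e))"
  proof (rule pt_fold_add[OF _ pt_rev[OF xs] ys, where h = "\<lambda>_. Cons" and q = "p + 1"])
    show "size (enc_list A (x # s)) \<le> size (enc_list A s) + poly (p + 1) (size (E e))"
      if "x \<in> set (rev (xs e))" for e x s
      using elem_le_size[of x "xs e" A] that p[of e] by simp
  qed (rule pt_Cons pt_fst pt_snd pt_id)+
  then show ?thesis by (simp add: fold_Cons_rev)
qed

lemma pt_elem_bound:
  assumes h: "pt (enc_prod E A) B (\<lambda>z. h (fst z) (snd z))" and xs: "pt E (enc_list A) xs"
  obtains q where "\<And>e x. x \<in> set (xs e) \<Longrightarrow> size (B (h e x)) \<le> poly q (size (E e))"
proof -
  obtain p where p: "\<And>e. size (enc_list A (xs e)) \<le> poly p (size (E e))" using pt_size[OF xs] by blast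
  obtain r where r: "\<And>z. size (B (h (fst z) (snd z))) \<le> poly r (size (enc_prod E A z))"
    using pt_size[OF h] by blast
  show thesis
  proof (rule that[of "pcompose r ([:1, 1:] + p)"])
    fix e x assume "x \<in> set (xs e)"
    then have "size (enc_prod E A (e, x)) \<le> poly ([:1, 1:] + p) (size (E e))"
      using elem_le_size[of x "xs e" A] p[of e] by simp
    from poly_nat_mono[OF this, of r] r[of "(e, x)"]
    show "size (B (h e x)) \<le> poly (pcompose r ([:1, 1:] + p)) (size (E e))"
      by (simp add: poly_pcompose)
  qed
qed

lemma pt_map:
  assumes h: "pt (enc_prod E A) B (\<lambda>z. h (fst z) (snd z))" and xs: "pt E (enc_list A) xs"
  shows "pt E (enc_list B) (\<lambda>e. map (h e) (xs e))"
proof -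
  obtain q where q: "\<And>e x. x \<in> set (xs e) \<Longrightarrow> size (B (h e x)) \<le> poly q (size (E e))"
    by (rule pt_elem_bound[OF assms]) (rule that)
  have "pt E (enc_list B) (\<lambda>e. fold (\<lambda>x acc. h e x # acc) (xs e) [])"
  proof (rule pt_fold_add[OF _ xs pt_const, where h = "\<lambda>e x acc. h e x # acc" and q = "q + 1"])
    have "pt (enc_prod E (enc_prod A (enc_list B))) (enc_prod E A) (\<lambda>z. (fst z, fst (snd z)))"
      by (rule pt_pair pt_fst pt_snd pt_id)+
    note hc = pt_comp[OF h this, simplified]
    show "pt (enc_prod E (enc_prod A (enc_list B))) (enc_list B)
        (\<lambda>z. h (fst z) (fst (snd z)) # snd (snd z))"
      by (rule pt_Cons hc pt_snd pt_id)+
    show "size (enc_list B (h e x # s)) \<le> size (enc_list B s) + poly (q + 1) (size (E e))"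
      if "x \<in> set (xs e)" for e x s
      using q[OF that] by simp
  qed
  moreover have "fold (\<lambda>x acc. f x # acc) ys zs = rev (map f ys) @ zs" for f :: "'b \<Rightarrow> 'c" and ys zs
    by (induction ys arbitrary: zs) auto
  ultimately have "pt E (enc_list B) (\<lambda>e. rev (map (h e) (xs e)))" by simp
  from pt_rev[OF this] show ?thesis by simp
qed

lemma pt_concat:
  assumes xs: "pt E (enc_list (enc_list A)) xs"
  shows "pt E (enc_list A) (\<lambda>e. concat (xs e))"
proof -
  obtain p where p: "\<And>e. size (enc_list (enc_list A) (xs e)) \<le> poly p (size (E e))"
    using pt_size[OF xs] by blast
  have app: "size (enc_list A (s @ x)) = size (enc_list A s) + size (enc_list A x)" for s x
    by (simp add: size_enc_list)
  have "pt E (enc_list A) (\<lambda>e. fold (\<lambda>x acc. acc @ x) (xs e) [])"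
  proof (rule pt_fold_add[OF _ xs pt_const, where h = "\<lambda>_ x acc. acc @ x" and q = p])
    show "size (enc_list A (s @ x)) \<le> size (enc_list A s) + poly p (size (E e))" if "x \<in> set (xs e)" for e x s
      using elem_le_size[OF that, of "enc_list A"] p[of e] app[of s x] by simp
  qed (rule pt_append pt_fst pt_snd pt_id)+
  moreover have "fold (\<lambda>x acc. acc @ x) ys zs = zs @ concat ys" for ys and zs :: "'b list"
    by (induction ys arbitrary: zs) auto
  ultimately show ?thesis by simp
qed

lemma pt_filter:
  assumes h: "pt (enc_prod E A) enc_bool (\<lambda>z. h (fst z) (snd z))" and xs: "pt E (enc_list A) xs"
  shows "pt E (enc_list A) (\<lambda>e. filter (h e) (xs e))"
proof -
  have "pt E (enc_list A) (\<lambda>e. concat (map (\<lambda>x. if h e x then [x] else []) (xs e)))"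
    by (rule pt_concat pt_map xs pt_if h pt_Cons pt_snd pt_id pt_const)+
  moreover have "concat (map (\<lambda>x. if P x then [x] else []) ys) = filter P ys" for P and ys :: "'b list"
    by (induction ys) auto
  ultimately show ?thesis by simp
qed

lemma pt_bex:
  assumes h: "pt (enc_prod E A) enc_bool (\<lambda>z. h (fst z) (snd z))" and xs: "pt E (enc_list A) xs"
  shows "pt E enc_bool (\<lambda>e. \<exists>x\<in>set (xs e). h e x)"
  using pt_not[OF pt_Nil[OF pt_filter[OF assms]]] by (rule pt_cast) (auto simp: filter_empty_conv)

lemma pt_length:
  assumes "pt E (enc_list A) xs"
  shows "pt E enc_unary (\<lambda>e. length (xs e))"
proof -
  have "pt E enc_unary (\<lambda>e. fold (\<lambda>_. Suc) (xs e) 0)"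
  proof (rule pt_fold_add[OF _ assms pt_const, where h = "\<lambda>_ _. Suc" and q = 1])
    show "pt (enc_prod E (enc_prod A enc_unary)) enc_unary (\<lambda>z. Suc (snd (snd z)))"
      by (rule pt_Suc pt_snd pt_id)+
  qed simp
  then show ?thesis by (simp add: fold_const_funpow funpow_Suc)
qed

lemma pt_sum_list:
  assumes xs: "pt E (enc_list enc_unary) xs"
  shows "pt E enc_unary (\<lambda>e. sum_list (xs e))"
proof -
  obtain p where p: "\<And>e. size (enc_list enc_unary (xs e)) \<le> poly p (size (E e))" using pt_size[OF xs] by blast
  have "pt E enc_unary (\<lambda>e. fold (+) (xs e) 0)"
  proof (rule pt_fold_add[OF _ xs pt_const, where h = "\<lambda>_. (+)" and q = p])
    show "size (enc_unary (x + s)) \<le> size (enc_unary s) + poly p (size (E e))" if "x \<in> set (xs e)" for e x s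
      using elem_le_size[OF that, of enc_unary] p[of e] by simp
  qed (rule pt_add pt_fst pt_snd pt_id)+
  moreover have "fold (+) ys s = s + sum_list ys" for ys and s :: nat by (induction ys arbitrary: s) auto
  ultimately show ?thesis by simp
qed

lemma pt_upt:
  assumes "pt E enc_unary n"
  shows "pt E (enc_list enc_unary) (\<lambda>e. [0..<n e])"
proof -
  have it: "((\<lambda>l. l @ [length l]) ^^ i) [] = [0..<i]" for i by (induction i) auto
  obtain p where p: "\<And>e. n e \<le> poly p (size (E e))" by (rule pt_unary_bound[OF assms]) (rule that)
  have sz: "size (enc_list enc_unary [0..<i]) \<le> i * i + i" for i
    by (induction i) (auto simp: size_enc_list)
  have "pt E (enc_list enc_unary) (\<lambda>e. ((\<lambda>l. l @ [length l]) ^^ n e) [])"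
  proof (rule pt_funpow[OF _ assms pt_const, where h = "\<lambda>_ l. l @ [length l]" and q = "p * p + p"])
    fix e i assume "i \<le> n e"
    then have "i \<le> poly p (size (E e))" using p[of e] by simp
    then have "i * i + i \<le> poly (p * p + p) (size (E e))" by (auto intro!: add_mono mult_mono)
    then show "size (enc_list enc_unary (((\<lambda>l. l @ [length l]) ^^ i) [])) \<le> poly (p * p + p) (size (E e))"
      using sz[of i] it[of i] by simp
  qed (rule pt_append pt_Cons pt_length pt_const pt_snd pt_id)+
  then show ?thesis by (simp add: it)
qed

text \<open>The fold discards its accumulator and so keeps the last element, or \<open>d\<close> on
  the empty list. Applied to a reversed list it delivers the head.\<close>

lemma pt_last_or:
  assumes xs: "pt E (enc_list A) xs" and d: "pt E A d"
  shows "pt E A (\<lambda>e. fold (\<lambda>x _. x) (xs e) (d e))"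
proof -
  obtain p where p: "\<And>e. size (enc_list A (xs e)) \<le> poly p (size (E e))" using pt_size[OF xs] by blast
  show ?thesis
  proof (rule pt_fold_add[OF _ xs d, where h = "\<lambda>_ x _. x" and q = p])
    show "size (A x) \<le> size (A s) + poly p (size (E e))" if "x \<in> set (xs e)" for e x s
      using elem_le_size[OF that, of A] p[of e] by simp
  qed (rule pt_fst pt_snd pt_id)+
qed

text \<open>\<open>pt\<close> speaks about all inputs of a type, hence list access goes through
  \<open>nth_default\<close>, which is specified for every index. The index is consumed by iterating
  \<open>tl\<close>.\<close>

lemma pt_nth_default:
  assumes xs: "pt E (enc_list A) xs" and i: "pt E enc_unary i" and d: "pt E A d"
  shows "pt E A (\<lambda>e. nth_default (d e) (xs e) (i e))"
proof -
  have "pt E (enc_list A) (\<lambda>e. (tl ^^ i e) (xs e))"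
  proof (rule pt_funpow_add[OF _ i xs, where h = "\<lambda>_. tl" and q = 0])
    show "size (enc_list A (tl t)) \<le> size (enc_list A t) + poly 0 (size (E e))" for e t
      by (cases t) auto
  qed (rule pt_tl pt_snd pt_id)+
  from pt_last_or[OF pt_rev[OF this] d]
  have "pt E A (\<lambda>e. fold (\<lambda>x _. x) (rev ((tl ^^ i e) (xs e))) (d e))" .
  moreover have "fold (\<lambda>x _. x) (rev ((tl ^^ k) ys)) b = nth_default b ys k" for ys k and b :: 'b
  proof -
    have l: "fold (\<lambda>x _. x) (rev zs) b = (if zs = [] then b else hd zs)" for zs by (cases zs) auto
    have "(tl ^^ k) ys = drop k ys" by (induction k) (auto simp: drop_Suc tl_drop)
    then show ?thesis using l[of "drop k ys"] by (auto simp: nth_default_def hd_drop_conv_nth)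
  qed
  ultimately show ?thesis by simp
qed

lemma pt_hd:
  assumes xs: "pt E (enc_list A) xs"
  shows "pt E A (\<lambda>e. nth_default d (xs e) 0)"
  by (rule pt_nth_default[OF xs pt_const pt_const])

subsection \<open>Binary arithmetic\<close>

fun bits :: "nat \<Rightarrow> bool list" where
  "bits n = (if n = 0 then [] else odd n # bits (n div 2))"

declare bits.simps [simp del]

lemma bits_0 [simp]: "bits 0 = []"
  by (simp add: bits.simps)

lemma enc_binary_bits: "enc_binary n = enc_list enc_bool (bits n)"
proof (induction n rule: less_induct)
  case (less n)
  then show ?case
    by (subst enc_binary.simps, subst bits.simps) (simp add: enc_bool_def[of True] enc_bool_def[of False])
qed

lemma size_bool_list: "length bs \<le> size (enc_list enc_bool bs)" "size (enc_list enc_bool bs) \<le> 2 * length bs"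
  by (induction bs) (auto simp: enc_bool_def)

lemma length_bits_le: "n < 2 ^ m \<Longrightarrow> length (bits n) \<le> m"
proof (induction m arbitrary: n)
  case (Suc m)
  then have "n div 2 < 2 ^ m" by auto
  from Suc.IH[OF this] show ?case by (subst bits.simps) auto
qed auto

lemma less_pow_length_bits: "n < 2 ^ length (bits n)"
proof (induction n rule: less_induct)
  case (less n)
  show ?case
  proof (cases "n = 0")
    case False
    then have "n div 2 < 2 ^ length (bits (n div 2))" using less by auto
    then have "n < 2 * 2 ^ length (bits (n div 2))" by auto
    then show ?thesis using False by (subst bits.simps) auto
  qed auto
qed

definition nth_bit :: "bool list \<Rightarrow> bool" where
  "nth_bit xs = nth_default False xs 0"

lemma nth_bit_simps [simp]: "nth_bit [] = False" "nth_bit (x # xs) = x"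
  by (auto simp: nth_bit_def)

lemma nth_bit_bits [simp]: "nth_bit (bits n) = odd n" "tl (bits n) = bits (n div 2)" "bits n = [] \<longleftrightarrow> n = 0"
  by (subst bits.simps; auto)+

text \<open>One round of a full adder, with the sum collected in reverse. The carry is the majority
  of the two bits and \<open>c\<close>, the new bit their parity, and a missing bit counts as
  \<open>False\<close>. The state with both inputs and the carry exhausted is a fixed point, so
  surplus rounds do no harm and produce no leading zeros.\<close>

definition adder :: "bool list \<times> bool list \<times> bool \<times> bool list \<Rightarrow> bool list \<times> bool list \<times> bool \<times> bool list" where
  "adder = (\<lambda>(xs, ys, c, out).
     if xs = [] \<and> ys = [] \<and> \<not> c then (xs, ys, c, out)
     else (tl xs, tl ys, if nth_bit xs = nth_bit ys then nth_bit xs else c,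
       ((nth_bit xs = nth_bit ys) = c) # out))"

lemma adder_bits:
  "length (bits a) + length (bits b) + of_bool c \<le> m \<Longrightarrow>
     (adder ^^ m) (bits a, bits b, c, out) = ([], [], False, rev (bits (a + b + of_bool c)) @ out)"
proof (induction m arbitrary: a b c out)
  case 0
  then show ?case by (auto simp del: nth_bit_bits simp: bits.simps[of a] bits.simps[of b] split: if_splits)
next
  case (Suc m)
  show ?case
  proof (cases "a = 0 \<and> b = 0 \<and> \<not> c")
    case True
    then show ?thesis using Suc.IH[of 0 0 False out] by (simp add: funpow_swap1 adder_def)
  next
    case False
    define c' where "c' = (if odd a = odd b then odd a else c)"
    have step: "adder (bits a, bits b, c, out) =
      (bits (a div 2), bits (b div 2), c', ((odd a = odd b) = c) # out)"
      using False by (auto simp: adder_def c'_def)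
    have la: "x \<noteq> 0 \<Longrightarrow> length (bits x) = Suc (length (bits (x div 2)))" for x
      by (subst bits.simps) auto
    have "length (bits (a div 2)) + length (bits (b div 2)) + of_bool c' \<le> m"
      using Suc.prems False la[of a] la[of b] unfolding c'_def
      by (cases "a = 0"; cases "b = 0") (auto split: if_splits)
    from Suc.IH[OF this, of "((odd a = odd b) = c) # out"]
    have "(adder ^^ Suc m) (bits a, bits b, c, out) =
       ([], [], False, rev (((odd a = odd b) = c) # bits (a div 2 + b div 2 + of_bool c')) @ out)"
      by (simp add: funpow_swap1 step)
    moreover have "bits (a + b + of_bool c) = ((odd a = odd b) = c) # bits (a div 2 + b div 2 + of_bool c')"
    proof -
      have "a + b + of_bool c \<noteq> 0" using False by auto
      moreover have "odd (a + b + of_bool c) = ((odd a = odd b) = c)" by (cases c) auto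
      moreover have "(a + b + of_bool c) div 2 = a div 2 + b div 2 + of_bool c'"
        unfolding c'_def by (cases c; cases "odd a"; cases "odd b") (auto elim!: oddE evenE)
      ultimately show ?thesis by (subst bits.simps) simp
    qed
    ultimately show ?thesis by simp
  qed
qed

lemma pt_binary_add:
  assumes "pt E enc_binary f" "pt E enc_binary g"
  shows "pt E enc_binary (\<lambda>e. f e + g e)"
proof -
  let ?B = "enc_list enc_bool"
  let ?S = "enc_prod ?B (enc_prod ?B (enc_prod enc_bool ?B))"
  have f: "pt E ?B (\<lambda>e. bits (f e))" and g: "pt E ?B (\<lambda>e. bits (g e))"
    using assms by (auto intro: pt_cast simp: enc_binary_bits)
  have bit: "pt E' enc_bool (\<lambda>e. nth_bit (h e))" if "pt E' ?B h" for E' :: "'x \<Rightarrow> btree" and h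
    unfolding nth_bit_def by (rule pt_hd[OF that])
  have add: "pt ?S ?S adder"
  proof -
    \<comment> \<open>The pattern in \<open>adder\<close> is written with projections, the form that
      the combinators can take apart.\<close>
    have "pt ?S ?S (\<lambda>z. if fst z = [] \<and> fst (snd z) = [] \<and> \<not> fst (snd (snd z)) then z
      else (tl (fst z), tl (fst (snd z)), if nth_bit (fst z) = nth_bit (fst (snd z)) then nth_bit (fst z) else fst (snd (snd z)),
       ((nth_bit (fst z) = nth_bit (fst (snd z))) = fst (snd (snd z))) # snd (snd (snd z))))"
      by (rule pt_if pt_and pt_not pt_Nil pt_pair pt_tl pt_eq_bool bit pt_Cons pt_fst pt_snd pt_id)+
    moreover have "(\<lambda>z. if fst z = [] \<and> fst (snd z) = [] \<and> \<not> fst (snd (snd z)) then z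
      else (tl (fst z), tl (fst (snd z)), if nth_bit (fst z) = nth_bit (fst (snd z)) then nth_bit (fst z) else fst (snd (snd z)),
       ((nth_bit (fst z) = nth_bit (fst (snd z))) = fst (snd (snd z))) # snd (snd (snd z)))) = adder"
      by (auto simp: adder_def fun_eq_iff)
    ultimately show ?thesis by simp
  qed
  have "pt E ?S (\<lambda>e. (adder ^^ (length (bits (f e)) + length (bits (g e)))) (bits (f e), bits (g e), False, []))"
  proof (rule pt_funpow_add[where h = "\<lambda>_. adder" and q = "[:4:]"])
    show "pt (enc_prod E ?S) ?S (\<lambda>z. adder (snd z))" by (rule pt_comp[OF add pt_second])
    have tl: "size (?B (tl xs)) \<le> size (?B xs)" for xs by (cases xs) auto
    have eb: "size (enc_bool b) \<le> 1" for b by (auto simp: enc_bool_def)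
    show "size (?S (adder t)) \<le> size (?S t) + poly [:4:] (size (E e))" for e t
    proof (cases t)
      case (fields xs ys c out)
      show ?thesis
        using tl[of xs] tl[of ys] eb[of "((nth_bit xs = nth_bit ys) = c)"]
          eb[of "(if nth_bit xs = nth_bit ys then nth_bit xs else c)"]
        unfolding fields by (simp add: adder_def)
    qed
  qed (rule pt_add pt_length f g pt_pair pt_const)+
  from pt_rev[OF pt_snd[OF pt_snd[OF pt_snd[OF this]]]]
  have "pt E ?B (\<lambda>e. bits (f e + g e))" by (simp add: adder_bits[where c = False, simplified])
  then show ?thesis by (rule pt_cast) (simp add: enc_binary_bits)
qed

lemma size_enc_binary: "n < 2 ^ m \<Longrightarrow> size (enc_binary n) \<le> 2 * m"
  using length_bits_le[of n m] size_bool_list(2)[of "bits n"] by (simp add: enc_binary_bits)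

text \<open>Repeated addition is affordable because one factor is unary. After \<open>i\<close>
  rounds the product is below \<open>2 ^ (i + length (bits (g e)))\<close>, which bounds every
  intermediate size.\<close>

lemma pt_binary_mult:
  assumes f: "pt E enc_unary f" and g: "pt E enc_binary g"
  shows "pt E enc_binary (\<lambda>e. f e * g e)"
proof -
  obtain p where p: "\<And>e. f e \<le> poly p (size (E e))" by (rule pt_unary_bound[OF f]) (rule that)
  obtain r where r: "\<And>e. size (enc_binary (g e)) \<le> poly r (size (E e))" using pt_size[OF g] by blast
  have it: "((\<lambda>s. b + s) ^^ a) 0 = a * b" for a b :: nat by (induction a) auto
  have "pt E enc_binary (\<lambda>e. ((\<lambda>s. g e + s) ^^ f e) 0)"
  proof (rule pt_funpow[OF _ f pt_const, where h = "\<lambda>e s. g e + s" and q = "[:2:] * (p + r)"])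
    show "pt (enc_prod E enc_binary) enc_binary (\<lambda>z. g (fst z) + snd z)"
      by (rule pt_binary_add pt_comp[OF g] pt_fst pt_snd pt_id)+
    fix e i assume i: "i \<le> f e"
    have "i * g e < 2 ^ i * 2 ^ length (bits (g e))"
      using less_exp[of i] less_pow_length_bits[of "g e"] by (intro mult_strict_mono) auto
    then have "i * g e < 2 ^ (i + length (bits (g e)))" by (simp add: power_add)
    from size_enc_binary[OF this]
    have "size (enc_binary (i * g e)) \<le> 2 * (i + length (bits (g e)))" .
    moreover have "length (bits (g e)) \<le> poly r (size (E e))"
      using r[of e] size_bool_list(1)[of "bits (g e)"] by (simp add: enc_binary_bits)
    ultimately show "size (enc_binary (((\<lambda>s. g e + s) ^^ i) 0)) \<le> poly ([:2:] * (p + r)) (size (E e))"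
      using i p[of e] unfolding it by simp
  qed
  then show ?thesis by (simp add: it)
qed

lemma pt_binary_of_unary:
  assumes "pt E enc_unary f"
  shows "pt E enc_binary f"
  using pt_binary_mult[OF assms pt_const[where b = 1]] by simp

text \<open>The bits arrive least significant first, so a later difference overrules earlier ones.
  \<open>c\<close> is the verdict on the bits read so far; starting with \<open>True\<close> decides
  \<le>, starting with \<open>False\<close> would decide strict inequality.\<close>

definition comparer :: "bool list \<times> bool list \<times> bool \<Rightarrow> bool list \<times> bool list \<times> bool" where
  "comparer = (\<lambda>(xs, ys, c). (tl xs, tl ys, if nth_bit xs = nth_bit ys then c else nth_bit ys))"

lemma comparer_bits:
  "length (bits a) \<le> m \<Longrightarrow> length (bits b) \<le> m \<Longrightarrow>
     (comparer ^^ m) (bits a, bits b, c) = ([], [], a < b \<or> a = b \<and> c)"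
proof (induction m arbitrary: a b c)
  case 0
  then show ?case by auto
next
  case (Suc m)
  define c' where "c' = (if odd a = odd b then c else odd b)"
  have la: "length (bits (x div 2)) = length (bits x) - 1" for x
    by (subst (2) bits.simps) auto
  have "comparer (bits a, bits b, c) = (bits (a div 2), bits (b div 2), c')"
    by (simp add: comparer_def c'_def)
  then have "(comparer ^^ Suc m) (bits a, bits b, c) = ([], [], a div 2 < b div 2 \<or> a div 2 = b div 2 \<and> c')"
    using Suc.IH[of "a div 2" "b div 2" c'] Suc.prems by (simp add: funpow_swap1 la)
  moreover have "(a div 2 < b div 2 \<or> a div 2 = b div 2 \<and> c') \<longleftrightarrow> (a < b \<or> a = b \<and> c)"
    unfolding c'_def by (cases c; cases "odd a"; cases "odd b"; simp; presburger)
  ultimately show ?case by simp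
qed

lemma pt_binary_le:
  assumes "pt E enc_binary f" "pt E enc_binary g"
  shows "pt E enc_bool (\<lambda>e. f e \<le> g e)"
proof -
  let ?B = "enc_list enc_bool"
  let ?S = "enc_prod ?B (enc_prod ?B enc_bool)"
  have f: "pt E ?B (\<lambda>e. bits (f e))" and g: "pt E ?B (\<lambda>e. bits (g e))"
    using assms by (auto intro: pt_cast simp: enc_binary_bits)
  have bit: "pt E' enc_bool (\<lambda>e. nth_bit (h e))" if "pt E' ?B h" for E' :: "'x \<Rightarrow> btree" and h
    unfolding nth_bit_def by (rule pt_hd[OF that])
  have cmp: "pt ?S ?S comparer"
  proof -
    have "pt ?S ?S (\<lambda>z. (tl (fst z), tl (fst (snd z)),
       if nth_bit (fst z) = nth_bit (fst (snd z)) then snd (snd z) else nth_bit (fst (snd z))))"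
      by (rule pt_if pt_pair pt_tl pt_eq_bool bit pt_fst pt_snd pt_id)+
    moreover have "(\<lambda>z. (tl (fst z), tl (fst (snd z)),
       if nth_bit (fst z) = nth_bit (fst (snd z)) then snd (snd z) else nth_bit (fst (snd z)))) = comparer"
      by (auto simp: comparer_def fun_eq_iff)
    ultimately show ?thesis by simp
  qed
  have "pt E ?S (\<lambda>e. (comparer ^^ (length (bits (f e)) + length (bits (g e)))) (bits (f e), bits (g e), True))"
  proof (rule pt_funpow_add[where h = "\<lambda>_. comparer" and q = "[:1:]"])
    show "pt (enc_prod E ?S) ?S (\<lambda>z. comparer (snd z))" by (rule pt_comp[OF cmp pt_second])
    have tl: "size (?B (tl xs)) \<le> size (?B xs)" for xs by (cases xs) auto
    have eb: "size (enc_bool b) \<le> 1" for b by (auto simp: enc_bool_def)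
    show "size (?S (comparer t)) \<le> size (?S t) + poly [:1:] (size (E e))" for e t
    proof (cases t)
      case (fields xs ys c)
      show ?thesis
        using tl[of xs] tl[of ys] eb[of "(if nth_bit xs = nth_bit ys then c else nth_bit ys)"]
        unfolding fields by (simp add: comparer_def)
    qed
  qed (rule pt_add pt_length f g pt_pair pt_const)+
  moreover have "(comparer ^^ (length (bits (f e)) + length (bits (g e)))) (bits (f e), bits (g e), True) =
      ([], [], f e \<le> g e)" for e
    using comparer_bits[OF le_add1 le_add2, of "f e" "g e" True] by (simp only: le_less simp_thms)
  ultimately have "pt E ?S (\<lambda>e. ([], [], f e \<le> g e))" by simp
  from pt_snd[OF pt_snd[OF this]] show ?thesis by simp
qed

section \<open>Paths in labelled networks\<close>

fun chain :: "('e \<Rightarrow> 'v) \<Rightarrow> ('e \<Rightarrow> 'v) \<Rightarrow> 'v \<Rightarrow> 'e list \<Rightarrow> 'v \<Rightarrow> bool" where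
  "chain src trg u [] v \<longleftrightarrow> u = v"
| "chain src trg u (e # p) v \<longleftrightarrow> src e = u \<and> chain src trg (trg e) p v"

definition path_sets :: "('e \<Rightarrow> 'v) \<Rightarrow> ('e \<Rightarrow> 'v) \<Rightarrow> 'e set \<Rightarrow> 'v \<Rightarrow> 'v \<Rightarrow> 'e set set" where
  "path_sets src trg A s t =
     {set p | p. set p \<subseteq> A \<and> chain src trg s p t \<and> distinct (s # map trg p)}"

lemma chain_append:
  "chain src trg u (p @ q) v \<longleftrightarrow> (\<exists>w. chain src trg u p w \<and> chain src trg w q v)"
  by (induction p arbitrary: u) auto

lemma path_sets_subset: "P \<in> path_sets src trg A s t \<Longrightarrow> P \<subseteq> A"
  by (auto simp: path_sets_def)

lemma finite_path_sets: "finite A \<Longrightarrow> finite (path_sets src trg A s t)"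
  by (rule finite_subset[of _ "Pow A"]) (auto dest: path_sets_subset)

lemma chain_telescope:
  fixes \<phi> :: "'v \<Rightarrow> 'a :: ab_group_add"
  shows "chain src trg u p v \<Longrightarrow> (\<Sum>e\<leftarrow>p. \<phi> (trg e) - \<phi> (src e)) = \<phi> v - \<phi> u"
  by (induction p arbitrary: u) auto

text \<open>The source of every conservation law below: with \<phi> the indicator of a set of
  vertices it says that a path enters the set as often as it leaves it, up to its endpoints. A
  general \<phi> gives the potential argument for \<open>pos\<close>.\<close>

lemma path_sets_telescope:
  fixes \<phi> :: "'v \<Rightarrow> 'a :: comm_ring_1"
  assumes "P \<in> path_sets src trg A s t" "finite A"
  shows "(\<Sum>e\<in>A. of_bool (e \<in> P) * (\<phi> (trg e) - \<phi> (src e))) = \<phi> t - \<phi> s"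
proof -
  obtain p where p: "P = set p" "set p \<subseteq> A" "chain src trg s p t" "distinct (s # map trg p)"
    using assms by (auto simp: path_sets_def)
  then have "distinct p" by (auto simp: distinct_map)
  have "(\<Sum>e\<in>A. of_bool (e \<in> P) * (\<phi> (trg e) - \<phi> (src e))) = (\<Sum>e\<in>P. \<phi> (trg e) - \<phi> (src e))"
    using assms(2) p by (intro sum.mono_neutral_cong_right) auto
  also have "\<dots> = (\<Sum>e\<leftarrow>p. \<phi> (trg e) - \<phi> (src e))"
    using \<open>distinct p\<close> p(1) by (simp add: sum_list_distinct_conv_sum_set)
  finally show ?thesis using chain_telescope[OF p(3)] by simp
qed

lemma cas_iff_chain: "pre_digraph.cas G u p v \<longleftrightarrow> chain (tail G) (head G) u p v"
  by (induction p arbitrary: u) (auto simp: pre_digraph.cas.simps)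

lemma apath_iff_chain:
  "pre_digraph.apath G u p v \<longleftrightarrow>
     u \<in> verts G \<and> set p \<subseteq> arcs G \<and> chain (tail G) (head G) u p v \<and> distinct (u # map (head G) p)"
proof -
  have "pre_digraph.awalk_verts G u p = u # map (head G) p" if "chain (tail G) (head G) u p v"
    using that
  proof (induction p arbitrary: u)
    case (Cons e p)
    then show ?case by (cases p) (auto simp: pre_digraph.awalk_verts.simps)
  qed (simp add: pre_digraph.awalk_verts.simps)
  then show ?thesis
    unfolding pre_digraph.apath_def pre_digraph.awalk_def cas_iff_chain by metis
qed

lemma st_paths_eq:
  assumes "is_network N"
  shows "st_paths N = path_sets (\<lambda>a. fst (arc_list N ! a)) (\<lambda>a. snd (arc_list N ! a))
    {..<length (arc_list N)} (source N) (sink N)"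
  using assms unfolding st_paths_def path_sets_def apath_iff_chain is_network_def
  by (auto simp: digraph_of_def)

text \<open>The instance must number vertices and arcs, while the proofs use labels. Injectivity of
  \<open>code\<close> is required only on the vertices that occur, since the type of labels may be
  infinite and no bounded numbering is injective on it.\<close>

lemma path_sets_transfer:
  fixes src trg :: "'e \<Rightarrow> 'v" and code :: "'v \<Rightarrow> 'w"
  assumes d: "distinct es" and inj: "inj_on code W"
    and W: "s \<in> W" "t \<in> W" "\<And>e. e \<in> set es \<Longrightarrow> src e \<in> W \<and> trg e \<in> W"
    and src': "\<And>i. i < length es \<Longrightarrow> src' i = code (src (es ! i))"
    and trg': "\<And>i. i < length es \<Longrightarrow> trg' i = code (trg (es ! i))"
  shows "bij_betw (\<lambda>P. (!) es ` P) (path_sets src' trg' {..<length es} (code s) (code t))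
    (path_sets src trg (set es) s t)"
proof -
  let ?f = "(!) es"
  have bij: "bij_betw ?f {..<length es} (set es)" using d by (rule bij_betw_nth) auto
  have ch: "chain src' trg' (code u) p (code t) \<longleftrightarrow> chain src trg u (map ?f p) t"
    if "u \<in> W" "set p \<subseteq> {..<length es}" for u p
    using that
  proof (induction p arbitrary: u)
    case Nil
    then show ?case using inj W by (auto dest: inj_onD)
  next
    case (Cons i p)
    then have "i < length es" "src (es ! i) \<in> W" "trg (es ! i) \<in> W" using W by auto
    then show ?case using Cons inj by (auto simp: src' trg' dest: inj_onD)
  qed
  have di: "distinct (code s # map trg' p) \<longleftrightarrow> distinct (s # map trg (map ?f p))"
    if "set p \<subseteq> {..<length es}" for p
  proof -
    have *: "code s # map trg' p = map code (s # map trg (map ?f p))"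
      using that by (auto simp: trg')
    have "set (s # map trg (map ?f p)) \<subseteq> W" using that W by auto
    then show ?thesis unfolding * distinct_map using inj inj_on_subset by blast
  qed
  have eq: "(\<lambda>P. ?f ` P) ` path_sets src' trg' {..<length es} (code s) (code t) = path_sets src trg (set es) s t"
  proof (intro equalityI subsetI)
    fix P assume "P \<in> (\<lambda>P. ?f ` P) ` path_sets src' trg' {..<length es} (code s) (code t)"
    then obtain p where p: "P = set (map ?f p)" "set p \<subseteq> {..<length es}"
      "chain src' trg' (code s) p (code t)" "distinct (code s # map trg' p)"
      by (auto simp: path_sets_def)
    then show "P \<in> path_sets src trg (set es) s t"
      unfolding path_sets_def using ch[OF W(1) p(2)] di[OF p(2)] bij
      by (intro CollectI exI[of _ "map ?f p"] conjI) (rule p(1), auto)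
  next
    fix P assume "P \<in> path_sets src trg (set es) s t"
    then obtain p where p: "P = set p" "set p \<subseteq> set es" "chain src trg s p t" "distinct (s # map trg p)"
      by (auto simp: path_sets_def)
    define q where "q = map (inv_into {..<length es} ?f) p"
    have im: "?f ` {..<length es} = set es" using bij by (auto simp: bij_betw_def)
    have q: "set q \<subseteq> {..<length es}" "map ?f q = p"
    proof -
      have "inv_into {..<length es} ?f e \<in> {..<length es}" if "e \<in> set p" for e
        using that p(2) im by (intro inv_into_into) auto
      then show "set q \<subseteq> {..<length es}" by (auto simp: q_def)
      have "es ! (inv_into {..<length es} ?f e) = e" if "e \<in> set p" for e
        using that p(2) im by (intro f_inv_into_f) auto
      then show "map ?f q = p" unfolding q_def map_map comp_def by (rule map_idI)
    qed
    have "set q \<in> path_sets src' trg' {..<length es} (code s) (code t)"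
      unfolding path_sets_def using ch[OF W(1) q(1)] di[OF q(1)] p(3,4) q(1) unfolding q(2)
      by (intro CollectI exI[of _ q] conjI) (rule refl, assumption, simp, blast)
    moreover have "P = ?f ` set q" unfolding p(1) set_map[symmetric] q(2) ..
    ultimately show "P \<in> (\<lambda>P. ?f ` P) ` path_sets src' trg' {..<length es} (code s) (code t)" by blast
  qed
  have "inj_on (\<lambda>P. ?f ` P) (Pow {..<length es})"
    using bij_betw_imp_inj_on[OF bij] by (rule inj_on_image_Pow)
  then have "inj_on (\<lambda>P. ?f ` P) (path_sets src' trg' {..<length es} (code s) (code t))"
    by (rule inj_on_subset) (auto dest: path_sets_subset)
  then show ?thesis using eq unfolding bij_betw_def by (rule conjI)
qed

section \<open>Maximum robust flow in labelled networks\<close>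

definition mk_mrf :: "'e list \<Rightarrow> ('e \<Rightarrow> 'v) \<Rightarrow> ('e \<Rightarrow> 'v) \<Rightarrow> ('e \<Rightarrow> rat) \<Rightarrow> ('v \<Rightarrow> nat) \<Rightarrow> nat \<Rightarrow>
    'v \<Rightarrow> 'v \<Rightarrow> nat \<Rightarrow> rat \<Rightarrow> mrf" where
  "mk_mrf es src trg cap code m s t k L =
     \<lparr> mrf_net = \<lparr> num_verts = m, arc_list = map (\<lambda>e. (code (src e), code (trg e))) es,
         source = code s, sink = code t \<rparr>,
       mrf_caps = map cap es, mrf_budget = k, mrf_threshold = L \<rparr>"

locale labelled_network =
  fixes es :: "'e list" and src trg :: "'e \<Rightarrow> 'v" and cap :: "'e \<Rightarrow> rat"
    and code :: "'v \<Rightarrow> nat" and m :: nat and s t :: 'v and k :: nat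
  assumes distinct_es: "distinct es"
    and inj_code: "inj_on code (insert s (insert t (src ` set es \<union> trg ` set es)))"
    and code_less: "code s < m" "code t < m"
      "\<And>e. e \<in> set es \<Longrightarrow> code (src e) < m \<and> code (trg e) < m"
    and s_neq_t: "s \<noteq> t"
    and k_le: "k \<le> length es"
    and cap_nonneg: "\<And>e. e \<in> set es \<Longrightarrow> 0 \<le> cap e"
begin

abbreviation "PS \<equiv> path_sets src trg (set es) s t"

definition flow :: "('e set \<Rightarrow> rat) \<Rightarrow> bool" where
  "flow y \<longleftrightarrow> (\<forall>P\<in>PS. 0 \<le> y P) \<and> (\<forall>e\<in>set es. (\<Sum>P | P \<in> PS \<and> e \<in> P. y P) \<le> cap e)"

definition surv :: "('e set \<Rightarrow> rat) \<Rightarrow> 'e set \<Rightarrow> rat" where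
  "surv y S = (\<Sum>P | P \<in> PS \<and> P \<inter> S = {}. y P)"

definition robust :: "('e set \<Rightarrow> rat) \<Rightarrow> rat \<Rightarrow> bool" where
  "robust y L \<longleftrightarrow> (\<forall>S. S \<subseteq> set es \<and> card S = k \<longrightarrow> L \<le> surv y S)"

abbreviation "inst \<equiv> mk_mrf es src trg cap code m s t k"

lemma is_network: "is_network (mrf_net (inst L))"
proof -
  have "code s \<noteq> code t" using inj_code s_neq_t by (auto dest: inj_onD)
  then show ?thesis
    using code_less by (auto simp: is_network_def mk_mrf_def digraph_of_def wf_digraph_def)
qed

lemma arcs_inst: "arcs (digraph_of (mrf_net (inst L))) = {..<length es}"
  by (simp add: digraph_of_def mk_mrf_def)

lemma inst_instance: "0 \<le> L \<Longrightarrow> inst L \<in> mrf_instances"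
  using is_network[of L] k_le cap_nonneg
  by (auto simp: mrf_instances_def arcs_inst) (auto simp: mk_mrf_def)

lemma bij_paths: "bij_betw (\<lambda>P. (!) es ` P) (st_paths (mrf_net (inst L))) PS"
proof -
  have "st_paths (mrf_net (inst L)) = path_sets (\<lambda>a. fst (arc_list (mrf_net (inst L)) ! a))
     (\<lambda>a. snd (arc_list (mrf_net (inst L)) ! a)) {..<length es} (code s) (code t)"
    unfolding st_paths_eq[OF is_network] by (simp add: mk_mrf_def)
  also have "bij_betw (\<lambda>P. (!) es ` P) \<dots> PS"
    by (rule path_sets_transfer[OF distinct_es inj_code]) (auto simp: mk_mrf_def)
  finally show ?thesis .
qed

lemma bij_nth: "bij_betw ((!) es) {..<length es} (set es)"
  using distinct_es by (rule bij_betw_nth) auto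

lemma st_path_subset: "P \<in> st_paths (mrf_net (inst L)) \<Longrightarrow> P \<subseteq> {..<length es}"
  unfolding st_paths_eq[OF is_network] by (auto simp: mk_mrf_def dest: path_sets_subset)

lemma sum_paths_transfer:
  assumes "\<And>P. P \<in> st_paths (mrf_net (inst L)) \<Longrightarrow> Q ((!) es ` P) \<longleftrightarrow> Q' P"
    and "\<And>P. P \<in> st_paths (mrf_net (inst L)) \<Longrightarrow> y ((!) es ` P) = x P"
  shows "(\<Sum>P | P \<in> PS \<and> Q P. y P) = (\<Sum>P | P \<in> st_paths (mrf_net (inst L)) \<and> Q' P. x P)"
proof -
  have "bij_betw (\<lambda>P. (!) es ` P) {P. P \<in> st_paths (mrf_net (inst L)) \<and> Q' P} {P. P \<in> PS \<and> Q P}"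
  proof (rule bij_betw_subset[OF bij_paths[of L]])
    have "PS = (\<lambda>P. (!) es ` P) ` st_paths (mrf_net (inst L))"
      using bij_paths[of L] by (simp add: bij_betw_def)
    then show "(\<lambda>P. (!) es ` P) ` {P. P \<in> st_paths (mrf_net (inst L)) \<and> Q' P} = {P. P \<in> PS \<and> Q P}"
      using assms(1) by auto
  qed auto
  from sum.reindex_bij_betw[OF this, of y, symmetric]
  have "(\<Sum>P | P \<in> PS \<and> Q P. y P) =
      (\<Sum>P | P \<in> st_paths (mrf_net (inst L)) \<and> Q' P. y ((!) es ` P))" .
  also have "\<dots> = (\<Sum>P | P \<in> st_paths (mrf_net (inst L)) \<and> Q' P. x P)"
    by (rule sum.cong[OF refl]) (simp add: assms(2))
  finally show ?thesis .
qed

lemma mem_transfer: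
  assumes "P \<subseteq> {..<length es}" "a < length es"
  shows "es ! a \<in> (!) es ` P \<longleftrightarrow> a \<in> P"
  using assms bij_nth by (auto simp: bij_betw_def inj_on_def)

lemma disjoint_transfer:
  assumes "P \<subseteq> {..<length es}" "S \<subseteq> {..<length es}"
  shows "(!) es ` P \<inter> (!) es ` S = {} \<longleftrightarrow> P \<inter> S = {}"
  using inj_on_image_Int[OF bij_betw_imp_inj_on[OF bij_nth] assms] image_is_empty by metis

lemma transfer_flow:
  assumes "\<And>P. P \<in> st_paths (mrf_net (inst L)) \<Longrightarrow> y ((!) es ` P) = x P"
  shows "x \<in> mrf_flows (inst L) \<longleftrightarrow> flow y"
    and "integral_flow (mrf_net (inst L)) x \<longleftrightarrow> (\<forall>P\<in>PS. y P \<in> \<int>)"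
    and "robust_value (inst L) x \<ge> L' \<longleftrightarrow> robust y L'"
    and "S \<subseteq> {..<length es} \<Longrightarrow> surviving_flow (mrf_net (inst L)) x S = surv y ((!) es ` S)"
proof -
  have im: "PS = (\<lambda>P. (!) es ` P) ` st_paths (mrf_net (inst L))"
    using bij_paths[of L] by (simp add: bij_betw_def)
  have cap: "(\<Sum>P | P \<in> PS \<and> es ! a \<in> P. y P) = (\<Sum>P | P \<in> st_paths (mrf_net (inst L)) \<and> a \<in> P. x P)"
    if "a < length es" for a
    using that by (intro sum_paths_transfer assms mem_transfer st_path_subset)
  have ses: "set es = (!) es ` {..<length es}" using bij_nth by (simp add: bij_betw_def)
  show "x \<in> mrf_flows (inst L) \<longleftrightarrow> flow y"
  proof -
    have nn: "(\<forall>P\<in>PS. 0 \<le> y P) \<longleftrightarrow> (\<forall>P\<in>st_paths (mrf_net (inst L)). 0 \<le> x P)"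
      unfolding im using assms by simp
    have "(\<forall>e\<in>set es. (\<Sum>P | P \<in> PS \<and> e \<in> P. y P) \<le> cap e) \<longleftrightarrow>
        (\<forall>a<length es. (\<Sum>P | P \<in> PS \<and> es ! a \<in> P. y P) \<le> cap (es ! a))"
      by (auto simp: all_set_conv_all_nth)
    also have "\<dots> \<longleftrightarrow> (\<forall>a<length es. (\<Sum>P | P \<in> st_paths (mrf_net (inst L)) \<and> a \<in> P. x P) \<le>
        mrf_caps (inst L) ! a)"
      using cap by (simp add: mk_mrf_def)
    finally show ?thesis
      unfolding mrf_flows_def path_flows_def flow_def arcs_inst nn by auto
  qed
  show "integral_flow (mrf_net (inst L)) x \<longleftrightarrow> (\<forall>P\<in>PS. y P \<in> \<int>)"
    unfolding integral_flow_def im using assms by auto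
  show surv: "surviving_flow (mrf_net (inst L)) x S = surv y ((!) es ` S)" if "S \<subseteq> {..<length es}" for S
    unfolding surviving_flow_def surv_def using that
    by (intro sum_paths_transfer[symmetric] assms disjoint_transfer) (auto dest: st_path_subset)
  have card: "card ((!) es ` S) = card S" if "S \<subseteq> {..<length es}" for S
    using bij_nth that by (intro card_image) (auto simp: bij_betw_def intro: inj_on_subset)
  define F where "F = {S. S \<subseteq> {..<length es} \<and> card S = k}"
  have fin: "finite F" unfolding F_def by (rule finite_subset[of _ "Pow {..<length es}"]) auto
  have "\<exists>S. S \<subseteq> {..<length es} \<and> card S = k"
    using obtain_subset_with_card_n[of k "{..<length es}"] k_le by (metis card_lessThan)
  then have ne: "F \<noteq> {}" by (auto simp: F_def)
  have "robust_value (inst L) x = Min (surviving_flow (mrf_net (inst L)) x ` F)"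
    unfolding robust_value_def arcs_inst F_def by (simp add: mk_mrf_def)
  then have "robust_value (inst L) x \<ge> L' \<longleftrightarrow> (\<forall>S\<in>F. L' \<le> surv y ((!) es ` S))"
    using fin ne surv by (simp add: Min_ge_iff F_def)
  also have "\<dots> \<longleftrightarrow> robust y L'"
  proof -
    have "(\<exists>S'\<in>F. S = (!) es ` S')" if "S \<subseteq> set es" "card S = k" for S
    proof -
      define S' where "S' = {i \<in> {..<length es}. es ! i \<in> S}"
      have S': "S' \<subseteq> {..<length es}" "S = (!) es ` S'"
        using that(1) unfolding S'_def ses by blast+
      then have "S' \<in> F" using that(2) card[of S'] unfolding F_def by simp
      then show ?thesis using S'(2) by (rule bexI[rotated])
    qed
    note ex = this
    have sub: "(!) es ` S \<subseteq> set es" "card ((!) es ` S) = k" if "S \<in> F" for S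
    proof -
      have S: "S \<subseteq> {..<length es}" "card S = k" using that by (simp_all add: F_def)
      show "(!) es ` S \<subseteq> set es" unfolding ses using S(1) by (rule image_mono)
      show "card ((!) es ` S) = k" using card[OF S(1)] S(2) by simp
    qed
    show ?thesis unfolding robust_def
    proof (intro iffI allI impI ballI)
      fix S assume *: "\<forall>S\<in>F. L' \<le> surv y ((!) es ` S)" and "S \<subseteq> set es \<and> card S = k"
      then have "\<exists>S'\<in>F. S = (!) es ` S'" by (intro ex) simp_all
      then obtain S' where S': "S' \<in> F" "S = (!) es ` S'" by (rule bexE)
      show "L' \<le> surv y S" unfolding S'(2) by (rule bspec[OF * S'(1)])
    next
      fix S assume *: "\<forall>S. S \<subseteq> set es \<and> card S = k \<longrightarrow> L' \<le> surv y S" and S: "S \<in> F"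
      show "L' \<le> surv y ((!) es ` S)" by (rule *[THEN spec, THEN mp, OF conjI[OF sub[OF S]]])
    qed
  qed
  finally show "robust_value (inst L) x \<ge> L' \<longleftrightarrow> robust y L'" .
qed

text \<open>Since no flow exceeds the threshold, a maximum is attained as soon as the threshold is.\<close>

lemma yes_iff:
  assumes ub: "\<And>y. flow y \<Longrightarrow> \<exists>S\<subseteq>set es. card S = k \<and> surv y S \<le> L"
  shows "mrf_yes (inst L) \<longleftrightarrow> (\<exists>y. flow y \<and> robust y L)"
    and "integral_mrf_yes (inst L) \<longleftrightarrow> (\<exists>y. flow y \<and> robust y L \<and> (\<forall>P\<in>PS. y P \<in> \<int>))"
proof -
  define fwd where "fwd = (\<lambda>(x :: nat set \<Rightarrow> rat) P. x (inv_into (st_paths (mrf_net (inst L))) (\<lambda>P. (!) es ` P) P))"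
  define bwd where "bwd = (\<lambda>(y :: 'e set \<Rightarrow> rat) P. y ((!) es ` P))"
  have inj: "inj_on (\<lambda>P. (!) es ` P) (st_paths (mrf_net (inst L)))"
    using bij_paths[of L] by (simp add: bij_betw_def)
  have fwd: "fwd x ((!) es ` P) = x P" if "P \<in> st_paths (mrf_net (inst L))" for x P
    unfolding fwd_def using inv_into_f_f[OF inj that] by simp
  have bwd: "y ((!) es ` P) = bwd y P" for y P by (simp add: bwd_def)
  note F = transfer_flow[where L = L and y = "fwd x" and x = x for x, OF fwd]
  have B: "bwd y \<in> mrf_flows (inst L) \<longleftrightarrow> flow y"
    "integral_flow (mrf_net (inst L)) (bwd y) \<longleftrightarrow> (\<forall>P\<in>PS. y P \<in> \<int>)"
    "robust_value (inst L) (bwd y) \<ge> L' \<longleftrightarrow> robust y L'" for y L'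
    by (rule transfer_flow, rule bwd)+
  have thr: "mrf_threshold (inst L) = L" by (simp add: mk_mrf_def)
  have le: "robust_value (inst L) x \<le> L" if "x \<in> mrf_flows (inst L)" for x
  proof -
    have "flow (fwd x)" using that F(1) by simp
    from ub[OF this] obtain S where S: "S \<subseteq> set es" "card S = k" "surv (fwd x) S \<le> L" by blast
    have "robust (fwd x) (robust_value (inst L) x)" using F(3) by blast
    then have "robust_value (inst L) x \<le> surv (fwd x) S" using S by (simp add: robust_def)
    then show ?thesis using S(3) by (rule order.trans)
  qed
  have nb: "\<not> (\<exists>x'. x' \<in> A \<and> robust_value (inst L) x < robust_value (inst L) x')"
    if "L \<le> robust_value (inst L) x" "A \<subseteq> mrf_flows (inst L)" for x A
  proof
    assume "\<exists>x'. x' \<in> A \<and> robust_value (inst L) x < robust_value (inst L) x'"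
    then obtain x' where "x' \<in> A" "robust_value (inst L) x < robust_value (inst L) x'" by blast
    with le[of x'] that show False by auto
  qed
  show "mrf_yes (inst L) \<longleftrightarrow> (\<exists>y. flow y \<and> robust y L)"
  proof
    assume "mrf_yes (inst L)"
    then obtain x where "x \<in> mrf_flows (inst L)" "robust_value (inst L) x \<ge> L"
      unfolding mrf_yes_def is_arg_max_def thr by blast
    then show "\<exists>y. flow y \<and> robust y L" using F by blast
  next
    assume "\<exists>y. flow y \<and> robust y L"
    then obtain y where "flow y" "robust y L" by blast
    then have x: "bwd y \<in> mrf_flows (inst L)" "robust_value (inst L) (bwd y) \<ge> L" using B by auto
    show "mrf_yes (inst L)" unfolding mrf_yes_def is_arg_max_def
      unfolding thr using x nb[OF x(2) order.refl] by (intro exI[of _ "bwd y"] conjI)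
  qed
  show "integral_mrf_yes (inst L) \<longleftrightarrow> (\<exists>y. flow y \<and> robust y L \<and> (\<forall>P\<in>PS. y P \<in> \<int>))"
  proof
    assume "integral_mrf_yes (inst L)"
    then obtain x where "x \<in> mrf_flows (inst L)" "robust_value (inst L) x \<ge> L"
      "integral_flow (mrf_net (inst L)) x"
      unfolding integral_mrf_yes_def is_arg_max_def thr by blast
    then show "\<exists>y. flow y \<and> robust y L \<and> (\<forall>P\<in>PS. y P \<in> \<int>)" using F by blast
  next
    assume "\<exists>y. flow y \<and> robust y L \<and> (\<forall>P\<in>PS. y P \<in> \<int>)"
    then obtain y where "flow y" "robust y L" "\<forall>P\<in>PS. y P \<in> \<int>" by blast
    then have x: "bwd y \<in> mrf_flows (inst L)" "robust_value (inst L) (bwd y) \<ge> L"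
      "integral_flow (mrf_net (inst L)) (bwd y)" using B by auto
    show "integral_mrf_yes (inst L)" unfolding integral_mrf_yes_def is_arg_max_def
      unfolding thr using x nb[OF x(2), of "{x \<in> mrf_flows (inst L). integral_flow (mrf_net (inst L)) x}"]
      by (intro exI[of _ "bwd y"] conjI) auto
  qed
qed

end

section \<open>The reduction network\<close>

datatype vx = VS | VT | V nat | In nat | Out nat | Nu nat | Tau bool nat

datatype ar = SrcA | SnkA | Din nat | Dout nat | Mid nat | Fi nat | Fo nat | Pr bool nat | Gu bool nat
  | Te bool nat | F nat | En nat | End | Ex bool nat nat | Li nat nat | Xi nat nat | Xo nat nat | Di nat | P2

text \<open>No assumptions are made here, so that the constants make sense for arbitrary data. They
  serve to define \<open>reduce\<close> and are computed in polynomial time on all inputs, whether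
  or not these come from instances.\<close>

locale gadget_defs =
  fixes n k :: nat and ta he :: "nat \<Rightarrow> nat" and s t :: nat and \<rho> :: "nat \<Rightarrow> nat"
    and E :: "nat set set" and \<theta> :: rat
begin

text \<open>The rank of the tail decides and the index breaks ties. Thus \<open>pos\<close> is
  injective on arcs and, once ranks increase along arcs, \<open>pos a\<close> lies strictly below
  \<open>n\<close> times the rank of the head of \<open>a\<close>.\<close>

definition pos :: "nat \<Rightarrow> nat" where
  "pos a = \<rho> (ta a) * n + a"

text \<open>Pairs that are not joined in \<open>E\<close>, oriented downhill in \<open>pos\<close>,
  so that every such pair of distinct arcs receives exactly one link.\<close>

definition link :: "nat \<Rightarrow> nat \<Rightarrow> bool" where
  "link a b \<longleftrightarrow> a < n \<and> b < n \<and> pos b < pos a \<and> {a, b} \<notin> E"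

fun src :: "ar \<Rightarrow> vx" where
  "src SrcA = VS"
| "src SnkA = V t"
| "src (Din a) = V (ta a)"
| "src (Dout a) = Out a"
| "src (Mid a) = In a"
| "src (Fi a) = VS"
| "src (Fo a) = Out a"
| "src (Pr h a) = VS"
| "src (Gu h a) = Out a"
| "src (Te h a) = Tau h a"
| "src (F 0) = VS"
| "src (F (Suc i)) = Nu i"
| "src (En i) = VS"
| "src End = Nu n"
| "src (Ex h i b) = Nu i"
| "src (Li a b) = Out a"
| "src (Xi a b) = VS"
| "src (Xo a b) = Out a"
| "src (Di j) = VS"
| "src P2 = VS"

fun trg :: "ar \<Rightarrow> vx" where
  "trg SrcA = V s"
| "trg SnkA = VT"
| "trg (Din a) = In a"
| "trg (Dout a) = V (he a)"
| "trg (Mid a) = Out a"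
| "trg (Fi a) = In a"
| "trg (Fo a) = VT"
| "trg (Pr h a) = Tau h a"
| "trg (Gu h a) = Tau h a"
| "trg (Te h a) = VT"
| "trg (F i) = Nu i"
| "trg (En i) = Nu i"
| "trg End = VT"
| "trg (Ex h i b) = In (if h \<and> link i b then i else b)"
| "trg (Li a b) = In b"
| "trg (Xi a b) = In a"
| "trg (Xo a b) = VT"
| "trg (Di j) = VT"
| "trg P2 = VT"

text \<open>\<open>U\<close> is the filler per arc. \<open>M\<close> is the largest load of an arc
  \<open>Mid a\<close>: \<open>U + n\<close> from filler and links out of \<open>a\<close>,
  \<open>2 (n + 1)\<close> towards the guards of \<open>a\<close>, and one unit of given flow.
  \<open>Q\<close> is the load of \<open>F 0\<close> when \<open>\<kappa> = n + 1\<close>, the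
  largest load at all. More than \<open>n\<close> arcs can never all be of the form
  \<open>Mid a\<close>, hence the cut-off at \<open>n + 1\<close>.\<close>

definition U :: nat where "U = 2 * n * n"
definition M :: nat where "M = U + 3 * n + 3"
definition Q :: nat where "Q = U + 5 * n + 3"
definition \<kappa> :: nat where "\<kappa> = min k (n + 1)"

text \<open>\<open>Pr h a\<close> agrees with \<open>P2\<close>, so that exchanging
  \<open>P2\<close> for \<open>Te h a\<close> in an interdiction set compares only the guard flow;
  it also brings the load of \<open>Te h a\<close> to \<open>M - 1\<close>. A guard has room for one
  unit of each of the \<open>n + 1\<close> colours. \<open>End\<close> takes the
  \<open>n (2 n - 1)\<close> units of all \<open>En i\<close> and \<open>2 n + 2 + \<kappa>\<close>
  further units from \<open>F 0\<close>. The zeros for \<open>SrcA\<close> and \<open>SnkA\<close>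
  are placeholders overridden in \<open>cap\<close>.\<close>

fun ncap :: "ar \<Rightarrow> nat" where
  "ncap SrcA = 0"
| "ncap SnkA = 0"
| "ncap (Din a) = 1"
| "ncap (Dout a) = 1"
| "ncap (Mid a) = Q"
| "ncap (Fi a) = U"
| "ncap (Fo a) = U"
| "ncap (Pr h a) = U + 2 * n + 1"
| "ncap (Gu h a) = n + 1"
| "ncap (Te h a) = Q"
| "ncap (F i) = Q"
| "ncap (En i) = 2 * n - 1"
| "ncap End = U + n + 2 + \<kappa>"
| "ncap (Ex h i b) = 1"
| "ncap (Li a b) = 1"
| "ncap (Xi a b) = 1"
| "ncap (Xo a b) = 1"
| "ncap (Di j) = (if j < \<kappa> - 2 then M - 1 else Q)"
| "ncap P2 = U + 2 * n + 1"

definition cap :: "ar \<Rightarrow> rat" where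
  "cap e = (if e = SrcA \<or> e = SnkA then \<theta> else of_nat (ncap e))"

text \<open>The arcs out of \<open>VS\<close>, other than \<open>SrcA\<close>, whose saturation is
  forced by reaching the threshold. \<open>SrcA\<close> is kept separate because its capacity may be
  fractional.\<close>

definition oarcs :: "ar list" where
  "oarcs = map En [0..<n] @ map Fi [0..<n] @ map (Pr False) [0..<n] @ map (Pr True) [0..<n] @
     concat (map (\<lambda>a. map (Xi a) (filter (\<lambda>b. \<not> link a b) [0..<n])) [0..<n])"

definition rarcs :: "ar list" where
  "rarcs = [SnkA, End, P2] @ map Din [0..<n] @ map Dout [0..<n] @ map Mid [0..<n] @ map Fo [0..<n] @
     map (Gu False) [0..<n] @ map (Gu True) [0..<n] @ map (Te False) [0..<n] @ map (Te True) [0..<n] @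
     map F [0..<Suc n] @
     concat (map (\<lambda>i. map (Ex False i) [0..<n]) [0..<Suc n]) @
     concat (map (\<lambda>i. map (Ex True i) [0..<n]) [0..<Suc n]) @
     concat (map (\<lambda>a. map (Li a) (filter (link a) [0..<n])) [0..<n]) @
     concat (map (\<lambda>a. map (Xo a) (filter (\<lambda>b. \<not> link a b) [0..<n])) [0..<n]) @
     map Di [0..<k - 2]"

definition arlist :: "ar list" where
  "arlist = SrcA # oarcs @ rarcs"

definition L :: rat where
  "L = \<theta> + of_nat (sum_list (map ncap oarcs))"

fun ok :: "ar \<Rightarrow> bool" where
  "ok SrcA = True"
| "ok SnkA = True"
| "ok (Din a) = (a < n)"
| "ok (Dout a) = (a < n)"
| "ok (Mid a) = (a < n)"
| "ok (Fi a) = (a < n)"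
| "ok (Fo a) = (a < n)"
| "ok (Pr h a) = (a < n)"
| "ok (Gu h a) = (a < n)"
| "ok (Te h a) = (a < n)"
| "ok (F i) = (i < Suc n)"
| "ok (En i) = (i < n)"
| "ok End = True"
| "ok (Ex h i b) = (i < Suc n \<and> b < n)"
| "ok (Li a b) = link a b"
| "ok (Xi a b) = (a < n \<and> b < n \<and> \<not> link a b)"
| "ok (Xo a b) = (a < n \<and> b < n \<and> \<not> link a b)"
| "ok (Di j) = (j < k - 2)"
| "ok P2 = True"

lemma link_less: "link a b \<Longrightarrow> a < n \<and> b < n"
  by (simp add: link_def)

lemma set_arlist: "set arlist = Collect ok"
proof (intro equalityI subsetI)
  fix e assume "e \<in> set arlist"
  then show "e \<in> Collect ok"
    unfolding arlist_def oarcs_def rarcs_def by (auto dest: link_less)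
next
  fix e assume ok: "e \<in> Collect ok"
  have Un: "e \<in> set (xs @ ys) \<longleftrightarrow> e \<in> set xs \<or> e \<in> set ys" for xs ys by simp
  have m: "e \<in> set (map c [0..<m]) \<longleftrightarrow> (\<exists>i<m. e = c i)" for c m by auto
  have c: "e \<in> set (concat (map (\<lambda>a. map (c a) (filter (P a) [0..<m])) [0..<m'])) \<longleftrightarrow>
      (\<exists>a<m'. \<exists>b<m. P a b \<and> e = c a b)" for c P m m' by auto
  have c': "e \<in> set (concat (map (\<lambda>a. map (c a) [0..<m]) [0..<m'])) \<longleftrightarrow>
      (\<exists>a<m'. \<exists>b<m. e = c a b)" for c m m'
    using c[of c "\<lambda>_ _. True" m m'] by simp
  note AL = arlist_def oarcs_def rarcs_def set_simps insert_iff Un m c c' append_Cons append_Nil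
  show "e \<in> set arlist"
  proof (cases e)
    case (Pr h a)
    with ok show ?thesis unfolding AL by (cases h) simp_all
  next
    case (Gu h a)
    with ok show ?thesis unfolding AL by (cases h) simp_all
  next
    case (Te h a)
    with ok show ?thesis unfolding AL by (cases h) simp_all
  next
    case (Ex h a b)
    with ok show ?thesis unfolding AL by (cases h) simp_all
  qed (use ok in \<open>unfold AL, auto dest: link_less\<close>)
qed

lemma distinct_concat_map:
  assumes "distinct xs" "\<And>x. x \<in> set xs \<Longrightarrow> distinct (f x)"
    "\<And>x y. x \<in> set xs \<Longrightarrow> y \<in> set xs \<Longrightarrow> x \<noteq> y \<Longrightarrow> set (f x) \<inter> set (f y) = {}"
  shows "distinct (concat (map f xs))"
  using assms
proof (induction xs)
  case (Cons x xs)
  then show ?case by fastforce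
qed simp

lemma distinct_arlist: "distinct arlist"
proof -
  have "distinct (concat (map (\<lambda>a. map (c a) (filter (P a) [0..<m])) [0..<m']))"
    if "\<And>a b a' b'. c a b = c a' b' \<longleftrightarrow> a = a' \<and> b = b'" for c :: "nat \<Rightarrow> nat \<Rightarrow> ar" and P m m'
    using that by (intro distinct_concat_map) (auto simp: distinct_map inj_on_def)
  note D = this this[where P = "\<lambda>_ _. True", simplified]
  show ?thesis
    unfolding arlist_def oarcs_def rarcs_def
    by (simp add: distinct_map inj_on_def D del: upt_Suc) auto
qed

text \<open>Combined with the telescoping identity, this expansion by kinds of arcs lets
  simplification produce each conservation law from its potential.\<close>

lemma sumAR:
  fixes f :: "ar \<Rightarrow> rat"
  shows "sum f (set arlist) = f SrcA + (\<Sum>a<n. f (En a)) + (\<Sum>a<n. f (Fi a)) +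
    (\<Sum>h\<in>UNIV. \<Sum>a<n. f (Pr h a)) + (\<Sum>a<n. \<Sum>b<n. if link a b then 0 else f (Xi a b)) +
    f SnkA + f End + f P2 + (\<Sum>a<n. f (Din a)) + (\<Sum>a<n. f (Dout a)) + (\<Sum>a<n. f (Mid a)) + (\<Sum>a<n. f (Fo a)) +
    (\<Sum>h\<in>UNIV. \<Sum>a<n. f (Gu h a)) + (\<Sum>h\<in>UNIV. \<Sum>a<n. f (Te h a)) +
    f (F 0) + (\<Sum>i<n. f (F (Suc i))) +
    (\<Sum>h\<in>UNIV. \<Sum>i<Suc n. \<Sum>b<n. f (Ex h i b)) +
    (\<Sum>a<n. \<Sum>b<n. if link a b then f (Li a b) else 0) +
    (\<Sum>a<n. \<Sum>b<n. if link a b then 0 else f (Xo a b)) + (\<Sum>j<k - 2. f (Di j))"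
proof -
  have u: "(\<Sum>i\<leftarrow>[0..<m]. g i) = (\<Sum>i<m. g i)" for g :: "nat \<Rightarrow> rat" and m
    by (simp add: interv_sum_list_conv_sum_set_nat atLeast0LessThan)
  have c: "(\<Sum>x\<leftarrow>concat (map g xs). f x) = (\<Sum>a\<leftarrow>xs. \<Sum>x\<leftarrow>g a. f x)" for g :: "nat \<Rightarrow> ar list" and xs
    by (induction xs) auto
  have b: "(\<Sum>h\<in>UNIV. g h) = g False + g True" for g :: "bool \<Rightarrow> rat"
    by (simp add: UNIV_bool)
  have neg: "(if \<not> P then x else 0) = (if P then 0 else x)" for P and x :: rat by simp
  have F: "(\<Sum>i<Suc n. f (F i)) = f (F 0) + (\<Sum>i<n. f (F (Suc i)))"
    by (rule sum.lessThan_Suc_shift)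
  have "sum f (set arlist) = (\<Sum>e\<leftarrow>arlist. f e)"
    using distinct_arlist by (simp add: sum_list_distinct_conv_sum_set)
  also have "\<dots> = f SrcA + (\<Sum>a<n. f (En a)) + (\<Sum>a<n. f (Fi a)) +
    (\<Sum>h\<in>UNIV. \<Sum>a<n. f (Pr h a)) + (\<Sum>a<n. \<Sum>b<n. if link a b then 0 else f (Xi a b)) +
    f SnkA + f End + f P2 + (\<Sum>a<n. f (Din a)) + (\<Sum>a<n. f (Dout a)) + (\<Sum>a<n. f (Mid a)) + (\<Sum>a<n. f (Fo a)) +
    (\<Sum>h\<in>UNIV. \<Sum>a<n. f (Gu h a)) + (\<Sum>h\<in>UNIV. \<Sum>a<n. f (Te h a)) +
    (\<Sum>i<Suc n. f (F i)) +
    (\<Sum>h\<in>UNIV. \<Sum>i<Suc n. \<Sum>b<n. f (Ex h i b)) +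
    (\<Sum>a<n. \<Sum>b<n. if link a b then f (Li a b) else 0) +
    (\<Sum>a<n. \<Sum>b<n. if link a b then 0 else f (Xo a b)) + (\<Sum>j<k - 2. f (Di j))"
    unfolding arlist_def oarcs_def rarcs_def
    by (simp add: c u b sum_list_map_filter' comp_def algebra_simps neg del: upt_Suc sum.lessThan_Suc cong: if_cong)
  finally show ?thesis unfolding F by simp
qed

end

section \<open>Conservation laws of a single path in the reduction network\<close>

locale gadget = gadget_defs +
  assumes n1: "1 \<le> n" and k2: "2 \<le> k" and s_neq_t: "s \<noteq> t"
    and rank: "\<And>a. a < n \<Longrightarrow> \<rho> (ta a) < \<rho> (he a)"
    and theta: "0 \<le> \<theta>" "\<theta> \<le> of_nat n"
begin

abbreviation "PP \<equiv> path_sets src trg (set arlist) VS VT"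

definition ind :: "ar \<Rightarrow> ar set \<Rightarrow> rat" where
  "ind e P = of_bool (e \<in> P)"

lemma ind_nonneg [simp]: "0 \<le> ind e P"
  by (simp add: ind_def)

lemma finite_PP: "finite PP"
  by (simp add: finite_path_sets)

lemma tele:
  fixes \<phi> :: "vx \<Rightarrow> rat"
  assumes "P \<in> PP"
  shows "(\<Sum>e\<in>set arlist. ind e P * (\<phi> (trg e) - \<phi> (src e))) = \<phi> VT - \<phi> VS"
  using path_sets_telescope[OF assms, of \<phi>] by (simp add: ind_def)

text \<open>Counts are rational because they are later weighted with flow. A path leaves the chain
  at most once, so \<open>exq i P\<close> tells whether \<open>P\<close> has colour
  \<open>i\<close>.\<close>

definition exq :: "nat \<Rightarrow> ar set \<Rightarrow> rat" where
  "exq i P = (\<Sum>h\<in>UNIV. \<Sum>b<n. ind (Ex h i b) P)"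

definition guq :: "ar set \<Rightarrow> rat" where
  "guq P = (\<Sum>h\<in>UNIV. \<Sum>a<n. ind (Gu h a) P)"

definition teq :: "ar set \<Rightarrow> rat" where
  "teq P = (\<Sum>h\<in>UNIV. \<Sum>a<n. ind (Te h a) P)"

definition diq :: "ar set \<Rightarrow> rat" where
  "diq P = (\<Sum>j<k - 2. ind (Di j) P)"

definition enq :: "ar set \<Rightarrow> rat" where
  "enq P = (\<Sum>a<n. ind (En a) P)"

definition fiq :: "ar set \<Rightarrow> rat" where
  "fiq P = (\<Sum>a<n. ind (Fi a) P) + (\<Sum>a<n. \<Sum>b<n. if link a b then 0 else ind (Xi a b) P)"

definition foq :: "ar set \<Rightarrow> rat" where
  "foq P = (\<Sum>a<n. ind (Fo a) P) + (\<Sum>a<n. \<Sum>b<n. if link a b then 0 else ind (Xo a b) P)"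

definition prq :: "ar set \<Rightarrow> rat" where
  "prq P = (\<Sum>h\<in>UNIV. \<Sum>a<n. ind (Pr h a) P)"

lemma exq_nonneg: "0 \<le> exq i P" unfolding exq_def by (intro sum_nonneg) auto
lemma guq_nonneg: "0 \<le> guq P" unfolding guq_def by (intro sum_nonneg) auto
lemma teq_nonneg: "0 \<le> teq P" unfolding teq_def by (intro sum_nonneg) auto
lemma diq_nonneg: "0 \<le> diq P" unfolding diq_def by (intro sum_nonneg) auto
lemma enq_nonneg: "0 \<le> enq P" unfolding enq_def by (intro sum_nonneg) auto
lemma fiq_nonneg: "0 \<le> fiq P" unfolding fiq_def by (intro add_nonneg_nonneg sum_nonneg) auto
lemma foq_nonneg: "0 \<le> foq P" unfolding foq_def by (intro add_nonneg_nonneg sum_nonneg) auto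
lemma prq_nonneg: "0 \<le> prq P" unfolding prq_def by (intro sum_nonneg) auto

lemma if_simps:
  fixes x :: rat
  shows "x * (if b then 1 else 0) = (if b then x else 0)"
    "x * - (if b then 1 else 0) = - (if b then x else 0)"
    "x * - 1 = - x"
    "(if b then 0 else - x) = - (if b then 0 else x)"
    "(if b then - x else 0) = - (if b then x else 0)"
  by simp_all

lemma delta_simps:
  fixes g :: "nat \<Rightarrow> nat \<Rightarrow> rat"
  assumes "a < m"
  shows "(\<Sum>i<m. \<Sum>b<m'. if R i b then (if i = a then g i b else 0) else 0) = (\<Sum>b<m'. if R a b then g a b else 0)"
    "(\<Sum>i<m. \<Sum>b<m'. if R i b then 0 else (if i = a then g i b else 0)) = (\<Sum>b<m'. if R a b then 0 else g a b)"
    "(\<Sum>i<m'. \<Sum>b<m. if R i b then (if b = a then g i b else 0) else 0) = (\<Sum>i<m'. if R i a then g i a else 0)"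
proof -
  have "(if R i b then (if i = a then g i b else 0) else 0) = (if i = a then (if R i b then g i b else 0) else 0)"
    "(if R i b then 0 else (if i = a then g i b else 0)) = (if i = a then (if R i b then 0 else g i b) else 0)"
    "(if R i b then (if b = a then g i b else 0) else 0) = (if b = a then (if R i b then g i b else 0) else 0)"
    for i b by auto
  note * = this
  show "(\<Sum>i<m. \<Sum>b<m'. if R i b then (if i = a then g i b else 0) else 0) = (\<Sum>b<m'. if R a b then g a b else 0)"
    unfolding * by (subst sum.swap) (simp add: assms)
  show "(\<Sum>i<m. \<Sum>b<m'. if R i b then 0 else (if i = a then g i b else 0)) = (\<Sum>b<m'. if R a b then 0 else g a b)"
    unfolding * by (subst sum.swap) (simp add: assms)
  show "(\<Sum>i<m'. \<Sum>b<m. if R i b then (if b = a then g i b else 0) else 0) = (\<Sum>i<m'. if R i a then g i a else 0)"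
    unfolding * by (simp add: assms)
qed

lemma delta_pair:
  fixes g :: "bool \<Rightarrow> nat \<Rightarrow> rat"
  assumes "a < m"
  shows "(\<Sum>h'\<in>UNIV. \<Sum>i<m. if h' = h \<and> i = a then g h' i else 0) = g h a"
proof -
  have "(if h' = h \<and> i = a then g h' i else 0) = (if i = a then (if h' = h then g h' i else 0) else 0)" for h' i
    by auto
  then show ?thesis using assms by simp
qed

lemma P_start:
  assumes "P \<in> PP"
  shows "ind SrcA P + ind (F 0) P + enq P + fiq P + prq P + diq P + ind P2 P = 1"
  using tele[OF assms, of "\<lambda>v. if v = VS then 1 else 0"]
  unfolding sumAR enq_def fiq_def prq_def diq_def
  by (simp add: sum_negf if_simps cong: if_cong)

lemma P_end:
  assumes "P \<in> PP"
  shows "ind SnkA P + foq P + teq P + ind End P + diq P + ind P2 P = 1"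
  using tele[OF assms, of "\<lambda>v. if v = VT then 1 else 0"]
  unfolding sumAR foq_def teq_def diq_def
  by (simp cong: if_cong)

text \<open>The cut that separates \<open>Nu r, ..., Nu n\<close> from the rest: what enters through
  \<open>F r\<close> or a later \<open>En i\<close> leaves through an exit or through
  \<open>End\<close>.\<close>

lemma P_chain:
  assumes "P \<in> PP" "r \<le> n"
  shows "ind (F r) P + (\<Sum>i<n. if r \<le> i then ind (En i) P else 0) =
    (\<Sum>i<Suc n. if r \<le> i then exq i P else 0) + ind End P"
proof -
  let ?\<phi> = "\<lambda>v. (case v of Nu i \<Rightarrow> (if r \<le> i then 1 else 0) | _ \<Rightarrow> 0) :: rat"
  \<comment> \<open>Chain arcs inside the cut cancel and only \<open>F r\<close> remains. For
    \<open>r = 0\<close> nothing remains here, since \<open>F 0\<close> is a separate summand of the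
    expansion.\<close>
  have Fd: "(\<Sum>i<n. if r \<le> Suc i then g (Suc i) else 0) - (\<Sum>i<n. if r \<le> i then g (Suc i) else 0) =
     g r - (if r = 0 then g 0 else 0)" for g :: "nat \<Rightarrow> rat"
  proof (cases r)
    case (Suc q)
    have "(\<Sum>i<n. if r \<le> Suc i then g (Suc i) else 0) - (\<Sum>i<n. if r \<le> i then g (Suc i) else 0) =
      (\<Sum>i<n. if i = q then g (Suc i) else 0)"
      unfolding sum_subtractf[symmetric] by (intro sum.cong) (auto simp: Suc)
    then show ?thesis using assms(2) Suc by simp
  qed simp
  have ex: "(\<Sum>h\<in>UNIV. \<Sum>i<Suc n. \<Sum>b<n. if r \<le> i then ind (Ex h i b) P else 0) =
     (\<Sum>i<Suc n. if r \<le> i then exq i P else 0)"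
    unfolding exq_def by (subst sum.swap) (intro sum.cong, auto)
  show ?thesis
    using tele[OF assms(1), of ?\<phi>] Fd[of "\<lambda>i. ind (F i) P"] ex assms(2)
    unfolding sumAR
    by (simp add: sum_negf if_simps right_diff_distrib sum_subtractf del: sum.lessThan_Suc cong: if_cong)
qed

text \<open>The cut around all vertices \<open>V\<close>, \<open>In\<close> and \<open>Out\<close>.
  Links, \<open>Mid\<close> arcs and the arcs of the given network stay inside it and drop
  out.\<close>

lemma P_mid:
  assumes "P \<in> PP"
  shows "ind SrcA P + fiq P + (\<Sum>i<Suc n. exq i P) = ind SnkA P + foq P + guq P"
proof -
  let ?\<phi> = "\<lambda>v. (case v of In i \<Rightarrow> 1 | Out i \<Rightarrow> 1 | V i \<Rightarrow> 1 | _ \<Rightarrow> 0) :: rat"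
  have ex: "(\<Sum>h\<in>UNIV. \<Sum>i<Suc n. \<Sum>b<n. ind (Ex h i b) P) = (\<Sum>i<Suc n. exq i P)"
    unfolding exq_def by (rule sum.swap)
  show ?thesis
    using tele[OF assms(1), of ?\<phi>] ex
    unfolding sumAR fiq_def foq_def guq_def
    by (simp add: sum_negf if_simps del: sum.lessThan_Suc cong: if_cong)
qed

lemma P_tau:
  assumes "P \<in> PP" "a < n"
  shows "ind (Gu h a) P + ind (Pr h a) P = ind (Te h a) P"
  using tele[OF assms(1), of "\<lambda>v. if v = Tau h a then 1 else 0"] unfolding sumAR
  by (simp add: if_simps sum_negf delta_pair[OF assms(2)] cong: if_cong)

lemma P_out:
  assumes "P \<in> PP" "a < n"
  shows "ind (Mid a) P = ind (Dout a) P + ind (Fo a) P + (\<Sum>b<n. if link a b then 0 else ind (Xo a b) P) +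
     (\<Sum>h\<in>UNIV. ind (Gu h a) P) + (\<Sum>b<n. if link a b then ind (Li a b) P else 0)"
  using tele[OF assms(1), of "\<lambda>v. if v = Out a then 1 else 0"] unfolding sumAR
  by (simp add: if_simps sum_negf delta_simps[OF assms(2)] assms(2) cong: if_cong)

lemma P_in:
  assumes "P \<in> PP" "a < n"
  shows "ind (Mid a) P = ind (Din a) P + ind (Fi a) P + (\<Sum>b<n. if link a b then 0 else ind (Xi a b) P) +
     (\<Sum>h\<in>UNIV. \<Sum>i<Suc n. \<Sum>b<n. if (if h \<and> link i b then i else b) = a then ind (Ex h i b) P else 0) +
     (\<Sum>b<n. if link b a then ind (Li b a) P else 0)"
  using tele[OF assms(1), of "\<lambda>v. if v = In a then 1 else 0"] unfolding sumAR
  by (simp add: if_simps sum_negf delta_simps[OF assms(2)] assms(2) del: sum.lessThan_Suc cong: if_cong)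

end

context gadget_defs
begin

definition deg :: "nat \<Rightarrow> rat" where
  "deg a = (\<Sum>b<n. if link a b then 1 else 0)"

lemma sumO:
  fixes f :: "ar \<Rightarrow> rat"
  shows "(\<Sum>e\<leftarrow>SrcA # oarcs. f e) = f SrcA + (\<Sum>a<n. f (En a)) + (\<Sum>a<n. f (Fi a)) +
    (\<Sum>h\<in>UNIV. \<Sum>a<n. f (Pr h a)) + (\<Sum>a<n. \<Sum>b<n. if link a b then 0 else f (Xi a b))"
proof -
  have u: "(\<Sum>i\<leftarrow>[0..<m]. g i) = (\<Sum>i<m. g i)" for g :: "nat \<Rightarrow> rat" and m
    by (simp add: interv_sum_list_conv_sum_set_nat atLeast0LessThan)
  have c: "(\<Sum>x\<leftarrow>concat (map g xs). f x) = (\<Sum>a\<leftarrow>xs. \<Sum>x\<leftarrow>g a. f x)" for g :: "nat \<Rightarrow> ar list" and xs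
    by (induction xs) auto
  have b: "(\<Sum>h\<in>UNIV. g h) = g False + g True" for g :: "bool \<Rightarrow> rat"
    by (simp add: UNIV_bool)
  have neg: "(if \<not> P then x else 0) = (if P then 0 else x)" for P and x :: rat by simp
  show ?thesis
    unfolding oarcs_def
    by (simp add: c u b sum_list_map_filter' comp_def algebra_simps neg cong: if_cong)
qed

lemma L_eq: "L = (\<Sum>e\<leftarrow>SrcA # oarcs. cap e)"
proof -
  have "cap e = of_nat (ncap e)" if "e \<in> set oarcs" for e
    using that by (auto simp: oarcs_def cap_def)
  then have "map cap oarcs = map (\<lambda>e. of_nat (ncap e)) oarcs" by simp
  moreover have "of_nat (sum_list (map ncap xs)) = (\<Sum>e\<leftarrow>xs. of_nat (ncap e) :: rat)" for xs
    by (induction xs) auto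
  moreover have "(\<Sum>e\<leftarrow>SrcA # oarcs. cap e) = cap SrcA + sum_list (map cap oarcs)" by simp
  moreover have "cap SrcA = \<theta>" by (simp add: cap_def)
  ultimately show ?thesis by (simp only: L_def)
qed

lemma L_nonneg: "0 \<le> \<theta> \<Longrightarrow> 0 \<le> L"
  by (simp add: L_def)

end

lemma Ints_01: "x \<in> \<int> \<Longrightarrow> 0 \<le> x \<Longrightarrow> x \<le> 1 \<Longrightarrow> x = 0 \<or> x = (1 :: rat)"
  by (elim Ints_cases) auto

context gadget
begin

lemma ind_int [simp]: "ind e P \<in> \<int>"
  by (simp add: ind_def)

lemma exq_int: "exq i P \<in> \<int>" unfolding exq_def by (intro Ints_sum) auto

definition aex :: "ar set \<Rightarrow> rat" where
  "aex P = (\<Sum>i<Suc n. exq i P)"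

definition rc :: "ar set \<Rightarrow> rat" where
  "rc P = (\<Sum>i<n. exq i P)"

lemma aex_rc: "aex P = rc P + exq n P"
  by (simp add: aex_def rc_def)

lemma rc_nonneg: "0 \<le> rc P" unfolding rc_def by (intro sum_nonneg exq_nonneg)
lemma aex_nonneg: "0 \<le> aex P" unfolding aex_def by (intro sum_nonneg exq_nonneg)
lemma rc_int: "rc P \<in> \<int>" unfolding rc_def by (intro Ints_sum exq_int)
lemma aex_int: "aex P \<in> \<int>" unfolding aex_def by (intro Ints_sum exq_int)

lemma P_chain0: "P \<in> PP \<Longrightarrow> ind (F 0) P + enq P = aex P + ind End P"
  using P_chain[of P 0] by (simp add: enq_def aex_def)

lemma exq_le_aex: "i \<le> n \<Longrightarrow> exq i P \<le> aex P"
  unfolding aex_def by (rule member_le_sum) (auto intro: exq_nonneg)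

text \<open>Exits are reached only from the chain, and the chain only from \<open>F 0\<close> or
  some \<open>En i\<close>. Since a path leaves \<open>VS\<close> once, a coloured path contains no
  other kind of starting arc.\<close>

lemma aex_le:
  assumes "P \<in> PP"
  shows "aex P + ind SrcA P + fiq P + prq P + diq P + ind P2 P \<le> 1"
  using P_start[OF assms] P_chain0[OF assms] ind_nonneg[of End P] by linarith

lemma F_le:
  assumes "P \<in> PP" "r \<le> n"
  shows "ind (F r) P \<le> (\<Sum>i\<in>{r..n}. exq i P) + ind End P"
    and "ind (F r) P + diq P \<le> 1"
proof -
  have e: "(\<Sum>i<Suc n. if r \<le> i then exq i P else 0) = (\<Sum>i\<in>{r..n}. exq i P)"
    by (rule sum.mono_neutral_cong_right) auto
  have "0 \<le> (\<Sum>i<n. if r \<le> i then ind (En i) P else 0)" by (intro sum_nonneg) auto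
  then show 1: "ind (F r) P \<le> (\<Sum>i\<in>{r..n}. exq i P) + ind End P"
    using P_chain[OF assms] unfolding e by linarith
  have "(\<Sum>i\<in>{r..n}. exq i P) \<le> aex P"
    unfolding aex_def by (rule sum_mono2) (auto intro: exq_nonneg)
  then show "ind (F r) P + diq P \<le> 1"
    using 1 P_chain0[OF assms(1)] P_start[OF assms(1)] ind_nonneg[of SrcA P] fiq_nonneg[of P]
      prq_nonneg[of P] ind_nonneg[of P2 P] by linarith
qed

lemma Te_le: "a < n \<Longrightarrow> ind (Te h a) P \<le> teq P"
  unfolding teq_def
  by (rule order.trans[OF member_le_sum[of a "{..<n}" "\<lambda>a. ind (Te h a) P"]
        member_le_sum[of h UNIV "\<lambda>h. \<Sum>a<n. ind (Te h a) P"]]) (auto intro: sum_nonneg)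

lemma Gu_le: "a < n \<Longrightarrow> ind (Gu h a) P \<le> guq P"
  unfolding guq_def
  by (rule order.trans[OF member_le_sum[of a "{..<n}" "\<lambda>a. ind (Gu h a) P"]
        member_le_sum[of h UNIV "\<lambda>h. \<Sum>a<n. ind (Gu h a) P"]]) (auto intro: sum_nonneg)

lemma teq_eq: "P \<in> PP \<Longrightarrow> teq P = guq P + prq P"
  unfolding teq_def guq_def prq_def by (simp add: P_tau[symmetric] sum.distrib)

lemma end_le:
  assumes "P \<in> PP"
  shows "ind SnkA P + foq P + teq P + ind End P + diq P \<le> 1"
  using P_end[OF assms] ind_nonneg[of P2 P] by linarith

lemma di_zero: "diq P = 0 \<longleftrightarrow> P \<inter> Di ` {..<k - 2} = {}"
  unfolding diq_def by (subst sum_nonneg_eq_0_iff) (auto simp: ind_def)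

lemma diq_int: "diq P \<in> \<int>" unfolding diq_def by (intro Ints_sum) auto

text \<open>Inclusion and exclusion. A dummy arc is a whole path by itself, so the only overlap is
  between \<open>F r\<close> and \<open>Te h a\<close>.\<close>

lemma tight_set_indicator:
  assumes "P \<in> PP" "r \<le> n" "a < n"
  shows "of_bool (P \<inter> ({F r, Te h a} \<union> Di ` {..<k - 2}) = {}) =
    1 - diq P - ind (F r) P - ind (Te h a) P + ind (F r) P * ind (Te h a) P"
proof (cases "diq P = 0")
  case True
  then have "P \<inter> Di ` {..<k - 2} = {}" by (simp add: di_zero)
  then have "P \<inter> ({F r, Te h a} \<union> Di ` {..<k - 2}) = {} \<longleftrightarrow> F r \<notin> P \<and> Te h a \<notin> P" by auto
  then show ?thesis using True by (auto simp: ind_def)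
next
  case False
  have "ind SnkA P + foq P + ind End P \<ge> 0" by (intro add_nonneg_nonneg foq_nonneg) auto
  then have "diq P + ind (Te h a) P \<le> 1"
    using end_le[OF assms(1)] Te_le[OF assms(3), of h P] by linarith
  moreover have "1 \<le> diq P"
    using False Ints_nonzero_abs_ge1[OF diq_int False] diq_nonneg[of P] by simp
  ultimately have "diq P = 1" "ind (Te h a) P = 0" "ind (F r) P = 0"
    using F_le(2)[OF assms(1,2)] ind_nonneg[of "Te h a" P] ind_nonneg[of "F r" P] by linarith+
  moreover have "P \<inter> ({F r, Te h a} \<union> Di ` {..<k - 2}) \<noteq> {}" using False by (auto simp: di_zero)
  ultimately show ?thesis by simp
qed

lemma card_tight:
  assumes "\<And>j. x \<noteq> Di j" "\<And>j. z \<noteq> Di j" "x \<noteq> z"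
  shows "card ({x, z} \<union> Di ` {..<k - 2}) = k"
proof -
  have "card (Di ` {..<k - 2}) = k - 2" by (subst card_image) (auto simp: inj_on_def)
  moreover have "card ({x, z} \<union> Di ` {..<k - 2}) = card {x, z} + card (Di ` {..<k - 2})"
    using assms by (intro card_Un_disjoint) auto
  ultimately show ?thesis using assms(3) k2 by simp
qed

end

section \<open>Flows as weights on path statistics, and the threshold as an upper bound\<close>

locale gadget_flow = gadget +
  fixes y :: "ar set \<Rightarrow> rat"
  assumes y_nonneg: "\<And>P. P \<in> PP \<Longrightarrow> 0 \<le> y P"
    and y_cap: "\<And>e. e \<in> set arlist \<Longrightarrow> (\<Sum>P | P \<in> PP \<and> e \<in> P. y P) \<le> cap e"
begin

text \<open>Integration against the flow turns an identity that holds on every path into one between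
  loads; \<open>av (ind e)\<close> is the load of \<open>e\<close>.\<close>

definition av :: "(ar set \<Rightarrow> rat) \<Rightarrow> rat" where
  "av f = (\<Sum>P\<in>PP. y P * f P)"

lemma av_mono: "(\<And>P. P \<in> PP \<Longrightarrow> f P \<le> g P) \<Longrightarrow> av f \<le> av g"
  unfolding av_def by (intro sum_mono mult_left_mono y_nonneg)

lemma av_cong: "(\<And>P. P \<in> PP \<Longrightarrow> f P = g P) \<Longrightarrow> av f = av g"
  unfolding av_def by (intro sum.cong) auto

lemma av_add: "av (\<lambda>P. f P + g P) = av f + av g"
  by (simp add: av_def algebra_simps sum.distrib)

lemma av_diff: "av (\<lambda>P. f P - g P) = av f - av g"
  by (simp add: av_def algebra_simps sum_subtractf)

lemma av_cmult: "av (\<lambda>P. c * f P) = c * av f"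
  unfolding av_def sum_distrib_left by (intro sum.cong) auto

lemma av_sum: "av (\<lambda>P. \<Sum>i\<in>A. f i P) = (\<Sum>i\<in>A. av (f i))"
  unfolding av_def sum_distrib_left by (rule sum.swap)

lemma av_0 [simp]: "av (\<lambda>P. 0) = 0"
  by (simp add: av_def)

lemma av_if0: "av (\<lambda>P. if b then f P else 0) = (if b then av f else 0)"
  "av (\<lambda>P. if b then 0 else f P) = (if b then 0 else av f)"
  by auto

lemma av_nonneg: "(\<And>P. P \<in> PP \<Longrightarrow> 0 \<le> f P) \<Longrightarrow> 0 \<le> av f"
  using av_mono[of "\<lambda>_. 0" f] by simp

text \<open>The device for returning from totals to single paths: once two totals are shown equal,
  the pointwise inequality between their integrands is an equality on every path that carries
  flow.\<close>

lemma av_zero: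
  assumes "av f \<le> 0" "\<And>P. P \<in> PP \<Longrightarrow> 0 \<le> y P * f P" "P \<in> PP" "y P \<noteq> 0"
  shows "f P = 0"
proof -
  have "av f = 0" unfolding av_def using assms(1,2) unfolding av_def by (intro antisym sum_nonneg) auto
  then have "y P * f P = 0"
    unfolding av_def using sum_nonneg_eq_0_iff[OF finite_PP, of "\<lambda>P. y P * f P"] assms(2,3) by simp
  then show ?thesis using assms(4) by simp
qed

abbreviation c :: "ar \<Rightarrow> rat" where "c e \<equiv> av (ind e)"

lemma c_nonneg [simp]: "0 \<le> c e"
  by (intro av_nonneg) simp

lemma c_eq: "c e = (\<Sum>P | P \<in> PP \<and> e \<in> P. y P)"
  unfolding av_def ind_def by (rule sum.mono_neutral_cong_right) (auto simp: finite_PP)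

lemma c_cap: "ok e \<Longrightarrow> c e \<le> cap e"
  using y_cap[of e] by (simp add: c_eq set_arlist)

lemma surv_eq: "(\<Sum>P | P \<in> PP \<and> P \<inter> S = {}. y P) = av (\<lambda>P. of_bool (P \<inter> S = {}))"
  unfolding av_def by (rule sum.mono_neutral_cong_left) (auto simp: finite_PP)

text \<open>After these \<open>k\<close> arcs fail, every path has to start with \<open>SrcA\<close>
  or an arc of \<open>oarcs\<close>, whose capacities add up to \<open>L\<close>.\<close>

definition Sstar :: "ar set" where
  "Sstar = {F 0, P2} \<union> Di ` {..<k - 2}"

lemma Sstar: "Sstar \<subseteq> set arlist" "card Sstar = k"
  unfolding Sstar_def using card_tight[of "F 0" P2] by (auto simp: set_arlist)

lemma sum_start_avoid:
  assumes "P \<in> PP"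
  shows "(\<Sum>e\<leftarrow>SrcA # oarcs. ind e P) = 1 - ind (F 0) P - diq P - ind P2 P"
  using P_start[OF assms] unfolding sumO enq_def fiq_def prq_def by simp

lemma av_O: "av (\<lambda>P. \<Sum>e\<leftarrow>SrcA # oarcs. ind e P) = (\<Sum>e\<leftarrow>SrcA # oarcs. c e)"
proof -
  have "av (\<lambda>P. \<Sum>e\<leftarrow>xs. ind e P) = (\<Sum>e\<leftarrow>xs. c e)" for xs
    by (induction xs) (auto simp: av_add)
  then show ?thesis .
qed

lemma Sstar_le: "av (\<lambda>P. of_bool (P \<inter> Sstar = {})) \<le> (\<Sum>e\<leftarrow>SrcA # oarcs. c e)"
  unfolding av_O[symmetric]
proof (rule av_mono)
  fix P assume P: "P \<in> PP"
  show "of_bool (P \<inter> Sstar = {}) \<le> (\<Sum>e\<leftarrow>SrcA # oarcs. ind e P)"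
  proof (cases "P \<inter> Sstar = {}")
    case True
    then have "ind (F 0) P = 0" "diq P = 0" "ind P2 P = 0"
      by (auto simp: Sstar_def ind_def di_zero)
    then show ?thesis unfolding sum_start_avoid[OF P] by simp
  next
    case False
    moreover have "0 \<le> (\<Sum>e\<leftarrow>xs. ind e P)" for xs by (rule sum_list_nonneg) auto
    ultimately show ?thesis by (simp only: of_bool_eq(1))
  qed
qed

lemma O_le: "(\<Sum>e\<leftarrow>SrcA # oarcs. c e) \<le> L"
  unfolding L_eq by (intro sum_list_mono c_cap) (use set_arlist in \<open>auto simp: arlist_def\<close>)

lemma Sstar_surv: "(\<Sum>P | P \<in> PP \<and> P \<inter> Sstar = {}. y P) \<le> L"
  unfolding surv_eq using Sstar_le O_le by (rule order.trans)

end

section \<open>Consequences of reaching the threshold: rigidity of the colours\<close>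

locale gadget_robust = gadget_flow +
  assumes y_surv: "\<And>S. S \<subseteq> set arlist \<Longrightarrow> card S = k \<Longrightarrow> L \<le> (\<Sum>P | P \<in> PP \<and> P \<inter> S = {}. y P)"
begin

lemma O_eq: "(\<Sum>e\<leftarrow>SrcA # oarcs. c e) = L"
  using O_le Sstar_le y_surv[OF Sstar] unfolding surv_eq by linarith

lemma c_O:
  assumes "e \<in> set (SrcA # oarcs)"
  shows "c e = cap e"
proof -
  have d: "distinct (SrcA # oarcs)" using distinct_arlist by (auto simp: arlist_def)
  have ok: "ok e" if "e \<in> set (SrcA # oarcs)" for e using that set_arlist by (auto simp: arlist_def)
  have "(\<Sum>e\<in>set (SrcA # oarcs). cap e - c e) = 0"
    using O_eq L_eq d by (simp only: sum_subtractf sum_list_distinct_conv_sum_set)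
  then have "\<forall>e\<in>set (SrcA # oarcs). cap e - c e = 0"
    by (subst (asm) sum_nonneg_eq_0_iff) (auto intro!: c_cap ok simp del: set_simps)
  from bspec[OF this assms] show ?thesis by simp
qed

lemma c_sat:
  "c SrcA = \<theta>"
  "a < n \<Longrightarrow> c (En a) = 2 * of_nat n - 1"
  "a < n \<Longrightarrow> c (Fi a) = of_nat U"
  "a < n \<Longrightarrow> c (Pr h a) = of_nat (U + 2 * n + 1)"
  "a < n \<Longrightarrow> b < n \<Longrightarrow> \<not> link a b \<Longrightarrow> c (Xi a b) = 1"
proof -
  show "c SrcA = \<theta>" using c_O[of SrcA] by (simp add: cap_def)
  show "c (En a) = 2 * of_nat n - 1" if "a < n"
    using c_O[of "En a"] that n1 by (simp add: cap_def oarcs_def of_nat_diff)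
  show "c (Fi a) = of_nat U" if "a < n"
    using c_O[of "Fi a"] that by (simp add: cap_def oarcs_def)
  show "c (Pr h a) = of_nat (U + 2 * n + 1)" if "a < n"
    using c_O[of "Pr h a"] that by (cases h) (simp_all add: cap_def oarcs_def)
  show "c (Xi a b) = 1" if "a < n" "b < n" "\<not> link a b"
  proof -
    have "Xi a b \<in> set oarcs" unfolding oarcs_def using that by auto
    then show ?thesis using c_O[of "Xi a b"] by (simp add: cap_def)
  qed
qed

definition X :: "nat \<Rightarrow> rat" where "X i = av (exq i)"
definition z :: "nat \<Rightarrow> bool \<Rightarrow> nat \<Rightarrow> rat" where "z i h a = av (\<lambda>P. exq i P * ind (Te h a) P)"
abbreviation g :: "bool \<Rightarrow> nat \<Rightarrow> rat" where "g h a \<equiv> c (Gu h a)"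

lemma V_eq: "av (\<lambda>P. 1) = L + c (F 0) + av diq + c P2"
proof -
  have "av (\<lambda>P. 1) = av (\<lambda>P. (\<Sum>e\<leftarrow>SrcA # oarcs. ind e P) + ind (F 0) P + diq P + ind P2 P)"
    by (rule av_cong) (drule sum_start_avoid, linarith)
  then show ?thesis by (simp only: av_add av_O O_eq)
qed

text \<open>Between \<open>F 0\<close> and \<open>F r\<close> the chain gains the saturated arcs
  \<open>En i\<close> and loses the exits of the colours below \<open>r\<close>.\<close>

lemma chain_flow:
  assumes "r \<le> n"
  shows "c (F r) - c (F 0) = of_nat r * (2 * of_nat n - 1) - (\<Sum>i<r. X i)"
proof -
  have en: "(\<Sum>i<n. f i) = (\<Sum>i<n. if r \<le> i then f i else 0) + (\<Sum>i<r. f i)" for f :: "nat \<Rightarrow> rat"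
  proof -
    have "(\<Sum>i<n. f i) = (\<Sum>i<n. if r \<le> i then f i else 0) + (\<Sum>i<n. if i < r then f i else 0)"
      unfolding sum.distrib[symmetric] by (intro sum.cong) auto
    also have "(\<Sum>i<n. if i < r then f i else 0) = (\<Sum>i<r. f i)"
      using assms by (intro sum.mono_neutral_cong_right) auto
    finally show ?thesis .
  qed
  have "ind (F r) P - ind (F 0) P = (\<Sum>i<r. ind (En i) P) - (\<Sum>i<r. exq i P)" if P: "P \<in> PP" for P
  proof -
    have "(\<Sum>i<Suc n. exq i P) = (\<Sum>i<Suc n. if r \<le> i then exq i P else 0) + (\<Sum>i<r. exq i P)"
      using en[of "\<lambda>i. exq i P"] assms by simp
    then show ?thesis
      using P_chain[OF P assms] P_chain0[OF P] en[of "\<lambda>i. ind (En i) P"]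
      unfolding enq_def aex_def by linarith
  qed
  then have "av (\<lambda>P. ind (F r) P - ind (F 0) P) = av (\<lambda>P. (\<Sum>i<r. ind (En i) P) - (\<Sum>i<r. exq i P))"
    by (rule av_cong)
  then have "c (F r) - c (F 0) = (\<Sum>i<r. c (En i)) - (\<Sum>i<r. X i)"
    by (simp only: av_diff av_sum X_def)
  moreover have "(\<Sum>i<r. c (En i)) = of_nat r * (2 * of_nat n - 1)"
    using assms by (simp add: c_sat(2))
  ultimately show ?thesis by simp
qed

text \<open>Compare the failure of \<open>F r\<close>, \<open>Te h a\<close> and the dummy arcs with
  that of \<open>Sstar\<close>, which leaves exactly \<open>L\<close>. The extra load of the first
  set must be covered by paths that it hits twice, and these have a colour at least
  \<open>r\<close>. The saturated \<open>Pr h a\<close> outweighs \<open>P2\<close>, so only the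
  guard flow remains.\<close>

lemma overlap:
  assumes "r \<le> n" "a < n"
  shows "g h a + of_nat r * (2 * of_nat n - 1) - (\<Sum>i<r. X i) \<le> (\<Sum>i\<in>{r..n}. z i h a)"
proof -
  let ?S = "{F r, Te h a} \<union> Di ` {..<k - 2}"
  have "?S \<subseteq> set arlist" using assms by (auto simp: set_arlist)
  moreover have "card ?S = k" by (rule card_tight) auto
  ultimately have "L \<le> av (\<lambda>P. of_bool (P \<inter> ?S = {}))" using y_surv[of ?S] by (simp only: surv_eq)
  also have "\<dots> = av (\<lambda>P. 1 - diq P - ind (F r) P - ind (Te h a) P + ind (F r) P * ind (Te h a) P)"
    by (rule av_cong) (rule tight_set_indicator[OF _ assms])
  also have "\<dots> = av (\<lambda>P. 1) - av diq - c (F r) - c (Te h a) + av (\<lambda>P. ind (F r) P * ind (Te h a) P)"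
    by (simp only: av_add av_diff)
  finally have 1: "c (F r) + c (Te h a) - c (F 0) - c P2 \<le> av (\<lambda>P. ind (F r) P * ind (Te h a) P)"
    unfolding V_eq by simp
  have "c (Te h a) = av (\<lambda>P. ind (Gu h a) P + ind (Pr h a) P)"
    by (rule av_cong) (simp add: P_tau assms)
  then have 2: "c (Te h a) = g h a + of_nat (U + 2 * n + 1)" by (simp only: av_add c_sat(4)[OF assms(2)])
  have 3: "c P2 \<le> of_nat (U + 2 * n + 1)" using c_cap[of P2] by (simp add: cap_def)
  have "av (\<lambda>P. ind (F r) P * ind (Te h a) P) \<le> av (\<lambda>P. \<Sum>i\<in>{r..n}. exq i P * ind (Te h a) P)"
  proof (rule av_mono)
    fix P assume P: "P \<in> PP"
    have nn: "0 \<le> (\<Sum>i\<in>{r..n}. exq i P)" by (intro sum_nonneg exq_nonneg)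
    have "0 \<le> ind SnkA P + foq P + diq P" by (intro add_nonneg_nonneg foq_nonneg diq_nonneg) simp
    \<comment> \<open>A path through \<open>Te h a\<close> misses \<open>End\<close>, so behind
      \<open>F r\<close> it must take an exit.\<close>
    then have "ind (Te h a) P + ind End P \<le> 1"
      using end_le[OF P] Te_le[OF assms(2), of h P] by linarith
    then have "ind (F r) P * ind (Te h a) P \<le> (\<Sum>i\<in>{r..n}. exq i P) * ind (Te h a) P"
      using F_le(1)[OF P assms(1)] nn by (cases "Te h a \<in> P"; cases "End \<in> P") (auto simp: ind_def)
    then show "ind (F r) P * ind (Te h a) P \<le> (\<Sum>i\<in>{r..n}. exq i P * ind (Te h a) P)"
      by (simp add: sum_distrib_right)
  qed
  also have "\<dots> = (\<Sum>i\<in>{r..n}. z i h a)" by (simp only: av_sum z_def)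
  finally show ?thesis using 1 2 3 chain_flow[OF assms(1)] by linarith
qed

lemma X_sum: "X i = (\<Sum>h\<in>UNIV. \<Sum>b<n. c (Ex h i b))"
  unfolding X_def exq_def[abs_def] av_sum ..

lemma X_le: "i \<le> n \<Longrightarrow> X i \<le> 2 * of_nat n"
proof -
  assume i: "i \<le> n"
  have "X i = (\<Sum>h\<in>UNIV. \<Sum>b<n. c (Ex h i b))" by (rule X_sum)
  also have "\<dots> \<le> (\<Sum>h\<in>(UNIV :: bool set). \<Sum>b<n. (1 :: rat))"
  proof (intro sum_mono)
    fix h b assume "b \<in> {..<n}"
    then show "c (Ex h i b) \<le> 1" using i c_cap[of "Ex h i b"] by (simp add: cap_def)
  qed
  finally show ?thesis by (simp add: UNIV_bool)
qed

text \<open>Whatever enters the middle part besides the exits is saturated, and outside the guards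
  flow can leave only through arcs of the same total capacity. So the guards receive at least the
  exit flow, and equality fills the other leaving arcs as well.\<close>

lemma balance:
  "(\<Sum>i<Suc n. X i) \<le> (\<Sum>h\<in>UNIV. \<Sum>a<n. g h a)"
  "(\<Sum>i<Suc n. X i) = (\<Sum>h\<in>UNIV. \<Sum>a<n. g h a) \<Longrightarrow>
     c SnkA = \<theta> \<and> (\<forall>a<n. c (Fo a) = of_nat U \<and> (\<forall>b<n. \<not> link a b \<longrightarrow> c (Xo a b) = 1))"
proof -
  have "av (\<lambda>P. ind SrcA P + fiq P + (\<Sum>i<Suc n. exq i P)) = av (\<lambda>P. ind SnkA P + foq P + guq P)"
    by (rule av_cong) (rule P_mid)
  then have b: "c SrcA + av fiq + (\<Sum>i<Suc n. X i) = c SnkA + av foq + (\<Sum>h\<in>UNIV. \<Sum>a<n. g h a)"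
    unfolding X_def guq_def by (simp only: av_add av_sum)
  have fi: "av fiq = (\<Sum>a<n. of_nat U) + (\<Sum>a<n. \<Sum>b<n. if link a b then 0 else 1)"
    unfolding fiq_def av_add av_sum av_if0
    by (intro arg_cong2[where f = "(+)"] sum.cong) (auto simp: c_sat)
  have fo: "av foq = (\<Sum>a<n. c (Fo a)) + (\<Sum>a<n. \<Sum>b<n. if link a b then 0 else c (Xo a b))"
    unfolding foq_def av_add av_sum av_if0 ..
  have le: "c SnkA \<le> \<theta>" "a < n \<Longrightarrow> c (Fo a) \<le> of_nat U"
    "a < n \<Longrightarrow> b < n \<Longrightarrow> (if link a b then 0 else c (Xo a b)) \<le> (if link a b then 0 else 1)" for a b
    using c_cap[of SnkA] c_cap[of "Fo a"] c_cap[of "Xo a b"] by (auto simp: cap_def)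
  have le2: "(\<Sum>a<n. c (Fo a)) \<le> (\<Sum>a<n. of_nat U)"
    "(\<Sum>a<n. \<Sum>b<n. if link a b then 0 else c (Xo a b)) \<le> (\<Sum>a<n. \<Sum>b<n. if link a b then 0 else 1)"
    by (intro sum_mono le; simp)+
  show "(\<Sum>i<Suc n. X i) \<le> (\<Sum>h\<in>UNIV. \<Sum>a<n. g h a)"
    using b le(1) le2 unfolding fi fo c_sat(1) by linarith
  assume eq: "(\<Sum>i<Suc n. X i) = (\<Sum>h\<in>UNIV. \<Sum>a<n. g h a)"
  have e1: "c SnkA = \<theta>" "(\<Sum>a<n. c (Fo a)) = (\<Sum>a<n. of_nat U)"
    "(\<Sum>a<n. \<Sum>b<n. if link a b then 0 else c (Xo a b)) = (\<Sum>a<n. \<Sum>b<n. if link a b then 0 else 1)"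
    using b le(1) le2 eq unfolding fi fo c_sat(1) by linarith+
  have "c (Fo a) = of_nat U" if "a < n" for a
    using sum_mono_inv[OF e1(2) le(2)] that by simp
  moreover
  have "(if link a b then 0 else c (Xo a b)) = (if link a b then 0 else 1)" if "a < n" "b < n" for a b
  proof -
    have "(\<Sum>b<n. if link a b then 0 else c (Xo a b)) = (\<Sum>b<n. if link a b then 0 else 1)"
      by (rule sum_mono_inv[OF e1(3)]) (auto intro!: sum_mono le(3) that simp del: of_nat_sum)
    from sum_mono_inv[OF this le(3)[OF that(1)]] that show ?thesis by simp
  qed
  then have "c (Xo a b) = 1" if "a < n" "b < n" "\<not> link a b" for a b using that by presburger
  ultimately show "c SnkA = \<theta> \<and> (\<forall>a<n. c (Fo a) = of_nat U \<and> (\<forall>b<n. \<not> link a b \<longrightarrow> c (Xo a b) = 1))"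
    using e1(1) by auto
qed

lemma z_le_X: "i \<le> n \<Longrightarrow> (\<Sum>h\<in>UNIV. \<Sum>a<n. z i h a) \<le> X i"
proof -
  have "(\<Sum>h\<in>UNIV. \<Sum>a<n. z i h a) = av (\<lambda>P. exq i P * teq P)"
    unfolding z_def teq_def sum_distrib_left by (simp only: av_sum)
  also have "\<dots> \<le> X i" unfolding X_def
  proof (rule av_mono)
    fix P assume P: "P \<in> PP"
    have "0 \<le> ind SnkA P + foq P + ind End P + diq P" by (intro add_nonneg_nonneg foq_nonneg diq_nonneg) auto
    then have "teq P \<le> 1" using end_le[OF P] by linarith
    then show "exq i P * teq P \<le> exq i P" using exq_nonneg[of i P] by (simp add: mult_left_le)
  qed
  finally show ?thesis .
qed

lemma sum_atLeast: "r \<le> n \<Longrightarrow> (\<Sum>i<Suc n. f i) = (\<Sum>i<r. f i) + (\<Sum>i\<in>{r..n}. f i)"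
  for f :: "nat \<Rightarrow> rat"
proof -
  assume "r \<le> n"
  then have "{..<Suc n} = {..<r} \<union> {r..n}" by auto
  then have "(\<Sum>i<Suc n. f i) = sum f ({..<r} \<union> {r..n})" by (rule arg_cong)
  also have "\<dots> = (\<Sum>i<r. f i) + (\<Sum>i\<in>{r..n}. f i)" by (rule sum.union_disjoint) auto
  finally show ?thesis .
qed

abbreviation "G \<equiv> \<Sum>h\<in>UNIV. \<Sum>a<n. g h a"

text \<open>All \<open>2 n\<close> guards are treated together: a path reaches at most one of them,
  so the right-hand sides add up to no more than the flow of the colours from \<open>r\<close>
  on.\<close>

lemma sum_overlap:
  assumes "r \<le> n"
  shows "G + 2 * of_nat n * (of_nat r * (2 * of_nat n - 1) - (\<Sum>i<r. X i)) \<le>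
     (\<Sum>h\<in>UNIV. \<Sum>a<n. \<Sum>i\<in>{r..n}. z i h a)"
    "(\<Sum>h\<in>UNIV. \<Sum>a<n. \<Sum>i\<in>{r..n}. z i h a) \<le> (\<Sum>i\<in>{r..n}. X i)"
proof -
  have "(\<Sum>h\<in>UNIV. \<Sum>a<n. g h a + (of_nat r * (2 * of_nat n - 1) - (\<Sum>i<r. X i))) \<le>
     (\<Sum>h\<in>UNIV. \<Sum>a<n. \<Sum>i\<in>{r..n}. z i h a)"
    using overlap[OF assms] by (intro sum_mono) (simp add: algebra_simps)
  moreover have "(\<Sum>h\<in>UNIV. \<Sum>a<n. g h a + K) = G + 2 * of_nat n * K" for K
    by (simp add: sum.distrib UNIV_bool algebra_simps)
  ultimately show "G + 2 * of_nat n * (of_nat r * (2 * of_nat n - 1) - (\<Sum>i<r. X i)) \<le>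
     (\<Sum>h\<in>UNIV. \<Sum>a<n. \<Sum>i\<in>{r..n}. z i h a)" by simp
  have "(\<Sum>h\<in>UNIV. \<Sum>a<n. \<Sum>i\<in>{r..n}. z i h a) = (\<Sum>i\<in>{r..n}. \<Sum>h\<in>UNIV. \<Sum>a<n. z i h a)"
  proof -
    have "(\<Sum>h\<in>UNIV. \<Sum>a<n. \<Sum>i\<in>{r..n}. z i h a) = (\<Sum>h\<in>UNIV. \<Sum>i\<in>{r..n}. \<Sum>a<n. z i h a)"
      by (intro sum.cong refl sum.swap)
    also have "\<dots> = (\<Sum>i\<in>{r..n}. \<Sum>h\<in>UNIV. \<Sum>a<n. z i h a)" by (rule sum.swap)
    finally show ?thesis .
  qed
  also have "\<dots> \<le> (\<Sum>i\<in>{r..n}. X i)" by (intro sum_mono z_le_X) auto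
  finally show "(\<Sum>h\<in>UNIV. \<Sum>a<n. \<Sum>i\<in>{r..n}. z i h a) \<le> (\<Sum>i\<in>{r..n}. X i)" .
qed

lemma X_total: "(\<Sum>i<Suc n. X i) = G"
proof -
  have "G \<le> (\<Sum>i\<in>{0..n}. X i)" using sum_overlap[of 0] by simp
  also have "\<dots> = (\<Sum>i<Suc n. X i)" by (rule sum.cong) auto
  finally show ?thesis using balance(1) by simp
qed

lemma c_Fo: "a < n \<Longrightarrow> c (Fo a) = of_nat U" using balance(2)[OF X_total] by blast
lemma c_Xo: "a < n \<Longrightarrow> b < n \<Longrightarrow> \<not> link a b \<Longrightarrow> c (Xo a b) = 1" using balance(2)[OF X_total] by blast

text \<open>Let \<open>d\<close> be what the first \<open>r\<close> colours lack compared with their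
  full \<open>2 n r\<close> exits. The lack is felt in the inequality of each of the
  \<open>2 n\<close> guards but only once in the total, so \<open>2 n d \<le> d\<close>.\<close>

lemma X_prefix:
  assumes "r \<le> n"
  shows "(\<Sum>i<r. X i) = 2 * of_nat n * of_nat r"
proof -
  define Y where "Y = (\<Sum>i<r. X i)"
  define d where "d = 2 * of_nat n * of_nat r - Y"
  have "Y \<le> (\<Sum>i<r. 2 * of_nat n)" unfolding Y_def using assms by (intro sum_mono X_le) auto
  then have d0: "0 \<le> d" by (simp add: d_def algebra_simps)
  have "G + 2 * of_nat n * (of_nat r * (2 * of_nat n - 1) - Y) \<le> G - Y"
    using order.trans[OF sum_overlap[OF assms]] sum_atLeast[OF assms, of X] unfolding X_total Y_def by linarith
  moreover have "of_nat r * (2 * of_nat n - 1) - Y = d - of_nat r" by (simp add: d_def algebra_simps)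
  ultimately have "2 * of_nat n * (d - of_nat r) \<le> - Y" by simp
  then have "2 * of_nat n * d \<le> d"
    using right_diff_distrib[of "2 * of_nat n" d "of_nat r"] d_def by linarith
  moreover have "1 * d \<le> of_nat n * d" using n1 d0 by (intro mult_right_mono) auto
  ultimately have "d = 0" using d0 by linarith
  then show ?thesis by (simp add: d_def Y_def)
qed

lemma X_eq: "i < n \<Longrightarrow> X i = 2 * of_nat n"
  using X_prefix[of i] X_prefix[of "Suc i"] by (simp add: algebra_simps)

lemma G_eq: "G = 2 * of_nat n * of_nat n + X n"
  using X_total X_prefix[of n] by simp

text \<open>With the colours below \<open>r\<close> at full strength, the inequalities of
  \<open>overlap\<close> add up to an equality, so each of them is tight.\<close>

lemma z_tail:
  assumes "r \<le> n" "a < n"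
  shows "(\<Sum>i\<in>{r..n}. z i h a) = g h a - of_nat r"
proof -
  have "(\<Sum>i\<in>{r..n}. X i) = G - 2 * of_nat n * of_nat r"
    using sum_atLeast[OF assms(1), of X] X_prefix[OF assms(1)] X_total by linarith
  moreover have K: "of_nat r * (2 * of_nat n - 1) - (\<Sum>i<r. X i) = - (of_nat r :: rat)"
    unfolding X_prefix[OF assms(1)] by (simp add: algebra_simps)
  ultimately have eq: "(\<Sum>h\<in>UNIV. \<Sum>a<n. \<Sum>i\<in>{r..n}. z i h a) = G - 2 * of_nat n * of_nat r"
    using sum_overlap[OF assms(1)] unfolding K by (simp add: algebra_simps)
  also have "\<dots> = (\<Sum>h\<in>UNIV. \<Sum>a<n. g h a - of_nat r)"
    by (simp add: sum_subtractf UNIV_bool algebra_simps)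
  finally have eq': "(\<Sum>h\<in>UNIV. \<Sum>a<n. g h a - of_nat r) = (\<Sum>h\<in>UNIV. \<Sum>a<n. \<Sum>i\<in>{r..n}. z i h a)" by simp
  have le: "g h a - of_nat r \<le> (\<Sum>i\<in>{r..n}. z i h a)" if "a < n" for h a
    using overlap[OF assms(1) that] K by (simp add: add_diff_eq[symmetric] del: add_diff_eq)
  have "(\<Sum>a<n. g h a - of_nat r) = (\<Sum>a<n. \<Sum>i\<in>{r..n}. z i h a)"
    by (rule sum_mono_inv[OF eq']) (auto intro!: sum_mono le)
  from sum_mono_inv[OF this le, of a] show ?thesis using assms(2) by simp
qed

text \<open>Subtract the tails at \<open>i\<close> and \<open>Suc i\<close>. The last tail is the
  one at \<open>n\<close>, so colour \<open>n\<close> alone remains undetermined.\<close>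

lemma z_eq: "i < n \<Longrightarrow> a < n \<Longrightarrow> z i h a = 1"
proof -
  assume "i < n" "a < n"
  moreover have "{i..n} = insert i {Suc i..n}" using \<open>i < n\<close> by auto
  ultimately show ?thesis using z_tail[of i a h] z_tail[of "Suc i" a h] by simp
qed

lemma z_n: "a < n \<Longrightarrow> z n h a = g h a - of_nat n"
  using z_tail[of n a h] by simp

text \<open>No flow of any colour is lost on the way to the guards: the estimate
  \<open>z_le_X\<close> is an equality.\<close>

lemma z_sum: "i \<le> n \<Longrightarrow> (\<Sum>h\<in>UNIV. \<Sum>a<n. z i h a) = X i"
proof (cases "i < n")
  case True
  then show ?thesis by (simp add: z_eq X_eq UNIV_bool)
next
  case False
  moreover assume "i \<le> n"
  ultimately have "i = n" by simp
  then show ?thesis using G_eq by (simp add: z_n sum_subtractf UNIV_bool algebra_simps)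
qed

lemma c_Ex: "i < n \<Longrightarrow> b < n \<Longrightarrow> c (Ex h i b) = 1"
proof -
  assume i: "i < n" and b: "b < n"
  have le: "c (Ex h i b) \<le> 1" if "b < n" for h b using c_cap[of "Ex h i b"] i that by (simp add: cap_def)
  from X_sum[of i] have eq: "(\<Sum>h\<in>UNIV. \<Sum>b<n. c (Ex h i b)) = (\<Sum>h\<in>(UNIV :: bool set). \<Sum>b<n. (1 :: rat))"
    using X_eq[OF i] by (simp add: UNIV_bool)
  have "(\<Sum>b<n. c (Ex h i b)) = (\<Sum>b<n. (1 :: rat))"
    by (rule sum_mono_inv[OF eq]) (auto intro!: sum_mono le simp del: sum_constant)
  from sum_mono_inv[OF this le, of b] show ?thesis using b by simp
qed

end

context gadget
begin

lemma Ex_le: "b < n \<Longrightarrow> ind (Ex h i b) P \<le> exq i P"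
  unfolding exq_def
  by (rule order.trans[OF member_le_sum[of b "{..<n}" "\<lambda>b. ind (Ex h i b) P"]
        member_le_sum[of h UNIV "\<lambda>h. \<Sum>b<n. ind (Ex h i b) P"]]) (auto intro: sum_nonneg)

lemma double_le:
  assumes "a < n" "b < n" "\<not> link a b" and that: "\<And>a b. 0 \<le> (f a b :: rat)"
  shows "f a b \<le> (\<Sum>a<n. \<Sum>b<n. if link a b then 0 else f a b)"
proof -
  have "f a b \<le> (\<Sum>b<n. if link a b then 0 else f a b)"
    using member_le_sum[of b "{..<n}" "\<lambda>b. if link a b then 0 else f a b"] assms that by simp
  also have "\<dots> \<le> (\<Sum>a<n. \<Sum>b<n. if link a b then 0 else f a b)"
    using member_le_sum[of a "{..<n}" "\<lambda>a. \<Sum>b<n. if link a b then 0 else f a b"] assms that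
    by (simp add: sum_nonneg)
  finally show ?thesis .
qed

lemma ind_01: "ind e P = 0 \<or> ind e P = 1"
  by (simp add: ind_def)

lemma fiq_ge:
  "a < n \<Longrightarrow> ind (Fi a) P \<le> fiq P"
  "a < n \<Longrightarrow> b < n \<Longrightarrow> \<not> link a b \<Longrightarrow> ind (Xi a b) P \<le> fiq P"
proof -
  have nn: "0 \<le> (\<Sum>a<n. ind (Fi a) P)" "0 \<le> (\<Sum>a<n. \<Sum>b<n. if link a b then 0 else ind (Xi a b) P)"
    by (intro sum_nonneg; simp)+
  show "ind (Fi a) P \<le> fiq P" if "a < n"
    using member_le_sum[of a "{..<n}" "\<lambda>a. ind (Fi a) P"] that nn unfolding fiq_def by simp
  show "ind (Xi a b) P \<le> fiq P" if "a < n" "b < n" "\<not> link a b"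
    using double_le[OF that, of "\<lambda>a b. ind (Xi a b) P"] nn unfolding fiq_def by simp
qed

lemma foq_ge:
  "a < n \<Longrightarrow> ind (Fo a) P \<le> foq P"
  "a < n \<Longrightarrow> b < n \<Longrightarrow> \<not> link a b \<Longrightarrow> ind (Xo a b) P \<le> foq P"
proof -
  have nn: "0 \<le> (\<Sum>a<n. ind (Fo a) P)" "0 \<le> (\<Sum>a<n. \<Sum>b<n. if link a b then 0 else ind (Xo a b) P)"
    by (intro sum_nonneg; simp)+
  show "ind (Fo a) P \<le> foq P" if "a < n"
    using member_le_sum[of a "{..<n}" "\<lambda>a. ind (Fo a) P"] that nn unfolding foq_def by simp
  show "ind (Xo a b) P \<le> foq P" if "a < n" "b < n" "\<not> link a b"
    using double_le[OF that, of "\<lambda>a b. ind (Xo a b) P"] nn unfolding foq_def by simp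
qed

lemma aex_01: "P \<in> PP \<Longrightarrow> aex P = 0 \<or> aex P = 1"
  using aex_le[of P] ind_nonneg[of SrcA P] fiq_nonneg[of P] prq_nonneg[of P] diq_nonneg[of P]
    ind_nonneg[of P2 P] aex_nonneg[of P] by (intro Ints_01 aex_int) linarith+

lemma exit_start:
  assumes "P \<in> PP" "aex P \<noteq> 0"
  shows "aex P = 1" "ind SrcA P = 0" "fiq P = 0" "prq P = 0"
  using assms aex_01[OF assms(1)] aex_le[of P] ind_nonneg[of SrcA P] fiq_nonneg[of P]
    prq_nonneg[of P] diq_nonneg[of P] ind_nonneg[of P2 P] by linarith+

text \<open>The only other way into the vertex before \<open>Te h a\<close> is
  \<open>Pr h a\<close>, which starts in \<open>VS\<close> and hence never lies on a coloured
  path.\<close>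

lemma exit_guard:
  assumes "P \<in> PP" "i \<le> n" "a < n"
  shows "exq i P * ind (Gu h a) P = exq i P * ind (Te h a) P"
proof (cases "aex P = 0")
  case True
  then show ?thesis using exq_le_aex[OF assms(2), of P] exq_nonneg[of i P] by simp
next
  case False
  then have "guq P = teq P" using teq_eq[OF assms(1)] exit_start(4)[OF assms(1) False] by simp
  have "ind (Pr h a) P \<le> prq P"
    unfolding prq_def
    by (rule order.trans[OF member_le_sum[of a "{..<n}" "\<lambda>a. ind (Pr h a) P"]
        member_le_sum[of h UNIV "\<lambda>h. \<Sum>a<n. ind (Pr h a) P"]]) (use assms in \<open>auto intro: sum_nonneg\<close>)
  then have "ind (Pr h a) P = 0" using exit_start(4)[OF assms(1) False] ind_nonneg[of "Pr h a" P] by linarith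
  then show ?thesis using P_tau[OF assms(1,3), of h] by simp
qed

lemma teq_le: "P \<in> PP \<Longrightarrow> teq P \<le> 1"
proof -
  assume P: "P \<in> PP"
  have "0 \<le> ind SnkA P + foq P + ind End P + diq P" by (intro add_nonneg_nonneg foq_nonneg diq_nonneg) auto
  then show ?thesis using end_le[OF P] by linarith
qed

lemma guq_le: "P \<in> PP \<Longrightarrow> guq P \<le> 1"
  using teq_le teq_eq[of P] prq_nonneg[of P] by fastforce

end

section \<open>The support of a robust flow: coloured paths, guards and links\<close>

context gadget_robust
begin

lemma av_supp_mono:
  assumes "\<And>P. P \<in> PP \<Longrightarrow> y P \<noteq> 0 \<Longrightarrow> f P \<le> f' P"
  shows "av f \<le> av f'"
  unfolding av_def
proof (rule sum_mono)
  fix P assume P: "P \<in> PP"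
  show "y P * f P \<le> y P * f' P"
    using assms[OF P] y_nonneg[OF P] by (cases "y P = 0") (auto intro: mult_left_mono)
qed

lemma av_supp_0:
  assumes "\<And>P. P \<in> PP \<Longrightarrow> y P \<noteq> 0 \<Longrightarrow> f P = 0"
  shows "av f = 0"
  unfolding av_def using assms by (intro sum.neutral) auto

lemma av_exq_teq: "i \<le> n \<Longrightarrow> av (\<lambda>P. exq i P * teq P) = X i"
  unfolding z_sum[symmetric] z_def teq_def sum_distrib_left by (simp only: av_sum)

lemma av_aex_teq: "av (\<lambda>P. aex P * teq P) = G"
proof -
  have "av (\<lambda>P. aex P * teq P) = (\<Sum>i<Suc n. av (\<lambda>P. exq i P * teq P))"
    unfolding aex_def sum_distrib_right by (rule av_sum)
  also have "\<dots> = (\<Sum>i<Suc n. X i)" by (rule sum.cong) (auto intro!: av_exq_teq simp del: sum.lessThan_Suc)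
  finally show ?thesis using X_total by simp
qed

lemma av_aex: "av aex = G"
  unfolding aex_def[abs_def] av_sum using X_total by (simp add: X_def)

text \<open>The coloured flow and the part of it that reaches guards both total \<open>G\<close>. So
  no coloured path with positive flow drains into the sink through \<open>SnkA\<close> or filler
  arcs.\<close>

lemma supp_exit:
  assumes "P \<in> PP" "y P \<noteq> 0" "aex P \<noteq> 0"
  shows "teq P = 1" "guq P = 1" "ind SnkA P = 0" "foq P = 0"
proof -
  have "aex P - aex P * teq P = 0"
  proof (rule av_zero[OF _ _ assms(1,2)])
    show "av (\<lambda>P. aex P - aex P * teq P) \<le> 0"
      using av_diff[of aex "\<lambda>P. aex P * teq P"] av_aex av_aex_teq by simp
    show "0 \<le> y P * (aex P - aex P * teq P)" if "P \<in> PP" for P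
      using mult_left_le[OF teq_le[OF that] aex_nonneg[of P]] y_nonneg[OF that]
      by (intro mult_nonneg_nonneg) auto
  qed
  then show t: "teq P = 1" using exit_start(1)[OF assms(1,3)] by simp
  then show "guq P = 1" using teq_eq[OF assms(1)] exit_start(4)[OF assms(1,3)] by simp
  show "ind SnkA P = 0" "foq P = 0"
    using end_le[OF assms(1)] t ind_nonneg[of SnkA P] foq_nonneg[of P] ind_nonneg[of End P] diq_nonneg[of P]
    by linarith+
qed

text \<open>Conversely, the guards carry \<open>G\<close> in total, so the coloured flow leaves no
  room in them for other paths.\<close>

lemma supp_no_exit:
  assumes "P \<in> PP" "y P \<noteq> 0" "aex P = 0"
  shows "guq P = 0"
proof -
  have le: "guq P * aex P \<le> guq P" if "P \<in> PP" for P
    using aex_01[OF that] guq_nonneg[of P] by auto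
  have eq: "guq P * aex P = aex P * teq P" if "P \<in> PP" for P
  proof (cases "aex P = 0")
    case False
    then show ?thesis using teq_eq[OF that] exit_start(4)[OF that False] by simp
  qed simp
  have "guq P - guq P * aex P = 0"
  proof (rule av_zero[OF _ _ assms(1,2)])
    have "av (\<lambda>P. guq P * aex P) = G" using av_cong[OF eq] av_aex_teq by simp
    moreover have "av guq = G" unfolding guq_def[abs_def] av_sum ..
    ultimately show "av (\<lambda>P. guq P - guq P * aex P) \<le> 0" by (simp add: av_diff)
    show "0 \<le> y P * (guq P - guq P * aex P)" if "P \<in> PP" for P
      using le[OF that] y_nonneg[OF that] by (intro mult_nonneg_nonneg) auto
  qed
  then show ?thesis using assms(3) by simp
qed

text \<open>Only the colours below \<open>n\<close> are counted, since their exits and their share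
  of each guard are known exactly; this is what the balance of \<open>pos\<close> needs.\<close>

definition w :: "ar \<Rightarrow> rat" where "w e = av (\<lambda>P. rc P * ind e P)"

lemma rc_le_aex: "rc P \<le> aex P"
  using exq_nonneg[of n P] by (simp add: aex_rc)

lemma rc_01: "P \<in> PP \<Longrightarrow> rc P = 0 \<or> rc P = 1"
  using rc_le_aex[of P] aex_01[of P] by (intro Ints_01 rc_int rc_nonneg) linarith

lemma rc_exit: "rc P \<noteq> 0 \<Longrightarrow> aex P \<noteq> 0"
  using rc_le_aex[of P] rc_nonneg[of P] by linarith

lemma exq_le_rc: "i < n \<Longrightarrow> exq i P \<le> rc P"
  unfolding rc_def by (rule member_le_sum) (auto intro: exq_nonneg)

lemma w_nonneg [simp]: "0 \<le> w e"
  unfolding w_def by (intro av_nonneg mult_nonneg_nonneg rc_nonneg) simp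

lemma w_le_c: "w e \<le> c e"
  unfolding w_def
proof (rule av_mono)
  show "rc P * ind e P \<le> ind e P" if "P \<in> PP" for P
    using rc_01[OF that] by auto
qed

text \<open>Coloured paths begin at the chain and, where they carry flow, finish behind a guard. So
  they use neither filler nor the terminal arcs of the given flow.\<close>

lemma w_zero:
  "w SrcA = 0" "a < n \<Longrightarrow> w (Fi a) = 0" "a < n \<Longrightarrow> b < n \<Longrightarrow> \<not> link a b \<Longrightarrow> w (Xi a b) = 0"
  "w SnkA = 0" "a < n \<Longrightarrow> w (Fo a) = 0" "a < n \<Longrightarrow> b < n \<Longrightarrow> \<not> link a b \<Longrightarrow> w (Xo a b) = 0"
proof -
  have *: "w e = 0" if "\<And>P. P \<in> PP \<Longrightarrow> y P \<noteq> 0 \<Longrightarrow> aex P \<noteq> 0 \<Longrightarrow> ind e P \<le> 0" for e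
    unfolding w_def
  proof (rule av_supp_0)
    fix P assume P: "P \<in> PP" "y P \<noteq> 0"
    show "rc P * ind e P = 0"
    proof (cases "rc P = 0")
      case False
      then have "ind e P \<le> 0" by (intro that P rc_exit)
      then have "ind e P = 0" by (intro antisym) simp_all
      then show ?thesis by simp
    qed simp
  qed
  show "w SrcA = 0" by (rule *) (simp add: exit_start)
  show "w (Fi a) = 0" if "a < n" using fiq_ge(1)[OF that] exit_start(3) by (intro *) metis
  show "w (Xi a b) = 0" if "a < n" "b < n" "\<not> link a b"
    using fiq_ge(2)[OF that] exit_start(3) by (intro *) metis
  show "w SnkA = 0" by (rule *) (simp add: supp_exit)
  show "w (Fo a) = 0" if "a < n" using foq_ge(1)[OF that] supp_exit(4) by (intro *) metis
  show "w (Xo a b) = 0" if "a < n" "b < n" "\<not> link a b"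
    using foq_ge(2)[OF that] supp_exit(4) by (intro *) metis
qed

lemma w_Gu: "a < n \<Longrightarrow> w (Gu h a) = of_nat n"
proof -
  assume a: "a < n"
  have "w (Gu h a) = av (\<lambda>P. \<Sum>i<n. exq i P * ind (Te h a) P)"
    unfolding w_def rc_def sum_distrib_right
    by (intro av_cong sum.cong refl exit_guard a) auto
  also have "\<dots> = (\<Sum>i<n. z i h a)" unfolding z_def by (rule av_sum)
  also have "\<dots> = of_nat n" using a by (simp add: z_eq)
  finally show ?thesis .
qed

lemma w_Ex: "i < n \<Longrightarrow> b < n \<Longrightarrow> w (Ex h i b) = 1" "b < n \<Longrightarrow> w (Ex h n b) = 0"
proof -
  show "w (Ex h i b) = 1" if "i < n" "b < n"
  proof -
    have "w (Ex h i b) = c (Ex h i b)" unfolding w_def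
    proof (rule av_cong)
      fix P assume P: "P \<in> PP"
      show "rc P * ind (Ex h i b) P = ind (Ex h i b) P"
        using Ex_le[OF that(2), of h i P] exq_le_rc[OF that(1), of P] rc_01[OF P] ind_01[of "Ex h i b" P] by auto
    qed
    then show ?thesis using c_Ex[OF that] by simp
  qed
  show "w (Ex h n b) = 0" if "b < n"
    unfolding w_def
  proof (rule av_supp_0)
    fix P assume P: "P \<in> PP"
    show "rc P * ind (Ex h n b) P = 0"
      using Ex_le[OF that, of h n P] aex_rc[of P] aex_01[OF P] rc_01[OF P] ind_01[of "Ex h n b" P] by auto
  qed
qed

text \<open>
  Links descend and arcs of the given network ascend in \<open>pos\<close>, so balancing \<open>pos\<close> over the paths of
  real colours leaves no room for arcs of the given network.
\<close>

lemma potential: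
  "(\<Sum>a<n. \<Sum>b<n. if link a b then (1 - w (Li a b)) * (of_nat (pos a) - of_nat (pos b)) else 0) +
    (\<Sum>a<n. w (Din a) * (of_nat (pos a) - of_nat (\<rho> (ta a) * n))) +
    (\<Sum>a<n. w (Dout a) * (of_nat (\<rho> (he a) * n) - of_nat (pos a))) = 0"
proof -
  let ?\<phi> = "\<lambda>v. (case v of In a \<Rightarrow> of_nat (pos a) | Out a \<Rightarrow> of_nat (pos a) | V v \<Rightarrow> of_nat (\<rho> v * n) | _ \<Rightarrow> 0) :: rat"
  have "(\<Sum>e\<in>set arlist. w e * (?\<phi> (trg e) - ?\<phi> (src e))) =
      av (\<lambda>P. \<Sum>e\<in>set arlist. (?\<phi> (trg e) - ?\<phi> (src e)) * (rc P * ind e P))"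
    unfolding w_def av_sum av_cmult by (simp add: mult.commute)
  also have "\<dots> = av (\<lambda>P. rc P * (\<Sum>e\<in>set arlist. ind e P * (?\<phi> (trg e) - ?\<phi> (src e))))"
    unfolding sum_distrib_left by (intro av_cong sum.cong) auto
  also have "\<dots> = 0"
  proof (rule av_supp_0)
    fix P assume "P \<in> PP"
    from tele[OF this, of ?\<phi>] show "rc P * (\<Sum>e\<in>set arlist. ind e P * (?\<phi> (trg e) - ?\<phi> (src e))) = 0"
      by simp
  qed
  finally have bal: "(\<Sum>e\<in>set arlist. w e * (?\<phi> (trg e) - ?\<phi> (src e))) = 0" .
  let ?p = "\<lambda>a. of_nat (pos a) :: rat"
  have ex: "(\<Sum>h\<in>UNIV. \<Sum>i<Suc n. \<Sum>b<n. w (Ex h i b) * ?\<phi> (In (if h \<and> link i b then i else b))) =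
     (\<Sum>h\<in>UNIV. \<Sum>i<n. \<Sum>b<n. ?p (if h \<and> link i b then i else b))"
    by (simp add: w_Ex)
  \<comment> \<open>A redirected exit \<open>Ex True i b\<close> enters at \<open>i\<close> instead
    of \<open>b\<close>. It gains \<open>pos i - pos b\<close>, precisely the drop of the link from
    \<open>i\<close> to \<open>b\<close>.\<close>
  have ex2: "(\<Sum>h\<in>UNIV. \<Sum>i<n. \<Sum>b<n. ?p (if h \<and> link i b then i else b)) =
     2 * of_nat n * (\<Sum>b<n. ?p b) + (\<Sum>i<n. \<Sum>b<n. if link i b then ?p i - ?p b else 0)"
  proof -
    have "(\<Sum>i<n. \<Sum>b<n. ?p (if link i b then i else b)) =
      (\<Sum>i<n. \<Sum>b<n. ?p b) + (\<Sum>i<n. \<Sum>b<n. if link i b then ?p i - ?p b else 0)"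
      unfolding sum.distrib[symmetric] by (intro sum.cong) auto
    then show ?thesis by (simp add: UNIV_bool)
  qed
  have gu: "(\<Sum>h\<in>UNIV. \<Sum>a<n. w (Gu h a) * ?p a) = 2 * of_nat n * (\<Sum>b<n. ?p b)"
    by (simp add: w_Gu UNIV_bool sum_distrib_left mult.assoc)
  have li: "(\<Sum>a<n. \<Sum>b<n. if link a b then w (Li a b) * (?p b - ?p a) else 0) +
     (\<Sum>i<n. \<Sum>b<n. if link i b then ?p i - ?p b else 0) =
     (\<Sum>a<n. \<Sum>b<n. if link a b then (1 - w (Li a b)) * (?p a - ?p b) else 0)"
    unfolding sum.distrib[symmetric] by (intro sum.cong) (auto simp: algebra_simps)
  show ?thesis
    using bal ex ex2 gu li unfolding sumAR
    by (simp add: w_zero sum_negf if_simps del: sum.lessThan_Suc cong: if_cong)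
qed

text \<open>All three sums in \<open>potential\<close> are nonnegative and therefore vanish. A link
  drops strictly and must be saturated; \<open>Dout a\<close> climbs strictly because
  \<open>pos a\<close> stays below \<open>n\<close> times the rank of the head, so it stays empty.
  \<open>Din a\<close> climbs only by the index \<open>a\<close>, which is 0 for the first arc;
  hence the conclusion is about \<open>Dout\<close>.\<close>

lemma w_Li_Dout:
  shows "link a b \<Longrightarrow> w (Li a b) = 1" "a < n \<Longrightarrow> w (Dout a) = 0"
proof -
  let ?p = "\<lambda>a. of_nat (pos a) :: rat"
  have li: "0 \<le> (if link a b then (1 - w (Li a b)) * (?p a - ?p b) else 0)" for a b
  proof (cases "link a b")
    case True
    then have "w (Li a b) \<le> 1" using w_le_c[of "Li a b"] c_cap[of "Li a b"] by (simp add: cap_def)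
    moreover have "?p b < ?p a" using True by (simp add: link_def)
    ultimately show ?thesis by simp
  qed simp
  have di: "0 \<le> w (Din a) * (?p a - of_nat (\<rho> (ta a) * n))" for a
    by (intro mult_nonneg_nonneg) (auto simp: pos_def)
  have dpos: "?p a < of_nat (\<rho> (he a) * n)" if "a < n" for a
  proof -
    have "Suc (\<rho> (ta a)) * n \<le> \<rho> (he a) * n" using rank[OF that] by (intro mult_right_mono) auto
    then have "pos a < \<rho> (he a) * n" using that by (simp add: pos_def)
    then show ?thesis by (simp only: of_nat_less_iff)
  qed
  have dn: "0 \<le> w (Dout a) * (of_nat (\<rho> (he a) * n) - ?p a)" if "a < n" for a
    using dpos[OF that] by (intro mult_nonneg_nonneg) (simp, linarith)
  have s1: "0 \<le> (\<Sum>a<n. \<Sum>b<n. if link a b then (1 - w (Li a b)) * (?p a - ?p b) else 0)"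
    by (intro sum_nonneg li)
  have s2: "0 \<le> (\<Sum>a<n. w (Din a) * (?p a - of_nat (\<rho> (ta a) * n)))" by (intro sum_nonneg di)
  have s3: "0 \<le> (\<Sum>a<n. w (Dout a) * (of_nat (\<rho> (he a) * n) - ?p a))" by (intro sum_nonneg dn) simp
  have z1: "(\<Sum>a<n. \<Sum>b<n. if link a b then (1 - w (Li a b)) * (?p a - ?p b) else 0) = 0"
    and z3: "(\<Sum>a<n. w (Dout a) * (of_nat (\<rho> (he a) * n) - ?p a)) = 0"
    using potential s1 s2 s3 by linarith+
  show "w (Dout a) = 0" if "a < n"
  proof -
    have nn: "0 \<le> w (Dout a) * (of_nat (\<rho> (he a) * n) - ?p a)" if "a \<in> {..<n}" for a
      using that by (intro dn) simp
    have "\<forall>a\<in>{..<n}. w (Dout a) * (of_nat (\<rho> (he a) * n) - ?p a) = 0"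
      by (rule iffD1[OF sum_nonneg_eq_0_iff[OF finite_lessThan nn] z3])
    from bspec[OF this, of a] dpos[OF that] that show ?thesis by auto
  qed
  show "w (Li a b) = 1" if l: "link a b"
  proof -
    have ab: "a < n" "b < n" "?p b < ?p a" using l by (auto simp: link_def)
    have "\<forall>a\<in>{..<n}. (\<Sum>b<n. if link a b then (1 - w (Li a b)) * (?p a - ?p b) else 0) = 0"
      by (rule iffD1[OF sum_nonneg_eq_0_iff[OF finite_lessThan] z1]) (intro sum_nonneg li)
    from bspec[OF this, of a] ab have zb: "(\<Sum>b<n. if link a b then (1 - w (Li a b)) * (?p a - ?p b) else 0) = 0"
      by simp
    have "\<forall>b\<in>{..<n}. (if link a b then (1 - w (Li a b)) * (?p a - ?p b) else 0) = 0"
      by (rule iffD1[OF sum_nonneg_eq_0_iff[OF finite_lessThan] zb]) (rule li)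
    from bspec[OF this, of b] ab l show ?thesis by simp
  qed
qed

lemma c_Li: "link a b \<Longrightarrow> c (Li a b) = 1"
  using w_Li_Dout(1)[of a b] w_le_c[of "Li a b"] c_cap[of "Li a b"] by (simp add: cap_def)

text \<open>The colours below \<open>n\<close> already fill every link to its capacity.\<close>

lemma supp_link_rc:
  assumes "P \<in> PP" "y P \<noteq> 0" "link a b" "Li a b \<in> P"
  shows "rc P = 1"
proof -
  have "ind (Li a b) P - rc P * ind (Li a b) P = 0"
  proof (rule av_zero[OF _ _ assms(1,2)])
    show "av (\<lambda>P. ind (Li a b) P - rc P * ind (Li a b) P) \<le> 0"
      using w_Li_Dout(1)[OF assms(3)] c_Li[OF assms(3)] by (simp add: av_diff w_def)
    show "0 \<le> y P * (ind (Li a b) P - rc P * ind (Li a b) P)" if "P \<in> PP" for P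
      using rc_01[OF that] y_nonneg[OF that] by auto
  qed
  then show ?thesis using assms(4) by (simp add: ind_def)
qed

lemma supp_rc_Dout:
  assumes "P \<in> PP" "y P \<noteq> 0" "a < n" "rc P \<noteq> 0"
  shows "ind (Dout a) P = 0"
proof -
  have "rc P * ind (Dout a) P = 0"
  proof (rule av_zero[OF _ _ assms(1,2)])
    show "av (\<lambda>P. rc P * ind (Dout a) P) \<le> 0" using w_Li_Dout(2)[OF assms(3)] by (simp add: w_def)
    show "0 \<le> y P * (rc P * ind (Dout a) P)" if "P \<in> PP" for P
      by (intro mult_nonneg_nonneg rc_nonneg y_nonneg that) simp
  qed
  then show ?thesis using assms(4) by simp
qed

text \<open>The exits of colour \<open>i\<close> that lead to arc \<open>i\<close> itself: a direct
  one for each \<open>h\<close>, and one redirected exit for every link out of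
  \<open>i\<close>.\<close>

definition exs :: "nat \<Rightarrow> ar set \<Rightarrow> rat" where
  "exs i P = (\<Sum>h\<in>UNIV. \<Sum>b<n. if (if h \<and> link i b then i else b) = i then ind (Ex h i b) P else 0)"

definition liq :: "nat \<Rightarrow> ar set \<Rightarrow> rat" where
  "liq i P = (\<Sum>b<n. if link i b then ind (Li i b) P else 0)"

lemma exs_nonneg: "0 \<le> exs i P" unfolding exs_def by (intro sum_nonneg) auto
lemma exs_int: "exs i P \<in> \<int>" unfolding exs_def by (intro Ints_sum) auto
lemma liq_nonneg: "0 \<le> liq i P" unfolding liq_def by (intro sum_nonneg) auto

lemma exs_le: "exs i P \<le> exq i P"
  unfolding exs_def exq_def by (intro sum_mono) auto

lemma exs_01: "i < n \<Longrightarrow> P \<in> PP \<Longrightarrow> exs i P = 0 \<or> exs i P = 1"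
  using exs_le[of i P] exq_le_rc[of i P] rc_01[of P] by (intro Ints_01 exs_int exs_nonneg) linarith

lemma link_irrefl: "\<not> link a a"
  by (simp add: link_def)

lemma exs_Mid:
  assumes "P \<in> PP" "i < n"
  shows "exs i P \<le> ind (Mid i) P"
proof -
  let ?f = "\<lambda>j. \<Sum>h\<in>UNIV. \<Sum>b<n. if (if h \<and> link j b then j else b) = i then ind (Ex h j b) P else 0"
  have "exs i P \<le> (\<Sum>j<Suc n. ?f j)"
    unfolding exs_def using assms(2)
    by (intro member_le_sum[of i "{..<Suc n}" ?f]) (auto intro!: sum_nonneg)
  also have "\<dots> = (\<Sum>h\<in>UNIV. \<Sum>j<Suc n. \<Sum>b<n. if (if h \<and> link j b then j else b) = i then ind (Ex h j b) P else 0)"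
    by (rule sum.swap)
  finally have 1: "exs i P \<le> \<dots>" .
  have 2: "0 \<le> (\<Sum>b<n. if link i b then 0 else ind (Xi i b) P)" "0 \<le> (\<Sum>b<n. if link b i then ind (Li b i) P else 0)"
    by (intro sum_nonneg; simp)+
  show ?thesis
    using P_in[OF assms] 1 2 ind_nonneg[of "Din i" P] ind_nonneg[of "Fi i" P] by linarith
qed

text \<open>Filler ends are excluded by \<open>supp_exit\<close> and \<open>Dout\<close> by the
  potential argument, so only guards and links remain behind \<open>Mid i\<close>.\<close>

lemma Mid_out:
  assumes "P \<in> PP" "y P \<noteq> 0" "i < n" "rc P \<noteq> 0"
  shows "ind (Mid i) P = (\<Sum>h\<in>UNIV. ind (Gu h i) P) + liq i P"
proof -
  note fo = supp_exit(4)[OF assms(1,2) rc_exit[OF assms(4)]]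
  have "ind (Fo i) P = 0" using foq_ge(1)[OF assms(3), of P] fo by (intro antisym) simp_all
  moreover have "(if link i b then 0 else ind (Xo i b) P) = 0" if "b < n" for b
    using foq_ge(2)[OF assms(3) that, of P] fo ind_nonneg[of "Xo i b" P] by auto
  then have "(\<Sum>b<n. if link i b then 0 else ind (Xo i b) P) = 0" by (intro sum.neutral) auto
  ultimately show ?thesis
    using P_out[OF assms(1,3)] supp_rc_Dout[OF assms] unfolding liq_def by simp
qed

lemma av_exs: "i < n \<Longrightarrow> av (exs i) = 2 + deg i"
proof -
  assume i: "i < n"
  have "av (exs i) = (\<Sum>h\<in>UNIV. \<Sum>b<n. if (if h \<and> link i b then i else b) = i then c (Ex h i b) else 0)"
    unfolding exs_def[abs_def] av_sum av_if0 ..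
  also have "\<dots> = (\<Sum>b<n. if b = i then 1 else 0) + (\<Sum>b<n. if b = i \<or> link i b then 1 else 0)"
    using i by (auto simp: UNIV_bool c_Ex intro!: arg_cong2[where f = "(+)"] sum.cong)
  also have "(\<Sum>b<n. if b = i \<or> link i b then 1 else 0) = (\<Sum>b<n. if b = i then 1 else 0) + deg i"
    unfolding deg_def sum.distrib[symmetric] using link_irrefl by (intro sum.cong) auto
  finally show ?thesis using i by simp
qed

lemma av_rc_liq: "av (\<lambda>P. rc P * liq i P) = deg i"
proof -
  have "av (\<lambda>P. rc P * liq i P) = (\<Sum>b<n. if link i b then w (Li i b) else 0)"
    unfolding liq_def sum_distrib_left av_sum w_def by (intro sum.cong) auto
  also have "\<dots> = deg i" unfolding deg_def by (intro sum.cong) (auto simp: w_Li_Dout(1))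
  finally show ?thesis .
qed

text \<open>
  Of the \<open>2 + deg i\<close> units of colour \<open>i\<close> that enter at arc \<open>i\<close> only two may leave through its guards,
  so they fill all links out of \<open>i\<close>.
\<close>

lemma supp_link_exs:
  assumes "P \<in> PP" "y P \<noteq> 0" "link i b" "Li i b \<in> P"
  shows "exs i P = 1"
proof -
  have i: "i < n" and b: "b < n" using link_less[OF assms(3)] by auto
  have rcle: "exs i P * liq i P \<le> rc P * liq i P" if "P \<in> PP" for P
    using exs_le[of i P] exq_le_rc[OF i, of P] liq_nonneg[of i P] by (intro mult_right_mono) auto
  have "av (exs i) \<le> av (\<lambda>P. (\<Sum>h\<in>UNIV. exq i P * ind (Te h i) P) + exs i P * liq i P)"
  proof (rule av_supp_mono)
    fix P assume P: "P \<in> PP" "y P \<noteq> 0"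
    show "exs i P \<le> (\<Sum>h\<in>UNIV. exq i P * ind (Te h i) P) + exs i P * liq i P"
    proof (cases "exs i P = 0")
      case True
      then show ?thesis by (auto intro!: add_nonneg_nonneg sum_nonneg mult_nonneg_nonneg exq_nonneg)
    next
      case False
      then have e1: "exs i P = 1" using exs_01[OF i P(1)] by simp
      then have rc: "rc P \<noteq> 0" using exs_le[of i P] exq_le_rc[OF i, of P] by auto
      have q1: "exq i P = 1"
        using exs_le[of i P] exq_le_rc[OF i, of P] rc_01[OF P(1)] e1 by auto
      have "1 \<le> (\<Sum>h\<in>UNIV. ind (Gu h i) P) + liq i P"
        using exs_Mid[OF P(1) i] Mid_out[OF P i rc] e1 by simp
      moreover have "ind (Gu h i) P = exq i P * ind (Te h i) P" for h
        using exit_guard[OF P(1) _ i, of i h] i q1 by simp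
      ultimately show ?thesis using e1 by simp
    qed
  qed
  also have "\<dots> = (\<Sum>h\<in>UNIV. z i h i) + av (\<lambda>P. exs i P * liq i P)"
    unfolding av_add av_sum z_def ..
  also have "(\<Sum>h\<in>UNIV. z i h i) = 2" using z_eq[OF i i] by (simp add: UNIV_bool)
  finally have "deg i \<le> av (\<lambda>P. exs i P * liq i P)" using av_exs[OF i] by simp
  then have le0: "av (\<lambda>P. rc P * liq i P - exs i P * liq i P) \<le> 0"
    by (simp add: av_diff av_rc_liq)
  have "rc P * liq i P - exs i P * liq i P = 0"
    by (rule av_zero[OF le0 _ assms(1,2)]) (intro mult_nonneg_nonneg y_nonneg, auto intro: rcle)
  moreover have "rc P = 1" by (rule supp_link_rc[OF assms])
  moreover have "1 \<le> liq i P"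
    unfolding liq_def using member_le_sum[of b "{..<n}" "\<lambda>b. if link i b then ind (Li i b) P else 0"] b assms(3,4)
    by (simp add: ind_def)
  ultimately show ?thesis by (simp add: left_diff_distrib[symmetric])
qed

section \<open>Cliques and the paths that meet them\<close>

definition hit :: "nat set \<Rightarrow> ar set \<Rightarrow> rat" where
  "hit S P = of_bool (P \<inter> Mid ` S \<noteq> {})"

lemma Mid_hit: "a \<in> S \<Longrightarrow> ind (Mid a) P \<le> hit S P"
  by (auto simp: hit_def ind_def)

lemma Gu_unique:
  assumes "P \<in> PP" "a < n" "a' < n" "Gu h a \<in> P" "Gu h' a' \<in> P"
  shows "a = a'"
proof (rule ccontr)
  assume ne: "a \<noteq> a'"
  have "guq P = (\<Sum>p\<in>UNIV \<times> {..<n}. ind (Gu (fst p) (snd p)) P)"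
    unfolding guq_def by (simp add: sum.cartesian_product case_prod_unfold)
  also have "\<dots> \<ge> (\<Sum>p\<in>{(h, a), (h', a')}. ind (Gu (fst p) (snd p)) P)"
    using assms by (intro sum_mono2) auto
  also have "(\<Sum>p\<in>{(h, a), (h', a')}. ind (Gu (fst p) (snd p)) P) = 2"
    using ne assms by (simp add: ind_def)
  finally show False using guq_le[OF assms(1)] by simp
qed

lemma exs_unique:
  assumes "P \<in> PP" "a < n" "a' < n" "exs a P = 1" "exs a' P = 1"
  shows "a = a'"
proof (rule ccontr)
  assume ne: "a \<noteq> a'"
  have "(\<Sum>i\<in>{a, a'}. exq i P) \<le> rc P"
    unfolding rc_def using assms(2,3) by (intro sum_mono2) (auto intro: exq_nonneg)
  then have "exq a P + exq a' P \<le> rc P" using ne by simp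
  moreover have "1 \<le> exq a P" "1 \<le> exq a' P" using exs_le[of a P] exs_le[of a' P] assms(4,5) by auto
  ultimately show False using rc_01[OF assms(1)] by auto
qed

lemma Mid_cases:
  assumes "P \<in> PP" "y P \<noteq> 0" "i < n" "rc P \<noteq> 0" "Mid i \<in> P"
  obtains (guard) h where "Gu h i \<in> P" | (link) b where "link i b" "Li i b \<in> P"
proof -
  have "(\<Sum>h\<in>UNIV. ind (Gu h i) P) + liq i P = 1"
    using Mid_out[OF assms(1-4)] assms(5) by (simp add: ind_def)
  then have "(\<Sum>h\<in>UNIV. ind (Gu h i) P) \<noteq> 0 \<or> liq i P \<noteq> 0" by linarith
  then show thesis
  proof
    assume "(\<Sum>h\<in>UNIV. ind (Gu h i) P) \<noteq> 0"
    then obtain h where "ind (Gu h i) P \<noteq> 0" by (auto elim: sum.not_neutral_contains_not_neutral)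
    then show thesis using that(1) by (simp add: ind_def)
  next
    assume "liq i P \<noteq> 0"
    then obtain b where "(if link i b then ind (Li i b) P else 0) \<noteq> 0"
      unfolding liq_def by (auto elim: sum.not_neutral_contains_not_neutral)
    then show thesis using that(2)[of b] by (auto simp: ind_def split: if_splits)
  qed
qed

lemma Li_Mid:
  assumes "P \<in> PP" "link a b" "Li a b \<in> P"
  shows "Mid b \<in> P"
proof -
  have b: "b < n" using link_less[OF assms(2)] by simp
  have nn: "0 \<le> (\<Sum>h\<in>UNIV. \<Sum>i<Suc n. \<Sum>c<n. if (if h \<and> link i c then i else c) = b then ind (Ex h i c) P else 0)"
    "0 \<le> (\<Sum>c<n. if link b c then 0 else ind (Xi b c) P)"
    by (intro sum_nonneg; simp)+
  have "1 \<le> (\<Sum>c<n. if link c b then ind (Li c b) P else 0)"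
    using member_le_sum[of a "{..<n}" "\<lambda>c. if link c b then ind (Li c b) P else 0"] assms link_less[OF assms(2)]
    by (simp add: ind_def)
  then have "1 \<le> ind (Mid b) P"
    using P_in[OF assms(1) b] nn ind_nonneg[of "Din b" P] ind_nonneg[of "Fi b" P] by linarith
  then show ?thesis by (cases "Mid b \<in> P") (simp_all add: ind_def)
qed

lemma Gu_Mid:
  assumes "P \<in> PP" "a < n"
  shows "(\<Sum>h\<in>UNIV. ind (Gu h a) P) \<le> ind (Mid a) P"
proof -
  have nn: "0 \<le> (\<Sum>b<n. if link a b then 0 else ind (Xo a b) P)" "0 \<le> (\<Sum>b<n. if link a b then ind (Li a b) P else 0)"
    by (intro sum_nonneg; simp)+
  show ?thesis using P_out[OF assms] nn ind_nonneg[of "Dout a" P] ind_nonneg[of "Fo a" P] by linarith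
qed

text \<open>A path on the link from \<open>a\<close> to \<open>b\<close> has colour
  \<open>a\<close>. A second link out of \<open>b\<close> would require colour \<open>b\<close>, so
  the path leaves \<open>b\<close> through a guard, and it has only one.\<close>

lemma link_guard_eq:
  assumes P: "P \<in> PP" "y P \<noteq> 0" and l: "link a b" "Li a b \<in> P" and g: "Gu h a' \<in> P" "a' < n"
  shows "b = a'"
proof -
  have ab: "a < n" "b < n" using link_less[OF l(1)] by auto
  have rc: "rc P \<noteq> 0" using supp_link_rc[OF P l] by simp
  show ?thesis
  proof (rule Mid_cases[OF P ab(2) rc Li_Mid[OF P(1) l]], goal_cases)
    case (1 h')
    then show ?thesis using Gu_unique[OF P(1) ab(2) g(2) _ g(1)] by simp
  next
    case (2 b')
    then have "a = b"
      using exs_unique[OF P(1) ab supp_link_exs[OF P l] supp_link_exs[OF P 2]] by simp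
    then show ?thesis using l(1) link_irrefl by simp
  qed
qed

text \<open>A path of these colours leaves an arc \<open>Mid a\<close> by its only guard or by a
  link that determines its colour \<open>a\<close>. Two distinct arcs on one path are therefore
  joined by a link, which a clique excludes.\<close>

lemma clique_Mid_unique:
  assumes P: "P \<in> PP" "y P \<noteq> 0" "rc P \<noteq> 0" and S: "S \<subseteq> {..<n}" "\<And>a b. a \<in> S \<Longrightarrow> b \<in> S \<Longrightarrow> \<not> link a b"
    and a: "a \<in> S" "Mid a \<in> P" and a': "a' \<in> S" "Mid a' \<in> P"
  shows "a = a'"
proof -
  have an: "a < n" "a' < n" using S(1) a(1) a'(1) by auto
  show ?thesis
  proof (rule Mid_cases[OF P(1,2) an(1) P(3) a(2)], goal_cases)
    case (1 h)
    note g = this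
    show ?thesis
    proof (rule Mid_cases[OF P(1,2) an(2) P(3) a'(2)], goal_cases)
      case (1 h')
      then show ?thesis using Gu_unique[OF P(1) an] g by simp
    next
      case (2 b)
      then show ?thesis using link_guard_eq[OF P(1,2) 2 g an(1)] S(2)[OF a'(1) a(1)] by simp
    qed
  next
    case (2 b)
    note l = this
    show ?thesis
    proof (rule Mid_cases[OF P(1,2) an(2) P(3) a'(2)], goal_cases)
      case (1 h')
      then show ?thesis using link_guard_eq[OF P(1,2) l 1 an(2)] S(2)[OF a(1) a'(1)] l(1) by simp
    next
      case (2 b')
      show ?thesis
        by (rule exs_unique[OF P(1) an supp_link_exs[OF P(1,2) l] supp_link_exs[OF P(1,2) 2]])
    qed
  qed
qed

lemma sum_unique_le:
  fixes f :: "nat \<Rightarrow> rat"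
  assumes "finite S" "\<And>a b. a \<in> S \<Longrightarrow> b \<in> S \<Longrightarrow> f a \<noteq> 0 \<Longrightarrow> f b \<noteq> 0 \<Longrightarrow> a = b"
    "\<And>a. a \<in> S \<Longrightarrow> f a \<le> B" "0 \<le> B"
  shows "sum f S \<le> B"
proof (cases "\<exists>a\<in>S. f a \<noteq> 0")
  case True
  then obtain a where a: "a \<in> S" "f a \<noteq> 0" by blast
  have "sum f S = sum f {a}"
    using assms(1,2) a by (intro sum.mono_neutral_right) auto
  then show ?thesis using assms(3)[OF a(1)] by simp
next
  case False
  then have "sum f S = 0" by (intro sum.neutral) auto
  then show ?thesis using assms(4) by simp
qed

text \<open>Failing the clique destroys at most what failing \<open>Sstar\<close> destroys. From
  this amount the coloured flow through the clique is subtracted, which can be counted arc by arc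
  without repetition; the contribution \<open>X n\<close> of the undetermined colour cancels. What
  remains is the filler of \<open>S\<close> plus \<open>k - 1\<close>.\<close>

lemma clique_bound:
  assumes S: "S \<subseteq> {..<n}" "card S = k" "\<And>a b. a \<in> S \<Longrightarrow> b \<in> S \<Longrightarrow> \<not> link a b"
  shows "av (\<lambda>P. (1 - aex P) * hit S P) \<le> (\<Sum>a\<in>S. of_nat U + of_nat n - deg a) + of_nat k - 1"
proof -
  have finS: "finite S" using S(1) finite_subset by blast
  have kn: "k \<le> n" using card_mono[OF _ S(1)] S(2) by simp
  \<comment> \<open>Each \<open>Mid a\<close> passes the \<open>2 n\<close> guard units of
    \<open>a\<close> and \<open>deg a\<close> link units, and by \<open>clique_Mid_unique\<close> no
    path is counted for two arcs of \<open>S\<close>.\<close>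
  have 1: "(\<Sum>a\<in>S. 2 * of_nat n + deg a) \<le> av (\<lambda>P. rc P * hit S P)"
  proof -
    have "av (\<lambda>P. rc P * ind (Mid a) P) = 2 * of_nat n + deg a" if "a \<in> S" for a
    proof -
      have a: "a < n" using that S(1) by auto
      have le: "av (\<lambda>P. rc P * ind (Mid a) P) \<le> av (\<lambda>P. (\<Sum>h\<in>UNIV. rc P * ind (Gu h a) P) + rc P * liq a P)"
        "av (\<lambda>P. (\<Sum>h\<in>UNIV. rc P * ind (Gu h a) P) + rc P * liq a P) \<le> av (\<lambda>P. rc P * ind (Mid a) P)"
      proof -
        have "rc P * ind (Mid a) P = (\<Sum>h\<in>UNIV. rc P * ind (Gu h a) P) + rc P * liq a P"
          if "P \<in> PP" "y P \<noteq> 0" for P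
          using Mid_out[OF that a] by (cases "rc P = 0") (simp_all add: sum_distrib_left[symmetric] algebra_simps)
        then show "av (\<lambda>P. rc P * ind (Mid a) P) \<le> av (\<lambda>P. (\<Sum>h\<in>UNIV. rc P * ind (Gu h a) P) + rc P * liq a P)"
          "av (\<lambda>P. (\<Sum>h\<in>UNIV. rc P * ind (Gu h a) P) + rc P * liq a P) \<le> av (\<lambda>P. rc P * ind (Mid a) P)"
          by (intro av_supp_mono; simp)+
      qed
      have "av (\<lambda>P. (\<Sum>h\<in>UNIV. rc P * ind (Gu h a) P) + rc P * liq a P) = (\<Sum>h\<in>UNIV. w (Gu h a)) + deg a"
        unfolding av_add av_sum av_rc_liq w_def ..
      also have "\<dots> = 2 * of_nat n + deg a" using a by (simp add: w_Gu UNIV_bool)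
      finally show ?thesis using le by simp
    qed
    then have "(\<Sum>a\<in>S. 2 * of_nat n + deg a) = av (\<lambda>P. \<Sum>a\<in>S. rc P * ind (Mid a) P)"
      unfolding av_sum by (intro sum.cong) auto
    also have "\<dots> \<le> av (\<lambda>P. rc P * hit S P)"
    proof (rule av_supp_mono)
      fix P assume P: "P \<in> PP" "y P \<noteq> 0"
      show "(\<Sum>a\<in>S. rc P * ind (Mid a) P) \<le> rc P * hit S P"
      proof (cases "rc P = 0")
        case False
        have "(\<Sum>a\<in>S. ind (Mid a) P) \<le> hit S P"
        proof (rule sum_unique_le[OF finS])
          show "a = b" if "a \<in> S" "b \<in> S" "ind (Mid a) P \<noteq> 0" "ind (Mid b) P \<noteq> 0" for a b
            using clique_Mid_unique[OF P False S(1,3), of a b] that by (simp add: ind_def)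
        next
          show "ind (Mid a) P \<le> hit S P" if "a \<in> S" for a by (rule Mid_hit[OF that])
        qed (simp add: hit_def)
        then show ?thesis unfolding sum_distrib_left[symmetric] by (intro mult_left_mono rc_nonneg)
      qed simp
    qed
    finally show ?thesis .
  qed
  have 2: "(\<Sum>a\<in>S. \<Sum>h\<in>UNIV. g h a - of_nat n) \<le> av (\<lambda>P. exq n P * hit S P)"
  proof -
    have "(\<Sum>a\<in>S. \<Sum>h\<in>UNIV. g h a - of_nat n) = (\<Sum>a\<in>S. \<Sum>h\<in>UNIV. z n h a)"
      using S(1) by (intro sum.cong refl) (auto simp: z_n)
    also have "\<dots> = av (\<lambda>P. \<Sum>a\<in>S. \<Sum>h\<in>UNIV. exq n P * ind (Te h a) P)"
      unfolding z_def av_sum ..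
    also have "\<dots> \<le> av (\<lambda>P. exq n P * hit S P)"
    proof (rule av_mono)
      fix P assume P: "P \<in> PP"
      have "(\<Sum>a\<in>S. \<Sum>h\<in>UNIV. exq n P * ind (Te h a) P) = (\<Sum>a\<in>S. exq n P * (\<Sum>h\<in>UNIV. ind (Gu h a) P))"
        unfolding sum_distrib_left using S(1) by (intro sum.cong refl exit_guard[symmetric] P) auto
      also have "\<dots> = exq n P * (\<Sum>a\<in>S. \<Sum>h\<in>UNIV. ind (Gu h a) P)" by (rule sum_distrib_left[symmetric])
      also have "\<dots> \<le> exq n P * hit S P"
      proof (rule mult_left_mono[OF _ exq_nonneg])
        show "(\<Sum>a\<in>S. \<Sum>h\<in>UNIV. ind (Gu h a) P) \<le> hit S P"
        proof (rule sum_unique_le[OF finS])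
          fix a b assume ab: "a \<in> S" "b \<in> S" "(\<Sum>h\<in>UNIV. ind (Gu h a) P) \<noteq> 0" "(\<Sum>h\<in>UNIV. ind (Gu h b) P) \<noteq> 0"
          obtain h where "ind (Gu h a) P \<noteq> 0" using ab(3) by (auto elim: sum.not_neutral_contains_not_neutral)
          moreover obtain h' where "ind (Gu h' b) P \<noteq> 0" using ab(4) by (auto elim: sum.not_neutral_contains_not_neutral)
          ultimately show "a = b" using Gu_unique[OF P, of a b h h'] ab S(1) by (auto simp: ind_def)
        next
          fix a assume "a \<in> S"
          then show "(\<Sum>h\<in>UNIV. ind (Gu h a) P) \<le> hit S P"
            using Gu_Mid[OF P, of a] Mid_hit[of a S P] S(1) by auto
        qed (simp add: hit_def)
      qed
      finally show "(\<Sum>a\<in>S. \<Sum>h\<in>UNIV. exq n P * ind (Te h a) P) \<le> exq n P * hit S P" .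
    qed
    finally show ?thesis .
  qed
  \<comment> \<open>Beyond the \<open>n\<close> units of the other colours a guard has room for one
    unit of colour \<open>n\<close>. So the \<open>n - k\<close> arcs outside \<open>S\<close>
    absorb at most \<open>2 (n - k)\<close> of \<open>X n\<close>.\<close>
  have 3: "X n - 2 * of_nat n + 2 * of_nat k \<le> (\<Sum>a\<in>S. \<Sum>h\<in>UNIV. g h a - of_nat n)"
  proof -
    have g1: "(\<Sum>h\<in>UNIV. g h a - of_nat n) \<le> 2" if "a < n" for a
      using c_cap[of "Gu True a"] c_cap[of "Gu False a"] that by (simp add: cap_def UNIV_bool)
    have "(\<Sum>a<n. \<Sum>h\<in>UNIV. g h a - of_nat n) = (\<Sum>h\<in>UNIV. \<Sum>a<n. z n h a)"
      by (subst sum.swap) (simp add: z_n)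
    then have "X n = (\<Sum>a<n. \<Sum>h\<in>UNIV. g h a - of_nat n)" by (simp add: z_sum)
    also have "\<dots> = (\<Sum>a\<in>S. \<Sum>h\<in>UNIV. g h a - of_nat n) + (\<Sum>a\<in>{..<n} - S. \<Sum>h\<in>UNIV. g h a - of_nat n)"
      using sum.subset_diff[OF S(1), of "\<lambda>a. \<Sum>h\<in>UNIV. g h a - of_nat n"] by simp
    also have "(\<Sum>a\<in>{..<n} - S. \<Sum>h\<in>UNIV. g h a - of_nat n) \<le> (\<Sum>a\<in>{..<n} - S. 2)"
      by (intro sum_mono g1) auto
    also have "(\<Sum>a\<in>{..<n} - S. (2 :: rat)) = 2 * (of_nat n - of_nat k)"
      using S(1,2) kn by (simp add: card_Diff_subset finS of_nat_diff)
    finally show ?thesis by simp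
  qed
  have 4: "av (hit S) \<le> c (F 0) + av diq + c P2"
  proof -
    have "Mid ` S \<subseteq> set arlist" using S(1) by (auto simp: set_arlist)
    moreover have "card (Mid ` S) = k" using S(2) by (simp add: card_image inj_on_def)
    ultimately have "L \<le> av (\<lambda>P. of_bool (P \<inter> Mid ` S = {}))" using y_surv[of "Mid ` S"] by (simp only: surv_eq)
    also have "\<dots> = av (\<lambda>P. 1 - hit S P)" by (rule av_cong) (auto simp: hit_def)
    also have "\<dots> = av (\<lambda>P. 1) - av (hit S)" by (rule av_diff)
    finally show ?thesis using V_eq by simp
  qed
  \<comment> \<open>The chain loses one unit per colour between \<open>F 0\<close> and
    \<open>F n\<close>, and \<open>F n\<close> feeds only colour \<open>n\<close> and
    \<open>End\<close>.\<close>
  have 5: "c (F 0) \<le> of_nat n + X n + of_nat (U + n + 2 + k)"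
  proof -
    have "c (F n) - c (F 0) = - of_nat n"
      using chain_flow[of n] X_prefix[of n] by (simp add: algebra_simps)
    moreover have "c (F n) = av (\<lambda>P. exq n P + ind End P)"
    proof (rule av_cong)
      fix P assume P: "P \<in> PP"
      have "(\<Sum>i<n. if n \<le> i then exq i P else 0) = 0" "(\<Sum>i<n. if n \<le> i then ind (En i) P else 0) = 0"
        by (intro sum.neutral; auto)+
      then show "ind (F n) P = exq n P + ind End P" using P_chain[OF P order.refl] by simp
    qed
    then have "c (F n) = X n + c End" by (simp add: av_add X_def)
    moreover have "c End \<le> of_nat (U + n + 2 + k)"
      using c_cap[of End] kn by (simp add: cap_def \<kappa>_def)
    ultimately show ?thesis by linarith
  qed
  \<comment> \<open>\<open>k \<le> n\<close> gives \<open>\<kappa> = k\<close>, so every dummy arc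
    has the capacity \<open>M - 1\<close>.\<close>
  have 6: "av diq \<le> (of_nat k - 2) * (of_nat U + 3 * of_nat n + 2)"
  proof -
    have "av diq = (\<Sum>j<k - 2. c (Di j))" unfolding diq_def[abs_def] by (rule av_sum)
    also have "\<dots> \<le> (\<Sum>j<k - 2. of_nat (M - 1))"
    proof (rule sum_mono)
      fix j assume "j \<in> {..<k - 2}"
      then show "c (Di j) \<le> of_nat (M - 1)"
        using c_cap[of "Di j"] kn by (simp add: cap_def \<kappa>_def)
    qed
    also have "\<dots> = (of_nat k - 2) * (of_nat U + 3 * of_nat n + 2)"
      using k2 by (simp add: M_def of_nat_diff)
    finally show ?thesis .
  qed
  have 7: "c P2 \<le> of_nat U + 2 * of_nat n + 1" using c_cap[of P2] by (simp add: cap_def)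
  have "av (\<lambda>P. (1 - aex P) * hit S P) = av (\<lambda>P. hit S P - rc P * hit S P - exq n P * hit S P)"
    by (rule av_cong) (simp add: aex_rc algebra_simps)
  also have "\<dots> = av (hit S) - av (\<lambda>P. rc P * hit S P) - av (\<lambda>P. exq n P * hit S P)"
    unfolding av_diff ..
  finally have 8: "av (\<lambda>P. (1 - aex P) * hit S P) =
     av (hit S) - av (\<lambda>P. rc P * hit S P) - av (\<lambda>P. exq n P * hit S P)" .
  have s1: "(\<Sum>a\<in>S. 2 * of_nat n + deg a) = of_nat k * (2 * of_nat n) + (\<Sum>a\<in>S. deg a)"
    using S(2) by (simp add: sum.distrib)
  have s2: "(\<Sum>a\<in>S. of_nat U + of_nat n - deg a) = of_nat k * (of_nat U + of_nat n) - (\<Sum>a\<in>S. deg a)"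
    using S(2) by (simp add: sum.distrib sum_subtractf algebra_simps)
  define K N u :: rat where "K = of_nat k" and "N = of_nat n" and "u = of_nat U"
  have e: "(K - 2) * (u + 3 * N + 2) = K * (u + N) + K * (2 * N) + 2 * K - 2 * u - 6 * N - 4"
    by (simp add: algebra_simps)
  show ?thesis
    unfolding s2
    using 1[unfolded s1] 2 3 4 5 6 7 8 e unfolding K_def[symmetric] N_def[symmetric] u_def[symmetric] of_nat_add
    by simp
qed

end

section \<open>Gluing pieces of walks\<close>

text \<open>A piece stands for a path that carries given flow or filler: the list holds the arcs
  \<open>a\<close> whose \<open>Mid a\<close> it uses, the first flag says that it began with
  \<open>SrcA\<close> rather than with filler, the second that it finished with \<open>SnkA\<close>
  rather than with filler.\<close>

type_synonym piece = "bool \<times> nat list \<times> bool"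

definition cnt :: "('a \<Rightarrow> bool) \<Rightarrow> 'a multiset \<Rightarrow> nat" where
  "cnt Q M = size (filter_mset Q M)"

lemma cnt_simps [simp]:
  "cnt Q {#} = 0" "cnt Q (add_mset x M) = (if Q x then 1 else 0) + cnt Q M" "cnt Q (M + M') = cnt Q M + cnt Q M'"
  by (simp_all add: cnt_def)

lemma cnt_0_iff: "cnt Q M = 0 \<longleftrightarrow> (\<forall>x\<in>#M. \<not> Q x)"
  by (induction M) (auto simp: cnt_def)

lemma cnt_cong: "(\<And>x. x \<in># M \<Longrightarrow> Q x \<longleftrightarrow> R x) \<Longrightarrow> cnt Q M = cnt R M"
  unfolding cnt_def by (metis filter_mset_cong)

lemma cnt_split: "cnt Q M = cnt (\<lambda>x. Q x \<and> R x) M + cnt (\<lambda>x. Q x \<and> \<not> R x) M"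
  by (induction M) auto

lemma cnt_sum: "finite A \<Longrightarrow> cnt Q (\<Sum>i\<in>A. f i) = (\<Sum>i\<in>A. cnt Q (f i))"
  by (induction A rule: finite_induct) auto

lemma cnt_replicate: "cnt Q (replicate_mset m x) = (if Q x then m else 0)"
  by (induction m) auto

fun starts :: "nat \<Rightarrow> piece \<Rightarrow> bool" where "starts a (i, q, o') \<longleftrightarrow> \<not> i \<and> hd q = a"
fun ends :: "nat \<Rightarrow> piece \<Rightarrow> bool" where "ends a (i, q, o') \<longleftrightarrow> \<not> o' \<and> last q = a"
fun pure :: "piece \<Rightarrow> bool" where "pure (i, q, o') \<longleftrightarrow> \<not> i \<and> \<not> o' \<and> length q = 1"
text \<open>Visits to \<open>a\<close> that came through \<open>Din a\<close> rather than as filler.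
  Only these consume the unit capacity of the arc, and gluing preserves their number.\<close>

fun inner :: "nat \<Rightarrow> piece \<Rightarrow> bool" where "inner a (i, q, o') \<longleftrightarrow> a \<in> set q \<and> (i \<or> hd q \<noteq> a)"
fun hits :: "nat set \<Rightarrow> piece \<Rightarrow> bool" where "hits S (i, q, o') \<longleftrightarrow> set q \<inter> S \<noteq> {}"
fun full :: "piece \<Rightarrow> bool" where "full (i, q, o') \<longleftrightarrow> i \<and> o'"

lemma chain_ends: "chain f g u q v \<Longrightarrow> q \<noteq> [] \<Longrightarrow> f (hd q) = u \<and> g (last q) = v"
proof -
  have "chain f g u q v \<Longrightarrow> q \<noteq> [] \<Longrightarrow> g (last q) = v"
    by (induction q arbitrary: u) auto
  moreover assume "chain f g u q v" "q \<noteq> []"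
  ultimately show ?thesis by (cases q) auto
qed

locale ranked =
  fixes n :: nat and ta he :: "nat \<Rightarrow> nat" and s t :: nat and \<rho> :: "nat \<Rightarrow> nat"
  assumes rank: "\<And>a. a < n \<Longrightarrow> \<rho> (ta a) < \<rho> (he a)"
begin

lemma chain_rank: "chain ta he u q v \<Longrightarrow> set q \<subseteq> {..<n} \<Longrightarrow> w \<in> set (map he q) \<Longrightarrow> \<rho> u < \<rho> w"
proof (induction q arbitrary: u)
  case (Cons a q)
  then have "\<rho> u < \<rho> (he a)" using rank[of a] by auto
  then show ?case using Cons by fastforce
qed simp

lemma chain_distinct: "chain ta he u q v \<Longrightarrow> set q \<subseteq> {..<n} \<Longrightarrow> distinct (u # map he q)"
proof (induction q arbitrary: u)
  case (Cons a q)
  then have "distinct (he a # map he q)" by auto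
  moreover have "u \<notin> set (map he (a # q))" using chain_rank[OF Cons.prems] by blast
  ultimately show ?case by simp
qed simp

fun valid :: "piece \<Rightarrow> bool" where
  "valid (i, q, o') \<longleftrightarrow> q \<noteq> [] \<and> set q \<subseteq> {..<n} \<and> chain ta he (ta (hd q)) q (he (last q)) \<and>
     (i \<longrightarrow> ta (hd q) = s) \<and> (o' \<longrightarrow> he (last q) = t)"

lemma valid_distinct: "valid (i, q, o') \<Longrightarrow> distinct q"
  using chain_distinct[of "ta (hd q)" q "he (last q)"] by (auto simp: distinct_map)

text \<open>
  A piece that ends at \<open>a\<close> without having started there as a single arc is continued by a piece that
  starts at \<open>a\<close>; the arc \<open>a\<close> itself is split off, so that all counts of ends are kept.
\<close>

lemma glue_step:
  assumes v: "valid (i, q, False)" "valid (False, r, o')" and a: "last q = a" "hd r = a"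
    and np: "\<not> pure (i, q, False)" "\<not> pure (False, r, o')"
  defines "p \<equiv> (i, butlast q @ r, o')"
  shows "valid p" "valid (False, [a], False)" "(i, q, False) \<noteq> (False, r, o')"
    "starts b p = starts b (i, q, False)" "ends b p = ends b (False, r, o')"
    "(if inner b p then 1 else 0 :: nat) = (if inner b (i, q, False) then 1 else 0) + (if inner b (False, r, o') then 1 else 0)"
    "(if hits S p then 1 else 0 :: nat) + (if hits S (False, [a], False) then 1 else 0) \<le>
      (if hits S (i, q, False) then 1 else 0) + (if hits S (False, r, o') then 1 else 0)"
proof -
  obtain \<alpha> where q: "q = \<alpha> @ [a]" using v(1) a(1) by (cases q rule: rev_cases) auto
  obtain \<beta> where r: "r = a # \<beta>" using v(2) a(2) by (cases r) auto
  have p: "p = (i, \<alpha> @ a # \<beta>, o')" by (simp add: p_def q r)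
  have c1: "chain ta he (ta (hd q)) \<alpha> (ta a)" and c2: "chain ta he (ta a) (a # \<beta>) (he (last r))"
    using v unfolding q r by (auto simp: chain_append)
  have ch: "chain ta he (ta (hd q)) (\<alpha> @ a # \<beta>) (he (last r))"
    using c1 c2 unfolding chain_append by blast
  have hd: "hd (\<alpha> @ a # \<beta>) = hd q" by (cases \<alpha>) (auto simp: q)
  have last: "last (\<alpha> @ a # \<beta>) = last r" by (simp add: r)
  have np1: "i \<or> \<alpha> \<noteq> []" using np(1) by (cases \<alpha>) (auto simp: q)
  show val: "valid p" using v ch hd last unfolding p by (auto simp: q r)
  have d: "distinct (\<alpha> @ a # \<beta>)" using valid_distinct val unfolding p by blast
  show "valid (False, [a], False)" using v(1) by (auto simp: q)
  show "(i, q, False) \<noteq> (False, r, o')"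
  proof
    assume *: "(i, q, False) = (False, r, o')"
    then have "\<alpha> \<noteq> []" using np1 by simp
    then have "hd q = hd \<alpha>" by (simp add: q)
    then have "a \<in> set \<alpha>" using * a(2) \<open>\<alpha> \<noteq> []\<close> by auto
    then show False using d by auto
  qed
  show "starts b p = starts b (i, q, False)" using hd by (simp add: p)
  show "ends b p = ends b (False, r, o')" using last by (simp add: p)
  have h2: "hd (\<alpha> @ a # \<beta>) = (if \<alpha> = [] then a else hd \<alpha>)" "hd (\<alpha> @ [a]) = (if \<alpha> = [] then a else hd \<alpha>)" by auto
  show "(if inner b p then 1 else 0 :: nat) = (if inner b (i, q, False) then 1 else 0) + (if inner b (False, r, o') then 1 else 0)"
  proof (cases "\<alpha> = []")
    case True
    then show ?thesis using d np1 unfolding p q r by auto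
  next
    case False
    then have "hd \<alpha> \<in> set \<alpha>" by simp
    with False show ?thesis using d unfolding p q r by (auto simp: h2)
  qed
  show "(if hits S p then 1 else 0 :: nat) + (if hits S (False, [a], False) then 1 else 0) \<le>
      (if hits S (i, q, False) then 1 else 0) + (if hits S (False, r, o') then 1 else 0)"
    unfolding p q r by auto
qed

text \<open>Induction on the number of pieces that are not pure: each gluing step replaces two of
  them by one and adds a pure one. Equal numbers of starts and ends at each arc supply the
  partner.\<close>

lemma glue:
  assumes "\<forall>x\<in>#M. valid x" "\<forall>a. cnt (starts a) M = cnt (ends a) M"
  shows "\<exists>M'. (\<forall>x\<in>#M'. valid x \<and> (pure x \<or> full x)) \<and>
    (\<forall>a. cnt (starts a) M' = cnt (starts a) M \<and> cnt (inner a) M' = cnt (inner a) M) \<and>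
    cnt fst M' = cnt fst M \<and> (\<forall>S. cnt (hits S) M' \<le> cnt (hits S) M)"
  using assms
proof (induction "cnt (\<lambda>x. \<not> pure x) M" arbitrary: M rule: less_induct)
  case less
  show ?case
  proof (cases "\<exists>i q. (i, q, False) \<in># M \<and> \<not> pure (i, q, False)")
    case False
    have "full x" if x: "x \<in># M" "\<not> pure x" for x
    proof -
      obtain i q o' where xe: "x = (i, q, o')" by (cases x)
      have o': "o'" using False x unfolding xe by (cases o') auto
      have "i"
      proof (rule ccontr)
        assume "\<not> i"
        then have st: "starts (hd q) x" by (simp add: xe)
        let ?a = "hd q"
        \<comment> \<open>All remaining pieces with a filler end are pure. They start where they
          end, and as starts and ends at \<open>?a\<close> are equally many, no start is left for
          \<open>x\<close>.\<close>
        have "cnt (ends ?a) M = cnt (\<lambda>x. starts ?a x \<and> pure x) M"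
        proof (rule cnt_cong)
          fix z assume z: "z \<in># M"
          obtain j r o2 where ze: "z = (j, r, o2)" by (cases z)
          show "ends ?a z \<longleftrightarrow> starts ?a z \<and> pure z"
          proof (cases o2)
            case True
            then show ?thesis by (simp add: ze)
          next
            case o2: False
            then have "pure z" using False z unfolding ze by auto
            then obtain c where "r = [c]" "\<not> j" unfolding ze by (auto simp: length_Suc_conv)
            then show ?thesis using o2 by (simp add: ze)
          qed
        qed
        moreover have "cnt (starts ?a) M = cnt (\<lambda>x. starts ?a x \<and> pure x) M + cnt (\<lambda>x. starts ?a x \<and> \<not> pure x) M"
          by (rule cnt_split)
        ultimately have "cnt (\<lambda>x. starts ?a x \<and> \<not> pure x) M = 0" using less.prems(2) by simp
        then show False using x st by (auto simp: cnt_0_iff)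
      qed
      then show ?thesis using o' by (simp add: xe)
    qed
    then show ?thesis using less.prems(1) by (intro exI[of _ M]) auto
  next
    case True
    then obtain i q where x: "(i, q, False) \<in># M" "\<not> pure (i, q, False)" by blast
    define a where "a = last q"
    \<comment> \<open>Pure pieces contribute equally to starts and ends, so an end at
      \<open>a\<close> of another piece forces a start at \<open>a\<close> of another piece.\<close>
    have "\<exists>z\<in>#M. starts a z \<and> \<not> pure z"
    proof (rule ccontr)
      assume "\<not> ?thesis"
      then have "cnt (\<lambda>x. starts a x \<and> \<not> pure x) M = 0" by (auto simp: cnt_0_iff)
      moreover have "cnt (starts a) M = cnt (\<lambda>x. starts a x \<and> pure x) M + cnt (\<lambda>x. starts a x \<and> \<not> pure x) M"
        by (rule cnt_split)
      moreover have "cnt (ends a) M = cnt (\<lambda>x. ends a x \<and> pure x) M + cnt (\<lambda>x. ends a x \<and> \<not> pure x) M"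
        by (rule cnt_split)
      moreover have "cnt (\<lambda>x. ends a x \<and> pure x) M = cnt (\<lambda>x. starts a x \<and> pure x) M"
      proof (rule cnt_cong)
        fix z :: piece
        obtain j r o2 where ze: "z = (j, r, o2)" by (cases z)
        show "ends a z \<and> pure z \<longleftrightarrow> starts a z \<and> pure z" unfolding ze by (auto simp: length_Suc_conv)
      qed
      ultimately have "cnt (\<lambda>x. ends a x \<and> \<not> pure x) M = 0" using less.prems(2) by simp
      then show False using x by (auto simp: cnt_0_iff a_def)
    qed
    then obtain z where z: "z \<in># M" "starts a z" "\<not> pure z" by blast
    obtain r o' where ze: "z = (False, r, o')" and r: "hd r = a" using z(2) by (cases z) auto
    have v: "valid (i, q, False)" "valid (False, r, o')" using bspec[OF less.prems(1)] x(1) z(1) unfolding ze by blast+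
    note G = glue_step[OF v a_def[symmetric] r x(2) z(3)[unfolded ze]]
    obtain M1 where "M = add_mset (i, q, False) M1" using x(1) by (metis mset_add)
    moreover from this have "z \<in># M1" using z(1) G(3) ze by auto
    ultimately obtain M0 where M: "M = add_mset (i, q, False) (add_mset (False, r, o') M0)"
      unfolding ze by (metis mset_add)
    let ?p = "(i, butlast q @ r, o')"
    let ?M = "add_mset ?p (add_mset (False, [a], False) M0)"
    have nq: "\<not> pure (False, r, o')" using z(3) ze by simp
    have st: "cnt (starts b) ?M = cnt (starts b) M" for b
      unfolding M by (simp only: cnt_simps G(4)) (simp add: r)
    have en: "cnt (ends b) ?M = cnt (ends b) M" for b
      unfolding M by (simp only: cnt_simps G(5)) (simp add: a_def)
    have inn: "cnt (inner b) ?M = cnt (inner b) M" for b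
      unfolding M by (simp only: cnt_simps G(6)) simp
    have ht: "cnt (hits S) ?M \<le> cnt (hits S) M" for S
      using G(7)[of S] unfolding M by (simp only: cnt_simps)
    have "cnt (\<lambda>x. \<not> pure x) ?M < cnt (\<lambda>x. \<not> pure x) M"
      unfolding M using x(2) nq by (simp only: cnt_simps) simp
    moreover have "\<forall>x\<in>#?M. valid x"
      using less.prems(1) G(1,2) unfolding M by auto
    moreover have "\<forall>b. cnt (starts b) ?M = cnt (ends b) ?M"
      using less.prems(2) st en by simp
    ultimately obtain M' where M': "\<forall>x\<in>#M'. valid x \<and> (pure x \<or> full x)"
      "\<forall>a. cnt (starts a) M' = cnt (starts a) ?M \<and> cnt (inner a) M' = cnt (inner a) ?M"
      "cnt fst M' = cnt fst ?M" "\<forall>S. cnt (hits S) M' \<le> cnt (hits S) ?M"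
      using less.hyps by meson
    have "cnt fst ?M = cnt fst M" unfolding M by simp
    then have f: "cnt fst M' = cnt fst M" by (simp only: M'(3))
    have "cnt (starts b) M' = cnt (starts b) M \<and> cnt (inner b) M' = cnt (inner b) M" for b
      using M'(2) st[of b] inn[of b] by (simp only:)
    moreover have "cnt (hits S) M' \<le> cnt (hits S) M" for S
      by (rule order.trans[OF M'(4)[THEN spec] ht])
    ultimately show ?thesis using M'(1) f by (intro exI[of _ M']) simp
  qed
qed

end

sublocale gadget \<subseteq> ranked n ta he s t \<rho>
  using rank by unfold_locales

section \<open>Reading a path of the reduction network as a piece\<close>

context gadget
begin

abbreviation "DP \<equiv> path_sets ta he {..<n} s t"

lemma src_not_VT: "src e \<noteq> VT"
  by (cases e rule: src.cases) auto

lemma trg_not_VS: "trg e \<noteq> VS"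
  by (cases e) auto

lemma chain_VT: "chain src trg VT p v \<Longrightarrow> p = []"
  using src_not_VT by (cases p) auto

lemma chain_not_VS: "chain src trg u p v \<Longrightarrow> u \<noteq> VS \<Longrightarrow> e \<in> set p \<Longrightarrow> src e \<noteq> VS"
proof (induction p arbitrary: u)
  case (Cons e' p)
  then show ?case using trg_not_VS[of e'] by auto
qed simp

definition fbeg :: "nat \<Rightarrow> ar set \<Rightarrow> bool" where
  "fbeg a P \<longleftrightarrow> Fi a \<in> P \<or> (\<exists>b. Xi a b \<in> P)"

definition fend :: "nat \<Rightarrow> ar set \<Rightarrow> bool" where
  "fend a P \<longleftrightarrow> Fo a \<in> P \<or> (\<exists>b. Xo a b \<in> P)"

definition walk :: "nat \<Rightarrow> ar list \<Rightarrow> nat list \<Rightarrow> bool \<Rightarrow> bool" where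
  "walk v p q o' \<longleftrightarrow> (\<exists>w. chain ta he v q w \<and> (o' \<longrightarrow> w = t)) \<and> set q \<subseteq> {..<n} \<and> (\<forall>a. Din a \<in> set p \<longleftrightarrow> a \<in> set q)"

text \<open>Without guards and links, a path in the middle part alternates between \<open>V\<close>,
  \<open>In\<close> and \<open>Out\<close> vertices until \<open>SnkA\<close> or a filler end. The
  three statements, one for each kind of start vertex, support one another along the path. From a
  \<open>V\<close> vertex the walk can be empty only if \<open>SnkA\<close> follows at once.\<close>

lemma decompose_walk:
  assumes "chain src trg u p VT" "\<forall>e\<in>set p. ok e \<and> (\<forall>h a. e \<noteq> Gu h a) \<and> (\<forall>a b. e \<noteq> Li a b)"
  shows "(\<forall>v. u = V v \<longrightarrow> (\<exists>q o'. walk v p q o' \<and> (\<forall>b. Mid b \<in> set p \<longleftrightarrow> b \<in> set q) \<and>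
      (\<forall>b. fend b (set p) \<longleftrightarrow> \<not> o' \<and> last q = b) \<and> (\<not> o' \<longrightarrow> q \<noteq> []))) \<and>
    (\<forall>a. u = Out a \<longrightarrow> (\<exists>q o'. walk (he a) p q o' \<and> (\<forall>b. Mid b \<in> set p \<longleftrightarrow> b \<in> set q) \<and>
      (\<forall>b. fend b (set p) \<longleftrightarrow> \<not> o' \<and> last (a # q) = b))) \<and>
    (\<forall>a. u = In a \<longrightarrow> (\<exists>q o'. walk (he a) p q o' \<and> (\<forall>b. Mid b \<in> set p \<longleftrightarrow> b \<in> set (a # q)) \<and>
      (\<forall>b. fend b (set p) \<longleftrightarrow> \<not> o' \<and> last (a # q) = b)))"
  using assms
proof (induction p arbitrary: u)
  case (Cons e p)
  from Cons.prems(1) have e: "src e = u" and ch: "chain src trg (trg e) p VT" by auto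
  have cl: "ok e" "\<And>h a. e \<noteq> Gu h a" "\<And>a b. e \<noteq> Li a b" using Cons.prems(2) by auto
  note IH = Cons.IH[OF ch] 
  have IH': "\<forall>e\<in>set p. ok e \<and> (\<forall>h a. e \<noteq> Gu h a) \<and> (\<forall>a b. e \<noteq> Li a b)" using Cons.prems(2) by auto
  note IH = IH[OF this]
  show ?case
  proof (intro conjI allI impI)
    fix v assume u: "u = V v"
    then consider "e = SnkA" "v = t" | a where "e = Din a" "v = ta a" "a < n"
      using e cl by (cases e rule: src.cases) auto
    then show "\<exists>q o'. walk v (e # p) q o' \<and> (\<forall>b. Mid b \<in> set (e # p) \<longleftrightarrow> b \<in> set q) \<and>
      (\<forall>b. fend b (set (e # p)) \<longleftrightarrow> \<not> o' \<and> last q = b) \<and> (\<not> o' \<longrightarrow> q \<noteq> [])"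
    proof cases
      case 1
      then have "p = []" using ch chain_VT by simp
      then show ?thesis using 1 by (intro exI[of _ "[]"] exI[of _ True]) (auto simp: walk_def fend_def)
    next
      case 2
      then obtain q o' where q: "walk (he a) p q o'" "\<forall>b. Mid b \<in> set p \<longleftrightarrow> b \<in> set (a # q)"
        "\<forall>b. fend b (set p) \<longleftrightarrow> \<not> o' \<and> last (a # q) = b" using IH by auto
      have "walk v (e # p) (a # q) o'" using q(1) 2 by (auto simp: walk_def)
      moreover have "\<forall>b. Mid b \<in> set (e # p) \<longleftrightarrow> b \<in> set (a # q)" using q(2) 2 by simp
      moreover have "\<forall>b. fend b (set (e # p)) \<longleftrightarrow> \<not> o' \<and> last (a # q) = b"
        using q(3) unfolding 2(1) by (simp add: fend_def)
      ultimately show ?thesis by (intro exI[of _ "a # q"] exI[of _ o']) simp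
    qed
  next
    fix a assume u: "u = Out a"
    then consider "e = Dout a" | "e = Fo a" | b where "e = Xo a b"
      using e cl by (cases e rule: src.cases) auto
    then show "\<exists>q o'. walk (he a) (e # p) q o' \<and> (\<forall>b. Mid b \<in> set (e # p) \<longleftrightarrow> b \<in> set q) \<and>
      (\<forall>b. fend b (set (e # p)) \<longleftrightarrow> \<not> o' \<and> last (a # q) = b)"
    proof cases
      case 1
      then obtain q o' where q: "walk (he a) p q o'" "\<forall>b. Mid b \<in> set p \<longleftrightarrow> b \<in> set q"
        "\<forall>b. fend b (set p) \<longleftrightarrow> \<not> o' \<and> last q = b" "\<not> o' \<longrightarrow> q \<noteq> []" using IH by auto
      then show ?thesis using 1
        by (intro exI[of _ q] exI[of _ o']) (auto simp: walk_def fend_def)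
    next
      case 2
      then have "p = []" using ch chain_VT by simp
      then show ?thesis using 2 by (intro exI[of _ "[]"] exI[of _ False]) (auto simp: walk_def fend_def)
    next
      case 3
      then have "p = []" using ch chain_VT by simp
      then show ?thesis using 3 by (intro exI[of _ "[]"] exI[of _ False]) (auto simp: walk_def fend_def)
    qed
  next
    fix a assume u: "u = In a"
    then have m: "e = Mid a" using e cl by (cases e rule: src.cases) auto
    then obtain q o' where q: "walk (he a) p q o'" "\<forall>b. Mid b \<in> set p \<longleftrightarrow> b \<in> set q"
      "\<forall>b. fend b (set p) \<longleftrightarrow> \<not> o' \<and> last (a # q) = b" using IH by auto
    then show "\<exists>q o'. walk (he a) (e # p) q o' \<and> (\<forall>b. Mid b \<in> set (e # p) \<longleftrightarrow> b \<in> set (a # q)) \<and>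
      (\<forall>b. fend b (set (e # p)) \<longleftrightarrow> \<not> o' \<and> last (a # q) = b)"
      using m by (intro exI[of _ q] exI[of _ o']) (auto simp: walk_def fend_def)
  qed
qed simp

definition piece_of :: "ar set \<Rightarrow> piece \<Rightarrow> bool" where
  "piece_of P x \<longleftrightarrow> valid x \<and> (fst x \<longleftrightarrow> SrcA \<in> P) \<and> (\<forall>a. starts a x \<longleftrightarrow> fbeg a P) \<and> (\<forall>a. ends a x \<longleftrightarrow> fend a P) \<and>
     (\<forall>a. a \<in> set (fst (snd x)) \<longleftrightarrow> Mid a \<in> P) \<and> (\<forall>a. inner a x \<longrightarrow> Din a \<in> P)"

lemma piece_exists:
  assumes "P \<in> PP" "SrcA \<in> P \<or> (\<exists>a. fbeg a P)" "\<And>h a. Gu h a \<notin> P" "\<And>a b. Li a b \<notin> P"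
  shows "\<exists>x. piece_of P x"
proof -
  obtain p where p: "P = set p" "set p \<subseteq> Collect ok" "chain src trg VS p VT"
    using assms(1) by (auto simp: path_sets_def set_arlist)
  have "p \<noteq> []" using p(3) by auto
  then obtain e p' where e: "p = e # p'" by (cases p) auto
  then have ch: "chain src trg (trg e) p' VT" and se: "src e = VS" using p(3) by auto
  have cl: "\<forall>e\<in>set p'. ok e \<and> (\<forall>h a. e \<noteq> Gu h a) \<and> (\<forall>a b. e \<noteq> Li a b)"
    using assms(3,4) p(2) unfolding p(1) e by auto
  note X = decompose_walk[OF ch cl]
  have nt: "e' \<notin> set p'" if "src e' = VS" for e'
    using chain_not_VS[OF ch trg_not_VS] that by blast
  \<comment> \<open>Starting arcs leave \<open>VS\<close>, which a path never revisits, so the one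
    that is present is the first arc.\<close>
  have "e = SrcA \<or> (\<exists>a. e = Fi a) \<or> (\<exists>a b. e = Xi a b)"
    using assms(2) nt[of SrcA] nt[of "Fi _"] nt[of "Xi _ _"] unfolding p(1) e fbeg_def by auto
  then consider "e = SrcA" | a where "e = Fi a \<or> (\<exists>b. e = Xi a b)" by blast
  then show ?thesis
  proof cases
    case 1
    then obtain q o' where q: "walk s p' q o'" "\<forall>b. Mid b \<in> set p' \<longleftrightarrow> b \<in> set q"
        "\<forall>b. fend b (set p') \<longleftrightarrow> \<not> o' \<and> last q = b" "\<not> o' \<longrightarrow> q \<noteq> []" using X by auto
    obtain w where w: "chain ta he s q w" "o' \<longrightarrow> w = t" using q(1) by (auto simp: walk_def)
    have qn: "q \<noteq> []" using q(4) w s_neq_t by (cases q) auto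
    note ce = chain_ends[OF w(1) qn]
    have fb: "\<not> fbeg a P" for a using nt[of "Fi a"] nt[of "Xi a _"] 1 unfolding p(1) e fbeg_def by auto
    have fe: "fend a P \<longleftrightarrow> fend a (set p')" for a unfolding p(1) e 1 fend_def by simp
    have "piece_of P (True, q, o')"
      unfolding piece_of_def using qn w ce q fb fe unfolding p(1) e 1 by (auto simp: walk_def)
    then show ?thesis ..
  next
    case 2
    have te: "trg e = In a" and an: "a < n" using 2 p(2) unfolding e by auto
    then obtain q o' where q: "walk (he a) p' q o'" "\<forall>b. Mid b \<in> set p' \<longleftrightarrow> b \<in> set (a # q)"
        "\<forall>b. fend b (set p') \<longleftrightarrow> \<not> o' \<and> last (a # q) = b" using X by auto
    obtain w where w: "chain ta he (he a) q w" "o' \<longrightarrow> w = t" using q(1) by (auto simp: walk_def)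
    have c: "chain ta he (ta a) (a # q) w" using w(1) by simp
    have ce: "he (last (a # q)) = w" using chain_ends[OF c] by simp
    have "SrcA \<notin> P" using nt[of SrcA] 2 unfolding p(1) e by auto
    moreover have "fbeg b P \<longleftrightarrow> b = a" for b
      using nt[of "Fi b"] nt[of "Xi b _"] 2 unfolding p(1) e fbeg_def by auto
    moreover have "fend b P \<longleftrightarrow> fend b (set p')" for b using 2 unfolding p(1) e fend_def by auto
    moreover have "Mid b \<in> P \<longleftrightarrow> Mid b \<in> set p'" for b using 2 unfolding p(1) e by auto
    moreover have "valid (False, a # q, o')"
      using an c ce w(2) q(1) by (auto simp: walk_def)
    moreover have "inner b (False, a # q, o') \<Longrightarrow> Din b \<in> P" for b
      using q(1) unfolding p(1) e walk_def by auto
    ultimately have "piece_of P (False, a # q, o')"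
      unfolding piece_of_def using q(2,3) by auto
    then show ?thesis ..
  qed
qed

end

text \<open>Scaling makes path flows into multiplicities. For integral flows the factor is 1, so
  integrality survives the later division by it.\<close>

lemma common_denominator:
  fixes y :: "'a \<Rightarrow> rat"
  assumes "finite A" "\<And>P. P \<in> A \<Longrightarrow> 0 \<le> y P"
  shows "\<exists>N>0. (\<forall>P\<in>A. \<exists>m. of_nat m = of_nat N * y P) \<and> ((\<forall>P\<in>A. y P \<in> \<int>) \<longrightarrow> N = (1 :: nat))"
proof -
  have nat: "\<exists>m. of_nat m = x" if "0 \<le> x" "x \<in> \<int>" for x :: rat
  proof -
    from that(2) obtain i where "x = of_int i" by (rule Ints_cases)
    then show ?thesis using that(1) by (intro exI[of _ "nat i"]) simp
  qed
  have "\<exists>N>0. \<forall>P\<in>A. \<exists>m. of_nat m = of_nat N * y P"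
    using assms
  proof (induction A rule: finite_induct)
    case (insert P A)
    then obtain N where N: "N > 0" "\<forall>P\<in>A. \<exists>m. of_nat m = of_nat N * y P" by auto
    obtain a b where ab: "quotient_of (y P) = (a, b)" by (cases "quotient_of (y P)")
    have b: "b > 0" and yP: "y P = of_int a / of_int b"
      using quotient_of_denom_pos[OF ab] quotient_of_div[OF ab] by auto
    have "\<exists>m. of_nat m = of_nat (N * nat b) * y Q" if Q: "Q \<in> insert P A" for Q
    proof (cases "Q = P")
      case True
      have eq: "of_nat (N * nat b) * y P = of_nat N * of_int a" using b yP by simp
      have "of_nat (N * nat b) * y P \<in> \<int>" unfolding eq by simp
      moreover have "0 \<le> of_nat (N * nat b) * y P"
        using insert.prems[of P] by (intro mult_nonneg_nonneg) simp_all
      ultimately show ?thesis unfolding True by (intro nat)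
    next
      case False
      then obtain m where "of_nat m = of_nat N * y Q" using N Q by auto
      then have "of_nat (m * nat b) = of_nat (N * nat b) * y Q" by simp
      then show ?thesis ..
    qed
    moreover have "N * nat b > 0" using N b by simp
    ultimately show ?case by blast
  qed auto
  moreover have "(\<forall>P\<in>A. y P \<in> \<int>) \<Longrightarrow> \<forall>P\<in>A. \<exists>m. of_nat m = of_nat 1 * y P"
    using nat assms(2) by simp
  ultimately show ?thesis by (metis zero_less_one)
qed

lemma cnt_mono: "(\<And>x. Q x \<Longrightarrow> R x) \<Longrightarrow> cnt Q M \<le> cnt R M"
  by (induction M) auto

section \<open>From a robust flow to a flow of the given network\<close>

context gadget_robust
begin

text \<open>The flow-carrying paths that become pieces. By \<open>end_DG\<close> they include every
  flow-carrying path with a filler end, as the count of ends requires.\<close>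

definition DG :: "ar set set" where
  "DG = {P \<in> PP. y P \<noteq> 0 \<and> (SrcA \<in> P \<or> (\<exists>a. fbeg a P))}"

lemma path_ok: "P \<in> PP \<Longrightarrow> e \<in> P \<Longrightarrow> ok e"
proof -
  assume P: "P \<in> PP" and "e \<in> P"
  then have "e \<in> set arlist" by (rule subsetD[OF path_sets_subset])
  then show ?thesis by (simp add: set_arlist)
qed

lemma DG_aex: "P \<in> DG \<Longrightarrow> aex P = 0"
proof -
  assume P: "P \<in> DG"
  then have PP: "P \<in> PP" by (simp add: DG_def)
  have "1 \<le> ind SrcA P + fiq P"
  proof (cases "SrcA \<in> P")
    case True
    then show ?thesis using fiq_nonneg[of P] by (simp add: ind_def)
  next
    case False
    then obtain a where "fbeg a P" using P by (auto simp: DG_def)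
    then consider "Fi a \<in> P" | b where "Xi a b \<in> P" by (auto simp: fbeg_def)
    then have "1 \<le> fiq P"
    proof cases
      case 1
      then show ?thesis using fiq_ge(1)[of a P] path_ok[OF PP 1] by (simp add: ind_def)
    next
      case 2
      then show ?thesis using fiq_ge(2)[of a b P] path_ok[OF PP 2] by (simp add: ind_def)
    qed
    then show ?thesis using ind_nonneg[of SrcA P] by linarith
  qed
  then show ?thesis
    using aex_le[OF PP] prq_nonneg[of P] diq_nonneg[of P] ind_nonneg[of P2 P] aex_nonneg[of P] by linarith
qed

lemma DG_piece: "P \<in> DG \<Longrightarrow> \<exists>x. piece_of P x"
proof (rule piece_exists)
  assume P: "P \<in> DG"
  then show PP: "P \<in> PP" and "SrcA \<in> P \<or> (\<exists>a. fbeg a P)" by (auto simp: DG_def)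
  have y: "y P \<noteq> 0" using P by (simp add: DG_def)
  show "Gu h a \<notin> P" for h a
  proof
    assume g: "Gu h a \<in> P"
    then have "a < n" using path_ok[OF PP g] by simp
    then show False using g Gu_le[of a h P] supp_no_exit[OF PP y DG_aex[OF P]] by (simp add: ind_def)
  qed
  show "Li a b \<notin> P" for a b
  proof
    assume l: "Li a b \<in> P"
    then have "link a b" using path_ok[OF PP l] by simp
    then show False using supp_link_rc[OF PP y _ l] rc_le_aex[of P] DG_aex[OF P] by simp
  qed
qed

lemma begin_DG: "P \<in> PP \<Longrightarrow> y P \<noteq> 0 \<Longrightarrow> fbeg a P \<Longrightarrow> P \<in> DG"
  by (auto simp: DG_def)

lemma fend_foq: "P \<in> PP \<Longrightarrow> fend a P \<Longrightarrow> 1 \<le> foq P"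
proof -
  assume P: "P \<in> PP" and "fend a P"
  then consider "Fo a \<in> P" | b where "Xo a b \<in> P" by (auto simp: fend_def)
  then show "1 \<le> foq P"
  proof cases
    case 1
    then show ?thesis using foq_ge(1)[of a P] path_ok[OF P 1] by (simp add: ind_def)
  next
    case 2
    then show ?thesis using foq_ge(2)[of a b P] path_ok[OF P 2] by (simp add: ind_def)
  qed
qed

text \<open>A flow-carrying path with a filler end is not coloured and avoids the guards, so by
  \<open>P_mid\<close> it entered the middle part through \<open>SrcA\<close> or filler.\<close>

lemma end_DG:
  assumes "P \<in> PP" "y P \<noteq> 0" "fend a P"
  shows "P \<in> DG"
proof -
  have f: "1 \<le> foq P" by (rule fend_foq[OF assms(1,3)])
  have ae: "aex P = 0" using supp_exit(4)[OF assms(1,2)] f by force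
  have "ind SrcA P + fiq P = ind SnkA P + foq P"
    using P_mid[OF assms(1)] supp_no_exit[OF assms(1,2) ae] ae by (simp add: aex_def)
  then have "ind SrcA P + fiq P \<noteq> 0" using f ind_nonneg[of SnkA P] by linarith
  then have "ind SrcA P \<noteq> 0 \<or> fiq P \<noteq> 0" by auto
  moreover have "\<exists>a. fbeg a P" if "fiq P \<noteq> 0"
  proof (rule ccontr)
    assume "\<not> ?thesis"
    then have "ind (Fi a) P = 0" "ind (Xi a b) P = 0" for a b by (auto simp: fbeg_def ind_def)
    then have "fiq P = 0" by (simp add: fiq_def cong: if_cong)
    with that show False ..
  qed
  ultimately show ?thesis using assms(1,2) by (auto simp: DG_def ind_def)
qed

text \<open>Both totals consist of saturated filler arcs. Their equality at every arc is the
  hypothesis for gluing, and their value is what the clique bound allows to subtract.\<close>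

lemma begin_value:
  "a < n \<Longrightarrow> av (\<lambda>P. of_bool (fbeg a P)) = of_nat U + of_nat n - deg a"
  "a < n \<Longrightarrow> av (\<lambda>P. of_bool (fend a P)) = of_nat U + of_nat n - deg a"
proof -
  assume a: "a < n"
  have nd: "(\<Sum>b<n. if link a b then 0 else 1) = of_nat n - deg a"
  proof -
    have "(\<Sum>b<n. if link a b then 0 else 1) + deg a = (\<Sum>b<n. 1)"
      unfolding deg_def sum.distrib[symmetric] by (intro sum.cong) auto
    then show ?thesis by simp
  qed
  \<comment> \<open>A path has at most one filler start and at most one filler end, so the
    disjunction over these arcs equals their sum.\<close>
  have mem: "of_bool (R \<or> (\<exists>b. B b)) = of_bool R + (\<Sum>b<n. if link a b then 0 else of_bool (B b) :: rat)"
    if le: "of_bool R + (\<Sum>b<n. if link a b then 0 else of_bool (B b)) \<le> (1 :: rat)"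
      and sub: "\<And>b. B b \<Longrightarrow> b < n \<and> \<not> link a b" for R B
  proof (cases "R \<or> (\<exists>b. B b)")
    case True
    then have "1 \<le> of_bool R + (\<Sum>b<n. if link a b then 0 else of_bool (B b) :: rat)"
    proof
      assume R
      then show ?thesis by (simp add: sum_nonneg)
    next
      assume "\<exists>b. B b"
      then obtain b where b: "B b" "b < n" "\<not> link a b" using sub by blast
      have "(if link a b then 0 else of_bool (B b) :: rat) \<le> (\<Sum>b<n. if link a b then 0 else of_bool (B b))"
        using b(2) by (intro member_le_sum) auto
      moreover have "(if link a b then 0 else of_bool (B b) :: rat) = 1" using b by simp
      ultimately have "1 \<le> (\<Sum>b<n. if link a b then 0 else of_bool (B b) :: rat)" by simp
      then show ?thesis by (simp add: add_increasing)
    qed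
    then show ?thesis using True le by simp
  next
    case False
    then have "(\<Sum>b<n. if link a b then 0 else of_bool (B b) :: rat) = 0" by (simp cong: if_cong)
    with False show ?thesis by simp
  qed
  have part: "f a P + (\<Sum>b<n. if link a b then 0 else g a b P) \<le> (\<Sum>a<n. f a P) + (\<Sum>a<n. \<Sum>b<n. if link a b then 0 else g a b P)"
    if "\<And>a b P. 0 \<le> (f a P :: rat)" "\<And>a b P. 0 \<le> (g a b P :: rat)" for f g and P :: "ar set"
    using a that by (intro add_mono member_le_sum[of a "{..<n}" "\<lambda>a. f a P"]
      member_le_sum[of a "{..<n}" "\<lambda>a. \<Sum>b<n. if link a b then 0 else g a b P"]) (auto intro!: sum_nonneg)
  have fi: "fiq P \<le> 1" if "P \<in> PP" for P
    using P_start[OF that] ind_nonneg[of SrcA P] ind_nonneg[of "F 0" P] enq_nonneg[of P] prq_nonneg[of P] diq_nonneg[of P]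
      ind_nonneg[of P2 P] by linarith
  have fo: "foq P \<le> 1" if "P \<in> PP" for P
    using end_le[OF that] ind_nonneg[of SnkA P] teq_nonneg[of P] ind_nonneg[of End P] diq_nonneg[of P] by linarith
  have "av (\<lambda>P. of_bool (fbeg a P)) = av (\<lambda>P. ind (Fi a) P + (\<Sum>b<n. if link a b then 0 else ind (Xi a b) P))"
  proof (rule av_cong)
    fix P assume P: "P \<in> PP"
    show "of_bool (fbeg a P) = ind (Fi a) P + (\<Sum>b<n. if link a b then 0 else ind (Xi a b) P)"
      unfolding fbeg_def ind_def
    proof (rule mem)
      show "of_bool (Fi a \<in> P) + (\<Sum>b<n. if link a b then 0 else of_bool (Xi a b \<in> P)) \<le> (1 :: rat)"
        using fi[OF P] part[of "\<lambda>a. ind (Fi a)" "\<lambda>a b. ind (Xi a b)" P] unfolding fiq_def ind_def by simp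
      show "b < n \<and> \<not> link a b" if "Xi a b \<in> P" for b using path_ok[OF P that] by simp
    qed
  qed
  also have "\<dots> = c (Fi a) + (\<Sum>b<n. if link a b then 0 else c (Xi a b))"
    by (simp only: av_add av_sum av_if0)
  also have "(\<Sum>b<n. if link a b then 0 else c (Xi a b)) = (\<Sum>b<n. if link a b then 0 else 1)"
    using a by (intro sum.cong) (auto simp: c_sat)
  finally show "av (\<lambda>P. of_bool (fbeg a P)) = of_nat U + of_nat n - deg a"
    using a nd by (simp add: c_sat)
  have "av (\<lambda>P. of_bool (fend a P)) = av (\<lambda>P. ind (Fo a) P + (\<Sum>b<n. if link a b then 0 else ind (Xo a b) P))"
  proof (rule av_cong)
    fix P assume P: "P \<in> PP"
    show "of_bool (fend a P) = ind (Fo a) P + (\<Sum>b<n. if link a b then 0 else ind (Xo a b) P)"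
      unfolding fend_def ind_def
    proof (rule mem)
      show "of_bool (Fo a \<in> P) + (\<Sum>b<n. if link a b then 0 else of_bool (Xo a b \<in> P)) \<le> (1 :: rat)"
        using fo[OF P] part[of "\<lambda>a. ind (Fo a)" "\<lambda>a b. ind (Xo a b)" P] unfolding foq_def ind_def by simp
      show "b < n \<and> \<not> link a b" if "Xo a b \<in> P" for b using path_ok[OF P that] by simp
    qed
  qed
  also have "\<dots> = c (Fo a) + (\<Sum>b<n. if link a b then 0 else c (Xo a b))"
    by (simp only: av_add av_sum av_if0)
  also have "(\<Sum>b<n. if link a b then 0 else c (Xo a b)) = (\<Sum>b<n. if link a b then 0 else 1)"
    using a by (intro sum.cong) (auto simp: c_Xo)
  finally show "av (\<lambda>P. of_bool (fend a P)) = of_nat U + of_nat n - deg a"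
    using a nd by (simp add: c_Fo)
qed

lemma full_path: "valid (i, q, o') \<Longrightarrow> full (i, q, o') \<Longrightarrow> set q \<in> DP"
proof -
  assume "valid (i, q, o')" "full (i, q, o')"
  then have "chain ta he s q t" "set q \<subseteq> {..<n}" by auto
  then show ?thesis unfolding path_sets_def using chain_distinct[of s q t] by (intro CollectI exI[of _ q] conjI) auto
qed

lemma sum_cnt_full:
  assumes "\<forall>x\<in>#Z. valid x"
  shows "(\<Sum>Q | Q \<in> DP \<and> R Q. cnt (\<lambda>x. full x \<and> set (fst (snd x)) = Q) Z) =
    cnt (\<lambda>x. full x \<and> R (set (fst (snd x)))) Z"
  using assms
proof (induction Z)
  case (add x Z)
  obtain i q o' where x: "x = (i, q, o')" by (cases x)
  have fin: "finite {Q. Q \<in> DP \<and> R Q}" by (simp add: finite_path_sets)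
  have "(\<Sum>Q | Q \<in> DP \<and> R Q. if full x \<and> set q = Q then 1 else 0 :: nat) = (if full x \<and> R (set q) then 1 else 0)"
  proof (cases "full x")
    case True
    moreover have "valid (i, q, o')" using add.prems x by simp
    ultimately have "set q \<in> DP" unfolding x by (intro full_path)
    then show ?thesis using True fin by simp
  qed simp
  then show ?case using add by (simp add: sum.distrib x)
qed simp

text \<open>After gluing, a piece that starts with filler is a single arc. It meets \<open>S\<close>
  exactly if that arc lies in \<open>S\<close>, so the filler part of the hits is counted by the
  starts.\<close>

lemma cnt_hits:
  assumes "\<forall>x\<in>#Z. valid x \<and> (pure x \<or> full x)" "finite S"
  shows "(\<Sum>a\<in>S. cnt (starts a) Z) + cnt (\<lambda>x. full x \<and> set (fst (snd x)) \<inter> S \<noteq> {}) Z = cnt (hits S) Z"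
  using assms(1)
proof (induction Z)
  case (add x Z)
  obtain i q o' where x: "x = (i, q, o')" by (cases x)
  have "(\<Sum>a\<in>S. if starts a x then 1 else 0 :: nat) + (if full x \<and> set (fst (snd x)) \<inter> S \<noteq> {} then 1 else 0) =
    (if hits S x then 1 else 0)"
  proof (cases "full x")
    case True
    then show ?thesis by (simp add: x)
  next
    case False
    then obtain b where "x = (False, [b], False)" using add.prems x by (auto simp: length_Suc_conv)
    then show ?thesis using assms(2) by simp
  qed
  then show ?case using add by (simp add: sum.distrib)
qed simp

theorem backward:
  "\<exists>x :: nat set \<Rightarrow> rat. (\<forall>Q\<in>DP. 0 \<le> x Q) \<and> (\<forall>a<n. (\<Sum>Q | Q \<in> DP \<and> a \<in> Q. x Q) \<le> 1) \<and>
    (\<Sum>Q\<in>DP. x Q) = \<theta> \<and>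
    (\<forall>S\<subseteq>{..<n}. card S = k \<and> (\<forall>a\<in>S. \<forall>b\<in>S. \<not> link a b) \<longrightarrow>
      (\<Sum>Q | Q \<in> DP \<and> Q \<inter> S \<noteq> {}. x Q) \<le> of_nat k - 1) \<and>
    ((\<forall>P\<in>PP. y P \<in> \<int>) \<longrightarrow> (\<forall>Q\<in>DP. x Q \<in> \<int>))"
proof -
  obtain N :: nat where N: "N > 0" "\<forall>P\<in>PP. \<exists>m. of_nat m = of_nat N * y P" "(\<forall>P\<in>PP. y P \<in> \<int>) \<longrightarrow> N = 1"
    using common_denominator[OF finite_PP, of y] y_nonneg by auto
  obtain m where m: "\<And>P. P \<in> PP \<Longrightarrow> of_nat (m P) = of_nat N * y P" using N(2) by metis
  obtain f where f: "\<And>P. P \<in> DG \<Longrightarrow> piece_of P (f P)" using DG_piece by metis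
  have fin: "finite DG" unfolding DG_def using finite_PP by simp
  \<comment> \<open>An integral model of \<open>N\<close> times the flow: each path contributes its
    piece with multiplicity \<open>N y P\<close>.\<close>
  define Z where "Z = (\<Sum>P\<in>DG. replicate_mset (m P) (f P))"
  have cntZ: "of_nat (cnt Q Z) = of_nat N * av (\<lambda>P. of_bool (P \<in> DG \<and> Q (f P)))" for Q
  proof -
    have "of_nat (cnt Q Z) = (\<Sum>P\<in>DG. of_nat N * (y P * of_bool (Q (f P))))"
      unfolding Z_def cnt_sum[OF fin] cnt_replicate of_nat_sum
      by (intro sum.cong) (auto simp: m DG_def)
    also have "\<dots> = of_nat N * av (\<lambda>P. of_bool (P \<in> DG \<and> Q (f P)))"
      unfolding av_def sum_distrib_left
      by (rule sum.mono_neutral_cong_left[OF finite_PP]) (auto simp: DG_def)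
    finally show ?thesis .
  qed
  have cnt_eq: "of_nat (cnt Q Z) = of_nat N * av g"
    if "\<And>P. P \<in> PP \<Longrightarrow> y P \<noteq> 0 \<Longrightarrow> g P = of_bool (P \<in> DG \<and> Q (f P))" for Q g
    unfolding cntZ using that by (intro arg_cong[where f = "(*) (of_nat N)"] antisym av_supp_mono) auto
  have cnt_le: "of_nat (cnt Q Z) \<le> of_nat N * av g"
    if "\<And>P. P \<in> PP \<Longrightarrow> y P \<noteq> 0 \<Longrightarrow> of_bool (P \<in> DG \<and> Q (f P)) \<le> g P" for Q g
    unfolding cntZ using that by (intro mult_left_mono av_supp_mono) auto
  have valZ: "\<forall>x\<in>#Z. valid x"
  proof
    fix x assume "x \<in># Z"
    then obtain P where "P \<in> DG" "x = f P" unfolding Z_def by (auto simp: set_mset_sum fin)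
    then show "valid x" using f by (simp add: piece_of_def)
  qed
  have st: "of_nat (cnt (starts a) Z) = of_nat N * av (\<lambda>P. of_bool (fbeg a P))" for a
  proof (rule cnt_eq)
    fix P assume P: "P \<in> PP" "y P \<noteq> 0"
    show "of_bool (fbeg a P) = of_bool (P \<in> DG \<and> starts a (f P))"
      using f[of P] begin_DG[OF P, of a] by (auto simp: piece_of_def)
  qed
  have en: "of_nat (cnt (ends a) Z) = of_nat N * av (\<lambda>P. of_bool (fend a P))" for a
  proof (rule cnt_eq)
    fix P assume P: "P \<in> PP" "y P \<noteq> 0"
    show "of_bool (fend a P) = of_bool (P \<in> DG \<and> ends a (f P))"
      using f[of P] end_DG[OF P, of a] by (auto simp: piece_of_def)
  qed
  have "cnt (starts a) Z = cnt (ends a) Z" for a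
  proof (cases "a < n")
    case True
    then have "(of_nat (cnt (starts a) Z) :: rat) = of_nat (cnt (ends a) Z)"
      unfolding st en by (simp add: begin_value)
    then show ?thesis by simp
  next
    case False
    have "av (\<lambda>P. of_bool (fbeg a P)) = 0" "av (\<lambda>P. of_bool (fend a P)) = 0"
      unfolding av_def fbeg_def fend_def using False
      by (intro sum.neutral ballI, use path_ok in fastforce)+
    then show ?thesis using st[of a] en[of a] by simp
  qed
  then obtain Z' where Z': "\<forall>x\<in>#Z'. valid x \<and> (pure x \<or> full x)"
    "\<forall>a. cnt (starts a) Z' = cnt (starts a) Z \<and> cnt (inner a) Z' = cnt (inner a) Z"
    "cnt fst Z' = cnt fst Z" "\<forall>S. cnt (hits S) Z' \<le> cnt (hits S) Z"
    using glue[OF valZ] by metis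
  define x :: "nat set \<Rightarrow> rat" where
    "x Q = of_nat (cnt (\<lambda>x. full x \<and> set (fst (snd x)) = Q) Z') / of_nat N" for Q
  have sumx: "(\<Sum>Q | Q \<in> DP \<and> R Q. x Q) = of_nat (cnt (\<lambda>x. full x \<and> R (set (fst (snd x)))) Z') / of_nat N" for R
    using sum_cnt_full[of Z' R] Z'(1) unfolding x_def sum_divide_distrib[symmetric] of_nat_sum[symmetric] by simp
  have Npos: "(0 :: rat) < of_nat N" using N(1) by simp
  have val: "(\<Sum>Q\<in>DP. x Q) = \<theta>"
  proof -
    have "cnt (\<lambda>x. full x \<and> True) Z' = cnt fst Z'" using Z'(1) by (intro cnt_cong) auto
    moreover have "of_nat (cnt fst Z) = of_nat N * c SrcA"
    proof (rule cnt_eq)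
      fix P assume P: "P \<in> PP" "y P \<noteq> 0"
      show "ind SrcA P = of_bool (P \<in> DG \<and> fst (f P))"
        unfolding ind_def using f[of P] P by (auto simp: piece_of_def DG_def)
    qed
    ultimately show ?thesis using sumx[of "\<lambda>_. True"] Z'(3) Npos by (simp add: c_sat)
  qed
  have cap: "(\<Sum>Q | Q \<in> DP \<and> a \<in> Q. x Q) \<le> 1" if a: "a < n" for a
  proof -
    \<comment> \<open>A full piece did not begin with filler, so all its arcs count as
      \<open>inner\<close>; their number is bounded by the load of \<open>Din a\<close>.\<close>
    have "cnt (\<lambda>x. full x \<and> a \<in> set (fst (snd x))) Z' \<le> cnt (inner a) Z'"
    proof (rule cnt_mono)
      fix x :: piece assume "full x \<and> a \<in> set (fst (snd x))"
      then show "inner a x" by (cases x) auto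
    qed
    also have "\<dots> = cnt (inner a) Z" using Z'(2) by simp
    finally have "of_nat (cnt (\<lambda>x. full x \<and> a \<in> set (fst (snd x))) Z') \<le> (of_nat (cnt (inner a) Z) :: rat)" by simp
    also have "\<dots> \<le> of_nat N * c (Din a)"
      using f by (intro cnt_le) (auto simp: piece_of_def ind_def)
    also have "\<dots> \<le> of_nat N" using c_cap[of "Din a"] a Npos by (simp add: cap_def)
    finally show ?thesis unfolding sumx using Npos by (simp add: divide_le_eq)
  qed
  have clique: "(\<Sum>Q | Q \<in> DP \<and> Q \<inter> S \<noteq> {}. x Q) \<le> of_nat k - 1"
    if S: "S \<subseteq> {..<n}" "card S = k" "\<forall>a\<in>S. \<forall>b\<in>S. \<not> link a b" for S
  proof -
    have finS: "finite S" using S(1) finite_subset by blast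
    \<comment> \<open>Gluing preserves the starts and does not increase the hits, so the filler of
      \<open>S\<close> can be subtracted from the bound on all hits; \<open>k - 1\<close> remains
      for the full pieces.\<close>
    have "(\<Sum>a\<in>S. cnt (starts a) Z) + cnt (\<lambda>x. full x \<and> set (fst (snd x)) \<inter> S \<noteq> {}) Z' \<le> cnt (hits S) Z"
      using cnt_hits[OF Z'(1) finS] Z'(2,4) by simp
    then have "(\<Sum>a\<in>S. of_nat (cnt (starts a) Z)) + of_nat (cnt (\<lambda>x. full x \<and> set (fst (snd x)) \<inter> S \<noteq> {}) Z') \<le> (of_nat (cnt (hits S) Z) :: rat)"
      by (simp flip: of_nat_sum of_nat_add)
    also have "\<dots> \<le> of_nat N * av (\<lambda>P. (1 - aex P) * hit S P)"
    proof (rule cnt_le)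
      fix P assume P: "P \<in> PP" "y P \<noteq> 0"
      show "of_bool (P \<in> DG \<and> hits S (f P)) \<le> (1 - aex P) * hit S P"
      proof (cases "P \<in> DG")
        case True
        obtain i q o' where fP: "f P = (i, q, o')" by (cases "f P")
        show ?thesis using f[OF True] DG_aex[OF True] unfolding fP hit_def piece_of_def by auto
      next
        case False
        then show ?thesis using aex_01[OF P(1)] by (auto simp: hit_def)
      qed
    qed
    also have "\<dots> \<le> of_nat N * ((\<Sum>a\<in>S. of_nat U + of_nat n - deg a) + of_nat k - 1)"
      using clique_bound[OF S(1,2)] S(3) by (intro mult_left_mono) auto
    also have "\<dots> = (\<Sum>a\<in>S. of_nat N * (of_nat U + of_nat n - deg a)) + of_nat N * (of_nat k - 1)"
      by (simp add: sum_distrib_left algebra_simps)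
    also have "(\<Sum>a\<in>S. of_nat N * (of_nat U + of_nat n - deg a)) = (\<Sum>a\<in>S. of_nat (cnt (starts a) Z))"
      using S(1) by (intro sum.cong) (auto simp: st begin_value)
    finally have "of_nat (cnt (\<lambda>x. full x \<and> set (fst (snd x)) \<inter> S \<noteq> {}) Z') \<le> of_nat N * (of_nat k - 1 :: rat)"
      by linarith
    then show ?thesis unfolding sumx using Npos by (simp add: divide_le_eq mult.commute)
  qed
  have "\<forall>Q\<in>DP. x Q \<in> \<int>" if "\<forall>P\<in>PP. y P \<in> \<int>"
    using N(3) that unfolding x_def by simp
  moreover have "\<forall>Q\<in>DP. 0 \<le> x Q" unfolding x_def by simp
  ultimately show ?thesis using val cap clique by (intro exI[of _ x] conjI allI impI ballI) simp_all
qed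

end

section \<open>Completing a flow of the given network to a robust one\<close>

definition wsum :: "(rat \<times> 'e list) list \<Rightarrow> ('e set \<Rightarrow> rat) \<Rightarrow> rat" where
  "wsum js f = (\<Sum>(w, p)\<leftarrow>js. w * f (set p))"

lemma wsum_simps [simp]:
  "wsum [] f = 0" "wsum ((w, p) # js) f = w * f (set p) + wsum js f" "wsum (js @ js') f = wsum js f + wsum js' f"
  by (simp_all add: wsum_def)

lemma wsum_map_upt: "wsum (map (\<lambda>a. (w a, p a)) [0..<m]) f = (\<Sum>a<m. w a * f (set (p a)))"
  by (induction m) auto

lemma wsum_map2:
  "wsum (concat (map (\<lambda>i. map (\<lambda>a. (w, p i a)) (filter (R i) [0..<m])) [0..<m'])) f =
    (\<Sum>i<m'. \<Sum>a<m. if R i a then w * f (set (p i a)) else 0)"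
proof -
  have "wsum (map (\<lambda>a. (w, p i a)) (filter (R i) [0..<m])) f = (\<Sum>a<m. if R i a then w * f (set (p i a)) else 0)" for i
    by (induction m) auto
  then show ?thesis by (induction m') auto
qed

lemma wsum_mono:
  assumes "\<And>w p. (w, p) \<in> set js \<Longrightarrow> 0 \<le> w" "\<And>w p. (w, p) \<in> set js \<Longrightarrow> f (set p) \<le> g (set p)"
  shows "wsum js f \<le> wsum js g"
  using assms
proof (induction js)
  case (Cons j js)
  obtain w p where j: "j = (w, p)" by (cases j)
  have "w * f (set p) \<le> w * g (set p)" using Cons.prems[of w p] by (intro mult_left_mono) (auto simp: j)
  moreover have "wsum js f \<le> wsum js g" using Cons by auto
  ultimately show ?case by (simp add: j)
qed simp

lemma wsum_add: "wsum js (\<lambda>P. f P + g P) = wsum js f + wsum js g"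
  by (induction js) (auto simp: algebra_simps)

lemma wsum_diff: "wsum js (\<lambda>P. f P - g P) = wsum js f - wsum js g"
  by (induction js) (auto simp: algebra_simps)

lemma wsum_sum: "wsum js (\<lambda>P. \<Sum>e\<in>A. f e P) = (\<Sum>e\<in>A. wsum js (f e))"
  by (induction js) (auto simp: sum.distrib sum_distrib_left)

text \<open>A flow is a function of arc sets, whereas the construction lists weighted paths,
  possibly with repeated sets. Adding the weights of equal sets loses nothing.\<close>

lemma wsum_collect:
  assumes "finite A" "\<And>w p. (w, p) \<in> set js \<Longrightarrow> set p \<in> A"
  shows "(\<Sum>P\<in>A. wsum js (\<lambda>P'. if P' = P then 1 else 0) * f P) = wsum js f"
  using assms(2)
proof (induction js)
  case (Cons j js)
  obtain w p where j: "j = (w, p)" by (cases j)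
  have "set p \<in> A" using Cons.prems[of w p] j by simp
  then have "(\<Sum>P\<in>A. w * (if set p = P then 1 else 0) * f P) = w * f (set p)"
    using sum.delta'[OF assms(1), of "set p" "\<lambda>P. w * f P"] by (simp add: if_distrib if_distribR cong: if_cong)
  moreover have "(\<Sum>P\<in>A. wsum js (\<lambda>P'. if P' = P then 1 else 0) * f P) = wsum js f"
    using Cons by auto
  ultimately show ?case by (simp add: j algebra_simps sum.distrib)
qed simp

lemma sum_if_const: "(\<Sum>x\<in>A. if b then f x else (0 :: rat)) = (if b then sum f A else 0)"
  by simp

lemma sum_prefix:
  "r \<le> m \<Longrightarrow> (\<Sum>i<m. if i < r then x else (0 :: rat)) = of_nat r * x"
  "r \<le> m \<Longrightarrow> (\<Sum>i<m. if r \<le> i then x else (0 :: rat)) = (of_nat m - of_nat r) * x"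
proof -
  assume r: "r \<le> m"
  have "{i \<in> {..<m}. i < r} = {..<r}" "{i \<in> {..<m}. r \<le> i} = {r..<m}" using r by auto
  then show "(\<Sum>i<m. if i < r then x else 0) = of_nat r * x"
    "(\<Sum>i<m. if r \<le> i then x else 0) = (of_nat m - of_nat r) * x"
    using r by (simp_all add: sum.If_cases Int_def of_nat_diff)
qed

lemma mem_concat_map: "y \<in> set xs \<Longrightarrow> x \<in> set (g y) \<Longrightarrow> x \<in> set (concat (map g xs))"
  by auto

context gadget
begin

definition pD :: "nat list \<Rightarrow> ar list" where
  "pD q = SrcA # concat (map (\<lambda>a. [Din a, Mid a, Dout a]) q) @ [SnkA]"

definition pE :: "nat \<Rightarrow> ar list" where
  "pE i = En i # map F [Suc i..<Suc n] @ [End]"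

definition pF :: "ar list" where
  "pF = map F [0..<Suc n] @ [End]"

text \<open>Colour \<open>i\<close> on its way to the guard \<open>h\<close> of \<open>a\<close>. If
  \<open>h\<close> holds and \<open>i\<close> is linked to \<open>a\<close>, its exit leads to
  \<open>i\<close> instead, and the link brings it back to \<open>a\<close>; in this way each link
  carries one unit that meets both of its arcs.\<close>

definition pC :: "bool \<Rightarrow> nat \<Rightarrow> nat \<Rightarrow> ar list" where
  "pC h i a = map F [0..<Suc i] @ Ex h i a # (if h \<and> link i a then [Mid i, Li i a] else []) @ [Mid a, Gu h a, Te h a]"

lemma mem_pE: "e \<in> set (pE i) \<longleftrightarrow>
    (case e of En j \<Rightarrow> j = i | F r \<Rightarrow> i < r \<and> r \<le> n | End \<Rightarrow> True | _ \<Rightarrow> False)"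
  unfolding pE_def by (cases e) auto

lemma mem_pF: "e \<in> set pF \<longleftrightarrow> (case e of F r \<Rightarrow> r \<le> n | End \<Rightarrow> True | _ \<Rightarrow> False)"
  unfolding pF_def by (cases e) auto

lemma mem_pC: "e \<in> set (pC h i a) \<longleftrightarrow>
    (case e of F r \<Rightarrow> r \<le> i | Ex h' j b \<Rightarrow> h' = h \<and> j = i \<and> b = a | Mid b \<Rightarrow> b = a \<or> h \<and> b = i \<and> link b a
      | Li b b' \<Rightarrow> h \<and> b = i \<and> b' = a \<and> link b b' | Gu h' b \<Rightarrow> h' = h \<and> b = a | Te h' b \<Rightarrow> h' = h \<and> b = a | _ \<Rightarrow> False)"
  unfolding pC_def by (cases e) auto

lemma path_PP: "set p \<subseteq> Collect ok \<Longrightarrow> chain src trg VS p VT \<Longrightarrow> distinct (VS # map trg p) \<Longrightarrow> set p \<in> PP"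
  unfolding path_sets_def set_arlist by blast

lemma chain_F: "i \<le> m \<Longrightarrow> chain src trg (Nu i) (map F [Suc i..<Suc m]) (Nu m)"
  by (induction m rule: dec_induct) (auto simp: chain_append)

lemma chain_F0: "chain src trg VS (map F [0..<Suc m]) (Nu m)"
  by (induction m) (auto simp: chain_append)

lemma pE_PP: "i < n \<Longrightarrow> set (pE i) \<in> PP"
proof (rule path_PP)
  assume i: "i < n"
  show "set (pE i) \<subseteq> Collect ok" using i by (auto simp: pE_def)
  have "chain src trg (Nu i) (map F [Suc i..<Suc n] @ [End]) VT"
    unfolding chain_append using chain_F[of i n] i by (intro exI[of _ "Nu n"] conjI) auto
  then show "chain src trg VS (pE i) VT" by (simp only: pE_def chain.simps src.simps trg.simps)
  show "distinct (VS # map trg (pE i))"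
    unfolding pE_def using i by (auto simp: comp_def distinct_map inj_on_def simp del: upt_Suc)
qed

lemma pF_PP: "set pF \<in> PP"
proof (rule path_PP)
  show "set pF \<subseteq> Collect ok" by (auto simp: pF_def)
  show "chain src trg VS pF VT" unfolding pF_def chain_append using chain_F0[of n] by (intro exI[of _ "Nu n"] conjI) auto
  show "distinct (VS # map trg pF)"
    unfolding pF_def by (auto simp: comp_def distinct_map inj_on_def simp del: upt_Suc)
qed

lemma no_self_link: "link a a = False"
  by (simp add: link_def)

lemma pC_PP: "i \<le> n \<Longrightarrow> a < n \<Longrightarrow> set (pC h i a) \<in> PP"
proof (rule path_PP)
  assume i: "i \<le> n" and a: "a < n"
  show "set (pC h i a) \<subseteq> Collect ok" using i a by (auto simp: pC_def dest: link_less)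
  show "chain src trg VS (pC h i a) VT"
    unfolding pC_def chain_append using chain_F0[of i] by (intro exI[of _ "Nu i"] conjI) auto
  show "distinct (VS # map trg (pC h i a))"
    unfolding pC_def by (auto simp: comp_def distinct_map inj_on_def no_self_link simp del: upt_Suc)
qed

lemma pD_PP:
  assumes "set q \<subseteq> {..<n}" "chain ta he s q t" "distinct (s # map he q)"
  shows "set (pD q) \<in> PP"
proof (rule path_PP)
  show "set (pD q) \<subseteq> Collect ok" using assms(1) by (auto simp: pD_def)
  have "chain ta he u q v \<Longrightarrow> chain src trg (V u) (concat (map (\<lambda>a. [Din a, Mid a, Dout a]) q)) (V v)" for u v q
    by (induction q arbitrary: u) auto
  from this[OF assms(2)] show "chain src trg VS (pD q) VT"
    unfolding pD_def by (auto simp: chain_append)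
  have d: "distinct (map trg (concat (map (\<lambda>a. [Din a, Mid a, Dout a]) q)))" if "distinct (map he q)" for q
    using that
  proof (induction q)
    case (Cons a q)
    then have "a \<notin> set q" "he a \<notin> he ` set q" by auto
    then show ?case using Cons by (auto simp: image_iff)
  qed simp
  have "V s \<notin> set (map trg (concat (map (\<lambda>a. [Din a, Mid a, Dout a]) q)))" using assms(3) by auto
  moreover have "VS \<notin> set (map trg (concat (map (\<lambda>a. [Din a, Mid a, Dout a]) q)))"
    "VT \<notin> set (map trg (concat (map (\<lambda>a. [Din a, Mid a, Dout a]) q)))" by auto
  ultimately show "distinct (VS # map trg (pD q))"
    unfolding pD_def using d[of q] assms(3) by simp
qed

text \<open>All coloured flow enters through \<open>F 0\<close>, while the supply of
  \<open>En i\<close> runs down the chain to \<open>End\<close>. The weight of \<open>pF\<close>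
  lifts the load of \<open>F r\<close> to the level at which it balances \<open>Te h a\<close>. The
  filler, \<open>Pr\<close>, dummy and \<open>P2\<close> paths saturate their starting arcs.\<close>

definition jN :: "(rat \<times> ar list) list" where
  "jN = map (\<lambda>i. (2 * of_nat n - 1, pE i)) [0..<n] @ [(of_nat (2 * n + 2 + \<kappa>), pF)] @
     concat (map (\<lambda>i. map (\<lambda>a. (1, pC False i a)) (filter (\<lambda>_. True) [0..<n])) [0..<Suc n]) @
     concat (map (\<lambda>i. map (\<lambda>a. (1, pC True i a)) (filter (\<lambda>_. True) [0..<n])) [0..<Suc n]) @
     map (\<lambda>a. (of_nat U, [Fi a, Mid a, Fo a])) [0..<n] @
     concat (map (\<lambda>a. map (\<lambda>b. (1, [Xi a b, Mid a, Xo a b])) (filter (\<lambda>b. \<not> link a b) [0..<n])) [0..<n]) @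
     map (\<lambda>a. (of_nat (U + 2 * n + 1), [Pr False a, Te False a])) [0..<n] @
     map (\<lambda>a. (of_nat (U + 2 * n + 1), [Pr True a, Te True a])) [0..<n] @
     map (\<lambda>j. (cap (Di j), [Di j])) [0..<k - 2] @ [(of_nat (U + 2 * n + 1), [P2])]"

lemma wN: "wsum jN f = (\<Sum>i<n. (2 * of_nat n - 1) * f (set (pE i))) + of_nat (2 * n + 2 + \<kappa>) * f (set pF) +
    (\<Sum>i<Suc n. \<Sum>a<n. f (set (pC False i a))) + (\<Sum>i<Suc n. \<Sum>a<n. f (set (pC True i a))) +
    (\<Sum>a<n. of_nat U * f {Fi a, Mid a, Fo a}) +
    (\<Sum>a<n. \<Sum>b<n. if link a b then 0 else f {Xi a b, Mid a, Xo a b}) +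
    (\<Sum>a<n. of_nat (U + 2 * n + 1) * f {Pr False a, Te False a}) +
    (\<Sum>a<n. of_nat (U + 2 * n + 1) * f {Pr True a, Te True a}) +
    (\<Sum>j<k - 2. cap (Di j) * f {Di j}) + of_nat (U + 2 * n + 1) * f {P2}"
proof -
  have neg: "(if \<not> b then y else 0) = (if b then 0 else y)" for b and y :: rat by simp
  show ?thesis
    unfolding jN_def
    by (simp only: wsum_simps wsum_map_upt wsum_map2 if_True mult_1 neg add.assoc add_0_right list.set)
qed

lemma jN_nonneg: "(v, p) \<in> set jN \<Longrightarrow> 0 \<le> v"
  using n1 unfolding jN_def by (auto simp: cap_def)

lemma jN_PP: "(v, p) \<in> set jN \<Longrightarrow> set p \<in> PP"
proof -
  assume "(v, p) \<in> set jN"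
  then consider i where "i < n" "p = pE i" | "p = pF" | i a where "i < Suc n" "a < n" "p = pC False i a"
    | i a where "i < Suc n" "a < n" "p = pC True i a"
    | a where "a < n" "p = [Fi a, Mid a, Fo a]" | a b where "a < n" "b < n" "\<not> link a b" "p = [Xi a b, Mid a, Xo a b]"
    | a where "a < n" "p = [Pr False a, Te False a]"
    | a where "a < n" "p = [Pr True a, Te True a]" | j where "j < k - 2" "p = [Di j]" | "p = [P2]"
    unfolding jN_def by (auto simp del: upt_Suc)
  then show "set p \<in> PP"
  proof cases
    case 1 then show ?thesis by (simp only: pE_PP)
  next
    case 2 then show ?thesis by (simp only: pF_PP)
  next
    case 3 then show ?thesis using pC_PP[of i a False] by simp
  next
    case 4 then show ?thesis using pC_PP[of i a True] by simp
  qed (rule path_PP; simp)+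
qed

lemma jN_int: "(v, p) \<in> set jN \<Longrightarrow> v \<in> \<int>"
  unfolding jN_def by (auto simp: cap_def)

text \<open>The part of the load of \<open>e\<close> that \<open>F r\<close> does not destroy
  already. Since there is no arc \<open>F (Suc n)\<close>, taking \<open>r = Suc n\<close> yields
  the whole load.\<close>

definition avd :: "ar \<Rightarrow> nat \<Rightarrow> ar set \<Rightarrow> rat" where
  "avd e r P = (if e \<in> P \<and> F r \<notin> P then 1 else 0)"

lemma ind_if: "ind e P = (if e \<in> P then 1 else 0)"
  by (simp add: ind_def)

lemmas mems = mem_pE mem_pF mem_pC

lemma nondeg: "(\<Sum>b<n. if link a b then 0 else 1) = of_nat n - deg a"
proof -
  have "(\<Sum>b<n. if link a b then 0 else 1) + deg a = (\<Sum>b<n. 1)"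
    unfolding deg_def sum.distrib[symmetric] by (intro sum.cong) auto
  then show ?thesis by simp
qed

lemma deg_nonneg: "0 \<le> deg a"
  unfolding deg_def by (intro sum_nonneg) auto

text \<open>Colour \<open>i\<close> avoids \<open>F r\<close> exactly if \<open>i < r\<close>. Two
  units of each such colour pass \<open>Mid a\<close> towards the guards of \<open>a\<close>, and
  colour \<open>a\<close> adds one unit for each link out of \<open>a\<close>.\<close>

lemma avd_Mid:
  assumes "a < n" "r \<le> Suc n"
  shows "wsum jN (avd (Mid a) r) = of_nat U + of_nat n - deg a + 2 * of_nat r + (if a < r then deg a else 0)"
proof -
  have C: "avd (Mid a) r (set (pC False i b)) = (if b = a then if i < r then 1 else 0 else 0)"
    "avd (Mid a) r (set (pC True i b)) = (if b = a then if i < r then 1 else 0 else 0) +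
       (if i = a then if a < r then if link a b then 1 else 0 else 0 else 0)" for i b
    by (auto simp: avd_def mem_pC no_self_link)
  have O: "avd (Mid a) r (set (pE i)) = 0" "avd (Mid a) r (set pF) = 0"
    "avd (Mid a) r {Fi b, Mid b, Fo b} = (if b = a then 1 else 0)"
    "avd (Mid a) r {Xi b b', Mid b, Xo b b'} = (if b = a then 1 else 0)"
    "avd (Mid a) r {Pr h b, Te h b} = 0" "avd (Mid a) r {Di j} = 0" "avd (Mid a) r {P2} = 0" for i b b' h j
    by (auto simp: avd_def mems)
  have s: "(\<Sum>i<Suc n. \<Sum>b<n. if b = a then if i < r then 1 else 0 else 0) = (of_nat r :: rat)"
    using assms sum_prefix(1)[OF assms(2), of 1] by (simp del: sum.lessThan_Suc)
  have s2: "(\<Sum>i<Suc n. \<Sum>b<n. if i = a then if a < r then if link a b then 1 else 0 else 0 else 0) = (if a < r then deg a else 0)"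
    using assms(1) by (simp add: sum_if_const deg_def del: sum.lessThan_Suc)
  have s3: "(\<Sum>b<n. \<Sum>b'<n. if link b b' then 0 else (if b = a then 1 else 0)) = of_nat n - deg a"
    using delta_simps(2)[OF assms(1), of link "\<lambda>_ _. 1" n] nondeg by simp
  show ?thesis
    unfolding wN C O sum.distrib s s2 s3 using assms(1) by (simp add: if_simps)
qed

lemma avd_Te:
  assumes "a < n" "r \<le> Suc n"
  shows "wsum jN (avd (Te h a) r) = of_nat (U + 2 * n + 1 + r)"
proof -
  have C: "avd (Te h a) r (set (pC h' i b)) = (if h' = h then if b = a then if i < r then 1 else 0 else 0 else 0)" for i b h'
    by (auto simp: avd_def mem_pC)
  have O: "avd (Te h a) r (set (pE i)) = 0" "avd (Te h a) r (set pF) = 0"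
    "avd (Te h a) r {Fi b, Mid b, Fo b} = 0" "avd (Te h a) r {Xi b b', Mid b, Xo b b'} = 0"
    "avd (Te h a) r {Pr h' b, Te h' b} = (if h' = h then if b = a then 1 else 0 else 0)"
    "avd (Te h a) r {Di j} = 0" "avd (Te h a) r {P2} = 0" for i b b' h' j
    by (auto simp: avd_def mems)
  have s: "(\<Sum>i<Suc n. \<Sum>b<n. if b = a then if i < r then 1 else 0 else 0) = (of_nat r :: rat)"
    using assms sum_prefix(1)[OF assms(2), of 1] by (simp del: sum.lessThan_Suc)
  show ?thesis
    unfolding wN C O using assms(1) s by (cases h) (simp_all add: if_simps sum_if_const cong: if_cong del: sum.lessThan_Suc)
qed

lemma avd_End:
  assumes "r \<le> n"
  shows "wsum jN (avd End r) \<le> of_nat n * (2 * of_nat n - 1)"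
proof -
  have O: "avd End r (set pF) = 0" "avd End r (set (pC h i b)) = 0"
    "avd End r {Fi b, Mid b, Fo b} = 0" "avd End r {Xi b b', Mid b, Xo b b'} = 0"
    "avd End r {Pr h b, Te h b} = 0" "avd End r {Di j} = 0" "avd End r {P2} = 0" for i b b' h j
    using assms by (auto simp: avd_def mems)
  have "(\<Sum>i<n. (2 * of_nat n - 1) * avd End r (set (pE i))) \<le> (\<Sum>i<n. 2 * of_nat n - 1)"
    using n1 by (intro sum_mono) (auto simp: avd_def)
  then show ?thesis unfolding wN O by simp
qed

text \<open>The joint damage of all chain arcs. It stays below \<open>2 M\<close>, so any number of
  them together does no more harm than two arcs of load \<open>M\<close>.\<close>

definition anyF :: "ar set \<Rightarrow> rat" where
  "anyF P = (if \<exists>r. F r \<in> P then 1 else 0)"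

lemma anyF_value: "wsum jN anyF \<le> of_nat (2 * M) - 1"
proof -
  have O: "anyF (set (pE i)) \<le> 1" "anyF (set pF) = 1" "anyF (set (pC h i b)) = 1"
    "anyF {Fi b, Mid b, Fo b} = 0" "anyF {Xi b b', Mid b, Xo b b'} = 0"
    "anyF {Pr h b, Te h b} = 0" "anyF {Di j} = 0" "anyF {P2} = 0" for i b b' h j
    by (auto simp: anyF_def mems)
  have "(\<Sum>i<n. (2 * of_nat n - 1) * anyF (set (pE i))) \<le> (\<Sum>i<n. (2 * of_nat n - 1))"
    using n1 O(1) by (intro sum_mono) (auto intro: mult_left_le)
  moreover have "of_nat \<kappa> \<le> (of_nat n + 1 :: rat)" unfolding \<kappa>_def by (simp flip: of_nat_Suc)
  ultimately show ?thesis unfolding wN O(2-) by (simp add: M_def U_def algebra_simps)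
qed

text \<open>Passing from \<open>r\<close> to \<open>r + 1\<close> the chain gains
  \<open>2 n - 1\<close> units from \<open>En r\<close> and loses the \<open>2 n\<close> units of
  colour \<open>r\<close>.\<close>

lemma load_F:
  assumes "r \<le> n"
  shows "wsum jN (ind (F r)) = of_nat M + of_nat \<kappa> - 2 + (of_nat n + 1 - of_nat r)"
proof -
  have O: "ind (F r) (set (pE i)) = (if i < r then 1 else 0)" "ind (F r) (set pF) = 1"
    "ind (F r) (set (pC h i b)) = (if r \<le> i then 1 else 0)"
    "ind (F r) {Fi b, Mid b, Fo b} = 0" "ind (F r) {Xi b b', Mid b, Xo b b'} = 0"
    "ind (F r) {Pr h b, Te h b} = 0" "ind (F r) {Di j} = 0" "ind (F r) {P2} = 0" for i b b' h j
    using assms by (auto simp: ind_if mems)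
  have s1: "(\<Sum>i<n. (2 * of_nat n - 1) * (if i < r then 1 else 0)) = of_nat r * (2 * of_nat n - 1 :: rat)"
    using sum_prefix(1)[OF assms, of "2 * of_nat n - 1"] by (simp only: if_simps)
  have s2: "(\<Sum>i<Suc n. \<Sum>b<n. if r \<le> i then 1 else 0) = (of_nat (Suc n) - of_nat r) * (of_nat n :: rat)"
    using sum_prefix(2)[of r "Suc n" "of_nat n"] assms by (simp add: sum_if_const if_simps cong: if_cong del: sum.lessThan_Suc)
  show ?thesis
    unfolding wN O s1 s2 by (simp add: M_def U_def algebra_simps cong: if_cong)
qed

lemma pair_le:
  fixes f :: "nat \<Rightarrow> nat \<Rightarrow> rat"
  assumes "\<And>i b. f i b \<le> (if i = i' then if b = b' then 1 else 0 else 0)"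
  shows "(\<Sum>i<m. \<Sum>b<m'. f i b) \<le> 1"
proof -
  have "(\<Sum>i<m. \<Sum>b<m'. f i b) \<le> (\<Sum>i<m. \<Sum>b<m'. if i = i' then if b = b' then 1 else 0 else 0)"
    by (intro sum_mono assms)
  also have "\<dots> \<le> 1" by (simp add: sum_if_const)
  finally show ?thesis .
qed

lemma load_rest:
  assumes "ok e" "\<And>a. e \<noteq> Mid a" "\<And>h a. e \<noteq> Te h a" "\<And>r. e \<noteq> F r" "e \<noteq> SrcA" "e \<noteq> SnkA" "\<And>a. e \<noteq> Din a" "\<And>a. e \<noteq> Dout a"
  shows "wsum jN (ind e) \<le> cap e"
proof (cases e)
  case (Fi a)
  then show ?thesis using assms(1) unfolding wN by (simp add: ind_if mems cap_def if_simps cong: if_cong)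
next
  case (Fo a)
  then show ?thesis using assms(1) unfolding wN by (simp add: ind_if mems cap_def if_simps cong: if_cong)
next
  case (Pr h a)
  then show ?thesis using assms(1) unfolding wN
    by (cases h) (simp_all add: ind_if mems cap_def if_simps cong: if_cong)
next
  case (Gu h a)
  then show ?thesis using assms(1) unfolding wN
    by (cases h) (simp_all add: ind_if mems cap_def if_simps cong: if_cong del: sum.lessThan_Suc)
next
  case (En a)
  then show ?thesis using assms(1) n1 unfolding wN by (simp add: ind_if mems cap_def if_simps of_nat_diff cong: if_cong)
next
  case End
  then show ?thesis unfolding wN by (simp add: ind_if mems cap_def U_def algebra_simps cong: if_cong)
next
  case (Ex h i b)
  have z: "ind e (set (pE i)) = 0" "ind e (set pF) = 0" "ind e {Fi b, Mid b, Fo b} = 0" "ind e {Xi b b', Mid b, Xo b b'} = 0"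
    "ind e {Pr h b, Te h b} = 0" "ind e {Di j} = 0" "ind e {P2} = 0" for i b b' h j
    using Ex by (auto simp: ind_if mems split: if_splits)
  have "(\<Sum>j<Suc n. \<Sum>a<n. ind e (set (pC h j a))) \<le> 1"
    by (rule pair_le[of _ i b]) (auto simp: ind_if mem_pC Ex)
  moreover have "(\<Sum>j<Suc n. \<Sum>a<n. ind e (set (pC (\<not> h) j a))) = 0"
    by (intro sum.neutral ballI) (auto simp: ind_if mem_pC Ex)
  ultimately show ?thesis unfolding wN z(1-7) using Ex by (cases h) (simp_all add: cap_def del: sum.lessThan_Suc)
next
  case (Li a b)
  have z: "ind e (set (pE i)) = 0" "ind e (set pF) = 0" "ind e {Fi b, Mid b, Fo b} = 0" "ind e {Xi b b', Mid b, Xo b b'} = 0"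
    "ind e {Pr h b, Te h b} = 0" "ind e {Di j} = 0" "ind e {P2} = 0" "ind e (set (pC False i b)) = 0" for i b b' h j
    using Li by (auto simp: ind_if mems)
  have "(\<Sum>j<Suc n. \<Sum>a<n. ind e (set (pC True j a))) \<le> 1"
    by (rule pair_le[of _ a b]) (auto simp: ind_if mem_pC Li)
  then show ?thesis unfolding wN z using Li by (simp add: cap_def del: sum.lessThan_Suc)
next
  case (Xi a b)
  have z: "ind e (set (pE i)) = 0" "ind e (set pF) = 0" "ind e {Fi b, Mid b, Fo b} = 0"
    "ind e {Pr h b, Te h b} = 0" "ind e {Di j} = 0" "ind e {P2} = 0" "ind e (set (pC h i b)) = 0" for i b b' h j
    using Xi by (auto simp: ind_if mems)
  have "(\<Sum>j<n. \<Sum>c<n. if link j c then 0 else ind e {Xi j c, Mid j, Xo j c}) \<le> 1"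
    by (rule pair_le[of _ a b]) (auto simp: ind_if Xi)
  then show ?thesis unfolding wN z using Xi by (simp add: cap_def)
next
  case (Xo a b)
  have z: "ind e (set (pE i)) = 0" "ind e (set pF) = 0" "ind e {Fi b, Mid b, Fo b} = 0"
    "ind e {Pr h b, Te h b} = 0" "ind e {Di j} = 0" "ind e {P2} = 0" "ind e (set (pC h i b)) = 0" for i b b' h j
    using Xo by (auto simp: ind_if mems)
  have "(\<Sum>j<n. \<Sum>c<n. if link j c then 0 else ind e {Xi j c, Mid j, Xo j c}) \<le> 1"
    by (rule pair_le[of _ a b]) (auto simp: ind_if Xo)
  then show ?thesis unfolding wN z using Xo by (simp add: cap_def)
next
  case (Di j)
  then show ?thesis using assms(1) unfolding wN by (simp add: ind_if mems if_simps cong: if_cong)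
next
  case P2
  then show ?thesis unfolding wN by (simp add: ind_if mems cap_def cong: if_cong)
qed (use assms in auto)

text \<open>The path \<open>pC True a b\<close> takes the link, and all other weights are
  nonnegative.\<close>

lemma load_Li: "link a b \<Longrightarrow> 1 \<le> wsum jN (ind (Li a b))"
proof -
  assume l: "link a b"
  then have ab: "a < Suc n" "b < n" using link_less[OF l] by auto
  have "(1 :: rat, pC True a b) \<in>
      set (concat (map (\<lambda>i. map (\<lambda>a. (1, pC True i a)) (filter (\<lambda>_. True) [0..<n])) [0..<Suc n]))"
    using ab by (intro mem_concat_map[of a]) (auto simp del: upt_Suc)
  then have "(1, pC True a b) \<in> set jN" unfolding jN_def set_append Un_iff by (intro disjI2 disjI1)
  then obtain js js' where js: "jN = js @ (1, pC True a b) # js'" by (meson split_list)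
  have nn: "0 \<le> wsum zs (ind (Li a b))" if "set zs \<subseteq> set jN" for zs
  proof -
    have "wsum zs (\<lambda>_. 0) \<le> wsum zs (ind (Li a b))"
      using that jN_nonneg by (intro wsum_mono) auto
    moreover have "wsum zs (\<lambda>_ :: ar set. 0) = 0" by (induction zs) auto
    ultimately show ?thesis by simp
  qed
  have "ind (Li a b) (set (pC True a b)) = 1" using l by (simp add: ind_if mem_pC)
  moreover have "0 \<le> wsum js (ind (Li a b))" "0 \<le> wsum js' (ind (Li a b))"
    by (rule nn, simp add: js, blast)+
  ultimately show ?thesis unfolding js by simp
qed

lemma Di_sum: "(\<Sum>j<k - 2. cap (Di j)) = (of_nat \<kappa> - 2) * (of_nat M - 1) + (of_nat k - of_nat \<kappa>) * of_nat Q"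
proof -
  have k: "2 \<le> \<kappa>" "\<kappa> \<le> k" using k2 n1 by (auto simp: \<kappa>_def)
  have "(\<Sum>j<k - 2. cap (Di j)) = (\<Sum>j<k - 2. (if j < \<kappa> - 2 then of_nat M - 1 else 0) + (if \<kappa> - 2 \<le> j then of_nat Q else 0))"
    by (intro sum.cong) (auto simp: cap_def M_def)
  also have "\<dots> = of_nat (\<kappa> - 2) * (of_nat M - 1) + (of_nat (k - 2) - of_nat (\<kappa> - 2)) * of_nat Q"
    unfolding sum.distrib using k by (simp only: sum_prefix[of "\<kappa> - 2" "k - 2"] diff_le_mono)
  also have "\<dots> = (of_nat \<kappa> - 2) * (of_nat M - 1) + (of_nat k - of_nat \<kappa>) * of_nat Q"
    using k by (simp add: of_nat_diff)
  finally show ?thesis .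
qed

text \<open>The surplus over \<open>L - \<theta>\<close> equals the bound of
  \<open>bound_all\<close> on the flow that \<open>k\<close> arcs can destroy; together with the
  given flow of value \<theta> this leaves \<open>L\<close>.\<close>

lemma total_N: "wsum jN (\<lambda>_. 1) = L - \<theta> + of_nat \<kappa> * of_nat M - 1 + (of_nat k - of_nat \<kappa>) * of_nat Q"
proof -
  have "L = \<theta> + (\<Sum>a<n. 2 * of_nat n - 1) + (\<Sum>a<n. of_nat U) + (\<Sum>h\<in>(UNIV :: bool set). \<Sum>a<n. of_nat (U + 2 * n + 1)) +
      (\<Sum>a<n. \<Sum>b<n. if link a b then 0 else 1)"
    unfolding L_eq sumO using n1 by (simp add: cap_def of_nat_diff cong: if_cong)
  then show ?thesis
    unfolding wN mult_1_right Di_sum by (simp add: M_def U_def UNIV_bool algebra_simps cong: if_cong)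
qed

end

context gadget
begin

lemma kap: "2 \<le> \<kappa>" "\<kappa> \<le> k" "\<kappa> \<le> n + 1"
  using k2 n1 by (auto simp: \<kappa>_def)

lemma kapr: "of_nat \<kappa> \<le> (of_nat n + 1 :: rat)"
  using kap(3) by (simp flip: of_nat_Suc)

lemma n1r: "1 \<le> (of_nat n :: rat)"
  using n1 by simp

lemma cap_le_Q: "ok e \<Longrightarrow> cap e \<le> of_nat Q"
  using theta(2) kapr n1r by (cases e) (auto simp: cap_def Q_def M_def of_nat_diff)

end

locale gadget_forward = gadget +
  fixes x :: "nat set \<Rightarrow> rat"
  assumes x_nonneg: "\<And>B. B \<in> DP \<Longrightarrow> 0 \<le> x B"
    and x_cap: "\<And>a. a < n \<Longrightarrow> (\<Sum>B | B \<in> DP \<and> a \<in> B. x B) \<le> 1"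
    and x_value: "(\<Sum>B\<in>DP. x B) = \<theta>"
    and x_clique: "\<And>S. S \<subseteq> {..<n} \<Longrightarrow> card S = k \<Longrightarrow> (\<And>a b. a \<in> S \<Longrightarrow> b \<in> S \<Longrightarrow> \<not> link a b) \<Longrightarrow>
      (\<Sum>B | B \<in> DP \<and> B \<inter> S \<noteq> {}. x B) \<le> of_nat k - 1"
begin

text \<open>The flow is indexed by arc sets, so for each set an ordering as a path has to be
  chosen.\<close>

lemma ex_jD:
  "\<exists>js :: (rat \<times> ar list) list. (\<forall>(v, p)\<in>set js. 0 \<le> v \<and> set p \<in> PP \<and> (\<exists>B\<in>DP. v = x B)) \<and>
     (\<forall>f. wsum js f = (\<Sum>B\<in>DP. x B * f ({SrcA, SnkA} \<union> Din ` B \<union> Mid ` B \<union> Dout ` B)))"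
proof -
  have fin: "finite DP" by (simp add: finite_path_sets)
  obtain Bs where Bs: "set Bs = DP" "distinct Bs" using finite_distinct_list[OF fin] by blast
  have "\<exists>q. B = set q \<and> set (pD q) \<in> PP" if "B \<in> DP" for B
    using that pD_PP unfolding path_sets_def by blast
  then obtain q where q: "\<And>B. B \<in> DP \<Longrightarrow> B = set (q B) \<and> set (pD (q B)) \<in> PP" by metis
  have pD: "set (pD (q B)) = {SrcA, SnkA} \<union> Din ` B \<union> Mid ` B \<union> Dout ` B" if "B \<in> DP" for B
  proof -
    have "set (pD q') = {SrcA, SnkA} \<union> Din ` set q' \<union> Mid ` set q' \<union> Dout ` set q'" for q'
      unfolding pD_def by auto
    then show ?thesis using q[OF that] by simp
  qed
  let ?js = "map (\<lambda>B. (x B, pD (q B))) Bs"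
  have "wsum ?js f = (\<Sum>B\<in>DP. x B * f ({SrcA, SnkA} \<union> Din ` B \<union> Mid ` B \<union> Dout ` B))" for f
  proof -
    have "wsum ?js f = (\<Sum>B\<leftarrow>Bs. x B * f (set (pD (q B))))" by (simp add: wsum_def comp_def)
    also have "\<dots> = (\<Sum>B\<in>DP. x B * f (set (pD (q B))))"
      using Bs by (simp add: sum_list_distinct_conv_sum_set)
    also have "\<dots> = (\<Sum>B\<in>DP. x B * f ({SrcA, SnkA} \<union> Din ` B \<union> Mid ` B \<union> Dout ` B))"
      by (intro sum.cong) (simp_all only: pD)
    finally show ?thesis .
  qed
  moreover have "\<forall>(v, p)\<in>set ?js. 0 \<le> v \<and> set p \<in> PP \<and> (\<exists>B\<in>DP. v = x B)"
    using q x_nonneg Bs(1) by auto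
  ultimately show ?thesis by (intro exI[of _ ?js] conjI allI)
qed

definition jD :: "(rat \<times> ar list) list" where
  "jD = (SOME js. (\<forall>(v, p)\<in>set js. 0 \<le> v \<and> set p \<in> PP \<and> (\<exists>B\<in>DP. v = x B)) \<and>
     (\<forall>f. wsum js f = (\<Sum>B\<in>DP. x B * f ({SrcA, SnkA} \<union> Din ` B \<union> Mid ` B \<union> Dout ` B))))"

lemma jD: "(v, p) \<in> set jD \<Longrightarrow> 0 \<le> v" "(v, p) \<in> set jD \<Longrightarrow> set p \<in> PP"
    "(v, p) \<in> set jD \<Longrightarrow> \<exists>B\<in>DP. v = x B"
  and wD: "wsum jD f = (\<Sum>B\<in>DP. x B * f ({SrcA, SnkA} \<union> Din ` B \<union> Mid ` B \<union> Dout ` B))"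
  using someI_ex[OF ex_jD] unfolding jD_def[symmetric] by blast+

abbreviation A :: "(ar set \<Rightarrow> rat) \<Rightarrow> rat" where "A \<equiv> wsum (jD @ jN)"

lemma jA_nonneg: "(v, p) \<in> set (jD @ jN) \<Longrightarrow> 0 \<le> v"
  using jD(1) jN_nonneg by auto

lemma jA_PP: "(v, p) \<in> set (jD @ jN) \<Longrightarrow> set p \<in> PP"
  using jD(2) jN_PP by auto

lemma A_mono: "(\<And>P. P \<in> PP \<Longrightarrow> f P \<le> g P) \<Longrightarrow> A f \<le> A g"
  by (rule wsum_mono[OF jA_nonneg]) (use jA_PP in blast)+

lemma sum_DP_if: "(\<Sum>B\<in>DP. x B * (if R B then 1 else 0)) = (\<Sum>B | B \<in> DP \<and> R B. x B)"
  by (rule sum.mono_neutral_cong_right) (auto simp: finite_path_sets)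

lemma D_zero: "(\<And>B. f ({SrcA, SnkA} \<union> Din ` B \<union> Mid ` B \<union> Dout ` B) = 0) \<Longrightarrow> wsum jD f = 0"
  unfolding wD by simp

lemma D_le: "(\<And>B. f ({SrcA, SnkA} \<union> Din ` B \<union> Mid ` B \<union> Dout ` B) \<le> (if R B then 1 else 0)) \<Longrightarrow>
    wsum jD f \<le> (\<Sum>B | B \<in> DP \<and> R B. x B)"
  unfolding wD sum_DP_if[symmetric] by (intro sum_mono mult_left_mono x_nonneg)

lemma avd_load: "P \<in> PP \<Longrightarrow> avd e (Suc n) P = ind e P"
  using path_sets_subset[of P src trg "set arlist" VS VT] by (auto simp: avd_def ind_if set_arlist subset_iff)

lemma A_load: "A (ind e) = A (avd e (Suc n))"
  by (intro antisym A_mono) (simp_all only: avd_load order.refl)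

lemma avd_Mid_le:
  assumes "a < n" "r \<le> Suc n"
  shows "A (avd (Mid a) r) \<le> of_nat U + of_nat n + 1 + 2 * of_nat r"
proof -
  have "wsum jD (avd (Mid a) r) \<le> (\<Sum>B | B \<in> DP \<and> a \<in> B. x B)"
    by (rule D_le) (auto simp: avd_def)
  also have "\<dots> \<le> 1" by (rule x_cap[OF assms(1)])
  finally show ?thesis using avd_Mid[OF assms] deg_nonneg[of a] by (simp split: if_splits)
qed

lemma D_Te: "wsum jD (avd (Te h a) r) = 0" by (rule D_zero) (auto simp: avd_def)
lemma D_F: "wsum jD (ind (F r)) = 0" by (rule D_zero) (auto simp: ind_if)
lemma D_End: "wsum jD (avd End r) = 0" by (rule D_zero) (auto simp: avd_def)

lemma load_cap: "ok e \<Longrightarrow> A (ind e) \<le> cap e"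
proof -
  assume e: "ok e"
  have kap: "of_nat \<kappa> \<le> (of_nat n + 1 :: rat)" unfolding \<kappa>_def by (simp flip: of_nat_Suc)
  have N0: "wsum jN (ind e) = 0" if "\<And>p v. (v, p) \<in> set jN \<Longrightarrow> e \<notin> set p"
  proof -
    have "wsum jN (ind e) \<le> wsum jN (\<lambda>_. 0)" using that jN_nonneg by (intro wsum_mono) (auto simp: ind_if)
    moreover have "wsum jN (\<lambda>_. 0) \<le> wsum jN (ind e)" using jN_nonneg by (intro wsum_mono) auto
    moreover have "wsum js (\<lambda>_ :: ar set. 0) = 0" for js by (induction js) auto
    ultimately show ?thesis by simp
  qed
  have rest: "wsum jN (ind e) \<le> cap e \<Longrightarrow> wsum jD (ind e) = 0 \<Longrightarrow> ?thesis" by simp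
  show ?thesis
  proof (cases e)
    case (Mid a)
    then show ?thesis using e avd_Mid_le[of a "Suc n"] unfolding A_load by (simp add: cap_def Q_def)
  next
    case (Te h a)
    then show ?thesis using e avd_Te[of a "Suc n" h] D_Te[of h a "Suc n"] unfolding A_load by (simp add: cap_def Q_def)
  next
    case (F r)
    then show ?thesis using e load_F[of r] D_F[of r] kap by (simp add: cap_def Q_def M_def)
  next
    case SrcA
    have "wsum jN (ind e) = 0" unfolding wN SrcA by (simp add: ind_if mems cong: if_cong)
    moreover have "wsum jD (ind e) \<le> (\<Sum>B | B \<in> DP \<and> True. x B)" unfolding SrcA by (rule D_le) (auto simp: ind_if)
    ultimately show ?thesis using x_value SrcA by (simp add: cap_def)
  next
    case SnkA
    have "wsum jN (ind e) = 0" unfolding wN SnkA by (simp add: ind_if mems cong: if_cong)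
    moreover have "wsum jD (ind e) \<le> (\<Sum>B | B \<in> DP \<and> True. x B)" unfolding SnkA by (rule D_le) (auto simp: ind_if)
    ultimately show ?thesis using x_value SnkA by (simp add: cap_def)
  next
    case (Din a)
    have "wsum jN (ind e) = 0" unfolding wN Din by (simp add: ind_if mems cong: if_cong)
    moreover have "wsum jD (ind e) \<le> (\<Sum>B | B \<in> DP \<and> a \<in> B. x B)" unfolding Din by (rule D_le) (auto simp: ind_if)
    ultimately show ?thesis using x_cap[of a] e Din by (simp add: cap_def)
  next
    case (Dout a)
    have "wsum jN (ind e) = 0" unfolding wN Dout by (simp add: ind_if mems cong: if_cong)
    moreover have "wsum jD (ind e) \<le> (\<Sum>B | B \<in> DP \<and> a \<in> B. x B)" unfolding Dout by (rule D_le) (auto simp: ind_if)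
    ultimately show ?thesis using x_cap[of a] e Dout by (simp add: cap_def)
  qed (intro rest load_rest e D_zero; simp add: ind_if image_iff)+
qed

text \<open>Dummy arcs of load \<open>Q\<close>, present only if \<open>k > n + 1\<close>. They
  absorb the budget beyond \<kappa>.\<close>

definition excess :: "ar \<Rightarrow> bool" where
  "excess e \<longleftrightarrow> (\<exists>j. e = Di j \<and> \<kappa> - 2 \<le> j)"

lemma Ur: "of_nat U = 2 * of_nat n * (of_nat n :: rat)"
  by (simp add: U_def)

lemma load_Q: "ok e \<Longrightarrow> A (ind e) \<le> of_nat Q"
  using load_cap cap_le_Q order.trans by metis

lemma avd_le_ind: "A (avd e r) \<le> A (ind e)"
  by (rule A_mono) (auto simp: avd_def ind_if)

lemma small_cap:
  assumes "ok e" "\<And>a. e \<noteq> Mid a" "\<And>h a. e \<noteq> Te h a" "\<And>r. e \<noteq> F r" "\<And>j. e \<noteq> Di j" "e \<noteq> End"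
  shows "cap e \<le> of_nat U + 2 * of_nat n + 1"
  using assms theta(2) n1r by (cases e) (auto simp: cap_def of_nat_diff)

text \<open>The right-hand side is what complements the load of \<open>F r\<close> to the tight
  value; \<open>Mid a\<close> meets it because \<open>r \<le> n\<close>.\<close>

lemma avoid_le:
  assumes "ok e" "\<And>r. e \<noteq> F r" "\<And>j. e \<noteq> Di j" "r \<le> n"
  shows "A (avd e r) \<le> of_nat U + 2 * of_nat n + 1 + of_nat r"
proof (cases "(\<exists>a. e = Mid a) \<or> (\<exists>h a. e = Te h a) \<or> e = End")
  case True
  then consider a where "e = Mid a" | h a where "e = Te h a" | "e = End" by blast
  then show ?thesis
  proof cases
    case 1
    then show ?thesis using avd_Mid_le[of a r] assms(1,4) by simp
  next
    case 2
    then show ?thesis using avd_Te[of a r h] D_Te[of h a r] assms(1,4) by simp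
  next
    case 3
    have "of_nat n * (2 * of_nat n - 1) = of_nat U - (of_nat n :: rat)" by (simp add: Ur algebra_simps)
    then show ?thesis using avd_End[OF assms(4)] D_End[of r] 3 by simp
  qed
next
  case False
  then have "cap e \<le> of_nat U + 2 * of_nat n + 1" using assms by (intro small_cap) auto
  moreover have "A (avd e r) \<le> cap e" using avd_le_ind load_cap[OF assms(1)] by (rule order.trans)
  moreover have "0 \<le> (of_nat r :: rat)" by simp
  ultimately show ?thesis by linarith
qed

lemma load_notF:
  assumes "ok e" "\<And>r. e \<noteq> F r" "\<not> excess e"
  shows "A (ind e) \<le> of_nat M" "(\<And>a. e \<noteq> Mid a) \<Longrightarrow> A (ind e) \<le> of_nat M - 1"
proof -
  show 1: "A (ind e) \<le> of_nat M - 1" if m: "\<And>a. e \<noteq> Mid a"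
  proof (cases "(\<exists>h a. e = Te h a) \<or> e = End \<or> (\<exists>j. e = Di j)")
    case True
    then consider h a where "e = Te h a" | "e = End" | j where "e = Di j" by blast
    then show ?thesis
    proof cases
      case 1
      then show ?thesis using avd_Te[of a "Suc n" h] D_Te[of h a "Suc n"] assms(1) unfolding A_load by (simp add: M_def)
    next
      case 2
      then show ?thesis using load_cap[OF assms(1)] kapr n1r by (simp add: cap_def M_def)
    next
      case 3
      then show ?thesis using load_cap[OF assms(1)] assms(3) by (auto simp: cap_def M_def excess_def)
    qed
  next
    case False
    then have "cap e \<le> of_nat U + 2 * of_nat n + 1" using assms m by (intro small_cap) auto
    then show ?thesis using load_cap[OF assms(1)] by (simp add: M_def)
  qed
  show "A (ind e) \<le> of_nat M"
  proof (cases "\<exists>a. e = Mid a")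
    case True
    then obtain a where "e = Mid a" ..
    then show ?thesis using avd_Mid_le[of a "Suc n"] assms(1) unfolding A_load by (simp add: M_def)
  next
    case False
    then show ?thesis using 1 by simp
  qed
qed

definition meet :: "ar set \<Rightarrow> ar set \<Rightarrow> rat" where
  "meet S P = (if P \<inter> S = {} then 0 else 1)"

lemma meet_le: "finite S \<Longrightarrow> meet S P \<le> (\<Sum>e\<in>S. ind e P)"
proof (cases "P \<inter> S = {}")
  case False
  assume "finite S"
  obtain e where e: "e \<in> P" "e \<in> S" using False by blast
  have "ind e P \<le> (\<Sum>e\<in>S. ind e P)" using e \<open>finite S\<close> by (intro member_le_sum) auto
  then show ?thesis using e False by (simp add: meet_def ind_if)
qed (simp add: meet_def sum_nonneg)

lemma A_meet_le: "finite S \<Longrightarrow> A (meet S) \<le> (\<Sum>e\<in>S. A (ind e))"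
  unfolding wsum_sum[symmetric] by (intro A_mono meet_le)

text \<open>One unit must be saved against \<open>\<kappa> M\<close>. A linked pair in
  \<open>S\<close> saves it through the path that uses the link and meets both arcs. Otherwise
  \<open>S\<close> is a clique of \<open>k\<close> arcs, and the hypothesis on the given flow saves
  it.\<close>

lemma bound_Mid:
  assumes S: "S \<subseteq> {..<n}" "card S = \<kappa>"
  shows "A (meet (Mid ` S)) \<le> of_nat \<kappa> * of_nat M - 1"
proof -
  have fin: "finite S" using S(1) finite_subset by blast
  have "\<kappa> \<le> n" using card_mono[OF _ S(1)] S(2) by simp
  \<comment> \<open>At most \<open>n\<close> arcs \<open>Mid a\<close> exist, so the cut-off at
    \<open>n + 1\<close> is not active here.\<close>
  then have kk: "\<kappa> = k" by (simp add: \<kappa>_def)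
  have sumM: "(\<Sum>e\<in>Mid ` S. f e) = (\<Sum>a\<in>S. f (Mid a))" for f :: "ar \<Rightarrow> rat"
    by (subst sum.reindex) (auto simp: inj_on_def)
  show ?thesis
  proof (cases "\<exists>a\<in>S. \<exists>b\<in>S. link a b")
    case True
    then obtain a b where ab: "a \<in> S" "b \<in> S" "link a b" by blast
    have ne: "a \<noteq> b" using ab(3) no_self_link by auto
    \<comment> \<open>The sum counts a path through the link for \<open>a\<close> and again for
      \<open>b\<close>, so one copy may be taken off. Testing for both \<open>Mid\<close> arcs makes
      the inequality hold for every set; that the link entails them is then checked on the listed
      paths.\<close>
    have "A (meet (Mid ` S)) \<le> A (\<lambda>P. (\<Sum>a\<in>S. ind (Mid a) P) - (if Li a b \<in> P then if Mid a \<in> P then if Mid b \<in> P then 1 else 0 else 0 else 0))"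
    proof (rule A_mono)
      fix P
      show "meet (Mid ` S) P \<le> (\<Sum>a\<in>S. ind (Mid a) P) - (if Li a b \<in> P then if Mid a \<in> P then if Mid b \<in> P then 1 else 0 else 0 else 0)"
      proof (cases "Li a b \<in> P \<and> Mid a \<in> P \<and> Mid b \<in> P")
        case True
        have "(\<Sum>a\<in>{a, b}. ind (Mid a) P) \<le> (\<Sum>a\<in>S. ind (Mid a) P)"
          using ab fin by (intro sum_mono2) auto
        then show ?thesis using True ne by (simp add: ind_if meet_def)
      next
        case False
        then show ?thesis using meet_le[of "Mid ` S" P] fin unfolding sumM by (simp split: if_splits)
      qed
    qed
    also have "\<dots> = (\<Sum>a\<in>S. A (ind (Mid a))) -
        A (\<lambda>P. if Li a b \<in> P then if Mid a \<in> P then if Mid b \<in> P then 1 else 0 else 0 else 0)"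
      by (simp only: wsum_diff wsum_sum)
    also have "(\<Sum>a\<in>S. A (ind (Mid a))) \<le> (\<Sum>a\<in>S. of_nat M)"
      using S(1) by (intro sum_mono load_notF(1)) (auto simp: excess_def)
    also have "(\<Sum>a\<in>S. of_nat M) = of_nat \<kappa> * (of_nat M :: rat)" using S(2) by simp
    finally have le: "A (meet (Mid ` S)) \<le> of_nat \<kappa> * of_nat M -
        A (\<lambda>P. if Li a b \<in> P then if Mid a \<in> P then if Mid b \<in> P then 1 else 0 else 0 else 0)" by simp
    have "1 \<le> A (\<lambda>P. if Li a b \<in> P then if Mid a \<in> P then if Mid b \<in> P then 1 else 0 else 0 else 0)"
    proof -
      have "wsum jN (ind (Li a b)) \<le> wsum jN (\<lambda>P. if Li a b \<in> P then if Mid a \<in> P then if Mid b \<in> P then 1 else 0 else 0 else 0)"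
      proof (rule wsum_mono[OF jN_nonneg])
        fix v p assume "(v, p) \<in> set jN"
        moreover have "Mid a \<in> set p \<and> Mid b \<in> set p" if "Li a b \<in> set p" "p = pC h i c" for h i c
          using that by (auto simp: mem_pC)
        moreover have "Li a b \<notin> set (pE i)" "Li a b \<notin> set pF" for i by (simp_all add: mems)
        ultimately have "Li a b \<in> set p \<Longrightarrow> Mid a \<in> set p \<and> Mid b \<in> set p"
          unfolding jN_def by (auto simp del: upt_Suc)
        then show "ind (Li a b) (set p) \<le> (if Li a b \<in> set p then if Mid a \<in> set p then if Mid b \<in> set p then 1 else 0 else 0 else 0)"
          by (simp add: ind_if)
      qed
      moreover have "0 \<le> wsum jD (\<lambda>P. if Li a b \<in> P then if Mid a \<in> P then if Mid b \<in> P then 1 else 0 else 0 else 0)"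
        unfolding wD by (intro sum_nonneg mult_nonneg_nonneg x_nonneg) auto
      ultimately show ?thesis using load_Li[OF ab(3)] unfolding wsum_simps by linarith
    qed
    then show ?thesis using le by linarith
  next
    case False
    have "wsum jD (meet (Mid ` S)) \<le> (\<Sum>B | B \<in> DP \<and> B \<inter> S \<noteq> {}. x B)"
      by (rule D_le) (auto simp: meet_def)
    also have "\<dots> \<le> of_nat k - 1" using False S kk by (intro x_clique) auto
    finally have 1: "wsum jD (meet (Mid ` S)) \<le> of_nat k - 1" .
    have "wsum jN (meet (Mid ` S)) \<le> wsum jN (\<lambda>P. \<Sum>e\<in>Mid ` S. ind e P)"
      using fin by (intro wsum_mono[OF jN_nonneg] meet_le) auto
    also have "\<dots> = (\<Sum>a\<in>S. wsum jN (ind (Mid a)))" unfolding sumM wsum_sum ..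
    also have "\<dots> = (\<Sum>a\<in>S. of_nat M - 1)"
    proof (intro sum.cong refl)
      fix a assume "a \<in> S"
      then have a: "a < n" using S(1) by auto
      have "wsum jN (ind (Mid a)) = wsum jN (avd (Mid a) (Suc n))"
        by (intro antisym wsum_mono[OF jN_nonneg]) (use avd_load jN_PP in \<open>fastforce+\<close>)
      then show "wsum jN (ind (Mid a)) = of_nat M - 1" using avd_Mid[OF a, of "Suc n"] a by (simp add: M_def)
    qed
    also have "\<dots> = of_nat k * (of_nat M - 1)" using S(2) kk by simp
    finally show ?thesis using 1 unfolding wsum_simps kk by (simp add: algebra_simps)
  qed
qed

text \<open>The number of chain arcs in \<open>S\<close> decides. Without any, a single arc outside
  \<open>Mid\<close> already saves the unit. With exactly one, say \<open>F r\<close>, the others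
  count only where they avoid it. With two or more, the whole chain is charged at once.\<close>

lemma bound_core:
  assumes S: "S \<subseteq> Collect ok" "finite S" "card S = \<kappa>" "\<And>e. e \<in> S \<Longrightarrow> \<not> excess e"
  shows "A (meet S) \<le> of_nat \<kappa> * of_nat M - 1"
proof -
  define R where "R = {e \<in> S. \<exists>r. e = F r}"
  have finR: "finite R" using S(2) by (simp add: R_def)
  have RS: "R \<subseteq> S" by (auto simp: R_def)
  have cS: "card (S - R) = \<kappa> - card R" using S(2,3) RS by (simp add: card_Diff_subset finR)
  have cR: "card R \<le> \<kappa>" using card_mono[OF S(2) RS] S(3) by simp
  have sumM: "(\<Sum>e\<in>T. of_nat M :: rat) = of_nat (card T) * of_nat M" for T :: "ar set" by simp
  have okS: "ok e" if "e \<in> S" for e using S(1) that by auto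
  consider "card R = 0" | "card R = 1" | "2 \<le> card R" by linarith
  then show ?thesis
  proof cases
    case 1
    then have "R = {}" using finR by simp
    then have nF: "e \<noteq> F r" if "e \<in> S" for e r using that by (auto simp: R_def)
    show ?thesis
    proof (cases "\<exists>e\<in>S. \<forall>a. e \<noteq> Mid a")
      case True
      then obtain e where e: "e \<in> S" "\<And>a. e \<noteq> Mid a" by blast
      have "A (meet S) \<le> (\<Sum>e\<in>S. A (ind e))" by (rule A_meet_le[OF S(2)])
      also have "\<dots> = A (ind e) + (\<Sum>e\<in>S - {e}. A (ind e))" by (rule sum.remove[OF S(2) e(1)])
      also have "(\<Sum>e\<in>S - {e}. A (ind e)) \<le> (\<Sum>e\<in>S - {e}. of_nat M)"
        using nF S(4) okS by (intro sum_mono load_notF(1)) auto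
      also have "\<dots> = (of_nat \<kappa> - 1) * of_nat M"
        unfolding sumM using S(2,3) e(1) kap(1) by (simp add: of_nat_diff)
      finally have "A (meet S) \<le> A (ind e) + (of_nat \<kappa> - 1) * of_nat M" by simp
      moreover have "A (ind e) \<le> of_nat M - 1" using nF S(4) okS e by (intro load_notF(2)) auto
      ultimately show ?thesis by (simp add: algebra_simps)
    next
      case False
      define S' where "S' = {a. Mid a \<in> S}"
      have SM: "S = Mid ` S'" using False by (auto simp: S'_def)
      have "S' \<subseteq> {..<n}" using okS by (auto simp: S'_def dest: okS)
      moreover have "card S' = \<kappa>" using S(3) unfolding SM by (simp add: card_image inj_on_def)
      ultimately show ?thesis unfolding SM by (rule bound_Mid)
    qed
  next
    case 2
    then obtain e0 where R: "R = {e0}" by (auto simp: card_Suc_eq)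
    then have "e0 \<in> R" by simp
    then obtain r where r: "e0 = F r" and eS: "F r \<in> S" by (auto simp: R_def)
    have rn: "r \<le> n" using okS[OF eS] by simp
    have nF: "e \<noteq> F r'" if e: "e \<in> S - {F r}" for e r'
    proof
      assume "e = F r'"
      then have "e \<in> R" using e unfolding R_def by blast
      then show False using e R r by simp
    qed
    have fin': "finite (S - {F r})" using S(2) by simp
    have c': "card (S - {F r}) = \<kappa> - 1" using S(2,3) eS by simp
    \<comment> \<open>\<open>\<kappa> - 1\<close> arcs remain but only \<open>\<kappa> - 2\<close>
      dummy arcs are eligible. The arc found here pays the smaller amount of
      \<open>avoid_le\<close>, which compensates for the large load of \<open>F r\<close>.\<close>
    have "\<exists>e\<in>S - {F r}. \<forall>j. e \<noteq> Di j"
    proof (rule ccontr)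
      assume no: "\<not> ?thesis"
      have "S - {F r} \<subseteq> Di ` {..<\<kappa> - 2}"
      proof
        fix e assume e: "e \<in> S - {F r}"
        then obtain j where "e = Di j" using no by blast
        then show "e \<in> Di ` {..<\<kappa> - 2}" using S(4)[of e] e by (auto simp: excess_def)
      qed
      then have "card (S - {F r}) \<le> card (Di ` {..<\<kappa> - 2})" by (intro card_mono) auto
      also have "\<dots> \<le> \<kappa> - 2" using card_image_le[of "{..<\<kappa> - 2}" Di] by simp
      finally show False using c' kap(1) by simp
    qed
    then obtain e where e: "e \<in> S - {F r}" "\<And>j. e \<noteq> Di j" by blast
    have "A (meet S) \<le> A (\<lambda>P. ind (F r) P + (\<Sum>e\<in>S - {F r}. avd e r P))"
    proof (rule A_mono)
      fix P
      have nn: "0 \<le> (\<Sum>e\<in>S - {F r}. avd e r P)" by (intro sum_nonneg) (simp add: avd_def)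
      show "meet S P \<le> ind (F r) P + (\<Sum>e\<in>S - {F r}. avd e r P)"
      proof (cases "F r \<in> P \<or> P \<inter> S = {}")
        case True
        then show ?thesis using nn by (auto simp: meet_def ind_if)
      next
        case False
        then obtain e where e: "e \<in> P" "e \<in> S - {F r}" by blast
        have "avd e r P \<le> (\<Sum>e\<in>S - {F r}. avd e r P)"
          using e S(2) by (intro member_le_sum) (auto simp: avd_def)
        then show ?thesis using e False by (simp add: avd_def ind_if meet_def)
      qed
    qed
    also have "\<dots> = A (ind (F r)) + (A (avd e r) + (\<Sum>e\<in>S - {F r} - {e}. A (avd e r)))"
      unfolding wsum_add wsum_sum by (simp only: sum.remove[OF fin' e(1)])
    also have "(\<Sum>e\<in>S - {F r} - {e}. A (avd e r)) \<le> (\<Sum>e\<in>S - {F r} - {e}. of_nat M - 1)"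
    proof (rule sum_mono)
      fix e' assume e': "e' \<in> S - {F r} - {e}"
      show "A (avd e' r) \<le> of_nat M - 1"
      proof (cases "\<exists>j. e' = Di j")
        case True
        then have "A (ind e') \<le> of_nat M - 1" using e' S(4) okS by (intro load_notF(2)) auto
        then show ?thesis using avd_le_ind[of e' r] by linarith
      next
        case False
        then have "A (avd e' r) \<le> of_nat U + 2 * of_nat n + 1 + of_nat r"
          using e' nF okS rn by (intro avoid_le) auto
        moreover have "of_nat r \<le> (of_nat n :: rat)" using rn by simp
        ultimately show ?thesis using n1r unfolding M_def by simp
      qed
    qed
    also have "(\<Sum>e\<in>S - {F r} - {e}. of_nat M - 1 :: rat) = of_nat (card (S - {F r} - {e})) * (of_nat M - 1)"
      by simp
    also have "card (S - {F r} - {e}) = \<kappa> - 2" using c' fin' e(1) by simp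
    also have "of_nat (\<kappa> - 2) = (of_nat \<kappa> - 2 :: rat)" using kap(1) by (simp add: of_nat_diff)
    finally have "A (meet S) \<le> A (ind (F r)) + (A (avd e r) + (of_nat \<kappa> - 2) * (of_nat M - 1))" by simp
    moreover have "A (avd e r) \<le> of_nat U + 2 * of_nat n + 1 + of_nat r"
      using e nF[OF e(1)] okS rn by (intro avoid_le) auto
    moreover have "A (ind (F r)) = of_nat M + of_nat \<kappa> - 2 + (of_nat n + 1 - of_nat r)"
      using load_F[OF rn] D_F[of r] by simp
    moreover have "of_nat M = of_nat U + 3 * of_nat n + (3 :: rat)" by (simp add: M_def)
    ultimately show ?thesis by (simp add: algebra_simps)
  next
    case 3
    have "A (meet S) \<le> A (\<lambda>P. anyF P + (\<Sum>e\<in>S - R. ind e P))"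
    proof (rule A_mono)
      fix P
      have nn: "0 \<le> (\<Sum>e\<in>S - R. ind e P)" by (intro sum_nonneg) simp
      show "meet S P \<le> anyF P + (\<Sum>e\<in>S - R. ind e P)"
      proof (cases "P \<inter> R = {}")
        case True
        then have "meet S P = meet (S - R) P" unfolding meet_def by (auto intro!: arg_cong[where f = "\<lambda>b. if b then 0 else 1"])
        then show ?thesis using meet_le[of "S - R" P] S(2) by (simp add: anyF_def)
      next
        case False
        then have "anyF P = 1" by (auto simp: anyF_def R_def)
        then show ?thesis using nn by (simp add: meet_def)
      qed
    qed
    also have "\<dots> = A anyF + (\<Sum>e\<in>S - R. A (ind e))" unfolding wsum_add wsum_sum ..
    also have "(\<Sum>e\<in>S - R. A (ind e)) \<le> (\<Sum>e\<in>S - R. of_nat M)"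
      using S(4) okS by (intro sum_mono load_notF(1)) (auto simp: R_def)
    also have "(\<Sum>e\<in>S - R. of_nat M) = of_nat (\<kappa> - card R) * (of_nat M :: rat)" unfolding sumM cS ..
    also have "\<dots> \<le> (of_nat \<kappa> - 2) * of_nat M"
      using 3 cR by (intro mult_right_mono) (simp_all add: of_nat_diff)
    finally have "A (meet S) \<le> A anyF + (of_nat \<kappa> - 2) * of_nat M" by simp
    moreover have "wsum jD anyF = 0" by (rule D_zero) (auto simp: anyF_def)
    ultimately show ?thesis using anyF_value by (simp add: algebra_simps)
  qed
qed

text \<open>Discarding all excess arcs, and others until \<kappa> remain, costs at most
  \<open>Q\<close> per arc, since no arc carries more.\<close>

lemma bound_all:
  assumes S: "S \<subseteq> set arlist" "card S = k"
  shows "A (meet S) \<le> of_nat \<kappa> * of_nat M - 1 + (of_nat k - of_nat \<kappa>) * of_nat Q"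
proof -
  have fin: "finite S" using S(1) by (rule finite_subset) simp
  have okS: "ok e" if "e \<in> S" for e using S(1) that by (auto simp: set_arlist)
  have "S \<inter> Collect excess \<subseteq> Di ` {\<kappa> - 2..<k - 2}"
  proof
    fix e assume e: "e \<in> S \<inter> Collect excess"
    then obtain j where j: "e = Di j" "\<kappa> - 2 \<le> j" by (auto simp: excess_def)
    then show "e \<in> Di ` {\<kappa> - 2..<k - 2}" using okS[of e] e by simp
  qed
  then have "card (S \<inter> Collect excess) \<le> card (Di ` {\<kappa> - 2..<k - 2})" by (intro card_mono) auto
  also have "\<dots> \<le> k - \<kappa>" using card_image_le[of "{\<kappa> - 2..<k - 2}" Di] kap by simp
  finally have "card (S \<inter> Collect excess) \<le> k - \<kappa>" .
  moreover have "card S = card (S \<inter> Collect excess) + card (S - Collect excess)"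
    using card_Un_disjoint[of "S \<inter> Collect excess" "S - Collect excess"] fin by (simp add: Int_Diff_disjoint Int_Diff_Un)
  ultimately have "\<kappa> \<le> card (S - Collect excess)" using S(2) kap(2) by linarith
  then obtain S1 where S1: "S1 \<subseteq> S - Collect excess" "card S1 = \<kappa>" "finite S1"
    using obtain_subset_with_card_n by metis
  have "A (meet S) \<le> A (\<lambda>P. meet S1 P + (\<Sum>e\<in>S - S1. ind e P))"
  proof (rule A_mono)
    fix P
    have "meet S P \<le> meet S1 P + meet (S - S1) P" by (auto simp: meet_def)
    also have "\<dots> \<le> meet S1 P + (\<Sum>e\<in>S - S1. ind e P)" using meet_le[of "S - S1" P] fin by simp
    finally show "meet S P \<le> meet S1 P + (\<Sum>e\<in>S - S1. ind e P)" .
  qed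
  also have "\<dots> = A (meet S1) + (\<Sum>e\<in>S - S1. A (ind e))" unfolding wsum_add wsum_sum ..
  also have "(\<Sum>e\<in>S - S1. A (ind e)) \<le> (\<Sum>e\<in>S - S1. of_nat Q)"
    using okS by (intro sum_mono load_Q) auto
  also have "\<dots> = (of_nat k - of_nat \<kappa>) * of_nat Q"
  proof -
    have "card (S - S1) = k - \<kappa>" using S1 S(2) by (subst card_Diff_subset) auto
    then show ?thesis using kap(2) by (simp add: of_nat_diff)
  qed
  also have "A (meet S1) \<le> of_nat \<kappa> * of_nat M - 1"
    using S1 okS by (intro bound_core) auto
  finally show ?thesis by simp
qed

theorem forward:
  "\<exists>y. (\<forall>P\<in>PP. 0 \<le> y P) \<and> (\<forall>e\<in>set arlist. (\<Sum>P | P \<in> PP \<and> e \<in> P. y P) \<le> cap e) \<and>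
    (\<forall>S\<subseteq>set arlist. card S = k \<longrightarrow> L \<le> (\<Sum>P | P \<in> PP \<and> P \<inter> S = {}. y P)) \<and>
    ((\<forall>B\<in>DP. x B \<in> \<int>) \<longrightarrow> (\<forall>P\<in>PP. y P \<in> \<int>))"
proof -
  define y where "y P = A (\<lambda>P'. if P' = P then 1 else 0)" for P
  have col: "(\<Sum>P | P \<in> PP \<and> R P. y P) = A (\<lambda>P. if R P then 1 else 0)" for R
  proof -
    have "(\<Sum>P | P \<in> PP \<and> R P. y P) = (\<Sum>P\<in>PP. y P * (if R P then 1 else 0))"
      by (rule sum.mono_neutral_cong_left) (auto simp: finite_PP)
    also have "\<dots> = A (\<lambda>P. if R P then 1 else 0)"
      unfolding y_def by (rule wsum_collect[OF finite_PP]) (rule jA_PP)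
    finally show ?thesis .
  qed
  have nn: "0 \<le> y P" for P
  proof -
    have "wsum js (\<lambda>_ :: ar set. 0) = 0" for js by (induction js) auto
    then show ?thesis unfolding y_def using A_mono[of "\<lambda>_. 0" "\<lambda>P'. if P' = P then 1 else 0"] by simp
  qed
  have cap: "(\<Sum>P | P \<in> PP \<and> e \<in> P. y P) \<le> cap e" if "e \<in> set arlist" for e
    using that load_cap[of e] unfolding col by (simp add: set_arlist ind_if[abs_def])
  have rob: "L \<le> (\<Sum>P | P \<in> PP \<and> P \<inter> S = {}. y P)" if S: "S \<subseteq> set arlist" "card S = k" for S
  proof -
    have "A (\<lambda>P. if P \<inter> S = {} then 1 else 0) = A (\<lambda>P. 1 - meet S P)"
      by (intro arg_cong[where f = A] ext) (simp add: meet_def)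
    also have "\<dots> = A (\<lambda>_. 1) - A (meet S)" by (rule wsum_diff)
    also have "A (\<lambda>_. 1) = \<theta> + wsum jN (\<lambda>_. 1)"
      unfolding wsum_simps wD using x_value by simp
    finally show ?thesis unfolding col using bound_all[OF S] total_N by simp
  qed
  have int: "y P \<in> \<int>" if "\<forall>B\<in>DP. x B \<in> \<int>" for P
  proof -
    have "wsum js (\<lambda>P'. if P' = P then 1 else 0) \<in> \<int>" if "\<And>v p. (v, p) \<in> set js \<Longrightarrow> v \<in> \<int>" for js
      using that
    proof (induction js)
      case (Cons j js)
      obtain v p where j: "j = (v, p)" by (cases j)
      have "v \<in> \<int>" "wsum js (\<lambda>P'. if P' = P then 1 else 0) \<in> \<int>" using Cons j by auto
      then show ?case by (simp add: j)
    qed simp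
    moreover have "v \<in> \<int>" if "(v, p) \<in> set (jD @ jN)" for v p
      using that jD(3)[of v p] jN_int[of v p] \<open>\<forall>B\<in>DP. x B \<in> \<int>\<close> by auto
    ultimately show ?thesis unfolding y_def by blast
  qed
  show ?thesis using nn cap rob int by (intro exI[of _ y] conjI ballI allI impI) simp_all
qed

end

section \<open>Numbering of the vertices and the equivalence for labelled instances\<close>

fun kind :: "vx \<Rightarrow> nat" where
  "kind VS = 0" | "kind VT = 1" | "kind (V v) = 2" | "kind (In a) = 3" | "kind (Out a) = 4" | "kind (Nu i) = 5"
| "kind (Tau h a) = (if h then 7 else 6)"

fun idx :: "vx \<Rightarrow> nat" where
  "idx VS = 0" | "idx VT = 0" | "idx (V v) = v" | "idx (In a) = a" | "idx (Out a) = a" | "idx (Nu i) = i"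
| "idx (Tau h a) = a"

text \<open>Each kind of vertex receives its own block of \<open>K\<close> numbers, so kind and
  index are recovered by \<open>div\<close> and \<open>mod\<close>.\<close>

definition code :: "nat \<Rightarrow> vx \<Rightarrow> nat" where
  "code K v = kind v * K + idx v"

lemma kind_idx_inj: "kind v = kind v' \<Longrightarrow> idx v = idx v' \<Longrightarrow> v = v'"
  by (cases v; cases v') (auto split: if_splits)

lemma inj_code: "inj_on (code K) {v. idx v < K}"
proof (rule inj_onI)
  fix v v' assume v: "v \<in> {v. idx v < K}" "v' \<in> {v. idx v < K}" and eq: "code K v = code K v'"
  have *: "code K w div K = kind w" "code K w mod K = idx w" if "idx w < K" for w
    using that by (simp_all add: code_def)
  have "kind v = kind v'" "idx v = idx v'"
    using v arg_cong[OF eq, of "\<lambda>x. x div K"] arg_cong[OF eq, of "\<lambda>x. x mod K"] by (simp_all add: *)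
  then show "v = v'" by (rule kind_idx_inj)
qed

lemma code_less: "idx v < K \<Longrightarrow> code K v < 8 * K"
proof -
  assume "idx v < K"
  moreover have "kind v \<le> 7" by (cases v) auto
  then have "kind v * K \<le> 7 * K" by (rule mult_right_mono) simp
  ultimately show ?thesis unfolding code_def by linarith
qed

locale gadget_net = gadget +
  fixes nv :: nat
  assumes ends_less: "\<And>a. a < n \<Longrightarrow> ta a < nv \<and> he a < nv" "s < nv" "t < nv"
begin

definition K :: nat where "K = nv + n + 1"

lemma idx_less: "ok e \<Longrightarrow> idx (src e) < K \<and> idx (trg e) < K"
proof -
  have "ta a < K" "he a < K" if "a < n" for a using ends_less(1)[OF that] by (auto simp: K_def)
  moreover have "s < K" "t < K" "n < K" "0 < K" using ends_less(2,3) by (auto simp: K_def)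
  ultimately show "ok e \<Longrightarrow> idx (src e) < K \<and> idx (trg e) < K"
    by (cases e rule: src.cases) (auto dest: link_less)
qed

text \<open>The \<open>k - 2\<close> dummy arcs and a few single arcs guarantee that sets of
  \<open>k\<close> arcs exist even if \<open>k\<close> exceeds the size of the given
  network.\<close>

lemma length_arlist: "k \<le> length arlist"
  unfolding arlist_def rarcs_def by simp

lemma cap_nonneg: "0 \<le> cap e"
  using theta(1) by (simp add: cap_def)

sublocale labelled_network arlist src trg cap "code K" "8 * K" VS VT k
proof
  show "distinct arlist" by (rule distinct_arlist)
  show "inj_on (code K) (insert VS (insert VT (src ` set arlist \<union> trg ` set arlist)))"
    by (rule inj_on_subset[OF inj_code]) (use idx_less in \<open>auto simp: set_arlist K_def\<close>)
  show "code K VS < 8 * K" "code K VT < 8 * K" by (rule code_less, simp add: K_def)+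
  show "code K (src e) < 8 * K \<and> code K (trg e) < 8 * K" if "e \<in> set arlist" for e
    using that idx_less[of e] by (auto intro!: code_less simp: set_arlist)
  show "VS \<noteq> VT" by simp
  show "k \<le> length arlist" by (rule length_arlist)
  show "0 \<le> cap e" for e by (rule cap_nonneg)
qed

definition good :: "(nat set \<Rightarrow> rat) \<Rightarrow> bool" where
  "good x \<longleftrightarrow> (\<forall>B\<in>DP. 0 \<le> x B) \<and> (\<forall>a<n. (\<Sum>B | B \<in> DP \<and> a \<in> B. x B) \<le> 1) \<and> (\<Sum>B\<in>DP. x B) = \<theta> \<and>
    (\<forall>S\<subseteq>{..<n}. card S = k \<and> (\<forall>a\<in>S. \<forall>b\<in>S. \<not> link a b) \<longrightarrow>
      (\<Sum>B | B \<in> DP \<and> B \<inter> S \<noteq> {}. x B) \<le> of_nat k - 1)"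

lemma flow_gadget: "flow y \<Longrightarrow> gadget_flow n k ta he s t \<rho> E \<theta> y"
  unfolding flow_def by unfold_locales auto

lemma flow_bound:
  assumes "flow y"
  shows "\<exists>S\<subseteq>set arlist. card S = k \<and> surv y S \<le> L"
proof -
  interpret G: gadget_flow n k ta he s t \<rho> E \<theta> y by (rule flow_gadget[OF assms])
  show ?thesis using G.Sstar G.Sstar_surv unfolding surv_def by (intro exI[of _ G.Sstar] conjI)
qed

lemma good_flow: "good x \<Longrightarrow> \<exists>y. flow y \<and> robust y L \<and> ((\<forall>B\<in>DP. x B \<in> \<int>) \<longrightarrow> (\<forall>P\<in>PP. y P \<in> \<int>))"
proof -
  assume g: "good x"
  interpret G: gadget_forward n k ta he s t \<rho> E \<theta> x
    using g unfolding good_def by unfold_locales auto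
  obtain y where y: "\<forall>P\<in>PP. 0 \<le> y P" "\<forall>e\<in>set arlist. (\<Sum>P | P \<in> PP \<and> e \<in> P. y P) \<le> cap e"
    "\<forall>S\<subseteq>set arlist. card S = k \<longrightarrow> L \<le> (\<Sum>P | P \<in> PP \<and> P \<inter> S = {}. y P)"
    "(\<forall>B\<in>DP. x B \<in> \<int>) \<longrightarrow> (\<forall>P\<in>PP. y P \<in> \<int>)"
    using G.forward by (elim exE conjE) (rule that)
  have "flow y" unfolding flow_def using y(1,2) by (rule conjI)
  moreover have "robust y L" unfolding robust_def surv_def using y(3) by simp
  ultimately show ?thesis using y(4) by (intro exI[of _ y] conjI)
qed

lemma flow_good: "flow y \<Longrightarrow> robust y L \<Longrightarrow> \<exists>x. good x \<and> ((\<forall>P\<in>PP. y P \<in> \<int>) \<longrightarrow> (\<forall>B\<in>DP. x B \<in> \<int>))"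
proof -
  assume f: "flow y" and r: "robust y L"
  interpret G: gadget_flow n k ta he s t \<rho> E \<theta> y by (rule flow_gadget[OF f])
  interpret G: gadget_robust n k ta he s t \<rho> E \<theta> y
    using r unfolding robust_def surv_def by unfold_locales auto
  show ?thesis using G.backward unfolding good_def by (elim exE conjE) (intro exI conjI; assumption)
qed

lemma yes_good:
  "mrf_yes (inst L) \<longleftrightarrow> (\<exists>x. good x)"
  "integral_mrf_yes (inst L) \<longleftrightarrow> (\<exists>x. good x \<and> (\<forall>B\<in>DP. x B \<in> \<int>))"
proof -
  note Y = yes_iff[OF flow_bound]
  \<comment> \<open>The flag \<open>b\<close> switches the integrality claim on or off, so both
    equivalences come from one argument.\<close>
  have gf: "\<exists>y. flow y \<and> robust y L \<and> (\<forall>P\<in>PP. y P \<in> \<int> \<or> \<not> b)"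
    if x: "good x" "b \<Longrightarrow> \<forall>B\<in>DP. x B \<in> \<int>" for x b
  proof -
    obtain y where y: "flow y" "robust y L" "(\<forall>B\<in>DP. x B \<in> \<int>) \<longrightarrow> (\<forall>P\<in>PP. y P \<in> \<int>)"
      using good_flow[OF x(1)] by (elim exE conjE) (rule that)
    then show ?thesis using x(2) by (intro exI[of _ y]) (cases b; simp)
  qed
  have fg: "\<exists>x. good x \<and> (\<forall>B\<in>DP. x B \<in> \<int> \<or> \<not> b)"
    if y: "flow y" "robust y L" "b \<Longrightarrow> \<forall>P\<in>PP. y P \<in> \<int>" for y b
  proof -
    obtain x where x: "good x" "(\<forall>P\<in>PP. y P \<in> \<int>) \<longrightarrow> (\<forall>B\<in>DP. x B \<in> \<int>)"
      using flow_good[OF y(1,2)] by (elim exE conjE) (rule that)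
    then show ?thesis using y(3) by (intro exI[of _ x]) (cases b; simp)
  qed
  show "mrf_yes (inst L) \<longleftrightarrow> (\<exists>x. good x)"
    using Y(1) gf[where b = False] fg[where b = False] by auto
  show "integral_mrf_yes (inst L) \<longleftrightarrow> (\<exists>x. good x \<and> (\<forall>B\<in>DP. x B \<in> \<int>))"
    using Y(2) gf[where b = True] fg[where b = True] by auto
qed

lemma pos_inj: "a < n \<Longrightarrow> b < n \<Longrightarrow> pos a = pos b \<Longrightarrow> a = b"
proof -
  assume ab: "a < n" "b < n" "pos a = pos b"
  have m: "pos a mod n = a" "pos b mod n = b" using ab(1,2) by (auto simp: pos_def)
  have "pos a mod n = pos b mod n" by (simp only: ab(3))
  then show ?thesis by (simp only: m)
qed

text \<open>\<open>pos\<close> is injective, so two incompatible arcs are linked in one of the two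
  directions.\<close>

lemma no_link_iff: "a < n \<Longrightarrow> b < n \<Longrightarrow> a \<noteq> b \<Longrightarrow> \<not> link a b \<and> \<not> link b a \<longleftrightarrow> {a, b} \<in> E"
  using pos_inj[of a b] by (auto simp: link_def insert_commute)

end

section \<open>Correctness of the reduction\<close>

text \<open>Adding an integer keeps a fraction in lowest terms with the same denominator. So the
  threshold is encoded by one multiplication and one addition, without computing a gcd.\<close>

lemma quotient_L:
  assumes "quotient_of \<theta> = (a, b)"
  shows "quotient_of (\<theta> + of_nat c) = (a + int c * b, b)"
proof -
  have b: "b > 0" and co: "coprime a b" and th: "\<theta> = of_int a / of_int b"
    using quotient_of_denom_pos[OF assms] quotient_of_coprime[OF assms] quotient_of_div[OF assms] by auto
  have "\<theta> + of_nat c = of_int (a + int c * b) / of_int b" using b by (simp add: th field_simps)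
  also have "\<dots> = Fract (a + int c * b) b" by (simp add: Fract_of_int_quotient)
  finally have "\<theta> + of_nat c = Fract (a + int c * b) b" .
  moreover have "coprime (a + int c * b) b"
    using co by (metis add.commute coprime_iff_gcd_eq_1 gcd_add_mult mult.commute gcd.commute)
  ultimately show ?thesis using b by (simp add: quotient_of_Fract normalize_stable)
qed

lemma quotient_of_nat: "quotient_of (of_nat m) = (int m, 1)"
  using quotient_of_int[of "int m"] by (simp add: of_int_def of_rat_of_nat_eq)

text \<open>A list with the newest level in front: level \<open>j\<close> holds the heads of walks
  with \<open>j + 1\<close> arcs. A level is read off from a sublist of the arc list, so it is never
  larger than that list.\<close>

definition heads :: "(nat \<times> nat) list \<Rightarrow> nat \<Rightarrow> nat list list" where
  "heads as m = ((\<lambda>hs. map snd (filter (\<lambda>a. fst a \<in> set (nth_default [] hs 0)) as) # hs) ^^ m) [map snd as]"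

definition rk :: "(nat \<times> nat) list \<Rightarrow> nat \<Rightarrow> nat" where
  "rk as v = length (filter (\<lambda>h. v \<in> set h) (heads as (length as)))"

text \<open>\<open>rk as v\<close> is the number of arcs of a longest walk ending in \<open>v\<close>.\<close>

lemma relpow_bound:
  assumes "finite R" "acyclic R" "(a, b) \<in> R ^^ m"
  shows "m \<le> card R"
proof -
  obtain f where f: "f 0 = a" "f m = b" "\<And>i. i < m \<Longrightarrow> (f i, f (Suc i)) \<in> R"
    using assms(3) unfolding relpow_fun_conv by blast
  have tr: "(f i, f j) \<in> R\<^sup>+" if "i < j" "j \<le> m" for i j
    using that
  proof (induction j)
    case (Suc j)
    show ?case
    proof (cases "i = j")
      case True
      then show ?thesis using f(3)[of j] Suc.prems by auto
    next
      case False
      then have "(f i, f j) \<in> R\<^sup>+" using Suc by auto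
      then show ?thesis using f(3)[of j] Suc.prems by (auto intro: trancl_into_trancl)
    qed
  qed simp
  have "inj_on f {..<m}"
  proof (rule linorder_inj_onI')
    fix i j assume "i \<in> {..<m}" "j \<in> {..<m}" "i < j"
    then have "(f i, f j) \<in> R\<^sup>+" by (intro tr) auto
    then show "f i \<noteq> f j" using assms(2) by (auto simp: acyclic_def)
  qed
  then have "m = card (f ` {..<m})" by (simp add: card_image)
  also have "\<dots> \<le> card (fst ` R)"
  proof (rule card_mono)
    show "f ` {..<m} \<subseteq> fst ` R" using f(3) by force
  qed (use assms(1) in simp)
  also have "\<dots> \<le> card R" by (rule card_image_le[OF assms(1)])
  finally show ?thesis .
qed

lemma heads_Suc: "heads as (Suc m) = map snd (filter (\<lambda>a. fst a \<in> set (nth_default [] (heads as m) 0)) as) # heads as m"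
  by (simp add: heads_def)

lemma heads_hd: "v \<in> set (nth_default [] (heads as m) 0) \<longleftrightarrow> (\<exists>w. (w, v) \<in> set as ^^ Suc m)"
proof (induction m arbitrary: v)
  case 0
  then show ?case by (force simp: heads_def)
next
  case (Suc m)
  have "v \<in> set (nth_default [] (heads as (Suc m)) 0) \<longleftrightarrow> (\<exists>u. (u, v) \<in> set as \<and> u \<in> set (nth_default [] (heads as m) 0))"
    unfolding heads_Suc by force
  also have "\<dots> \<longleftrightarrow> (\<exists>w. (w, v) \<in> set as ^^ Suc (Suc m))"
    unfolding Suc.IH
  proof
    assume "\<exists>u. (u, v) \<in> set as \<and> (\<exists>w. (w, u) \<in> set as ^^ Suc m)"
    then obtain u w where u: "(u, v) \<in> set as" and w: "(w, u) \<in> set as ^^ Suc m" by (elim exE conjE) (rule that)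
    from w u have "(w, v) \<in> set as ^^ Suc (Suc m)" by (rule relpow_Suc_I)
    then show "\<exists>w. (w, v) \<in> set as ^^ Suc (Suc m)" by (rule exI)
  next
    assume "\<exists>w. (w, v) \<in> set as ^^ Suc (Suc m)"
    then obtain w where "(w, v) \<in> set as ^^ Suc (Suc m)" by (rule exE)
    then show "\<exists>u. (u, v) \<in> set as \<and> (\<exists>w. (w, u) \<in> set as ^^ Suc m)"
      by (rule relpow_Suc_E) (intro exI conjI)
  qed
  finally show ?case .
qed

lemma rk_card: "length (filter (\<lambda>h. v \<in> set h) (heads as m)) = card {j. j \<le> m \<and> (\<exists>w. (w, v) \<in> set as ^^ Suc j)}"
proof (induction m)
  case 0
  have "{j. j \<le> 0 \<and> (\<exists>w. (w, v) \<in> set as ^^ Suc j)} = (if \<exists>w. (w, v) \<in> set as then {0} else {})" by auto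
  moreover have "v \<in> snd ` set as \<longleftrightarrow> (\<exists>w. (w, v) \<in> set as)" by force
  ultimately show ?case by (simp add: heads_def)
next
  case (Suc m)
  have step: "{j. j \<le> Suc m \<and> W j} = (if W (Suc m) then insert (Suc m) {j. j \<le> m \<and> W j} else {j. j \<le> m \<and> W j})"
    for W by (auto simp: le_Suc_eq)
  define Z where "Z \<longleftrightarrow> (\<exists>w. (w, v) \<in> set as ^^ Suc (Suc m))"
  have hz: "v \<in> set (nth_default [] (heads as (Suc m)) 0) \<longleftrightarrow> Z" unfolding Z_def by (rule heads_hd)
  have "{j. j \<le> Suc m \<and> (\<exists>w. (w, v) \<in> set as ^^ Suc j)} =
    (if Z then insert (Suc m) {j. j \<le> m \<and> (\<exists>w. (w, v) \<in> set as ^^ Suc j)}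
     else {j. j \<le> m \<and> (\<exists>w. (w, v) \<in> set as ^^ Suc j)})"
    unfolding Z_def by (rule step)
  moreover have "length (filter (\<lambda>h. v \<in> set h) (heads as (Suc m))) =
    (if Z then 1 else 0) + length (filter (\<lambda>h. v \<in> set h) (heads as m))"
    using hz unfolding heads_Suc by simp
  ultimately show ?case using Suc by simp
qed

text \<open>Walks into \<open>u\<close> extend to \<open>v\<close> by one arc, and the arc alone is
  a further walk into \<open>v\<close>. The shifted lengths stay within the range that is counted,
  since acyclicity bounds walks by the number of arcs.\<close>

lemma rk_less:
  assumes "acyclic (set as)" "(u, v) \<in> set as"
  shows "rk as u < rk as v"
proof -
  let ?W = "\<lambda>v. {j. j \<le> length as \<and> (\<exists>w. (w, v) \<in> set as ^^ Suc j)}"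
  have "insert 0 (Suc ` ?W u) \<subseteq> ?W v"
  proof (rule insert_subsetI)
    show "0 \<in> ?W v" using assms(2) by auto
    show "Suc ` ?W u \<subseteq> ?W v"
    proof clarify
      fix j w assume "(w, u) \<in> set as ^^ Suc j"
      then have w: "(w, v) \<in> set as ^^ Suc (Suc j)" using assms(2) by (rule relpow_Suc_I)
      have "Suc (Suc j) \<le> card (set as)" using relpow_bound[OF _ assms(1) w] by simp
      also have "\<dots> \<le> length as" by (rule card_length)
      finally show "Suc j \<le> length as \<and> (\<exists>w. (w, v) \<in> set as ^^ Suc (Suc j))" using w by auto
    qed
  qed
  then have "card (insert 0 (Suc ` ?W u)) \<le> card (?W v)" by (intro card_mono) auto
  moreover have "card (insert 0 (Suc ` ?W u)) = Suc (card (?W u))"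
    by (subst card_insert_disjoint) (auto simp: card_image)
  ultimately show ?thesis unfolding rk_def rk_card by simp
qed

context
  fixes I :: mrfr
begin

abbreviation "as \<equiv> arc_list (mrfr_net I)"
abbreviation "tl' \<equiv> \<lambda>a. fst (nth_default (0, 0) as a)"
abbreviation "hd' \<equiv> \<lambda>a. snd (nth_default (0, 0) as a)"

abbreviation "trivial_case \<equiv> mrfr_budget I \<le> 1 \<or> as = [] \<or> \<not> mrfr_demand I \<le> of_nat (length as)"

text \<open>
  In the degenerate case the given instance is feasible iff the demand vanishes and the budget does not;
  the parallel arcs of capacity 0 then only carry the zero flow.
\<close>

definition reduce :: mrf where
  "reduce = (if trivial_case
     then mk_mrf [0..<Suc (mrfr_budget I)] (\<lambda>_. False) (\<lambda>_. True) (\<lambda>_. 0) of_bool 2 False True (mrfr_budget I)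
       (if mrfr_budget I = 0 then 1 else mrfr_demand I)
     else mk_mrf (gadget_defs.arlist (length as) (mrfr_budget I) tl' (rk as) (compat_edges I))
       (gadget_defs.src (length as) tl' (sink (mrfr_net I)))
       (gadget_defs.trg (length as) tl' hd' (source (mrfr_net I)) (rk as) (compat_edges I))
       (gadget_defs.cap (length as) (mrfr_budget I) (mrfr_demand I))
       (code (num_verts (mrfr_net I) + length as + 1)) (8 * (num_verts (mrfr_net I) + length as + 1)) VS VT (mrfr_budget I)
       (gadget_defs.L (length as) (mrfr_budget I) tl' (rk as) (compat_edges I) (mrfr_demand I)))"

end

lemma path_sets_cong:
  assumes "\<And>a. a \<in> A \<Longrightarrow> f a = f' a" "\<And>a. a \<in> A \<Longrightarrow> g a = g' a"
  shows "path_sets f g A s t = path_sets f' g' A s t"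
proof -
  have c: "chain f g u p t = chain f' g' u p t" if "set p \<subseteq> A" for u p
    using that assms by (induction p arbitrary: u) auto
  have m: "map g p = map g' p" if "set p \<subseteq> A" for p using that assms by auto
  have "set p \<subseteq> A \<and> chain f g s p t \<and> distinct (s # map g p) \<longleftrightarrow> set p \<subseteq> A \<and> chain f' g' s p t \<and> distinct (s # map g' p)" for p
  proof (cases "set p \<subseteq> A")
    case True
    then show ?thesis by (simp only: c[OF True] m[OF True])
  qed simp
  then show ?thesis unfolding path_sets_def by simp
qed

lemma path_nonempty: "s \<noteq> t \<Longrightarrow> B \<in> path_sets f g A s t \<Longrightarrow> B \<noteq> {}"
  unfolding path_sets_def by (auto elim: chain.elims)

lemma union_bound:
  fixes x :: "'a set \<Rightarrow> rat"
  assumes "finite D" "finite S" "\<And>B. B \<in> D \<Longrightarrow> 0 \<le> x B"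
  shows "(\<Sum>B | B \<in> D \<and> B \<inter> S \<noteq> {}. x B) \<le> (\<Sum>a\<in>S. \<Sum>B | B \<in> D \<and> a \<in> B. x B)"
proof -
  have eq: "(\<Sum>B | B \<in> D \<and> R B. x B) = (\<Sum>B\<in>D. if R B then x B else 0)" for R
    by (rule sum.inter_filter[OF assms(1)])
  have "(\<Sum>B\<in>D. if B \<inter> S \<noteq> {} then x B else 0) \<le> (\<Sum>B\<in>D. \<Sum>a\<in>S. if a \<in> B then x B else 0)"
  proof (rule sum_mono)
    fix B assume B: "B \<in> D"
    have nn: "0 \<le> (\<Sum>a\<in>S. if a \<in> B then x B else 0)" using assms(3)[OF B] by (intro sum_nonneg) auto
    show "(if B \<inter> S \<noteq> {} then x B else 0) \<le> (\<Sum>a\<in>S. if a \<in> B then x B else 0)"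
    proof (cases "B \<inter> S = {}")
      case False
      then obtain a where a: "a \<in> B" "a \<in> S" by blast
      have "(if a \<in> B then x B else 0) \<le> (\<Sum>a\<in>S. if a \<in> B then x B else 0)"
        using a assms(2) assms(3)[OF B] by (intro member_le_sum) auto
      then show ?thesis using a False by simp
    qed (use nn in simp)
  qed
  also have "\<dots> = (\<Sum>a\<in>S. \<Sum>B\<in>D. if a \<in> B then x B else 0)" by (rule sum.swap)
  finally show ?thesis unfolding eq .
qed

lemma feasible_iff:
  assumes I: "I \<in> mrfr_instances"
  defines "D \<equiv> path_sets (tl' I) (hd' I) {..<length (as I)} (source (mrfr_net I)) (sink (mrfr_net I))"
  shows "mrfr_feasible I x \<longleftrightarrow> (\<forall>B\<in>D. 0 \<le> x B) \<and> (\<forall>a<length (as I). (\<Sum>B | B \<in> D \<and> a \<in> B. x B) \<le> 1) \<and>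
      (\<Sum>B\<in>D. x B) = mrfr_demand I \<and>
      (\<forall>S\<in>interdictable_cliques I. (\<Sum>B | B \<in> D \<and> B \<inter> S \<noteq> {}. x B) \<le> of_nat (mrfr_budget I) - 1)"
    and "integral_flow (mrfr_net I) x \<longleftrightarrow> (\<forall>B\<in>D. x B \<in> \<int>)"
proof -
  have net: "is_network (mrfr_net I)" using I by (simp add: mrfr_instances_def)
  have st: "st_paths (mrfr_net I) = D"
    unfolding st_paths_eq[OF net] D_def by (rule path_sets_cong) (auto simp: nth_default_def)
  have arcs: "arcs (digraph_of (mrfr_net I)) = {..<length (as I)}" by (simp add: digraph_of_def)
  have fin: "finite (interdictable_cliques I)"
    by (rule finite_subset[of _ "Pow {..<length (as I)}"]) (auto simp: interdictable_cliques_def arcs)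
  have ne: "interdictable_cliques I \<noteq> {}"
    by (rule ex_in_conv[THEN iffD1], rule exI[of _ "{}"]) (simp add: interdictable_cliques_def)
  have "Max (interdicted_flow (mrfr_net I) x ` interdictable_cliques I) \<le> b \<longleftrightarrow>
    (\<forall>S\<in>interdictable_cliques I. (\<Sum>B | B \<in> D \<and> B \<inter> S \<noteq> {}. x B) \<le> b)" for b
    using fin ne by (simp add: interdicted_flow_def st)
  then show "mrfr_feasible I x \<longleftrightarrow> (\<forall>B\<in>D. 0 \<le> x B) \<and> (\<forall>a<length (as I). (\<Sum>B | B \<in> D \<and> a \<in> B. x B) \<le> 1) \<and>
      (\<Sum>B\<in>D. x B) = mrfr_demand I \<and>
      (\<forall>S\<in>interdictable_cliques I. (\<Sum>B | B \<in> D \<and> B \<inter> S \<noteq> {}. x B) \<le> of_nat (mrfr_budget I) - 1)"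
    unfolding mrfr_feasible_def path_flows_def flow_value_def arcs st by auto
  show "integral_flow (mrfr_net I) x \<longleftrightarrow> (\<forall>B\<in>D. x B \<in> \<int>)"
    unfolding integral_flow_def st ..
qed

lemma instance_facts:
  assumes "I \<in> mrfr_instances"
  shows "source (mrfr_net I) \<noteq> sink (mrfr_net I)" "0 \<le> mrfr_demand I" "acyclic (set (as I))"
    "source (mrfr_net I) < num_verts (mrfr_net I)" "sink (mrfr_net I) < num_verts (mrfr_net I)"
    "\<And>a. a < length (as I) \<Longrightarrow> tl' I a < num_verts (mrfr_net I) \<and> hd' I a < num_verts (mrfr_net I)"
    "\<And>a. a < length (as I) \<Longrightarrow> (tl' I a, hd' I a) \<in> set (as I)"
proof -
  have net: "is_network (mrfr_net I)" and ac: "acyclic (arcs_ends (digraph_of (mrfr_net I)))"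
    using assms by (auto simp: mrfr_instances_def)
  show "source (mrfr_net I) \<noteq> sink (mrfr_net I)" "source (mrfr_net I) < num_verts (mrfr_net I)"
    "sink (mrfr_net I) < num_verts (mrfr_net I)" using net by (auto simp: is_network_def digraph_of_def)
  show "0 \<le> mrfr_demand I" using assms by (simp add: mrfr_instances_def)
  have "arcs_ends (digraph_of (mrfr_net I)) = set (as I)"
    by (auto simp: arcs_ends_def arc_to_ends_def digraph_of_def set_conv_nth image_iff)
  then show "acyclic (set (as I))" using ac by simp
  have w: "wf_digraph (digraph_of (mrfr_net I))" using net by (simp add: is_network_def)
  show "tl' I a < num_verts (mrfr_net I) \<and> hd' I a < num_verts (mrfr_net I)" if "a < length (as I)" for a
    using wf_digraph.tail_in_verts[OF w, of a] wf_digraph.head_in_verts[OF w, of a] that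
    by (simp add: digraph_of_def nth_default_def)
  show "(tl' I a, hd' I a) \<in> set (as I)" if "a < length (as I)" for a
    using that by (simp add: nth_default_def)
qed

lemma reduce_trivial:
  assumes I: "I \<in> mrfr_instances" and triv: "trivial_case I"
  shows "reduce I \<in> mrf_instances" "mrf_yes (reduce I) \<longleftrightarrow> mrfr_yes I"
    "integral_mrf_yes (reduce I) \<longleftrightarrow> integral_mrfr_yes I"
proof -
  let ?k = "mrfr_budget I" and ?\<theta> = "mrfr_demand I" and ?n = "length (as I)"
  define L :: rat where "L = (if ?k = 0 then 1 else ?\<theta>)"
  note F = instance_facts[OF I]
  interpret T: labelled_network "[0..<Suc ?k]" "\<lambda>_. False" "\<lambda>_. True" "\<lambda>_. 0" "of_bool :: bool \<Rightarrow> nat" 2 False True ?k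
    by unfold_locales (auto simp: inj_on_def)
  have L0: "0 \<le> L" using F(2) by (simp add: L_def)
  have red: "reduce I = T.inst L" using triv unfolding reduce_def L_def by simp
  show "reduce I \<in> mrf_instances" unfolding red by (rule T.inst_instance[OF L0])
  have fin: "finite T.PS" by (simp add: finite_path_sets)
  have zero: "y P = 0" if y: "T.flow y" and P: "P \<in> T.PS" for y P
  proof -
    obtain e where e: "e \<in> P" using path_nonempty[OF _ P] by auto
    then have es: "e \<in> set [0..<Suc ?k]" using path_sets_subset[OF P] by blast
    have nn: "0 \<le> y P'" if "P' \<in> T.PS" for P' using y that unfolding T.flow_def by blast
    have "y P \<le> (\<Sum>P | P \<in> T.PS \<and> e \<in> P. y P)"
      by (rule member_le_sum) (use P e fin nn in \<open>simp_all del: upt_Suc\<close>)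
    also have "\<dots> \<le> 0" using y es unfolding T.flow_def by blast
    finally show ?thesis using nn[OF P] by simp
  qed
  have s0: "T.surv y S = 0" if "T.flow y" for y S
    unfolding T.surv_def by (intro sum.neutral ballI zero[OF that]) simp
  obtain S0 where S0: "S0 \<subseteq> set [0..<Suc ?k]" "card S0 = ?k"
    using obtain_subset_with_card_n[of ?k "set [0..<Suc ?k]"] by auto
  have ub: "\<exists>S\<subseteq>set [0..<Suc ?k]. card S = ?k \<and> T.surv y S \<le> L" if "T.flow y" for y
    using S0 s0[OF that] L0 by (intro exI[of _ S0]) simp
  have f0: "T.flow (\<lambda>_. 0)" unfolding T.flow_def by simp
  have rob: "T.robust y L \<longleftrightarrow> L = 0" if "T.flow y" for y
    unfolding T.robust_def s0[OF that] using S0 L0 by (auto intro: antisym)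
  have yes: "mrf_yes (reduce I) \<longleftrightarrow> L = 0" "integral_mrf_yes (reduce I) \<longleftrightarrow> L = 0"
    using T.yes_iff[OF ub] f0 rob rob[OF f0] unfolding red by (blast, auto intro!: exI[of _ "\<lambda>_. 0"])
  let ?D = "path_sets (tl' I) (hd' I) {..<?n} (source (mrfr_net I)) (sink (mrfr_net I))"
  note FE = feasible_iff[OF I]
  have finD: "finite ?D" by (simp add: finite_path_sets)
  have "mrfr_feasible I (\<lambda>_. 0)" if "L = 0"
  proof -
    have "?k \<noteq> 0" "?\<theta> = 0" using that by (auto simp: L_def split: if_splits)
    then show ?thesis unfolding FE(1) by simp
  qed
  moreover have "L = 0" if "mrfr_feasible I x" for x
  proof -
    have x: "\<And>B. B \<in> ?D \<Longrightarrow> 0 \<le> x B" "\<And>a. a < ?n \<Longrightarrow> (\<Sum>B | B \<in> ?D \<and> a \<in> B. x B) \<le> 1" "(\<Sum>B\<in>?D. x B) = ?\<theta>"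
      and cl: "\<And>S. S \<in> interdictable_cliques I \<Longrightarrow> (\<Sum>B | B \<in> ?D \<and> B \<inter> S \<noteq> {}. x B) \<le> of_nat ?k - 1"
      using that unfolding FE(1) by blast+
    have "{B. B \<in> ?D \<and> B \<inter> {..<?n} \<noteq> {}} = ?D"
      using path_nonempty[OF F(1)] path_sets_subset by fastforce
    then have le: "?\<theta> \<le> (\<Sum>a<?n. \<Sum>B | B \<in> ?D \<and> a \<in> B. x B)"
      using union_bound[OF finD, of "{..<?n}" x] x(1,3) by simp
    have "{} \<in> interdictable_cliques I" by (simp add: interdictable_cliques_def)
    \<comment> \<open>The empty set is a clique, so a budget of 0 would demand a flow of at most -1
      through it. This is why \<open>L\<close> is 1 in that case.\<close>
    from cl[OF this] have k: "1 \<le> ?k" by simp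
    \<comment> \<open>For budget 1 each single arc is a clique and must carry nothing. For larger
      budgets the degenerate case leaves a network without arcs, because the unit capacities already
      exclude a demand above the number of arcs.\<close>
    have "?\<theta> \<le> 0"
    proof (cases "?k = 1")
      case True
      have z: "(\<Sum>B | B \<in> ?D \<and> a \<in> B. x B) \<le> 0" if "a < ?n" for a
      proof -
        have "{a} \<in> interdictable_cliques I" using that True by (simp add: interdictable_cliques_def digraph_of_def)
        from cl[OF this] show ?thesis using True by simp
      qed
      have "(\<Sum>a<?n. \<Sum>B | B \<in> ?D \<and> a \<in> B. x B) \<le> 0" by (rule sum_nonpos) (rule z, simp)
      then show ?thesis using le by simp
    next
      case False
      have "(\<Sum>a<?n. \<Sum>B | B \<in> ?D \<and> a \<in> B. x B) \<le> (\<Sum>a<?n. 1)" by (intro sum_mono x(2)) simp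
      then have "?\<theta> \<le> of_nat ?n" using le by simp
      then have "as I = []" using triv False k by auto
      then show ?thesis using le by simp
    qed
    then show ?thesis using F(2) k by (simp add: L_def)
  qed
  ultimately have "mrfr_yes I \<longleftrightarrow> L = 0" "integral_mrfr_yes I \<longleftrightarrow> L = 0"
    unfolding mrfr_yes_def integral_mrfr_yes_def integral_flow_def by (blast, auto intro!: exI[of _ "\<lambda>_. 0"])
  then show "mrf_yes (reduce I) \<longleftrightarrow> mrfr_yes I" "integral_mrf_yes (reduce I) \<longleftrightarrow> integral_mrfr_yes I"
    using yes by simp_all
qed

lemma reduce_net:
  assumes I: "I \<in> mrfr_instances" and nt: "\<not> trivial_case I"
  shows "gadget_net (length (as I)) (mrfr_budget I) (tl' I) (hd' I) (source (mrfr_net I)) (sink (mrfr_net I))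
    (rk (as I)) (mrfr_demand I) (num_verts (mrfr_net I))"
proof -
  note F = instance_facts[OF I]
  show ?thesis
  proof
    show "1 \<le> length (as I)" using nt by (cases "as I") auto
    show "rk (as I) (tl' I a) < rk (as I) (hd' I a)" if "a < length (as I)" for a
      using F(3,7) that by (intro rk_less) auto
  qed (use F nt in auto)
qed

lemma reduce_main:
  assumes I: "I \<in> mrfr_instances" and nt: "\<not> trivial_case I"
  shows "reduce I \<in> mrf_instances" "mrf_yes (reduce I) \<longleftrightarrow> mrfr_yes I"
    "integral_mrf_yes (reduce I) \<longleftrightarrow> integral_mrfr_yes I"
    "c \<in> set (mrf_caps (reduce I)) \<Longrightarrow> c \<le> of_nat (2 * length (as I) * length (as I) + 5 * length (as I) + 3)"
    "length (as I) \<le> network_size (mrf_net (reduce I))"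
proof -
  let ?k = "mrfr_budget I" and ?n = "length (as I)"
  interpret G: gadget_net ?n ?k "tl' I" "hd' I" "source (mrfr_net I)" "sink (mrfr_net I)" "rk (as I)"
    "compat_edges I" "mrfr_demand I" "num_verts (mrfr_net I)"
    by (rule reduce_net[OF I nt])
  have red: "reduce I = G.inst G.L" using nt unfolding reduce_def G.K_def by simp
  show "reduce I \<in> mrf_instances" unfolding red by (intro G.inst_instance G.L_nonneg G.theta(1))
  have good: "G.good x \<longleftrightarrow> mrfr_feasible I x" for x
  proof -
    have arcs: "arcs (digraph_of (mrfr_net I)) = {..<?n}" by (simp add: digraph_of_def)
    have "(\<forall>S\<subseteq>{..<?n}. card S = ?k \<and> (\<forall>a\<in>S. \<forall>b\<in>S. \<not> G.link a b) \<longrightarrow>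
        (\<Sum>B | B \<in> G.DP \<and> B \<inter> S \<noteq> {}. x B) \<le> of_nat ?k - 1) \<longleftrightarrow>
      (\<forall>S\<in>interdictable_cliques I. (\<Sum>B | B \<in> G.DP \<and> B \<inter> S \<noteq> {}. x B) \<le> of_nat ?k - 1)" (is "?l \<longleftrightarrow> ?r")
      if x: "\<forall>B\<in>G.DP. 0 \<le> x B" "\<forall>a<?n. (\<Sum>B | B \<in> G.DP \<and> a \<in> B. x B) \<le> 1"
    proof
      assume l: ?l
      show ?r
      proof
        fix S assume "S \<in> interdictable_cliques I"
        then have S: "S \<subseteq> {..<?n}" "card S \<le> ?k" "\<And>a b. a \<in> S \<Longrightarrow> b \<in> S \<Longrightarrow> a \<noteq> b \<Longrightarrow> {a, b} \<in> compat_edges I"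
          by (auto simp: interdictable_cliques_def arcs)
        show "(\<Sum>B | B \<in> G.DP \<and> B \<inter> S \<noteq> {}. x B) \<le> of_nat ?k - 1"
        proof (cases "card S = ?k")
          case True
          have "\<not> G.link a b" if "a \<in> S" "b \<in> S" for a b
            using S(3)[OF that] G.no_self_link[of a] by (cases "a = b") (auto simp: G.link_def)
          then show ?thesis using l S(1) True by simp
        next
          case False
          \<comment> \<open>Fewer than \<open>k\<close> arcs carry at most \<open>k - 1\<close>
            units by the capacities alone, so only cliques of exactly \<open>k\<close> arcs
            matter.\<close>
          have fS: "finite S" using S(1) finite_subset by blast
          have "(\<Sum>B | B \<in> G.DP \<and> B \<inter> S \<noteq> {}. x B) \<le> (\<Sum>a\<in>S. \<Sum>B | B \<in> G.DP \<and> a \<in> B. x B)"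
            using x(1) by (intro union_bound fS) (auto simp: finite_path_sets)
          also have "\<dots> \<le> (\<Sum>a\<in>S. 1)" using x(2) S(1) by (intro sum_mono) auto
          also have "\<dots> \<le> of_nat (?k - 1)" using False S(2) by simp
          also have "\<dots> = of_nat ?k - 1" using G.k2 by (simp add: of_nat_diff)
          finally show ?thesis .
        qed
      qed
    next
      assume r: ?r
      show ?l
      proof (intro allI impI)
        fix S assume S: "S \<subseteq> {..<?n}" "card S = ?k \<and> (\<forall>a\<in>S. \<forall>b\<in>S. \<not> G.link a b)"
        have "{a, b} \<in> compat_edges I" if "a \<in> S" "b \<in> S" "a \<noteq> b" for a b
          using G.no_link_iff[of a b] S that by auto
        then have "S \<in> interdictable_cliques I" using S by (auto simp: interdictable_cliques_def arcs)
        then show "(\<Sum>B | B \<in> G.DP \<and> B \<inter> S \<noteq> {}. x B) \<le> of_nat ?k - 1" using r by blast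
      qed
    qed
    then show ?thesis unfolding G.good_def feasible_iff(1)[OF I] by (intro conj_cong refl) simp
  qed
  show "mrf_yes (reduce I) \<longleftrightarrow> mrfr_yes I" "integral_mrf_yes (reduce I) \<longleftrightarrow> integral_mrfr_yes I"
    unfolding red using G.yes_good unfolding mrfr_yes_def integral_mrfr_yes_def feasible_iff(2)[OF I] good by simp_all
  show "c \<le> of_nat (2 * ?n * ?n + 5 * ?n + 3)" if "c \<in> set (mrf_caps (reduce I))"
  proof -
    from that obtain e where "e \<in> set G.arlist" "c = G.cap e" unfolding red mk_mrf_def by auto
    then show ?thesis using G.cap_le_Q[of e] by (simp add: G.set_arlist G.Q_def G.U_def)
  qed
  show "?n \<le> network_size (mrf_net (reduce I))"
    unfolding red network_size_def mk_mrf_def G.K_def by (simp add: digraph_of_def)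
qed

text \<open>The polynomial is \<open>Q\<close> as a function of the number of arcs, which is at most
  the size of either network. In the degenerate case all capacities are 0.\<close>

lemma reduce_bound:
  assumes I: "I \<in> mrfr_instances" and c: "c \<in> set (mrf_caps (reduce I))"
  shows "c \<le> of_nat (poly [:3, 5, 2:] (network_size (mrfr_net I)))"
    "c \<le> of_nat (poly [:3, 5, 2:] (network_size (mrf_net (reduce I))))"
proof -
  have p: "c \<le> of_nat (poly [:3, 5, 2:] m)" if "c \<le> of_nat (2 * length (as I) * length (as I) + 5 * length (as I) + 3)"
    "length (as I) \<le> m" for m
  proof -
    have "2 * length (as I) * length (as I) + 5 * length (as I) + 3 = poly [:3, 5, 2:] (length (as I))"
      by (simp add: algebra_simps)
    also have "\<dots> \<le> poly [:3, 5, 2:] m" using that(2) by (simp add: add_mono mult_mono)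
    finally show ?thesis using that(1) by (meson of_nat_mono order.trans)
  qed
  have t: "c = 0" if "trivial_case I"
    using c that unfolding reduce_def mk_mrf_def by auto
  have n: "length (as I) \<le> network_size (mrfr_net I)" by (simp add: network_size_def digraph_of_def)
  show "c \<le> of_nat (poly [:3, 5, 2:] (network_size (mrfr_net I)))"
    using t p[OF reduce_main(4)[OF I _ c] n] by (cases "trivial_case I") (simp_all del: poly_pCons)
  show "c \<le> of_nat (poly [:3, 5, 2:] (network_size (mrf_net (reduce I))))"
    using t p[OF reduce_main(4)[OF I _ c] reduce_main(5)[OF I]] by (cases "trivial_case I") (simp_all del: poly_pCons)
qed

section \<open>Polynomial-time computation of the reduction\<close>

abbreviation "encP \<equiv> enc_list (enc_prod enc_unary enc_unary)"
abbreviation "encI \<equiv> enc_prod (enc_prod enc_unary (enc_prod encP (enc_prod enc_unary enc_unary)))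
  (enc_prod encP (enc_prod enc_unary (enc_prod enc_binary enc_binary)))"
abbreviation "encR \<equiv> enc_prod (enc_prod enc_unary enc_unary) (enc_prod enc_binary enc_binary)"
abbreviation "encO \<equiv> enc_prod (enc_prod enc_unary (enc_prod encP (enc_prod enc_unary enc_unary)))
  (enc_prod (enc_list (enc_prod enc_binary enc_binary)) (enc_prod enc_unary (enc_prod enc_binary enc_binary)))"

text \<open>Nested pairs shaped like the encoded instance, so that the combinators for
  \<open>pt\<close> apply directly. The demand appears as numerator and denominator.\<close>

type_synonym inp = "(nat \<times> (nat \<times> nat) list \<times> nat \<times> nat) \<times> (nat \<times> nat) list \<times> nat \<times> nat \<times> nat"

definition iV :: "inp \<Rightarrow> nat" where "iV e = fst (fst e)"
definition iA :: "inp \<Rightarrow> (nat \<times> nat) list" where "iA e = fst (snd (fst e))"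
definition iS :: "inp \<Rightarrow> nat" where "iS e = fst (snd (snd (fst e)))"
definition iT :: "inp \<Rightarrow> nat" where "iT e = snd (snd (snd (fst e)))"
definition iC :: "inp \<Rightarrow> (nat \<times> nat) list" where "iC e = fst (snd e)"
definition ik :: "inp \<Rightarrow> nat" where "ik e = fst (snd (snd e))"
definition iNum :: "inp \<Rightarrow> nat" where "iNum e = fst (snd (snd (snd e)))"
definition iDen :: "inp \<Rightarrow> nat" where "iDen e = snd (snd (snd (snd e)))"
definition iN :: "inp \<Rightarrow> nat" where "iN e = length (iA e)"
definition iK :: "inp \<Rightarrow> nat" where "iK e = iV e + iN e + 1"

context
  fixes E :: "'a \<Rightarrow> btree" and e :: "'a \<Rightarrow> inp"
  assumes e: "pt E encI e"
begin

lemma pt_inp: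
  "pt E enc_unary (\<lambda>x. iV (e x))" "pt E encP (\<lambda>x. iA (e x))" "pt E enc_unary (\<lambda>x. iS (e x))"
  "pt E enc_unary (\<lambda>x. iT (e x))" "pt E encP (\<lambda>x. iC (e x))" "pt E enc_unary (\<lambda>x. ik (e x))"
  "pt E enc_binary (\<lambda>x. iNum (e x))" "pt E enc_binary (\<lambda>x. iDen (e x))"
  unfolding iV_def iA_def iS_def iT_def iC_def ik_def iNum_def iDen_def
  by ((rule pt_fst pt_snd)+, rule e)+

lemma pt_iN: "pt E enc_unary (\<lambda>x. iN (e x))"
  unfolding iN_def by (rule pt_length, rule pt_inp)

lemma pt_iK: "pt E enc_unary (\<lambda>x. iK (e x))"
  unfolding iK_def by (rule pt_add pt_inp pt_iN pt_const)+

end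

lemma pt_mem:
  assumes "pt E enc_unary a" "pt E (enc_list enc_unary) l"
  shows "pt E enc_bool (\<lambda>x. a x \<in> set (l x))"
proof -
  have "pt E enc_bool (\<lambda>x. \<exists>y\<in>set (l x). y = a x)"
    by (rule pt_bex[OF _ assms(2)], rule pt_eq, rule pt_second, rule pt_comp[OF assms(1)], rule pt_first)
  then show ?thesis by simp
qed

lemma size_heads_step:
  "size (enc_list enc_unary (map snd (filter R zs))) \<le> size (encP zs)"
  by (induction zs) auto

lemma pt_heads: "pt encP (enc_list (enc_list enc_unary)) (\<lambda>as. heads as (length as))"
  unfolding heads_def
proof (rule pt_funpow_add)
  show "pt (enc_prod encP (enc_list (enc_list enc_unary))) (enc_list (enc_list enc_unary))
    (\<lambda>z. map snd (filter (\<lambda>a. fst a \<in> set (nth_default [] (snd z) 0)) (fst z)) # snd z)"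
    by (rule pt_Cons, rule pt_map, rule pt_snd, rule pt_second, rule pt_filter, rule pt_mem, rule pt_fst, rule pt_second,
      rule pt_nth_default, rule pt_snd, rule pt_first, rule pt_const, rule pt_const, rule pt_first, rule pt_second)
  show "pt encP enc_unary length" by (rule pt_length[OF pt_id])
  show "pt encP (enc_list (enc_list enc_unary)) (\<lambda>as. [map snd as])"
    by (rule pt_Cons, rule pt_map, rule pt_snd, rule pt_second, rule pt_id, rule pt_const)
  show "size (enc_list (enc_list enc_unary) (map snd (filter (\<lambda>a. fst a \<in> set (nth_default [] t 0)) e) # t)) \<le>
    size (enc_list (enc_list enc_unary) t) + poly [:1, 1:] (size (encP e))" for e t
    using size_heads_step[of _ e] by simp
qed

lemma pt_rk:
  assumes "pt E encP zs" "pt E enc_unary v"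
  shows "pt E enc_unary (\<lambda>x. rk (zs x) (v x))"
  unfolding rk_def
  by (rule pt_length, rule pt_filter, rule pt_mem, rule pt_comp[OF assms(2)], rule pt_first, rule pt_second,
    rule pt_comp[OF pt_heads assms(1)])

definition itl :: "inp \<Rightarrow> nat \<Rightarrow> nat" where "itl e a = fst (nth_default (0, 0) (iA e) a)"
definition ihd :: "inp \<Rightarrow> nat \<Rightarrow> nat" where "ihd e a = snd (nth_default (0, 0) (iA e) a)"
definition iE :: "inp \<Rightarrow> nat set set" where "iE e = {{a, b} | a b. (a, b) \<in> set (iC e)}"
definition ipos :: "inp \<Rightarrow> nat \<Rightarrow> nat" where "ipos e a = rk (iA e) (itl e a) * iN e + a"
definition ilink :: "inp \<Rightarrow> nat \<Rightarrow> nat \<Rightarrow> bool" where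
  "ilink e a b \<longleftrightarrow> a < iN e \<and> b < iN e \<and> ipos e b < ipos e a \<and>
     \<not> (\<exists>c\<in>set (iC e). (fst c = a \<and> snd c = b) \<or> (fst c = b \<and> snd c = a))"

text \<open>Non-adjacency is tested by searching the edge list for the pair in either order; this
  replaces the set of doubletons by something computable.\<close>

lemma link_ilink: "gadget_defs.link (iN e) (itl e) (rk (iA e)) (iE e) = ilink e"
proof (intro ext)
  fix a b
  have "{a, b} \<in> iE e \<longleftrightarrow> (a, b) \<in> set (iC e) \<or> (b, a) \<in> set (iC e)"
    unfolding iE_def by (simp add: doubleton_eq_iff) blast
  also have "\<dots> \<longleftrightarrow> (\<exists>c\<in>set (iC e). (fst c = a \<and> snd c = b) \<or> (fst c = b \<and> snd c = a))"
    by force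
  finally have "{a, b} \<in> iE e \<longleftrightarrow> (\<exists>c\<in>set (iC e). (fst c = a \<and> snd c = b) \<or> (fst c = b \<and> snd c = a))" .
  then show "gadget_defs.link (iN e) (itl e) (rk (iA e)) (iE e) a b = ilink e a b"
    unfolding gadget_defs.link_def gadget_defs.pos_def ilink_def ipos_def by simp
qed

context
  fixes E :: "'a \<Rightarrow> btree" and e :: "'a \<Rightarrow> inp" and a :: "'a \<Rightarrow> nat"
  assumes e: "pt E encI e" and a: "pt E enc_unary a"
begin

lemma pt_itl: "pt E enc_unary (\<lambda>x. itl (e x) (a x))"
  unfolding itl_def by (rule pt_fst, rule pt_nth_default, rule pt_inp[OF e], rule a, rule pt_const)

lemma pt_ihd: "pt E enc_unary (\<lambda>x. ihd (e x) (a x))"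
  unfolding ihd_def by (rule pt_snd, rule pt_nth_default, rule pt_inp[OF e], rule a, rule pt_const)

lemma pt_ipos: "pt E enc_unary (\<lambda>x. ipos (e x) (a x))"
  unfolding ipos_def by (rule pt_add, rule pt_mult, rule pt_rk, rule pt_inp[OF e], rule pt_itl, rule pt_iN[OF e], rule a)

end

lemma pt_ilink:
  assumes "pt E encI e" "pt E enc_unary a" "pt E enc_unary b"
  shows "pt E enc_bool (\<lambda>x. ilink (e x) (a x) (b x))"
proof -
  have ab: "pt (enc_prod E (enc_prod enc_unary enc_unary)) enc_unary (\<lambda>z. a (fst z))"
    "pt (enc_prod E (enc_prod enc_unary enc_unary)) enc_unary (\<lambda>z. b (fst z))"
    by (rule pt_comp[OF assms(2) pt_first], rule pt_comp[OF assms(3) pt_first])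
  show ?thesis
    unfolding ilink_def
    by (rule pt_and, rule pt_less, rule assms, rule pt_iN, rule assms,
      rule pt_and, rule pt_less, rule assms, rule pt_iN, rule assms,
      rule pt_and, rule pt_less, rule pt_ipos, rule assms, rule assms, rule pt_ipos, rule assms, rule assms,
      rule pt_not, rule pt_bex, rule pt_or,
      rule pt_and, rule pt_eq, rule pt_fst, rule pt_second, rule ab, rule pt_eq, rule pt_snd, rule pt_second, rule ab,
      rule pt_and, rule pt_eq, rule pt_fst, rule pt_second, rule ab, rule pt_eq, rule pt_snd, rule pt_second, rule ab,
      rule pt_inp, rule assms)
qed

definition iar :: "inp \<Rightarrow> ar list" where
  "iar e = gadget_defs.arlist (iN e) (ik e) (itl e) (rk (iA e)) (iE e)"

definition icap :: "inp \<Rightarrow> ar \<Rightarrow> nat" where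
  "icap e = gadget_defs.ncap (iN e) (ik e)"

text \<open>Endpoints and capacity of an arc in one entry, the capacity as numerator and
  denominator. Only \<open>SrcA\<close> and \<open>SnkA\<close> may have a denominator other than
  1.\<close>

definition row :: "inp \<Rightarrow> ar \<Rightarrow> (nat \<times> nat) \<times> (nat \<times> nat)" where
  "row e l = ((code (iK e) (gadget_defs.src (iN e) (itl e) (iT e) l),
      code (iK e) (gadget_defs.trg (iN e) (itl e) (ihd e) (iS e) (rk (iA e)) (iE e) l)),
    (if l = SrcA \<or> l = SnkA then (iNum e, iDen e) else (icap e l, 1)))"

lemma row_F: "row e (F i) = (((if i = 0 then 0 else 5 * iK e + (i - 1)), 5 * iK e + i), (icap e (F i), 1))"
  by (cases i) (simp_all add: row_def code_def gadget_defs.src.simps gadget_defs.trg.simps)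

lemma row_Ex: "row e (ar.Ex h i b) =
  ((5 * iK e + i, 3 * iK e + (if h \<and> ilink e i b then i else b)), (icap e (ar.Ex h i b), 1))"
  by (simp add: row_def code_def gadget_defs.src.simps gadget_defs.trg.simps link_ilink)

lemma row_simps:
  "row e SrcA = ((0, 2 * iK e + iS e), (iNum e, iDen e))"
  "row e SnkA = ((2 * iK e + iT e, iK e), (iNum e, iDen e))"
  "row e (Din a) = ((2 * iK e + itl e a, 3 * iK e + a), (icap e (Din a), 1))"
  "row e (Dout a) = ((4 * iK e + a, 2 * iK e + ihd e a), (icap e (Dout a), 1))"
  "row e (Mid a) = ((3 * iK e + a, 4 * iK e + a), (icap e (Mid a), 1))"
  "row e (Fi a) = ((0, 3 * iK e + a), (icap e (Fi a), 1))"
  "row e (Fo a) = ((4 * iK e + a, iK e), (icap e (Fo a), 1))"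
  "row e (Pr False a) = ((0, 6 * iK e + a), (icap e (Pr False a), 1))"
  "row e (Pr True a) = ((0, 7 * iK e + a), (icap e (Pr True a), 1))"
  "row e (Gu False a) = ((4 * iK e + a, 6 * iK e + a), (icap e (Gu False a), 1))"
  "row e (Gu True a) = ((4 * iK e + a, 7 * iK e + a), (icap e (Gu True a), 1))"
  "row e (Te False a) = ((6 * iK e + a, iK e), (icap e (Te False a), 1))"
  "row e (Te True a) = ((7 * iK e + a, iK e), (icap e (Te True a), 1))"
  "row e (En i) = ((0, 5 * iK e + i), (icap e (En i), 1))"
  "row e End = ((5 * iK e + iN e, iK e), (icap e End, 1))"
  "row e (Li a b) = ((4 * iK e + a, 3 * iK e + b), (icap e (Li a b), 1))"
  "row e (Xi a b) = ((0, 3 * iK e + a), (icap e (Xi a b), 1))"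
  "row e (Xo a b) = ((4 * iK e + a, iK e), (icap e (Xo a b), 1))"
  "row e (Di j) = ((0, iK e), (icap e (Di j), 1))"
  "row e P2 = ((0, iK e), (icap e P2, 1))"
  by (simp_all add: row_def code_def gadget_defs.src.simps gadget_defs.trg.simps)

lemmas icap_simps = icap_def gadget_defs.ncap.simps gadget_defs.Q_def gadget_defs.M_def gadget_defs.U_def
  gadget_defs.\<kappa>_def min_def

text \<open>Unfolding pushes \<open>row\<close> into every sublist of the arc list. Each sublist is
  then a map over index ranges with a known constructor, so arcs themselves never need an
  encoding.\<close>

lemma pt_rows: "pt encI (enc_list encR) (\<lambda>e. map (row e) (iar e))"
  unfolding iar_def gadget_defs.arlist_def gadget_defs.oarcs_def gadget_defs.rarcs_def link_ilink
    list.map map_append map_concat map_map comp_def row_simps row_F row_Ex simp_thms icap_simps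
  by (rule pt_append pt_Cons pt_pair pt_concat pt_map pt_filter pt_upt pt_const
      pt_if pt_le pt_less pt_is_0 pt_not pt_ilink pt_inp pt_binary_of_unary pt_add pt_mult pt_minus pt_Suc
      pt_iN pt_iK pt_itl pt_ihd pt_id pt_first pt_second pt_fst pt_snd)+

text \<open>The sum of the natural-number capacities stays polynomial and is computed in unary; it
  later serves as the unary factor of a binary product.\<close>

definition c0 :: "inp \<Rightarrow> nat" where
  "c0 e = sum_list (map (icap e) (gadget_defs.oarcs (iN e) (itl e) (rk (iA e)) (iE e)))"

lemma pt_c0: "pt encI enc_unary c0"
  unfolding c0_def[abs_def] gadget_defs.oarcs_def link_ilink
    list.map map_append map_concat map_map comp_def simp_thms icap_simps
  by (rule pt_sum_list, (rule pt_append pt_concat pt_map pt_filter pt_upt pt_const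
      pt_not pt_ilink pt_add pt_mult pt_minus pt_iN pt_id pt_first pt_second pt_fst pt_snd)+)

text \<open>The demand is compared with the number of arcs by cross-multiplication.\<close>

definition itriv :: "inp \<Rightarrow> bool" where
  "itriv e \<longleftrightarrow> ik e \<le> 1 \<or> iA e = [] \<or> \<not> iNum e \<le> iN e * iDen e"

lemma pt_itriv: "pt encI enc_bool itriv"
  unfolding itriv_def[abs_def]
  by (rule pt_or pt_le pt_Nil pt_not pt_binary_le pt_binary_mult pt_inp pt_iN pt_const pt_id)+

definition out :: "inp \<Rightarrow> (nat \<times> (nat \<times> nat) list \<times> nat \<times> nat) \<times> (nat \<times> nat) list \<times> nat \<times> nat \<times> nat" where
  "out e = (if itriv e
     then ((2, map (\<lambda>_. (0, 1)) [0..<Suc (ik e)], 0, 1), map (\<lambda>_. (0, 1)) [0..<Suc (ik e)], ik e,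
       (if ik e = 0 then (1, 1) else (iNum e, iDen e)))
     else ((8 * iK e, map fst (map (row e) (iar e)), 0, iK e), map snd (map (row e) (iar e)), ik e,
       (iNum e + c0 e * iDen e, iDen e)))"

lemma pt_out: "pt encI encO out"
  unfolding out_def[abs_def]
  by (rule pt_itriv pt_c0 pt_rows pt_binary_add pt_binary_mult pt_if pt_pair pt_map pt_upt pt_const pt_is_0 pt_inp
      pt_iN pt_iK pt_mult pt_Suc pt_id pt_fst pt_snd)+

definition inp_of :: "mrfr \<Rightarrow> inp" where
  "inp_of I = ((num_verts (mrfr_net I), arc_list (mrfr_net I), source (mrfr_net I), sink (mrfr_net I)),
     mrfr_compat I, mrfr_budget I, nat (fst (quotient_of (mrfr_demand I))), nat (snd (quotient_of (mrfr_demand I))))"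

lemma enc_inp: "enc_mrfr I = encI (inp_of I)"
  by (simp add: enc_mrfr_def enc_network_def enc_rat_def inp_of_def prod.case_eq_if split: prod.splits) (cases "quotient_of (mrfr_demand I)"; simp)

lemma enc_list_map_cong: "(\<And>x. A (f x) = B (g x)) \<Longrightarrow> enc_list A (map f xs) = enc_list B (map g xs)"
  by (induction xs) auto

lemma enc_mk_mrf:
  "enc_mrf (mk_mrf es src trg cap cd m s t k L) =
     Node (Node (enc_unary m) (Node (encP (map (\<lambda>e. (cd (src e), cd (trg e))) es))
       (Node (enc_unary (cd s)) (enc_unary (cd t)))))
     (Node (enc_list enc_rat (map cap es)) (Node (enc_unary k) (enc_rat L)))"
  by (simp add: enc_mrf_def enc_network_def mk_mrf_def)

text \<open>Membership in \<open>mrfr_instances\<close> enters through the sign of the demand: a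
  nonnegative numerator passes through \<open>nat\<close> unchanged.\<close>

lemma enc_out:
  assumes "I \<in> mrfr_instances"
  shows "enc_mrf (reduce I) = encO (out (inp_of I))"
proof -
  let ?e = "inp_of I"
  obtain p q where pq: "quotient_of (mrfr_demand I) = (p, q)" by (cases "quotient_of (mrfr_demand I)")
  have q: "q > 0" and th: "mrfr_demand I = of_int p / of_int q"
    using quotient_of_denom_pos[OF pq] quotient_of_div[OF pq] by auto
  have p: "p \<ge> 0" using instance_facts(2)[OF assms] q unfolding th by (simp add: zero_le_divide_iff)
  have acc: "iV ?e = num_verts (mrfr_net I)" "iA ?e = as I" "iS ?e = source (mrfr_net I)" "iT ?e = sink (mrfr_net I)"
    "iC ?e = mrfr_compat I" "ik ?e = mrfr_budget I" "iNum ?e = nat p" "iDen ?e = nat q" "iN ?e = length (as I)"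
    "iK ?e = num_verts (mrfr_net I) + length (as I) + 1" "itl ?e = tl' I" "ihd ?e = hd' I" "iE ?e = compat_edges I"
    by (auto simp: iV_def iA_def iS_def iT_def iC_def ik_def iNum_def iDen_def iN_def iK_def inp_of_def pq
        itl_def ihd_def iE_def compat_edges_def fun_eq_iff)
  have rat: "enc_rat (mrfr_demand I) = enc_prod enc_binary enc_binary (nat p, nat q)"
    by (simp add: enc_rat_def pq)
  have rat_nat: "enc_rat (of_nat c) = enc_prod enc_binary enc_binary (c, 1)" for c
    by (simp add: enc_rat_def quotient_of_nat)
  have "mrfr_demand I \<le> of_nat (length (as I)) \<longleftrightarrow> of_int p \<le> (of_int (int (length (as I)) * q) :: rat)"
    using q by (simp add: th divide_le_eq)
  also have "\<dots> \<longleftrightarrow> p \<le> int (length (as I)) * q" by (rule of_int_le_iff)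
  also have "\<dots> \<longleftrightarrow> nat p \<le> length (as I) * nat q"
    using p q by (simp add: nat_le_iff)
  finally have triv: "trivial_case I \<longleftrightarrow> itriv ?e" unfolding itriv_def acc by simp
  show ?thesis
  proof (cases "trivial_case I")
    case True
    have l: "enc_list enc_rat (map (\<lambda>_. 0) xs) = enc_list (enc_prod enc_binary enc_binary) (map (\<lambda>_. (0, 1)) xs)" for xs :: "nat list"
      using rat_nat[of 0] by (intro enc_list_map_cong) simp
    show ?thesis
    proof (cases "mrfr_budget I = 0")
      case True
      then show ?thesis using \<open>trivial_case I\<close> triv rat_nat[of 1] l
        unfolding reduce_def out_def acc by (simp add: enc_mk_mrf del: upt_Suc)
    next
      case False
      then show ?thesis using True triv rat l
        unfolding reduce_def out_def acc by (simp add: enc_mk_mrf del: upt_Suc)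
    qed
  next
    case False
    have L: "enc_rat (gadget_defs.L (length (as I)) (mrfr_budget I) (tl' I) (rk (as I)) (compat_edges I) (mrfr_demand I)) =
      enc_prod enc_binary enc_binary (nat p + c0 ?e * nat q, nat q)"
      unfolding gadget_defs.L_def enc_rat_def quotient_L[OF pq] c0_def icap_def acc
      using p q by (simp add: nat_add_distrib nat_mult_distrib)
    have caps: "enc_list enc_rat (map (gadget_defs.cap (length (as I)) (mrfr_budget I) (mrfr_demand I)) xs) =
      enc_list (enc_prod enc_binary enc_binary) (map (\<lambda>l. snd (row ?e l)) xs)" for xs
      by (rule enc_list_map_cong) (simp add: gadget_defs.cap_def row_def icap_def acc rat rat_nat)
    show ?thesis
      using False triv L caps
      unfolding reduce_def out_def iar_def acc
      by (simp add: enc_mk_mrf comp_def row_def[of ?e, unfolded acc] code_def[of _ VS] code_def[of _ VT])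
  qed
qed

lemma reduce_poly_time: "poly_time_computable mrfr_instances enc_mrfr enc_mrf reduce"
proof -
  obtain p c m where c: "\<And>x \<sigma>. \<sigma> 0 = encI x \<Longrightarrow>
       \<exists>n \<tau>. exec c \<sigma> n \<tau> \<and> n \<le> poly p (size (encI x)) \<and> \<tau> 0 = encO (out x) \<and> (\<forall>v>m. \<tau> v = \<sigma> v)"
    by (rule ptE[OF pt_out]) (rule that)
  have "computes_within c (enc_mrfr I) (poly p (size (enc_mrfr I))) (enc_mrf (reduce I))" if "I \<in> mrfr_instances" for I
    using c[of "(\<lambda>_. Leaf)(0 := encI (inp_of I))" "inp_of I"]
    unfolding computes_within_def enc_out[OF that] enc_inp by auto
  then show ?thesis unfolding poly_time_computable_def by blast
qed

theorem theorem4: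
  "\<exists>f :: mrfr \<Rightarrow> mrf.
     polynomial_transformation MRF_R MRF f \<and>
     polynomial_transformation Integral_MRF_R Integral_MRF f \<and>
     (\<forall>I\<in>instances MRF_R. mrf_budget (f I) = mrfr_budget I) \<and>
     (\<exists>p :: nat poly. \<forall>I\<in>instances MRF_R. \<forall>c\<in>set (mrf_caps (f I)).
        c \<le> of_nat (poly p (network_size (mrfr_net I))) \<and>
        c \<le> of_nat (poly p (network_size (mrf_net (f I)))))"
proof (intro exI[of _ reduce] conjI exI[of _ "[:3, 5, 2:]"] ballI)
  have r: "reduce I \<in> mrf_instances" "mrf_yes (reduce I) \<longleftrightarrow> mrfr_yes I"
    "integral_mrf_yes (reduce I) \<longleftrightarrow> integral_mrfr_yes I" if "I \<in> mrfr_instances" for I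
    using reduce_trivial[OF that] reduce_main(1-3)[OF that] by blast+
  show "polynomial_transformation MRF_R MRF reduce"
    using r reduce_poly_time by (simp add: polynomial_transformation_def MRF_R_def MRF_def)
  show "polynomial_transformation Integral_MRF_R Integral_MRF reduce"
    using r reduce_poly_time by (simp add: polynomial_transformation_def Integral_MRF_R_def Integral_MRF_def)
  show "mrf_budget (reduce I) = mrfr_budget I" for I
    by (simp add: reduce_def mk_mrf_def)
  fix I c
  assume "I \<in> instances MRF_R" "c \<in> set (mrf_caps (reduce I))"
  then show "c \<le> of_nat (poly [:3, 5, 2:] (network_size (mrfr_net I)))"
    "c \<le> of_nat (poly [:3, 5, 2:] (network_size (mrf_net (reduce I))))"
    using reduce_bound[of I c] by (simp_all only: MRF_R_def decision_problem.simps)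
qed

end
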